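(* Suppose that there exist a function $w:S\to[1,\infty)$ and constants $\rho_1,\rho_2,\rho_3>0$, $b_1,b_2,b_3\ge0$, $L>0$, $M>0$ such that: (1) $\sum_{j\in S}w(j)q(j|i,a)\le\rho_1w(i)+b_1$ for all $(i,a)\in K$, and $q^*(i)\le Lw(i)$ for all $i\in S$; (2) $\sum_{i\in S}w(i)\gamma(i)<\infty$, and $|c_n(i,a)|\le Mw(i)$ for all $(i,a)\in K$ and $n=0,1,\ldots,N$; (3) $\sum_{j\in S}w^2(j)q(j|i,a)\le\rho_2w^2(i)+b_2$ and $\sum_{j\in S}w^3(j)q(j|i,a)\le\rho_3w^3(i)+b_3$ for all $(i,a)\in K$; (4) for each $i\in S$ the set $A(i)$ is compact; (5) for each fixed $i,j\in S$ and $n=0,1,\ldots,N$, the functions $c_n(i,a)$, $q(j|i,a)$ and $\sum_{k\in S}w(k)q(k|i,a)$ are continuous in $a\in A(i)$; (6) for each integer $m\ge1$ the set $S_m:=\{i\in S:w(i)\le m\}$ is nonempty and finite; (7) $\sum_{i\in S}w^2(i)\gamma(i)<\infty$ and $\sum_{i\in S}w^3(i)\gamma(i)<\infty$; (8) there exists a policy $\widetilde\pi\in\Pi$ such that $V_n(\widetilde\pi)<d_n$ for all $1\le n\le N$. Consider the primal linear program $$\textbf{P}:\quad\text{minimize }\ T\int_{[0,T]}\sum_{i\in S}\int_Ac_0(i,a)\,\eta(dt,i,da)$$ over $\eta\in\mathcal{M}^+_{w^3}(X)$ and real numbers $x_1\ge0,\ldots,x_N\ge0$, subject to $\Gamma(\eta,x_1,\ldots,x_N)=\left(\tfrac1T\gamma\,dt,d_1,\ldots,d_N\right)$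 (where $\gamma\,dt$ is the measure $\gamma(j)\,dt$ on $[0,T]\times S$), and the dual program $$\textbf{P}^*:\quad\text{maximize }\ \frac1T\int_0^T\sum_{i\in S}h(t,i)\gamma(i)\,dt+\sum_{n=1}^Nd_nu_n$$ over $h\in B_{w^2}(Y)$ and $u_1\le0,\ldots,u_N\le0$, subject to $$Tc_0(i,a)-h(t,i)+\int_t^T\sum_{j\in S}h(s,j)q(j|i,a)\,ds-T\sum_{n=1}^Nu_nc_n(i,a)\ge0\quad\text{for all }(t,i,a)\in X.$$ Let $\inf(\textbf{P})$ and $\sup(\textbf{P}^* )$ denote the optimal values. Then both $\textbf{P}$ and $\textbf{P}^*$ admit optimal solutions, and $\inf(\textbf{P})=\sup(\textbf{P}^* )$.
   Context: Model. $S$ is a denumerable set (discrete topology), $A$ is a Polish space with Borel $\sigma$-algebra $\mathcal{B}(A)$, and for each $i\in S$, $A(i)\in\mathcal{B}(A)$ is the set of admissible actions in state $i$; $K:=\{(i,a): i\in S, a\in A(i)\}$. The transition rates $q(j|i,a)$ are real numbers, measurable in $a\in A(i)$ for fixed $i,j\in S$, with $q(j|i,a)\ge 0$ for $j\ne i$, $\sum_{j\in S}q(j|i,a)=0$ for all $(i,a)\in K$, and $q^*(i):=\sup_{a\in A(i)}|q(i|i,a)|<\infty$ for all $i\in S$. The cost functions $c_n:K\to\mathbb{R}$ $(0\le n\le N)$ are measurable in $a\in A(i)$ for each $i$; $d_1,\ldots,d_N$ are real constants. $T>0$ is a fixed terminal time and $\gamma$ a fixed (initial) probability distribution on $S$.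 Path space. $S_\infty:=S\cup\{i_\infty\}$ and $A_\infty:=A\cup\{a_\infty\}$ with isolated points $i_\infty\notin S$, $a_\infty\notin A$; $A(i_\infty):=\{a_\infty\}$ and $q(\cdot|i_\infty,a_\infty):=0$. $\mathbb{R}_+:=(0,\infty)$, $\mathbb{R}_+^0:=[0,\infty)$. $\Omega$ is the union of $(S\times\mathbb{R}_+)^\infty$ (sequences $(i_0,\theta_1,i_1,\theta_2,i_2,\ldots)$) and the set of all sequences $(i_0,\theta_1,i_1,\ldots,\theta_{m-1},i_{m-1},\infty,i_\infty,\infty,i_\infty,\ldots)$ with $m\ge1$, $i_l\in S$, $\theta_l\in\mathbb{R}_+$; $\mathcal{F}$ is its Borel $\sigma$-algebra. For $\omega=(i_0,\theta_1,i_1,\ldots)$: $T_0:=0$, $X_m(\omega):=i_m$ $(m\ge 0)$, $T_m:=\theta_1+\cdots+\theta_m$ $(m\ge1)$, $T_\infty:=\lim_mT_m$, and $\xi_t:=X_m$ for $T_m\le t<T_{m+1}$, $\xi_t:=i_\infty$ for $t\ge T_\infty$. $\xi_{t-}:=X_m$ for $T_m<t\le T_{m+1}$ with $t<T_\infty$, $\xi_{0-}:=\xi_0$, $\xi_{t-}:=i_\infty$ for $t\ge T_\infty$. $\mathcal{F}_t:=\sigma(\{T_m\le s,X_m=j\}:j\in S,s\le t,m\ge0)$, $\mathcal{F}_{s-}:=\bigvee_{0\le t<s}\mathcal{F}_t$, and $\mathcal{P}:=\sigma(B\times\{0\}\,(B\in\mathcal{F}_0),\ B\times(s,\infty)\,(B\in\mathcal{F}_{s-},s>0))$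 is the predictable $\sigma$-algebra on $\Omega\times\mathbb{R}_+^0$. Policies. $\Pi$ is the set of randomized history-dependent policies: $\mathcal{P}$-measurable transition probabilities $\pi(\cdot|\omega,t)$ on $(A_\infty,\mathcal{B}(A_\infty))$ concentrated on $A(\xi_{t-}(\omega))$. Probability and costs. For $\pi\in\Pi$, $P_\gamma^\pi$ is the unique probability measure on $(\Omega,\mathcal{F})$ with $P_\gamma^\pi(\xi_0=i)=\gamma(i)$ for all $i\in S$ and such that, under it, $\nu^\pi(\omega,dt,j):=\left[\int_A\pi(da|\omega,t)q(j|\xi_{t-}(\omega),a)I_{\{j\ne\xi_{t-}(\omega)\}}\right]dt$ is the dual predictable projection (compensator) of the random measure $\mu(\omega,dt,j):=\sum_{m\ge1}I_{\{T_m<\infty\}}I_{\{X_m=j\}}\delta_{T_m}(dt)$ on $\mathbb{R}_+\times S$; the stochastic basis is assumed complete. $E_\gamma^\pi$ is the corresponding expectation, and $V_n(\pi):=E_\gamma^\pi\left[\int_0^T\int_Ac_n(\xi_{t-},a)\pi(da|\omega,t)dt\right]$ (integrands at $i_\infty$ are taken to be $0$; immaterial). Spaces. $X:=[0,T]\times K$ and $Y:=[0,T]\times S$ with Borel $\sigma$-algebras. $\mathcal{M}_{w^3}(X)$ is the space of signed measures $\eta$ on $\mathcal{B}(X)$ with $\int_{[0,T]}\sum_{i\in S}\int_Aw^3(i)|\eta|(dt,i,da)<\infty$ ($|\eta|$ the total variation), and $\mathcal{M}^+_{w^3}(X):=\{\eta\in\mathcal{M}_{w^3}(X):\eta\ge0\}$.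 $\mathcal{M}_{w^2}(Y)$ is the space of signed measures $\nu$ on $\mathcal{B}(Y)$ with $\int_{[0,T]}\sum_{i\in S}w^2(i)|\nu|(dt,i)<\infty$. $B_{w^2}(Y)$ is the set of real measurable functions $h$ on $Y$ with $\sup_{(t,i)\in Y}|h(t,i)|/w^2(i)<\infty$. Operator. $\Gamma:\mathcal{M}_{w^3}(X)\times\mathbb{R}^N\to\mathcal{M}_{w^2}(Y)\times\mathbb{R}^N$ is defined by $$\Gamma(\eta,x_1,\ldots,x_N):=\Big(\eta(ds,j,A)-\Big[\int_{[0,T]}\sum_{i\in S}\int_AI_{[t,T]}(s)q(j|i,a)\eta(dt,i,da)\Big]ds,\ \ T\!\int_{[0,T]}\sum_{i\in S}\int_Ac_1(i,a)\eta(dt,i,da)+x_1,\ldots,\ T\!\int_{[0,T]}\sum_{i\in S}\int_Ac_N(i,a)\eta(dt,i,da)+x_N\Big),$$ the first component being a signed measure in $(s,j)\in Y$. *)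

theory Defs
  imports "HOL-Probability.Probability"
begin

section \<open>Sample paths\<close>

text \<open>
  The state space \<open>S\<close> is a countable type \<open>'s\<close> (discrete, hence with \<open>\<sigma>\<close>-algebra
  \<open>count_space UNIV\<close>) and the action space is a type \<open>'a\<close> of class \<open>polish_space\<close>. The isolated
  points \<open>i\<^sub>\<infinity>\<close>, \<open>a\<^sub>\<infinity>\<close> are the value \<^term>\<open>None\<close> of \<open>'s option\<close>, \<open>'a option\<close>. A sequence
  \<open>(i\<^sub>0, \<theta>\<^sub>1, i\<^sub>1, \<theta>\<^sub>2, \<dots>)\<close> is encoded by \<open>\<omega> l = (i\<^sub>l, \<theta>\<^bsub>l+1\<^esub>)\<close>. Rates are written \<open>q j i a\<close> for
  \<open>q(j|i,a)\<close>; their values (and those of the costs) for \<open>a \<notin> A i\<close> are never used.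
\<close>

type_synonym 's path = "nat \<Rightarrow> 's option \<times> ereal"

definition paths :: "'s path set" where
  "paths =
     {\<omega>. \<forall>l. fst (\<omega> l) \<noteq> None \<and> 0 < snd (\<omega> l) \<and> snd (\<omega> l) < \<infinity>} \<union>
     {\<omega>. \<exists>m\<ge>1. (\<forall>l<m. fst (\<omega> l) \<noteq> None) \<and> (\<forall>l<m - 1. 0 < snd (\<omega> l) \<and> snd (\<omega> l) < \<infinity>) \<and>
        snd (\<omega> (m - 1)) = \<infinity> \<and> (\<forall>l\<ge>m. \<omega> l = (None, \<infinity>))}"

text \<open>All factors are second countable, so the Borel \<open>\<sigma>\<close>-algebra of \<open>\<Omega>\<close> is the trace of the
  product \<open>\<sigma>\<close>-algebra.\<close>

definition path_space :: "'s path measure" where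
  "path_space = restrict_space (\<Pi>\<^sub>M l\<in>UNIV. count_space UNIV \<Otimes>\<^sub>M borel) paths"

definition jump_state :: "nat \<Rightarrow> 's path \<Rightarrow> 's option" where
  "jump_state m \<omega> = fst (\<omega> m)"

definition jump_time :: "nat \<Rightarrow> 's path \<Rightarrow> ereal" where
  "jump_time m \<omega> = (\<Sum>l<m. snd (\<omega> l))"

definition explosion_time :: "'s path \<Rightarrow> ereal" where
  "explosion_time \<omega> = lim (\<lambda>m. jump_time m \<omega>)"

definition state_at :: "'s path \<Rightarrow> real \<Rightarrow> 's option" where
  "state_at \<omega> t =
     (if ereal t < explosion_time \<omega>
      then jump_state (THE m. jump_time m \<omega> \<le> ereal t \<and> ereal t < jump_time (Suc m) \<omega>) \<omega>
      else None)"

definition state_before :: "'s path \<Rightarrow> real \<Rightarrow> 's option" where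
  "state_before \<omega> t =
     (if t = 0 then state_at \<omega> 0
      else if ereal t < explosion_time \<omega>
      then jump_state (THE m. jump_time m \<omega> < ereal t \<and> ereal t \<le> jump_time (Suc m) \<omega>) \<omega>
      else None)"

definition history :: "real \<Rightarrow> 's path measure" where
  "history t = sigma paths
     {{\<omega> \<in> paths. jump_time m \<omega> \<le> ereal s \<and> jump_state m \<omega> = Some j} | j s m. 0 \<le> s \<and> s \<le> t}"

definition history_before :: "real \<Rightarrow> 's path measure" where
  "history_before s = sigma paths (\<Union>t\<in>{0..<s}. sets (history t))"

definition predictable :: "('s path \<times> real) measure" where
  "predictable = sigma (paths \<times> {0..})
     ({B \<times> {0} | B. B \<in> sets (history 0)} \<union>
      {B \<times> {s<..} | B s. 0 < s \<and> B \<in> sets (history_before s)})"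


section \<open>Policies, controlled path laws and costs\<close>

definition ext_action_space :: "'a :: topological_space option measure" where
  "ext_action_space = sigma UNIV {B. Some -` B \<in> sets borel}"

fun ext_actions :: "('s \<Rightarrow> 'a set) \<Rightarrow> 's option \<Rightarrow> 'a option set" where
  "ext_actions A (Some i) = Some ` A i"
| "ext_actions A None = {None}"

text \<open>A function on \<open>K = {(i, a). a \<in> A i}\<close>, extended by \<open>0\<close>.\<close>

fun on_K :: "('s \<Rightarrow> 'a set) \<Rightarrow> ('s \<Rightarrow> 'a \<Rightarrow> real) \<Rightarrow> 's option \<Rightarrow> 'a option \<Rightarrow> real" where
  "on_K A f (Some i) (Some a) = (if a \<in> A i then f i a else 0)"
| "on_K A f _ _ = 0"

definition policies ::
    "('s \<Rightarrow> 'a :: topological_space set) \<Rightarrow> ('s path \<Rightarrow> real \<Rightarrow> 'a option measure) set" where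
  "policies A =
     {\<pi>. (\<lambda>(\<omega>, t). \<pi> \<omega> t) \<in> predictable \<rightarrow>\<^sub>M prob_algebra ext_action_space \<and>
         (\<forall>\<omega>\<in>paths. \<forall>t\<ge>0. emeasure (\<pi> \<omega> t) (ext_actions A (state_before \<omega> t)) = 1)}"

text \<open>Random measures on \<open>(0, \<infinity>) \<times> S\<close>: the jump measure \<open>\<mu> = \<Sum>\<^bsub>m\<ge>1, T\<^sub>m<\<infinity>\<^esub> \<delta>\<^bsub>(T\<^sub>m, X\<^sub>m)\<^esub>\<close> and
  \<open>\<nu>\<^sup>\<pi>\<close>, given by its density with respect to \<open>dt\<close> times counting measure.\<close>

definition jump_measure :: "'s path \<Rightarrow> (real \<times> 's) measure" where
  "jump_measure \<omega> =
     distr (count_space {m. 1 \<le> m \<and> jump_time m \<omega> < \<infinity>})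
       (restrict_space borel {0<..} \<Otimes>\<^sub>M count_space UNIV)
       (\<lambda>m. (real_of_ereal (jump_time m \<omega>), the (jump_state m \<omega>)))"

definition jump_intensity ::
    "('s \<Rightarrow> 'a set) \<Rightarrow> ('s \<Rightarrow> 's \<Rightarrow> 'a \<Rightarrow> real) \<Rightarrow> ('s path \<Rightarrow> real \<Rightarrow> 'a option measure) \<Rightarrow>
      's path \<Rightarrow> (real \<times> 's) measure" where
  "jump_intensity A q \<pi> \<omega> =
     density (restrict_space lborel {0<..} \<Otimes>\<^sub>M count_space UNIV)
       (\<lambda>(t, j). \<integral>\<^sup>+b. ennreal (on_K A (\<lambda>i a. if j \<noteq> i then q j i a else 0) (state_before \<omega> t) b) \<partial>\<pi> \<omega> t)"

text \<open>\<open>\<nu>\<close> is the dual predictable projection of \<open>\<mu>\<close> under \<open>P\<close>: it is a predictable random measure,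
  and the two measures have the same expected integral of every nonnegative predictable function
  on \<open>\<Omega> \<times> [0, \<infinity>) \<times> S\<close>.\<close>

definition predictable_random_measure :: "('s path \<Rightarrow> (real \<times> 's) measure) \<Rightarrow> bool" where
  "predictable_random_measure \<nu> \<longleftrightarrow>
     (\<forall>W :: ('s path \<times> real) \<times> 's \<Rightarrow> ennreal. W \<in> borel_measurable (predictable \<Otimes>\<^sub>M count_space UNIV) \<longrightarrow>
        (\<lambda>(\<omega>, t). \<integral>\<^sup>+(s, j). W ((\<omega>, s), j) * indicator {0<..t} s \<partial>\<nu> \<omega>) \<in> borel_measurable predictable)"

definition dual_predictable_projection ::
    "'s path measure \<Rightarrow> ('s path \<Rightarrow> (real \<times> 's) measure) \<Rightarrow> ('s path \<Rightarrow> (real \<times> 's) measure) \<Rightarrow> bool" where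
  "dual_predictable_projection P \<mu> \<nu> \<longleftrightarrow>
     predictable_random_measure \<nu> \<and>
     (\<forall>W :: ('s path \<times> real) \<times> 's \<Rightarrow> ennreal. W \<in> borel_measurable (predictable \<Otimes>\<^sub>M count_space UNIV) \<longrightarrow>
        (\<integral>\<^sup>+\<omega>. (\<integral>\<^sup>+(t, j). W ((\<omega>, t), j) \<partial>\<mu> \<omega>) \<partial>P) = (\<integral>\<^sup>+\<omega>. (\<integral>\<^sup>+(t, j). W ((\<omega>, t), j) \<partial>\<nu> \<omega>) \<partial>P))"

text \<open>\<open>P\<close> is the measure \<open>P\<^sub>\<gamma>\<^sup>\<pi>\<close>. For a policy \<open>\<pi>\<close> there is exactly one such \<open>P\<close> (Jacod), which is why
  it is given by its characterization rather than chosen by a description operator.\<close>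

definition path_law ::
    "('s \<Rightarrow> 'a set) \<Rightarrow> ('s \<Rightarrow> 's \<Rightarrow> 'a \<Rightarrow> real) \<Rightarrow> 's pmf \<Rightarrow> ('s path \<Rightarrow> real \<Rightarrow> 'a option measure) \<Rightarrow>
      's path measure \<Rightarrow> bool" where
  "path_law A q \<gamma> \<pi> P \<longleftrightarrow>
     prob_space P \<and> sets P = sets path_space \<and>
     (\<forall>i. measure P {\<omega> \<in> space P. state_at \<omega> 0 = Some i} = pmf \<gamma> i) \<and>
     dual_predictable_projection P jump_measure (jump_intensity A q \<pi>)"

definition expected_cost ::
    "real \<Rightarrow> ('s \<Rightarrow> 'a set) \<Rightarrow> ('s \<Rightarrow> 'a \<Rightarrow> real) \<Rightarrow> ('s path \<Rightarrow> real \<Rightarrow> 'a option measure) \<Rightarrow>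
      's path measure \<Rightarrow> real" where
  "expected_cost T A f \<pi> P =
     (\<integral>\<omega>. (LINT t:{0..T}|lborel. (\<integral>b. on_K A f (state_before \<omega> t) b \<partial>\<pi> \<omega> t)) \<partial>P)"


section \<open>Finite signed measures\<close>

text \<open>Signed measures on the \<open>\<sigma>\<close>-algebra of \<open>M\<close> (the measure carried by \<open>M\<close> plays no role) are
  real-valued set functions, made canonical by the value \<open>0\<close> off the \<open>\<sigma>\<close>-algebra. The spaces below
  have weights \<open>\<ge> 1\<close>, so that only finite signed measures occur.\<close>

definition signed_measure :: "'x measure \<Rightarrow> ('x set \<Rightarrow> real) \<Rightarrow> bool" where
  "signed_measure M \<nu> \<longleftrightarrow>
     \<nu> {} = 0 \<and>
     (\<forall>F. range F \<subseteq> sets M \<longrightarrow> disjoint_family F \<longrightarrow> (\<lambda>n. \<nu> (F n)) sums \<nu> (\<Union>n. F n)) \<and>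
     (\<forall>B. B \<notin> sets M \<longrightarrow> \<nu> B = 0)"

text \<open>Jordan decomposition: \<open>\<nu>\<^sup>+(B) = sup {\<nu>(C) | C \<subseteq> B}\<close>.\<close>

definition pos_variation :: "'x measure \<Rightarrow> ('x set \<Rightarrow> real) \<Rightarrow> 'x measure" where
  "pos_variation M \<nu> =
     measure_of (space M) (sets M) (\<lambda>B. SUP C\<in>{C \<in> sets M. C \<subseteq> B}. ennreal (\<nu> C))"

definition neg_variation :: "'x measure \<Rightarrow> ('x set \<Rightarrow> real) \<Rightarrow> 'x measure" where
  "neg_variation M \<nu> = pos_variation M (\<lambda>B. - \<nu> B)"

definition total_variation :: "'x measure \<Rightarrow> ('x set \<Rightarrow> real) \<Rightarrow> 'x measure" where
  "total_variation M \<nu> =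
     measure_of (space M) (sets M)
       (\<lambda>B. emeasure (pos_variation M \<nu>) B + emeasure (neg_variation M \<nu>) B)"

definition signed_integral :: "'x measure \<Rightarrow> ('x set \<Rightarrow> real) \<Rightarrow> ('x \<Rightarrow> real) \<Rightarrow> real" where
  "signed_integral M \<nu> f = (\<integral>x. f x \<partial>pos_variation M \<nu>) - (\<integral>x. f x \<partial>neg_variation M \<nu>)"

definition weighted_signed_measures :: "'x measure \<Rightarrow> ('x \<Rightarrow> real) \<Rightarrow> ('x set \<Rightarrow> real) set" where
  "weighted_signed_measures M v =
     {\<nu>. signed_measure M \<nu> \<and> (\<integral>\<^sup>+x. ennreal (v x) \<partial>total_variation M \<nu>) < \<infinity>}"


section \<open>The linear programs\<close>

definition X_space :: "real \<Rightarrow> ('s \<Rightarrow> 'a :: topological_space set) \<Rightarrow> (real \<times> 's \<times> 'a) measure" where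
  "X_space T A =
     restrict_space (borel \<Otimes>\<^sub>M count_space UNIV \<Otimes>\<^sub>M borel) {(t, i, a). t \<in> {0..T} \<and> a \<in> A i}"

definition Y_space :: "real \<Rightarrow> (real \<times> 's) measure" where
  "Y_space T = restrict_space (borel \<Otimes>\<^sub>M count_space UNIV) ({0..T} \<times> UNIV)"

definition M_w3 ::
    "real \<Rightarrow> ('s \<Rightarrow> 'a :: topological_space set) \<Rightarrow> ('s \<Rightarrow> real) \<Rightarrow> ((real \<times> 's \<times> 'a) set \<Rightarrow> real) set" where
  "M_w3 T A w = weighted_signed_measures (X_space T A) (\<lambda>(t, i, a). w i ^ 3)"

definition M_w3_plus ::
    "real \<Rightarrow> ('s \<Rightarrow> 'a :: topological_space set) \<Rightarrow> ('s \<Rightarrow> real) \<Rightarrow> ((real \<times> 's \<times> 'a) set \<Rightarrow> real) set" where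
  "M_w3_plus T A w = {\<eta> \<in> M_w3 T A w. \<forall>B. 0 \<le> \<eta> B}"

definition B_w2 :: "real \<Rightarrow> ('s \<Rightarrow> real) \<Rightarrow> (real \<times> 's \<Rightarrow> real) set" where
  "B_w2 T w =
     {h \<in> borel_measurable (Y_space T).
        bdd_above ((\<lambda>(t, i). \<bar>h (t, i)\<bar> / w i ^ 2) ` space (Y_space T))}"

text \<open>The measure \<open>g(s, j) ds\<close> on \<open>[0, T] \<times> S\<close>.\<close>

definition Y_density :: "real \<Rightarrow> (real \<times> 's \<Rightarrow> real) \<Rightarrow> (real \<times> 's) set \<Rightarrow> real" where
  "Y_density T g B =
     (if B \<in> sets (Y_space T) then LINT z:B|lborel \<Otimes>\<^sub>M count_space UNIV. g z else 0)"

text \<open>The measure \<open>\<eta>(ds, j, A)\<close>.\<close>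

definition Y_marginal ::
    "real \<Rightarrow> ('s \<Rightarrow> 'a :: topological_space set) \<Rightarrow> ((real \<times> 's \<times> 'a) set \<Rightarrow> real) \<Rightarrow>
      (real \<times> 's) set \<Rightarrow> real" where
  "Y_marginal T A \<eta> B =
     (if B \<in> sets (Y_space T) then \<eta> {(t, i, a) \<in> space (X_space T A). (t, i) \<in> B} else 0)"

text \<open>Vectors in \<open>\<real>\<^sup>N\<close> are elements of \<^term>\<open>{1..N} \<rightarrow>\<^sub>E (UNIV :: real set)\<close>.\<close>

definition Gamma_op ::
    "nat \<Rightarrow> real \<Rightarrow> ('s \<Rightarrow> 'a :: topological_space set) \<Rightarrow> ('s \<Rightarrow> 's \<Rightarrow> 'a \<Rightarrow> real) \<Rightarrow>
      (nat \<Rightarrow> 's \<Rightarrow> 'a \<Rightarrow> real) \<Rightarrow> ((real \<times> 's \<times> 'a) set \<Rightarrow> real) \<times> (nat \<Rightarrow> real) \<Rightarrow>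
      ((real \<times> 's) set \<Rightarrow> real) \<times> (nat \<Rightarrow> real)" where
  "Gamma_op N T A q c = (\<lambda>(\<eta>, x).
     ((\<lambda>B. Y_marginal T A \<eta> B -
        Y_density T
          (\<lambda>(s, j). signed_integral (X_space T A) \<eta> (\<lambda>(t, i, a). indicator {t..T} s * q j i a)) B),
      (\<lambda>n\<in>{1..N}. T * signed_integral (X_space T A) \<eta> (\<lambda>(t, i, a). c n i a) + x n)))"

definition primal_feasible ::
    "nat \<Rightarrow> real \<Rightarrow> ('s \<Rightarrow> 'a :: topological_space set) \<Rightarrow> ('s \<Rightarrow> 's \<Rightarrow> 'a \<Rightarrow> real) \<Rightarrow>
      (nat \<Rightarrow> 's \<Rightarrow> 'a \<Rightarrow> real) \<Rightarrow> (nat \<Rightarrow> real) \<Rightarrow> 's pmf \<Rightarrow> ('s \<Rightarrow> real) \<Rightarrow>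
      (((real \<times> 's \<times> 'a) set \<Rightarrow> real) \<times> (nat \<Rightarrow> real)) set" where
  "primal_feasible N T A q c d \<gamma> w =
     {(\<eta>, x). \<eta> \<in> M_w3_plus T A w \<and> x \<in> {1..N} \<rightarrow>\<^sub>E {0..} \<and>
        Gamma_op N T A q c (\<eta>, x) = (\<lambda>B. 1 / T * Y_density T (\<lambda>(t, j). pmf \<gamma> j) B, \<lambda>n\<in>{1..N}. d n)}"

definition primal_cost ::
    "real \<Rightarrow> ('s \<Rightarrow> 'a :: topological_space set) \<Rightarrow> (nat \<Rightarrow> 's \<Rightarrow> 'a \<Rightarrow> real) \<Rightarrow>
      ((real \<times> 's \<times> 'a) set \<Rightarrow> real) \<times> (nat \<Rightarrow> real) \<Rightarrow> real" where
  "primal_cost T A c = (\<lambda>(\<eta>, x). T * signed_integral (X_space T A) \<eta> (\<lambda>(t, i, a). c 0 i a))"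

definition dual_feasible ::
    "nat \<Rightarrow> real \<Rightarrow> ('s \<Rightarrow> 'a :: topological_space set) \<Rightarrow> ('s \<Rightarrow> 's \<Rightarrow> 'a \<Rightarrow> real) \<Rightarrow>
      (nat \<Rightarrow> 's \<Rightarrow> 'a \<Rightarrow> real) \<Rightarrow> ('s \<Rightarrow> real) \<Rightarrow> ((real \<times> 's \<Rightarrow> real) \<times> (nat \<Rightarrow> real)) set" where
  "dual_feasible N T A q c w =
     {(h, u). h \<in> B_w2 T w \<and> u \<in> {1..N} \<rightarrow>\<^sub>E {..0} \<and>
        (\<forall>(t, i, a) \<in> space (X_space T A).
           T * c 0 i a - h (t, i) + (LINT s:{t..T}|lborel. (\<Sum>\<^sub>\<infinity>j. h (s, j) * q j i a))
             - T * (\<Sum>n=1..N. u n * c n i a) \<ge> 0)}"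

definition dual_value ::
    "nat \<Rightarrow> real \<Rightarrow> (nat \<Rightarrow> real) \<Rightarrow> 's pmf \<Rightarrow> (real \<times> 's \<Rightarrow> real) \<times> (nat \<Rightarrow> real) \<Rightarrow> real" where
  "dual_value N T d \<gamma> = (\<lambda>(h, u).
     1 / T * (LINT t:{0..T}|lborel. (\<Sum>\<^sub>\<infinity>i. h (t, i) * pmf \<gamma> i)) + (\<Sum>n=1..N. d n * u n))"

end

theory Submission
  imports Defs
begin

text \<open>
  A measure \<open>\<eta>\<close> satisfies the flow constraint of the primal program iff it is an occupation measure:
  the identity \<open>balance\<close>, tested with all nonnegative measurable functions, gives total mass one and
  a bound on \<open>\<integral>w\<^sup>3 d\<eta>\<close> that does not depend on \<open>\<eta>\<close>. Policies give occupation measures, because under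
  the path law the intensity compensates the jumps. By Prokhorov's theorem and the moment bound the
  occupation measures are sequentially compact with respect to test functions that are continuous on
  \<open>[0, T] \<times> A(i)\<close> and \<open>O(w)\<close>, so the primal optimum is attained. Lagrange multipliers for the finitely
  many constraints reduce the dual to a single cost rate \<open>g\<close>. For it the Hamilton-Jacobi-Bellman
  equation has a solution of order \<open>w\<close>, whose negative time derivative \<open>h\<close> is dual feasible, and
  nearly minimizing Markov controls produce occupation measures with cost close to the dual value of \<open>h\<close>.
\<close>

text \<open>The rates are unbounded, so a term such as \<open>w ^ 3\<close> times a rate need not be
  integrable. The flow identities are therefore kept in \<open>ennreal\<close>: the negative
  diagonal rates are moved to the other side, and each moment estimate ends by cancelling an outflow
  term whose finiteness is secured beforehand by a cap or by a level set of \<open>w\<close>. The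
  powers of \<open>w\<close> fit together because a rate costs one power: test functions in
  \<open>B_w2\<close> have flow terms of order \<open>w ^ 3\<close>, and costs of order
  \<open>w\<close> leave two powers for uniform integrability in the compactness argument. The shift
  by \<open>L * w i\<close> on the diagonal is used twice. It makes the generator monotone, which
  gives a decreasing iteration from a supersolution for the Hamilton-Jacobi-Bellman equation, and
  for a Markov control an increasing iteration to a solution of the forward equation. That solution
  yields the occupation measure directly. The cost of any occupation measure exceeds the dual value
  by the integrated slack of the dual constraint, and this slack is small along a nearly minimizing
  control.\<close>

abbreviation counting :: "'x measure" where "counting == count_space UNIV"

abbreviation borel_counting :: "('x :: topological_space \<times> 'y) measure" where
  "borel_counting == borel \<Otimes>\<^sub>M count_space UNIV"

syntax "_nnint" :: "pttrn => ennreal => 'x measure => ennreal"  ("NN _. _ \<partial>_" [60, 61] 110)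
translations "NN x. f \<partial>M" => "CONST nn_integral M (%x. f)"

section \<open>Nonnegative integrals and countable sums\<close>

lemma nn_integral_count_space_off_point:
 fixes f :: "'s => real"
 assumes "f summable_on UNIV" and "!!j. j \<noteq> i ==> 0 <= f j"
 shows "(NN j. (if j = i then 0 else ennreal (f j)) \<partial>counting) = ennreal (infsum f UNIV - f i)"
proof -
 let ?g = "%j. if j = i then 0 else f j"
 have hs: "(?g has_sum (infsum f UNIV - f i)) UNIV"
 proof -
  have "(f has_sum (infsum f UNIV - f i)) (UNIV - {i})"
   using has_sum_infsum[OF assms(1)] has_sum_finite[of "{i}" f]
   by (intro has_sum_Diff) auto
  then show ?thesis
   by (subst has_sum_cong_neutral[where T = "UNIV - {i}" and g = f]) auto
 qed
 then have "?g summable_on UNIV" by (auto simp: summable_on_def)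
 then have "Infinite_Sum.abs_summable_on ?g UNIV"
  by (rule summable_on_iff_abs_summable_on_real[THEN iffD1])
 then have ab: "Infinite_Set_Sum.abs_summable_on ?g UNIV"
  by (simp only: abs_summable_equivalent)
 have "(NN j. ennreal (?g j) \<partial>counting) = ennreal (infsetsum ?g UNIV)"
  using assms by (intro nn_integral_conv_infsetsum ab) auto
 also have "infsetsum ?g UNIV = infsum f UNIV - f i"
  using infsetsum_infsum[OF ab] hs by (simp add: infsumI)
 also have "(NN j. ennreal (?g j) \<partial>counting) = (NN j. (if j = i then 0 else ennreal (f j)) \<partial>counting)"
  by (intro nn_integral_cong) auto
 finally show ?thesis .
qed

lemma measurable_by_state:
 assumes "!!i. (%(t, a). f t i a) : (borel :: real measure) \<Otimes>\<^sub>M (borel :: 'a::second_countable_topology measure) \<rightarrow>\<^sub>M N"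
 shows "(%(t, i :: 's :: countable, a). f t i a) : borel \<Otimes>\<^sub>M counting \<Otimes>\<^sub>M borel \<rightarrow>\<^sub>M N"
proof -
 have "(%x. (%i x. (%(t, a). f t i a) (fst x, snd (snd x))) (fst (snd x)) x) : borel \<Otimes>\<^sub>M counting \<Otimes>\<^sub>M borel \<rightarrow>\<^sub>M N"
  by (rule measurable_compose_countable, rule measurable_compose[OF _ assms]) auto
 then show ?thesis by (simp add: case_prod_beta')
qed

lemma nn_integral_swap:
 assumes "sigma_finite_measure M" "sigma_finite_measure N"
  and "case_prod f : borel_measurable (M \<Otimes>\<^sub>M N)"
 shows "(NN x. (NN y. f x y \<partial>N) \<partial>M) = (NN y. (NN x. f x y \<partial>M) \<partial>N)"
proof -
 interpret pair_sigma_finite M N using assms by (simp add: pair_sigma_finite_def)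
 show ?thesis using Fubini'[OF assms(3)] by simp
qed

lemma sigma_finite_count_countable: "sigma_finite_measure (count_space (UNIV :: 's::countable set))"
 by (rule sigma_finite_measure_count_space_countable) simp

text \<open>Cancellation in \<open>ennreal\<close> with the larger of the two cancelled terms known
  to be finite; it removes outflow terms from both sides of moment inequalities.\<close>

lemma nn_integral_diff_bound:
 fixes a b c d :: ennreal
 assumes "a + b <= c + d" "d <= b" "b < top"
 shows "a <= c"
proof -
 have "a + b <= c + b" using assms(1,2) by (meson add_left_mono order_trans)
 then show ?thesis using assms(3) by (simp add: ennreal_add_left_cancel_le add.commute[of _ b]) auto
qed

section \<open>The controlled model and its occupation measures\<close>

locale ctmdp =
 fixes T :: real and A :: "'s :: countable => 'a :: polish_space set"
  and q :: "'s => 's => 'a => real" and \<gamma> :: "'s pmf" and w :: "'s => real" and L R :: real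
 assumes T_pos: "0 < T" and L_pos: "0 < L" and R_pos: "0 < R"
  and A_compact: "!!i. compact (A i)" and A_nonempty: "!!i. A i \<noteq> {}"
  and q_cont: "!!i j. continuous_on (A i) (q j i)"
  and q_nonneg: "!!i j a. a : A i ==> j \<noteq> i ==> 0 <= q j i a"
  and q_conservative: "!!i a. a : A i ==> ((%j. q j i a) has_sum 0) UNIV"
  and q_diag: "!!i a. a : A i ==> \<bar>q i i a\<bar> <= L * w i"
  and w_ge_1: "!!i. 1 <= w i"
  and w_drift: "!!k i a. k : {1, 2, 3 :: nat} ==> a : A i ==>
     (%j. w j ^ k * q j i a) summable_on UNIV & (\<Sum>\<^sub>\<infinity>j. w j ^ k * q j i a) <= R * w i ^ k"
  and finite_level: "!!n :: nat. finite {i. w i <= real n}"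
  and w3_init: "(%i. w i ^ 3 * pmf \<gamma> i) summable_on UNIV"
begin

abbreviation Xs :: "(real \<times> 's \<times> 'a) measure" where "Xs \<equiv> X_space T A"
abbreviation Zs :: "(real \<times> 's \<times> 'a) measure" where "Zs \<equiv> borel \<Otimes>\<^sub>M counting \<Otimes>\<^sub>M borel"

abbreviation w3_mean :: "(real \<times> 's \<times> 'a) measure => ennreal" where
 "w3_mean eta == nn_integral eta (%(t, i, a). ennreal (w i ^ 3))"

text \<open>The rates are extended by zero outside \<open>A i\<close>, which makes them Borel on the
  whole action space. The diagonal is set to zero here and kept apart, with positive sign, as
  \<open>outrate\<close>.\<close>

definition inrate :: "'s => 'a => 's => ennreal" where
 "inrate i a j = (if j = i then 0 else ennreal (indicator (A i) a * q j i a))"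

definition outrate :: "'s => 'a => ennreal" where
 "outrate i a = ennreal (indicator (A i) a * (- q i i a))"

text \<open>Adjoint of the time integration in the primal operator: testing the density
  \<open>I[s <= t] dt\<close> with \<open>h\<close> leaves the integral of \<open>h\<close> over the
  times after \<open>s\<close>.\<close>

definition tail :: "(real \<times> 's => ennreal) => real => 's => ennreal" where
 "tail h s j = (NN t. h (t, j) * indicator {s..T} t \<partial>lborel)"

text \<open>The flow constraint tested with \<open>h\<close>, with the diagonal rates moved to the
  left, so that all four terms are nonnegative and the identity makes sense for every nonnegative
  measurable \<open>h\<close>.\<close>

definition balance :: "(real \<times> 's \<times> 'a) measure => (real \<times> 's => ennreal) => bool" where
 "balance eta h \<longleftrightarrow>
   (NN (t, i, a). h (t, i) \<partial>eta) + (NN (t, i, a). tail h t i * outrate i a \<partial>eta) =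
   ennreal (1 / T) * (NN t. (NN j. h (t, j) * ennreal (pmf \<gamma> j) * indicator {0..T} t \<partial>counting) \<partial>lborel)
    + (NN (t, i, a). (NN j. tail h t j * inrate i a j \<partial>counting) \<partial>eta)"

definition occ :: "(real \<times> 's \<times> 'a) measure => bool" where
 "occ eta \<longleftrightarrow> sets eta = sets Xs & (NN (t, i, a). ennreal (w i ^ 3) \<partial>eta) < \<infinity> &
   (\<forall>h\<in>borel_measurable borel_counting. balance eta h)"

lemma A_sets [measurable, simp]: "A i : sets borel"
 using A_compact by (simp add: borel_closed compact_imp_closed)

lemma qz_measurable [measurable]: "(%a. indicator (A i) a * q j i a) : borel_measurable borel"
 using borel_measurable_continuous_on_indicator[OF _ q_cont, of i j] by simp

lemma inrate_measurable [measurable]: "(%a. inrate i a j) : borel_measurable borel"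
 unfolding inrate_def by measurable

lemma outrate_measurable [measurable]: "outrate i : borel_measurable borel"
proof -
 have "outrate i = (%a. ennreal (- (indicator (A i) a * q i i a)))" by (auto simp: outrate_def fun_eq_iff)
 then show ?thesis by simp
qed

lemma space_Xs: "space Xs = {(t, i, a). t : {0..T} & a : A i}"
 unfolding X_space_def space_restrict_space by (auto simp: space_pair_measure)

lemma measurable_Xs_I: "f : Zs \<rightarrow>\<^sub>M N ==> f : Xs \<rightarrow>\<^sub>M N"
 unfolding X_space_def by (rule measurable_restrict_space1)

lemma w_pos: "0 < w i" using w_ge_1[of i] by linarith

text \<open>The sum over all states splits into the off-diagonal part and the diagonal term; moving
  the latter to the right turns a signed drift condition into an inequality between nonnegative
  quantities.\<close>

lemma drift_in_out_aux:
 assumes "a : A i" and "(%j. w j ^ k * q j i a) summable_on UNIV" "(\<Sum>\<^sub>\<infinity>j. w j ^ k * q j i a) <= c"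
 shows "(NN j. ennreal (w j ^ k) * inrate i a j \<partial>counting) <= ennreal c + ennreal (w i ^ k) * outrate i a"
proof -
 have "(NN j. ennreal (w j ^ k) * inrate i a j \<partial>counting)
   = (NN j. (if j = i then 0 else ennreal (w j ^ k * q j i a)) \<partial>counting)"
  using assms(1) w_pos by (intro nn_integral_cong) (auto simp: inrate_def ennreal_mult' less_imp_le)
 also have "... = ennreal ((\<Sum>\<^sub>\<infinity>j. w j ^ k * q j i a) - w i ^ k * q i i a)"
  using assms w_pos q_nonneg by (intro nn_integral_count_space_off_point) (auto simp: less_imp_le)
 also have "... <= ennreal (c + w i ^ k * (- q i i a))"
  using assms by (intro ennreal_leI) simp
 also have "... <= ennreal c + ennreal (w i ^ k * (- q i i a))"
  by (simp only: ennreal_plus_if) (auto intro: ennreal_leI)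
 also have "... = ennreal c + ennreal (w i ^ k) * outrate i a"
  using assms(1) w_pos by (simp add: outrate_def ennreal_mult'[symmetric] less_imp_le)
 finally show ?thesis .
qed

lemma q_diag_nonpos:
 assumes "a : A i" shows "q i i a <= 0"
proof (rule ccontr)
 assume "\<not> q i i a <= 0"
 have "0 = (\<Sum>\<^sub>\<infinity>j. q j i a)" using q_conservative[OF assms] by (simp add: infsumI)
 moreover have "(\<Sum>\<^sub>\<infinity>j. q j i a) \<ge> (\<Sum>\<^sub>\<infinity>j\<in>{i}. q j i a)"
  using q_conservative[OF assms] q_nonneg[OF assms]
  by (intro infsum_mono_neutral summable_on_finite[of "{i}"]) (auto simp: summable_on_def)
 ultimately show False using \<open>\<not> q i i a <= 0\<close> by simp
qed

lemma sum_inrate: "(NN j. inrate i a j \<partial>counting) = outrate i a"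
proof (cases "a : A i")
 case True
 have "(NN j. inrate i a j \<partial>counting)
   = (NN j. (if j = i then 0 else ennreal (q j i a)) \<partial>counting)"
  using True by (intro nn_integral_cong) (auto simp: inrate_def)
 also have "... = ennreal ((\<Sum>\<^sub>\<infinity>j. q j i a) - q i i a)"
  using q_conservative[OF True] q_nonneg[OF True]
  by (intro nn_integral_count_space_off_point) (auto simp: summable_on_def)
 finally show ?thesis using q_conservative[OF True] True by (simp add: infsumI outrate_def)
qed (simp add: inrate_def outrate_def cong: if_cong)

lemma sum_w_inrate:
 assumes "k : {1, 2, 3}"
 shows "(NN j. ennreal (w j ^ k) * inrate i a j \<partial>counting) <= ennreal (R * w i ^ k) + ennreal (w i ^ k) * outrate i a"
proof (cases "a : A i")
 case True
 then show ?thesis using w_drift[OF assms True] by (intro drift_in_out_aux) auto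
qed (simp add: inrate_def outrate_def cong: if_cong)

lemma outrate_le: "outrate i a <= ennreal (L * w i)"
 using q_diag[of a i] L_pos w_pos[of i] by (auto simp: outrate_def indicator_def intro!: ennreal_leI)

lemma tail_measurable:
 assumes [measurable]: "h : borel_measurable borel_counting"
 shows "(%s. tail h s j) : borel_measurable borel"
proof -
 have "(%s. NN t. h (t, j) * (if s <= t & t <= T then 1 else 0) \<partial>lborel) : borel_measurable borel"
  by measurable
 also have "(%s. NN t. h (t, j) * (if s <= t & t <= T then 1 else 0) \<partial>lborel) = (%s. tail h s j)"
  unfolding tail_def by (intro ext nn_integral_cong) (auto simp: indicator_def)
 finally show ?thesis .
qed

lemma measurable_occ:
 assumes "sets eta = sets Xs" "f : Zs \<rightarrow>\<^sub>M N"
 shows "f : eta \<rightarrow>\<^sub>M N"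
 using measurable_Xs_I[OF assms(2)] assms(1) measurable_cong_sets by blast

lemma space_occ: "sets eta = sets Xs ==> space eta = {(t, i, a). t : {0..T} & a : A i}"
 using sets_eq_imp_space_eq[of eta Xs] by (simp add: space_Xs)

lemma measurable_ti_occ:
 assumes "sets eta = sets Xs" "f : borel_measurable borel_counting"
 shows "(%(t, i, a). f (t, i)) : borel_measurable eta"
proof (rule measurable_occ[OF assms(1)])
 have "(%x. f (fst x, fst (snd x))) : borel_measurable Zs"
  by (rule measurable_compose[OF _ assms(2)]) auto
 then show "(%(t, i, a). f (t, i)) : borel_measurable Zs" by (simp add: case_prod_beta')
qed

lemma measurable_tail_out:
 assumes "sets eta = sets Xs" "h : borel_measurable borel_counting"
 shows "(%(t, i, a). tail h t i * outrate i a) : borel_measurable eta"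
proof (intro measurable_occ[OF assms(1)] measurable_by_state)
 fix i
 note [measurable] = tail_measurable[OF assms(2)]
 show "(%(t, a). tail h t i * outrate i a) : borel_measurable (borel \<Otimes>\<^sub>M borel)" by measurable
qed

lemma measurable_tail_in:
 assumes "sets eta = sets Xs" "h : borel_measurable borel_counting"
 shows "(%(t, i, a). (NN j. tail h t j * inrate i a j \<partial>counting)) : borel_measurable eta"
proof (intro measurable_occ[OF assms(1)] measurable_by_state)
 fix i
 interpret sigma_finite_measure "count_space (UNIV :: 's set)" by (rule sigma_finite_count_countable)
 have [measurable]: "(%s. tail h s j) : borel_measurable borel" for j by (rule tail_measurable[OF assms(2)])
 have "(%x. (NN j. tail h (fst x) j * inrate i (snd x) j \<partial>counting)) : borel_measurable (borel \<Otimes>\<^sub>M borel)"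
 proof (rule borel_measurable_nn_integral)
  show "(%(x, j). tail h (fst x) j * inrate i (snd x) j) : borel_measurable ((borel \<Otimes>\<^sub>M borel) \<Otimes>\<^sub>M counting)"
   by (rule measurable_pair_measure_countable1 | simp)+
 qed
 then show "(%(t, a). (NN j. tail h t j * inrate i a j \<partial>counting)) : borel_measurable (borel \<Otimes>\<^sub>M borel)"
  by (simp add: case_prod_beta')
qed

lemma finite_if_w_integrable:
 assumes "sets eta = sets Xs" "(NN (t, i, a). ennreal (w i ^ 3) \<partial>eta) < \<infinity>"
 shows "finite_measure eta"
proof
 have "emeasure eta (space eta) = (NN x. 1 \<partial>eta)" by simp
 also have "... <= (NN (t, i, a). ennreal (w i ^ 3) \<partial>eta)"
  using w_ge_1 by (intro nn_integral_mono) (auto simp: one_le_power)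
 finally show "emeasure eta (space eta) \<noteq> \<infinity>" using assms(2) by (auto simp: top_unique)
qed

lemma occ_sets: "occ eta ==> sets eta = sets Xs" by (simp add: occ_def)
lemma occ_w3: "occ eta ==> (NN (t, i, a). ennreal (w i ^ 3) \<partial>eta) < \<infinity>" by (simp add: occ_def)
lemma occ_balance: "occ eta ==> h : borel_measurable borel_counting ==> balance eta h" by (simp add: occ_def)
lemma occ_finite: "occ eta ==> finite_measure eta" by (simp add: occ_def finite_if_w_integrable)

lemma pmf_sum: "(NN j. ennreal (pmf \<gamma> j) \<partial>counting) = 1"
 by (subst nn_integral_pmf) (use measure_pmf.emeasure_space_1[of \<gamma>] in simp)

lemma measurable_w_occ [measurable]:
 assumes "sets eta = sets Xs" shows "(%(t, i, a). g (w i)) : borel_measurable eta"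
 using measurable_ti_occ[OF assms, of "%x. g (w (snd x))"]
 by (simp add: measurable_compose[OF measurable_snd])

lemma w_pow_le:
 assumes "k <= l" shows "w i ^ k <= w i ^ l"
 using assms w_ge_1 by (simp add: power_increasing)

lemma nn_integral_w3_finite:
 assumes sets: "sets eta = sets Xs" and w3: "(NN (t, i, a). ennreal (w i ^ 3) \<partial>eta) < \<infinity>"
  and "!!t i a. t : {0..T} ==> a : A i ==> f (t, i, a) <= ennreal c * ennreal (w i ^ 3)"
 shows "(NN x. f x \<partial>eta) < \<infinity>"
proof -
 have "(NN x. f x \<partial>eta) <= (NN x. ennreal c * (case x of (t, i, a) => ennreal (w i ^ 3)) \<partial>eta)"
  using assms(3) space_occ[OF sets] by (intro nn_integral_mono) auto
 also have "... = ennreal c * (NN (t, i, a). ennreal (w i ^ 3) \<partial>eta)"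
  by (intro nn_integral_cmult measurable_w_occ[OF sets])
 also have "... < \<infinity>" using w3 by (simp add: ennreal_mult_less_top)
 finally show ?thesis .
qed

lemma nn_integral_finite_of_bound:
 assumes "occ eta" "!!t i a. t : {0..T} ==> a : A i ==> f (t, i, a) <= ennreal c * ennreal (w i ^ 3)"
 shows "(NN x. f x \<partial>eta) < \<infinity>"
 using occ_sets[OF assms(1)] occ_w3[OF assms(1)] assms(2) by (rule nn_integral_w3_finite)

lemma tail_le_const:
 assumes "!!t. s <= t ==> t <= T ==> h (t, j) <= ennreal c" "0 <= s" "0 <= c"
 shows "tail h s j <= ennreal (c * T)"
proof -
 have "tail h s j <= (NN t. ennreal c * indicator {0..T} t \<partial>lborel)"
  unfolding tail_def using assms by (intro nn_integral_mono) (auto simp: indicator_def)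
 also have "... = ennreal (c * T)" using T_pos assms(3) by (simp add: nn_integral_cmult_indicator ennreal_mult)
 finally show ?thesis .
qed

lemma tail_const: "s : {0..T} ==> 0 <= c ==> tail (%x. ennreal c) s j = ennreal (c * (T - s))"
 unfolding tail_def by (simp add: nn_integral_cmult_indicator ennreal_mult)

text \<open>For the test function one the inflow and outflow terms coincide by
  \<open>sum_inrate\<close>. Both are finite because the rates are of order \<open>w\<close>, so
  they cancel and only the initial term remains.\<close>

lemma occ_mass:
 assumes "occ eta" shows "emeasure eta (space eta) = 1"
proof -
 let ?h = "%_ :: real \<times> 's. ennreal 1"
 note sets = occ_sets[OF assms]
 have b: "balance eta ?h" using assms by (rule occ_balance) simp
 have eq: "(NN (t, i, a). (NN j. tail ?h t j * inrate i a j \<partial>counting) \<partial>eta)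
   = (NN (t, i, a). tail ?h t i * outrate i a \<partial>eta)"
  unfolding space_occ[OF sets] using tail_const[of _ 1]
  by (intro nn_integral_cong) (auto simp: space_occ[OF sets] nn_integral_cmult sum_inrate)
 have fin: "(NN (t, i, a). tail ?h t i * outrate i a \<partial>eta) < \<infinity>"
 proof (rule nn_integral_finite_of_bound[OF assms, of _ "T * L"], simp only: prod.case)
  fix t i a assume "t : {0..T}"
  have "tail ?h t i * outrate i a <= ennreal (1 * T) * ennreal (L * w i)"
   using \<open>t : {0..T}\<close> by (intro mult_mono tail_le_const outrate_le) auto
  also have "... <= ennreal (T * L) * ennreal (w i ^ 3)"
   using T_pos L_pos w_pos[of i] w_pow_le[of 1 3 i]
   by (simp add: ennreal_mult[symmetric] less_imp_le mult.assoc)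
  finally show "tail ?h t i * outrate i a <= ennreal (T * L) * ennreal (w i ^ 3)" .
 qed
 have "(NN t. (NN j. ?h (t, j) * ennreal (pmf \<gamma> j) * indicator {0..T} t \<partial>counting) \<partial>lborel) = ennreal T"
  using T_pos by (simp add: nn_integral_multc pmf_sum)
 then have "emeasure eta (space eta) + (NN (t, i, a). tail ?h t i * outrate i a \<partial>eta)
   = ennreal (1 / T) * ennreal T + (NN (t, i, a). tail ?h t i * outrate i a \<partial>eta)"
  using b unfolding balance_def eq by (simp add: case_prod_beta')
 moreover have "ennreal (1 / T) * ennreal T = 1" using T_pos by (simp add: ennreal_mult[symmetric])
 ultimately show ?thesis using fin
  by (auto simp: add.commute[of _ "NN x. _ x \<partial>eta"] ennreal_add_left_cancel)
qed

lemma occ_prob: "occ eta ==> prob_space eta"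
 by (rule prob_spaceI) (rule occ_mass)

text \<open>Below the cap this is the drift of \<open>w ^ 3\<close>; above it the capped function is
  maximal, so the inflow is at most the cap times the total rate. The cap matters because
  \<open>w ^ 3\<close> times a rate is of order \<open>w ^ 4\<close>, which cannot be cancelled as
  finite.\<close>

lemma cap_drift:
 fixes m :: nat
 defines "f \<equiv> %i. min (w i ^ 3) (real m)"
 shows "(NN j. ennreal (f j) * inrate i a j \<partial>counting) <= ennreal (R * f i) + ennreal (f i) * outrate i a"
proof (cases "w i ^ 3 <= real m")
 case True
 have "(NN j. ennreal (f j) * inrate i a j \<partial>counting) <= (NN j. ennreal (w j ^ 3) * inrate i a j \<partial>counting)"
  by (intro nn_integral_mono mult_right_mono) (auto simp: f_def intro: ennreal_leI)
 also have "... <= ennreal (R * w i ^ 3) + ennreal (w i ^ 3) * outrate i a" by (rule sum_w_inrate) simp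
 also have "w i ^ 3 = f i" using True by (simp add: f_def)
 finally show ?thesis .
next
 case False
 have "(NN j. ennreal (f j) * inrate i a j \<partial>counting) <= (NN j. ennreal (real m) * inrate i a j \<partial>counting)"
  by (intro nn_integral_mono mult_right_mono) (auto simp: f_def intro: ennreal_leI)
 also have "... = ennreal (real m) * outrate i a" by (simp add: nn_integral_cmult sum_inrate)
 also have "real m = f i" using False by (simp add: f_def)
 finally show ?thesis by (simp add: add_increasing)
qed

text \<open>The solution of \<open>kap' = - R * kap\<close> with final value one. Its integral over
  \<open>[s, T]\<close> is \<open>(kap s - 1) / R\<close>, hence \<open>kap\<close> equals one plus
  \<open>R\<close> times its own tail; this identity lets the drift term cancel in
  \<open>occ_cap_bound\<close>.\<close>

definition kap :: "real => real" where "kap t = exp (R * (T - t))"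

lemma tail_kap:
 assumes "s : {0..T}" "0 <= g j"
 shows "tail (%(t, j). ennreal (g j * kap t)) s j = ennreal (g j * ((kap s - 1) / R))"
proof -
 have "(NN t. ennreal (kap t) * indicator {s..T} t \<partial>lborel) = ennreal ((- 1 / R) * kap T - (- 1 / R) * kap s)"
 proof (rule nn_integral_FTC_Icc)
  show "(%t. kap t) : borel_measurable borel" unfolding kap_def by measurable
  show "!!x. 0 <= kap x" by (simp add: kap_def)
  show "((%t. (- 1 / R) * kap t) has_real_derivative kap x) (at x)" for x
   unfolding kap_def using R_pos by (auto intro!: derivative_eq_intros)
 qed (use assms in auto)
 also have "(- 1 / R) * kap T - (- 1 / R) * kap s = (kap s - 1) / R"
  by (simp add: kap_def diff_divide_distrib)
 finally have "(NN t. ennreal (kap t) * indicator {s..T} t \<partial>lborel) = ennreal ((kap s - 1) / R)" .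
 moreover have "tail (%(t, j). ennreal (g j * kap t)) s j = (NN t. ennreal (g j) * (ennreal (kap t) * indicator {s..T} t) \<partial>lborel)"
  unfolding tail_def using assms(2) by (intro nn_integral_cong) (auto simp: ennreal_mult' mult.assoc)
 moreover have "(%t. ennreal (kap t) * indicator {s..T} t) : borel_measurable lborel"
  unfolding kap_def by measurable
 ultimately show ?thesis using assms(2) by (simp only: nn_integral_cmult ennreal_mult')
qed

lemma kap_ge_1: "t <= T ==> 1 <= kap t" using R_pos by (simp add: kap_def)

definition w3_const :: ennreal where
 "w3_const = ennreal (exp (R * T)) * (NN j. ennreal (w j ^ 3 * pmf \<gamma> j) \<partial>counting)"

lemma w3_const_finite: "w3_const < \<infinity>"
proof -
 have "Infinite_Sum.abs_summable_on (%i. w i ^ 3 * pmf \<gamma> i) UNIV"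
  using w3_init by (rule summable_on_iff_abs_summable_on_real[THEN iffD1])
 then have "Infinite_Set_Sum.abs_summable_on (%i. w i ^ 3 * pmf \<gamma> i) UNIV"
  by (simp only: abs_summable_equivalent)
 from nn_integral_conv_infsetsum[OF this] show ?thesis
  using w_pos by (simp add: w3_const_def less_imp_le ennreal_mult_less_top)
qed

text \<open>Balance is tested with the capped \<open>f\<close> times \<open>kap\<close>. By
  \<open>cap_drift\<close> the inflow exceeds the outflow by at most \<open>R * f * K\<close>, and
  \<open>f * kap = f + R * f * K\<close> produces the same term on the left. After cancelling the
  outflow and then the drift term only the initial moment is left, so the bound depends neither on
  \<open>m\<close> nor on \<open>eta\<close>.\<close>

lemma occ_cap_bound:
 assumes "occ eta"
 shows "(NN (t, i, a). ennreal (min (w i ^ 3) (real m)) \<partial>eta) <= w3_const"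
proof -
 define f where "f = (%i. min (w i ^ 3) (real m))"
 have f0: "0 <= f i" "f i <= w i ^ 3" for i using w_pos[of i] by (auto simp: f_def less_imp_le)
 define h where "h = (%(t, j). ennreal (f j * kap t))"
 define K where "K = (%t. (kap t - 1) / R)"
 have K0: "t : {0..T} ==> 0 <= K t" for t using kap_ge_1[of t] R_pos by (simp add: K_def)
 note sets = occ_sets[OF assms]
 note sp = space_occ[OF sets]
 have h_meas: "h : borel_measurable borel_counting"
  unfolding h_def kap_def by measurable
 note b = occ_balance[OF assms h_meas]
 have tl: "s : {0..T} ==> tail h s j = ennreal (f j * K s)" for s j
  unfolding h_def K_def using f0 by (intro tail_kap) auto
 have m1: "(%(t, i, a). ennreal (f i)) : borel_measurable eta" "(%(t, i, a). ennreal (R * f i * K t)) : borel_measurable eta"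
  using measurable_ti_occ[OF sets, of "%(t, i). ennreal (f i)"] measurable_ti_occ[OF sets, of "%(t, i). ennreal (R * f i * K t)"]
  by (simp_all add: K_def kap_def case_prod_beta' cong: if_cong)
 have m2: "(%(t, i, a). tail h t i * outrate i a) : borel_measurable eta"
  by (rule measurable_tail_out[OF sets h_meas])
 have fin1: "(NN (t, i, a). tail h t i * outrate i a \<partial>eta) < \<infinity>"
 \<comment> \<open>The constant is the product of the cap, the maximum of \<open>kap\<close>, the
   length of the time interval and the rate constant.\<close>
 proof (rule nn_integral_finite_of_bound[OF assms, of _ "real m * kap 0 * T * L"], simp only: prod.case)
  fix t i a assume t: "t : {0..T}"
  have "tail h t i * outrate i a <= ennreal (real m * kap 0 * T) * ennreal (L * w i)"
  proof (intro mult_mono tail_le_const outrate_le)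
   fix s assume "t <= s" "s <= T"
   then show "h (s, i) <= ennreal (real m * kap 0)" unfolding h_def
    using t R_pos by (auto intro!: ennreal_leI mult_mono simp: f_def kap_def)
  qed (use t in \<open>auto simp: kap_def\<close>)
  also have "... = ennreal (real m * kap 0 * T * L * w i)"
   using T_pos L_pos w_pos[of i] by (subst ennreal_mult[symmetric]) (auto simp: kap_def mult_ac)
  also have "... <= ennreal (real m * kap 0 * T * L * w i ^ 3)"
   using T_pos L_pos w_pow_le[of 1 3 i] by (intro ennreal_leI mult_left_mono) (auto simp: kap_def)
  also have "... = ennreal (real m * kap 0 * T * L) * ennreal (w i ^ 3)"
   using T_pos L_pos w_pos[of i] by (subst ennreal_mult[symmetric]) (auto simp: kap_def)
  finally show "tail h t i * outrate i a <= ennreal (real m * kap 0 * T * L) * ennreal (w i ^ 3)" .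
 qed
 have fin2: "(NN (t, i, a). ennreal (R * f i * K t) \<partial>eta) < \<infinity>"
 proof (rule nn_integral_finite_of_bound[OF assms, of _ "kap 0"], simp only: prod.case)
  fix t i a assume t: "t : {0..T}"
  have "R * f i * K t = f i * (kap t - 1)" using R_pos by (simp add: K_def)
  also have "... <= kap 0 * w i ^ 3"
  proof -
   have "kap t <= kap 0" using t R_pos by (auto simp: kap_def)
   then have "f i * (kap t - 1) <= w i ^ 3 * kap 0"
    using f0[of i] t kap_ge_1[of t] w_pos[of i] by (intro mult_mono) auto
   then show ?thesis by (simp add: mult.commute)
  qed
  finally show "ennreal (R * f i * K t) <= ennreal (kap 0) * ennreal (w i ^ 3)"
   by (simp add: ennreal_mult'[symmetric] kap_def ennreal_leI)
 qed
 have init: "ennreal (1 / T) * (NN t. (NN j. h (t, j) * ennreal (pmf \<gamma> j) * indicator {0..T} t \<partial>counting) \<partial>lborel) <= w3_const"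
 proof -
  have "(NN t. (NN j. h (t, j) * ennreal (pmf \<gamma> j) * indicator {0..T} t \<partial>counting) \<partial>lborel)
    <= (NN t. (NN j. ennreal (exp (R * T)) * (ennreal (w j ^ 3 * pmf \<gamma> j) * indicator {0..T} t) \<partial>counting) \<partial>lborel)"
  proof (intro nn_integral_mono)
   fix t j
   have "t : {0..T} ==> f j * kap t * pmf \<gamma> j <= exp (R * T) * (w j ^ 3 * pmf \<gamma> j)"
   proof -
    assume "t : {0..T}"
    then have "kap t <= exp (R * T)" using R_pos by (auto simp: kap_def)
    then have "f j * kap t * pmf \<gamma> j <= w j ^ 3 * exp (R * T) * pmf \<gamma> j"
     using f0[of j] w_pos[of j] by (intro mult_mono mult_right_mono) (auto simp: kap_def)
    then show ?thesis by (simp only: mult_ac)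
   qed
   then show "h (t, j) * ennreal (pmf \<gamma> j) * indicator {0..T} t <= ennreal (exp (R * T)) * (ennreal (w j ^ 3 * pmf \<gamma> j) * indicator {0..T} t)"
    using f0[of j] w_pos[of j] by (auto simp: indicator_def h_def ennreal_mult'[symmetric] ennreal_leI kap_def)
  qed
  also have "... = w3_const * ennreal T"
   using T_pos by (simp add: nn_integral_cmult nn_integral_multc w3_const_def mult.assoc)
  finally have "ennreal (1 / T) * (NN t. (NN j. h (t, j) * ennreal (pmf \<gamma> j) * indicator {0..T} t \<partial>counting) \<partial>lborel)
    <= ennreal (1 / T) * (w3_const * ennreal T)" by (intro mult_left_mono) auto
  also have "... = w3_const * (ennreal (1 / T) * ennreal T)" by (simp only: mult_ac)
  also have "... = w3_const" using T_pos by (simp add: ennreal_mult[symmetric])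
  finally show ?thesis .
 qed
 have "(NN (t, i, a). (NN j. tail h t j * inrate i a j \<partial>counting) \<partial>eta)
   <= (NN x. (case x of (t, i, a) => ennreal (R * f i * K t)) + (case x of (t, i, a) => tail h t i * outrate i a) \<partial>eta)"
 proof (intro nn_integral_mono, clarsimp simp: sp)
  fix t i a assume t: "0 <= t" "t <= T"
  have "(NN j. tail h t j * inrate i a j \<partial>counting) = (NN j. ennreal (K t) * (ennreal (f j) * inrate i a j) \<partial>counting)"
   using t K0[of t] f0 by (intro nn_integral_cong) (simp add: tl ennreal_mult mult_ac)
  also have "... <= ennreal (K t) * (ennreal (R * f i) + ennreal (f i) * outrate i a)"
   using cap_drift[of m i a] by (simp add: nn_integral_cmult f_def mult_left_mono)
  also have "... = ennreal (R * f i * K t) + tail h t i * outrate i a"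
   using t K0[of t] f0 R_pos by (simp add: tl ennreal_mult distrib_left mult_ac)
  finally show "(NN j. tail h t j * inrate i a j \<partial>counting) <= ennreal (R * f i * K t) + tail h t i * outrate i a" .
 qed
 also have "... = (NN (t, i, a). ennreal (R * f i * K t) \<partial>eta) + (NN (t, i, a). tail h t i * outrate i a \<partial>eta)"
  by (rule nn_integral_add[OF m1(2) m2])
 finally have i1: "(NN (t, i, a). h (t, i) \<partial>eta) + (NN (t, i, a). tail h t i * outrate i a \<partial>eta)
   <= (w3_const + (NN (t, i, a). ennreal (R * f i * K t) \<partial>eta)) + (NN (t, i, a). tail h t i * outrate i a \<partial>eta)"
  using b init unfolding balance_def by (simp add: add.assoc add_mono)
 have "(NN (t, i, a). h (t, i) \<partial>eta) <= w3_const + (NN (t, i, a). ennreal (R * f i * K t) \<partial>eta)"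
  using nn_integral_diff_bound[OF i1] fin1 by simp
 moreover have "(NN (t, i, a). h (t, i) \<partial>eta) = (NN x. (case x of (t, i, a) => ennreal (f i)) + (case x of (t, i, a) => ennreal (R * f i * K t)) \<partial>eta)"
 proof (intro nn_integral_cong, clarsimp simp: sp)
  fix t i a assume t: "0 <= t" "t <= T"
  have "f i * kap t = f i + R * f i * K t" using R_pos by (simp add: K_def field_simps)
  then show "h (t, i) = ennreal (f i) + ennreal (R * f i * K t)"
   using t K0[of t] f0[of i] R_pos by (simp add: h_def)
 qed
 ultimately have "(NN (t, i, a). ennreal (f i) \<partial>eta) + (NN (t, i, a). ennreal (R * f i * K t) \<partial>eta) <= w3_const + (NN (t, i, a). ennreal (R * f i * K t) \<partial>eta)"
  by (simp only: nn_integral_add[OF m1])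
 from nn_integral_diff_bound[OF this] fin2 show ?thesis by (simp add: f_def)
qed

lemma w3_bound_of_caps:
 assumes sets: "sets eta = sets Xs" and "!!m :: nat. (NN (t, i, a). ennreal (min (w i ^ 3) (real m)) \<partial>eta) <= c"
 shows "(NN (t, i, a). ennreal (w i ^ 3) \<partial>eta) <= c"
proof -
 have "(NN x. (SUP m. (case x of (t, i, a) => ennreal (min (w i ^ 3) (real m)))) \<partial>eta)
   = (SUP m. (NN (t, i, a). ennreal (min (w i ^ 3) (real m)) \<partial>eta))"
 proof (rule nn_integral_monotone_convergence_SUP)
  show "incseq (%m (t, i, a). ennreal (min (w i ^ 3) (real m)))"
   by (auto simp: incseq_def le_fun_def intro!: ennreal_leI)
  show "(%(t, i, a). ennreal (min (w i ^ 3) (real m))) : borel_measurable eta" for m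
   by (rule measurable_w_occ[OF sets])
 qed
 moreover have "(SUP m. (case x of (t, i, a) => ennreal (min (w i ^ 3) (real m)))) = (case x of (t, i, a) => ennreal (w i ^ 3))"
  for x :: "real \<times> 's \<times> 'a"
 proof (clarsimp split: prod.split, rule antisym)
  fix i
  show "(SUP m. ennreal (min (w i ^ 3) (real m))) <= ennreal (w i ^ 3)" by (intro SUP_least ennreal_leI) simp
  have "ennreal (w i ^ 3) <= ennreal (min (w i ^ 3) (real (nat \<lceil>w i ^ 3\<rceil>)))"
   by (intro ennreal_leI) (simp add: le_nat_iff, linarith)
  then show "ennreal (w i ^ 3) <= (SUP m. ennreal (min (w i ^ 3) (real m)))" by (rule SUP_upper2[rotated]) simp
 qed
 ultimately show ?thesis using assms(2) by (simp add: SUP_le_iff)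
qed

lemma occ_w3_bound:
 assumes "occ eta"
 shows "(NN (t, i, a). ennreal (w i ^ 3) \<partial>eta) <= w3_const"
 using occ_sets[OF assms] occ_cap_bound[OF assms] by (rule w3_bound_of_caps)

end

section \<open>Fubini and the forward form of the balance identity\<close>

lemma nn_integral_swap3:
 fixes f :: "'x => real => 's::countable => ennreal"
 assumes "sigma_finite_measure M"
  and f: "(%(x, t, j). f x t j) : borel_measurable (M \<Otimes>\<^sub>M borel \<Otimes>\<^sub>M counting)"
 shows "(NN x. NN t. NN j. f x t j \<partial>counting \<partial>lborel \<partial>M)
    = (NN t. NN j. NN x. f x t j \<partial>M \<partial>counting \<partial>lborel)"
proof -
 interpret C: sigma_finite_measure "count_space (UNIV :: 's set)" by (rule sigma_finite_count_countable)
 have f': "(%((x, t), j). f x t j) : borel_measurable ((M \<Otimes>\<^sub>M lborel) \<Otimes>\<^sub>M counting)"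
 proof -
  have "(%y. (fst (fst y), snd (fst y), snd y)) : (M \<Otimes>\<^sub>M lborel) \<Otimes>\<^sub>M counting \<rightarrow>\<^sub>M M \<Otimes>\<^sub>M borel \<Otimes>\<^sub>M counting"
   by measurable
  from measurable_compose[OF this f] show ?thesis by (simp add: case_prod_beta')
 qed
 have "(NN x. NN t. NN j. f x t j \<partial>counting \<partial>lborel \<partial>M)
   = (NN t. NN x. NN j. f x t j \<partial>counting \<partial>M \<partial>lborel)"
 proof (rule nn_integral_swap[OF assms(1) sigma_finite_lborel])
  have "(%y. NN j. f (fst y) (snd y) j \<partial>counting) : borel_measurable (M \<Otimes>\<^sub>M lborel)"
   by (rule C.borel_measurable_nn_integral) (use f' in \<open>simp add: case_prod_beta'\<close>)
  then show "(%(x, t). NN j. f x t j \<partial>counting) : borel_measurable (M \<Otimes>\<^sub>M lborel)"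
   by (simp add: case_prod_beta')
 qed
 also have "... = (NN t. NN j. NN x. f x t j \<partial>M \<partial>counting \<partial>lborel)"
 proof (intro nn_integral_cong nn_integral_swap[OF assms(1) sigma_finite_count_countable])
  fix t :: real
  have "(%y. (fst y, t, snd y)) : M \<Otimes>\<^sub>M counting \<rightarrow>\<^sub>M M \<Otimes>\<^sub>M borel \<Otimes>\<^sub>M counting"
   by measurable
  from measurable_compose[OF this f] show "(%(x, j). f x t j) : borel_measurable (M \<Otimes>\<^sub>M counting)"
   by (simp add: case_prod_beta')
 qed
 finally show ?thesis .
qed

lemma measurable_swap3_inner:
 fixes f :: "'x => real => 's::countable => ennreal"
 assumes "sigma_finite_measure M"
  and f: "(%(x, t, j). f x t j) : borel_measurable (M \<Otimes>\<^sub>M borel \<Otimes>\<^sub>M counting)"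
 shows "(%(t, j). NN x. f x t j \<partial>M) : borel_measurable borel_counting"
proof -
 interpret sigma_finite_measure M by fact
 have "(%y. (snd y, fst (fst y), snd (fst y))) : borel_counting \<Otimes>\<^sub>M M \<rightarrow>\<^sub>M M \<Otimes>\<^sub>M borel \<Otimes>\<^sub>M counting"
  by measurable
 from measurable_compose[OF this f]
 have "(%(y, x). f x (fst y) (snd y)) : borel_measurable (borel_counting \<Otimes>\<^sub>M M)"
  by (simp add: case_prod_beta')
 from borel_measurable_nn_integral[OF this] show ?thesis by (simp add: case_prod_beta')
qed

lemma measurable_over_countable:
 fixes f :: "'x => 't => 's::countable => 'y"
 assumes "!!j. (%(x, t). f x t j) : M \<Otimes>\<^sub>M N \<rightarrow>\<^sub>M K"
 shows "(%(x, t, j). f x t j) : M \<Otimes>\<^sub>M N \<Otimes>\<^sub>M counting \<rightarrow>\<^sub>M K"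
proof -
 have "(%y. (%j y. (%(x, t). f x t j) (fst y, fst (snd y))) (snd (snd y)) y) : M \<Otimes>\<^sub>M N \<Otimes>\<^sub>M counting \<rightarrow>\<^sub>M K"
  by (rule measurable_compose_countable, rule measurable_compose[OF _ assms]) auto
 then show ?thesis by (simp add: case_prod_beta')
qed

context ctmdp
begin

text \<open>The rate of leaving \<open>j\<close> accumulated up to time \<open>t\<close>; by Fubini
  it is the \<open>dt\<close>-density of the outflow term of the balance identity.
  \<open>occ_in\<close> is the same for arrivals.\<close>

definition occ_out :: "(real \<times> 's \<times> 'a) measure => real => 's => ennreal" where
 "occ_out eta t j = (NN (s, i, a). indicator {..t} s * (if i = j then outrate i a else 0) \<partial>eta)"

definition occ_in :: "(real \<times> 's \<times> 'a) measure => real => 's => ennreal" where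
 "occ_in eta t j = (NN (s, i, a). indicator {..t} s * inrate i a j \<partial>eta)"

lemma measurable_time_rate:
 fixes r :: "'s => 'a => 's => ennreal"
 assumes "sets eta = sets Xs" "!!i j. (%a. r i a j) : borel_measurable borel"
  and [measurable]: "g : borel_measurable borel_counting"
 shows "(%((s, i, a), t, j). g (t, j) * (indicator {..t} s * r i a j)) : borel_measurable (eta \<Otimes>\<^sub>M (borel :: real measure) \<Otimes>\<^sub>M counting)"
proof -
 have 1: "(%((s, i, a), t). g (t, j) * ((if s <= t then 1 else 0) * r i a j :: ennreal)) : borel_measurable (eta \<Otimes>\<^sub>M borel)" for j
 proof -
  have [measurable]: "(%x. x) : eta \<rightarrow>\<^sub>M Zs" by (rule measurable_occ[OF assms(1)]) simp
  have [measurable]: "(%x. r (fst (snd x)) (snd (snd x)) j) : borel_measurable Zs"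
   using measurable_by_state[of "%t i a. r i a j" borel] assms(2) by (simp add: case_prod_beta' measurable_compose[OF measurable_snd])
  have [measurable]: "(%x. r (fst (snd x)) (snd (snd x)) j) : borel_measurable eta" "fst : eta \<rightarrow>\<^sub>M borel"
   by (rule measurable_occ[OF assms(1)], simp)+
  show ?thesis unfolding case_prod_beta' by measurable
 qed
 have "(%(x, t, j). g (t, j) * ((if fst x <= t then 1 else 0) * r (fst (snd x)) (snd (snd x)) j)) : borel_measurable (eta \<Otimes>\<^sub>M borel \<Otimes>\<^sub>M counting)"
  by (rule measurable_over_countable) (use 1 in \<open>simp add: case_prod_beta'\<close>)
 also have "(%(x, t, j). g (t, j) * ((if fst x <= t then 1 else 0) * r (fst (snd x)) (snd (snd x)) j))
   = (%((s, i, a), t, j). g (t, j) * (indicator {..t} s * r i a j))"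
  by (auto simp: fun_eq_iff indicator_def)
 finally show ?thesis .
qed

text \<open>Fubini on the set of pairs \<open>s <= t\<close>: integrating the test function over the
  times after \<open>s\<close> becomes, at a fixed \<open>t\<close>, integrating the rates over the
  times \<open>s\<close> up to \<open>t\<close>.\<close>

lemma occ_time_swap:
 fixes r :: "'s => 'a => 's => ennreal"
 assumes sets: "sets eta = sets Xs" and fin: "finite_measure eta"
  and r: "!!i j. (%a. r i a j) : borel_measurable borel"
  and h: "h : borel_measurable borel_counting"
 shows "(NN (s, i, a). (NN j. tail h s j * r i a j \<partial>counting) \<partial>eta)
  = (NN t. NN j. h (t, j) * indicator {0..T} t * (NN (s, i, a). indicator {..t} s * r i a j \<partial>eta) \<partial>counting \<partial>lborel)"
  (is "?L = ?R")
  and "(%(t, j). NN (s, i, a). indicator {..t} s * r i a j \<partial>eta) : borel_measurable borel_counting"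
proof -
 have sf: "sigma_finite_measure eta" using fin by (rule finite_measure.axioms(1))
 note [measurable] = h r
 let ?g = "%(t :: real, j :: 's). h (t, j) * indicator {0..T} t"
 have g: "?g : borel_measurable borel_counting" by measurable
 note m = measurable_time_rate[where r = r, OF sets r g]
 have "?L = (NN x. NN t. NN j. (case x of (s, i, a) => ?g (t, j) * (indicator {..t} s * r i a j)) \<partial>counting \<partial>lborel \<partial>eta)"
 proof (rule nn_integral_cong, clarsimp simp: space_occ[OF sets])
  fix s i a assume s: "0 <= s" "s <= T"
  have "(NN j. tail h s j * r i a j \<partial>counting)
   = (NN j. NN t. h (t, j) * indicator {0..T} t * (indicator {..t} s * r i a j) \<partial>lborel \<partial>counting)"
   unfolding tail_def using s
   by (subst nn_integral_multc[symmetric]) (auto intro!: nn_integral_cong simp: indicator_def)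
  also have "... = (NN t. NN j. h (t, j) * indicator {0..T} t * (indicator {..t} s * r i a j) \<partial>counting \<partial>lborel)"
  proof (rule nn_integral_swap[OF sigma_finite_count_countable sigma_finite_lborel])
   show "(%(j, t). h (t, j) * indicator {0..T} t * (indicator {..t} s * r i a j)) : borel_measurable (counting \<Otimes>\<^sub>M lborel)"
    unfolding indicator_def by (rule measurable_pair_measure_countable1) auto
  qed
  finally show "(NN j. tail h s j * r i a j \<partial>counting)
   = (NN t. NN j. h (t, j) * indicator {0..T} t * (indicator {..t} s * r i a j) \<partial>counting \<partial>lborel)" .
 qed
 also have "... = (NN t. NN j. NN x. (case x of (s, i, a) => ?g (t, j) * (indicator {..t} s * r i a j)) \<partial>eta \<partial>counting \<partial>lborel)"
  using m by (intro nn_integral_swap3[OF sf]) (simp add: case_prod_beta')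
 also have "... = ?R"
 proof (intro nn_integral_cong)
  fix t j
  have "(%(s, i, a). indicator {..t} s * r i a j) : borel_measurable eta"
   by (intro measurable_occ[OF sets] measurable_by_state) measurable
  then show "(NN x. (case x of (s, i, a) => ?g (t, j) * (indicator {..t} s * r i a j)) \<partial>eta)
   = h (t, j) * indicator {0..T} t * (NN (s, i, a). indicator {..t} s * r i a j \<partial>eta)"
   by (subst nn_integral_cmult[symmetric]) (auto intro!: nn_integral_cong)
 qed
 finally show "?L = ?R" .
 show "(%(t, j). NN (s, i, a). indicator {..t} s * r i a j \<partial>eta) : borel_measurable borel_counting"
  using measurable_swap3_inner[OF sf, of "%(s, i, a) t j. indicator {..t} s * r i a j"]
   measurable_time_rate[where r = r and g = "%_. 1", OF sets r] by (simp add: case_prod_beta')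
qed

lemma tail_out_eq:
 "tail h s i * outrate i a = (NN j. tail h s j * (if i = j then outrate i a else 0) \<partial>counting)"
proof -
 have "(NN j. tail h s j * (if i = j then outrate i a else 0) \<partial>counting)
   = (NN j. tail h s j * outrate i a * indicator {i} j \<partial>counting)"
  by (intro nn_integral_cong) (auto simp: indicator_def)
 then show ?thesis by simp
qed

text \<open>Read in this form, the identity says that the time-state marginal plus the outflow
  density equals the initial density plus the inflow density, tested with \<open>h\<close>.\<close>

lemma balance_iff:
 assumes sets: "sets eta = sets Xs" and fin: "finite_measure eta"
  and h: "h : borel_measurable borel_counting"
 shows "balance eta h \<longleftrightarrow>
   (NN (t, i, a). h (t, i) \<partial>eta) + (NN t. NN j. h (t, j) * indicator {0..T} t * occ_out eta t j \<partial>counting \<partial>lborel) =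
   ennreal (1 / T) * (NN t. (NN j. h (t, j) * ennreal (pmf \<gamma> j) * indicator {0..T} t \<partial>counting) \<partial>lborel)
    + (NN t. NN j. h (t, j) * indicator {0..T} t * occ_in eta t j \<partial>counting \<partial>lborel)"
proof -
 have "(NN (s, i, a). (NN j. tail h s j * (if i = j then outrate i a else 0) \<partial>counting) \<partial>eta)
   = (NN t. NN j. h (t, j) * indicator {0..T} t * occ_out eta t j \<partial>counting \<partial>lborel)"
  unfolding occ_out_def by (rule occ_time_swap(1)[OF sets fin _ h]) (auto cong: if_cong)
 moreover have "(NN (s, i, a). (NN j. tail h s j * inrate i a j \<partial>counting) \<partial>eta)
   = (NN t. NN j. h (t, j) * indicator {0..T} t * occ_in eta t j \<partial>counting \<partial>lborel)"
  unfolding occ_in_def by (rule occ_time_swap(1)[OF sets fin _ h]) auto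
 ultimately show ?thesis unfolding balance_def by (simp add: tail_out_eq[abs_def])
qed

lemma occ_out_measurable:
 assumes "sets eta = sets Xs" "finite_measure eta"
 shows "(%(t, j). occ_out eta t j) : borel_measurable borel_counting"
 unfolding occ_out_def by (rule occ_time_swap(2)[OF assms _ borel_measurable_const[of 0]]) (auto cong: if_cong)

lemma occ_in_measurable:
 assumes "sets eta = sets Xs" "finite_measure eta"
 shows "(%(t, j). occ_in eta t j) : borel_measurable borel_counting"
 unfolding occ_in_def by (rule occ_time_swap(2)[OF assms _ borel_measurable_const[of 0]]) auto

lemma nn_integral_prod_add:
 assumes [measurable]: "f : borel_measurable (borel \<Otimes>\<^sub>M count_space (UNIV :: 's set))" "g : borel_measurable borel_counting"
 shows "(NN t. NN j. f (t, j) + g (t, j) \<partial>counting \<partial>lborel)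
  = (NN t. NN j. f (t, j) \<partial>counting \<partial>lborel) + (NN t. NN j. g (t, j) \<partial>counting \<partial>lborel)"
proof -
 interpret C: sigma_finite_measure "count_space (UNIV :: 's set)" by (rule sigma_finite_count_countable)
 have "(%t. NN j. f (t, j) \<partial>counting) : borel_measurable lborel"
    "(%t. NN j. g (t, j) \<partial>counting) : borel_measurable lborel"
  by (rule C.borel_measurable_nn_integral, simp)+
 then show ?thesis by (simp add: nn_integral_add)
qed

lemma nn_integral_prod_cmult:
 assumes [measurable]: "f : borel_measurable (borel \<Otimes>\<^sub>M count_space (UNIV :: 's set))"
 shows "(NN t. NN j. c * f (t, j) \<partial>counting \<partial>lborel)
  = c * (NN t. NN j. f (t, j) \<partial>counting \<partial>lborel)"
proof -
 interpret C: sigma_finite_measure "count_space (UNIV :: 's set)" by (rule sigma_finite_count_countable)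
 have "(%t. NN j. f (t, j) \<partial>counting) : borel_measurable lborel"
  by (rule C.borel_measurable_nn_integral, simp)
 then show ?thesis by (simp add: nn_integral_cmult)
qed

text \<open>The criterion used both for policies and for Markov controls: the time-state marginal
  has density \<open>p / T\<close>, and \<open>p\<close> solves the integrated forward equation.
  Time zero is a null set, hence the equation for positive times only.\<close>

lemma occ_forwardI:
 assumes sets: "sets eta = sets Xs" and w3: "(NN (t, i, a). ennreal (w i ^ 3) \<partial>eta) < \<infinity>"
  and p: "(%(t, j). p t j) : borel_measurable borel_counting"
  and marg: "!!f. f : borel_measurable borel_counting ==>
    (NN (t, i, a). f (t, i) \<partial>eta) = ennreal (1 / T) * (NN t. NN j. f (t, j) * p t j * indicator {0..T} t \<partial>counting \<partial>lborel)"
  and fwd: "!!t j. 0 < t ==> t <= T ==> p t j + ennreal T * occ_out eta t j = ennreal (pmf \<gamma> j) + ennreal T * occ_in eta t j"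
 shows "occ eta"
 unfolding occ_def
proof (intro conjI ballI sets w3)
 fix h :: "real \<times> 's => ennreal" assume h: "h : borel_measurable (borel \<Otimes>\<^sub>M count_space (UNIV :: 's set))"
 note fin = finite_if_w_integrable[OF sets w3]
 note [measurable] = h p occ_in_measurable[OF sets fin] occ_out_measurable[OF sets fin]
 have [measurable]: "(%x. p (fst x) (snd x)) : borel_measurable borel_counting"
  "(%x. occ_in eta (fst x) (snd x)) : borel_measurable borel_counting"
  "(%x. occ_out eta (fst x) (snd x)) : borel_measurable borel_counting"
  using p occ_in_measurable[OF sets fin] occ_out_measurable[OF sets fin] by (simp_all add: case_prod_beta')
 let ?i = "%F. NN t. NN j. F (t, j) \<partial>counting \<partial>lborel"
 let ?P = "%x. h x * p (fst x) (snd x) * indicator {0..T} (fst x)"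
 let ?G = "%x. h x * ennreal (pmf \<gamma> (snd x)) * indicator {0..T} (fst x)"
 let ?O = "%x. h x * indicator {0..T} (fst x) * occ_out eta (fst x) (snd x)"
 let ?I = "%x. h x * indicator {0..T} (fst x) * occ_in eta (fst x) (snd x)"
 have e: "ennreal (1 / T) * ?i ?P = ?i (%x. ennreal (1 / T) * ?P x)" "ennreal (1 / T) * ?i ?G = ?i (%x. ennreal (1 / T) * ?G x)"
  by (rule nn_integral_prod_cmult[symmetric], measurable)+
 have "ennreal (1 / T) * ?i ?P + ?i ?O = ?i (%x. ennreal (1 / T) * ?P x + ?O x)"
  unfolding e by (rule nn_integral_prod_add[symmetric]; measurable)
 also have "... = ?i (%x. ennreal (1 / T) * ?G x + ?I x)"
 proof (rule nn_integral_cong_AE)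
  have "AE t in lborel. t \<noteq> (0 :: real)" by (rule AE_lborel_singleton)
  then show "AE t in lborel. (NN j. ennreal (1 / T) * ?P (t, j) + ?O (t, j) \<partial>counting)
    = (NN j. ennreal (1 / T) * ?G (t, j) + ?I (t, j) \<partial>counting)"
  proof (eventually_elim, intro nn_integral_cong)
   fix t :: real and j assume "t \<noteq> 0"
   show "ennreal (1 / T) * ?P (t, j) + ?O (t, j) = ennreal (1 / T) * ?G (t, j) + ?I (t, j)"
   proof (cases "t : {0..T}")
    case True
    have T1: "ennreal (1 / T) * ennreal T = 1" using T_pos by (simp add: ennreal_mult[symmetric])
    have "p t j + ennreal T * occ_out eta t j = ennreal (pmf \<gamma> j) + ennreal T * occ_in eta t j"
     using True \<open>t \<noteq> 0\<close> by (intro fwd) auto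
    then have "ennreal (1 / T) * (p t j + ennreal T * occ_out eta t j) = ennreal (1 / T) * (ennreal (pmf \<gamma> j) + ennreal T * occ_in eta t j)"
     by simp
    then have "ennreal (1 / T) * p t j + occ_out eta t j = ennreal (1 / T) * ennreal (pmf \<gamma> j) + occ_in eta t j"
     by (simp add: distrib_left mult.assoc[symmetric] T1)
    then have "h (t, j) * (ennreal (1 / T) * p t j + occ_out eta t j) = h (t, j) * (ennreal (1 / T) * ennreal (pmf \<gamma> j) + occ_in eta t j)"
     by simp
    then show ?thesis using True by (simp add: distrib_left mult_ac)
   qed simp
  qed
 qed
 also have "... = ennreal (1 / T) * ?i ?G + ?i ?I"
  unfolding e by (rule nn_integral_prod_add; measurable)
 finally show "balance eta h"
  unfolding balance_iff[OF sets fin h] marg[OF h] by simp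
qed

end

section \<open>Real test functions and the dual integral term\<close>

lemma has_sum_nn_integral_count:
 fixes f :: "'s => real"
 assumes "!!j. 0 <= f j" "(NN j. ennreal (f j) \<partial>counting) < \<infinity>"
 shows "(f has_sum enn2real (NN j. ennreal (f j) \<partial>counting)) UNIV"
proof -
 have "integrable (counting) f"
  using assms by (intro integrableI_nonneg) auto
 then have ab: "Infinite_Set_Sum.abs_summable_on f UNIV" by (simp add: Infinite_Set_Sum.abs_summable_on_def)
 then have "f summable_on UNIV"
  using abs_summable_equivalent[of f UNIV] summable_on_iff_abs_summable_on_real by blast
 moreover have "infsum f UNIV = enn2real (NN j. ennreal (f j) \<partial>counting)"
  unfolding infsetsum_infsum[OF ab, symmetric] infsetsum_def
  using assms by (intro integral_eq_nn_integral) auto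
 ultimately show ?thesis using has_sum_infsum by metis
qed

lemma infsum_diff_real:
 fixes f g :: "'s => real"
 assumes "f summable_on S" "g summable_on S"
 shows "(\<Sum>\<^sub>\<infinity>x\<in>S. f x - g x) = infsum f S - infsum g S"
proof -
 have "(g has_sum infsum g S) S" using assms(2) by (rule has_sum_infsum)
 then have "((%x. - g x) has_sum - infsum g S) S" by (simp add: has_sum_uminus)
 then have "((%x. f x + - g x) has_sum infsum f S + - infsum g S) S"
  by (rule has_sum_add[OF has_sum_infsum[OF assms(1)]])
 then show ?thesis by (simp add: infsumI)
qed

lemma integral_enn2real:
 assumes "f : borel_measurable M" "(NN x. f x \<partial>M) < \<infinity>"
 shows "integrable M (%x. enn2real (f x))" "(\<integral>x. enn2real (f x) \<partial>M) = enn2real (NN x. f x \<partial>M)"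
proof -
 have "AE x in M. f x \<noteq> \<infinity>" using assms by (intro nn_integral_noteq_infinite) auto
 then have eq: "(NN x. ennreal (enn2real (f x)) \<partial>M) = (NN x. f x \<partial>M)"
  by (intro nn_integral_cong_AE) (auto simp: top.not_eq_extremum)
 then show "integrable M (%x. enn2real (f x))" using assms by (intro integrableI_nonneg) auto
 show "(\<integral>x. enn2real (f x) \<partial>M) = enn2real (NN x. f x \<partial>M)"
  using assms by (subst integral_eq_nn_integral) (auto simp: eq)
qed

context ctmdp
begin

definition dual_term :: "(real \<times> 's => real) => real => 's => 'a => real" where
 "dual_term h t i a = (LINT s:{t..T}|lborel. (\<Sum>\<^sub>\<infinity>j. h (s, j) * q j i a))"

definition w2_bounded :: "(real \<times> 's => real) => real => bool" where
 "w2_bounded h C \<longleftrightarrow> h : borel_measurable borel_counting & 0 <= C &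
   (\<forall>t\<in>{0..T}. \<forall>i. \<bar>h (t, i)\<bar> <= C * w i ^ 2)"

text \<open>A rate costs one power of the weight: order \<open>w ^ 2\<close> becomes order
  \<open>w ^ 3\<close>, which the measures in \<open>M_w3\<close> integrate. In the constant,
  \<open>R\<close> comes from the drift and \<open>L\<close> from the outflow that the drift
  inequality carries along.\<close>

lemma w2_in_bound:
 assumes "0 <= C" "!!j. f j <= ennreal (C * w j ^ 2)"
 shows "(NN j. f j * inrate i a j \<partial>counting) <= ennreal (C * (R + L)) * ennreal (w i ^ 3)"
proof -
 have "(NN j. f j * inrate i a j \<partial>counting) <= (NN j. ennreal C * (ennreal (w j ^ 2) * inrate i a j) \<partial>counting)"
  using assms by (intro nn_integral_mono) (auto simp: ennreal_mult' mult.assoc[symmetric] intro!: mult_right_mono)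
 also have "... = ennreal C * (NN j. (ennreal (w j ^ 2) * inrate i a j) \<partial>counting)"
  by (simp add: nn_integral_cmult)
 also have "... <= ennreal C * (ennreal (R * w i ^ 2) + ennreal (w i ^ 2) * ennreal (L * w i))"
  using sum_w_inrate[of 2 i a] outrate_le[of i a]
  by (intro mult_left_mono order_trans[OF sum_w_inrate[of 2 i a]] add_left_mono) auto
 also have "... = ennreal (C * (R * w i ^ 2 + L * w i ^ 3))"
  using assms(1) R_pos L_pos w_pos[of i]
  by (simp add: ennreal_mult'[symmetric] ennreal_plus[symmetric] less_imp_le power2_eq_square power3_eq_cube mult_ac del: ennreal_plus)
 also have "... <= ennreal (C * ((R + L) * w i ^ 3))"
  using assms(1) R_pos w_pow_le[of 2 3 i]
  by (intro ennreal_leI mult_left_mono) (auto simp: distrib_right)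
 also have "... = ennreal (C * (R + L)) * ennreal (w i ^ 3)"
  using assms(1) R_pos L_pos by (simp add: ennreal_mult'[symmetric] mult.assoc)
 finally show ?thesis .
qed

lemma w2_out_bound:
 assumes "0 <= C" "f <= ennreal (C * w i ^ 2)"
 shows "f * outrate i a <= ennreal (C * L) * ennreal (w i ^ 3)"
proof -
 have "f * outrate i a <= ennreal (C * w i ^ 2) * ennreal (L * w i)"
  using assms outrate_le by (intro mult_mono) auto
 also have "... = ennreal (C * L) * ennreal (w i ^ 3)"
  using assms(1) L_pos w_pos[of i]
  by (simp add: ennreal_mult'[symmetric] less_imp_le power2_eq_square power3_eq_cube mult_ac)
 finally show ?thesis .
qed

lemma tail_swap:
 assumes [measurable]: "hh : borel_measurable borel_counting"
 shows "(NN j. tail hh t j * r j \<partial>counting) = (NN s. (NN j. hh (s, j) * r j \<partial>counting) * indicator {t..T} s \<partial>lborel)"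
proof -
 have "(NN j. tail hh t j * r j \<partial>counting) = (NN j. NN s. hh (s, j) * r j * indicator {t..T} s \<partial>lborel \<partial>counting)"
  unfolding tail_def by (subst nn_integral_multc[symmetric]) (auto intro!: nn_integral_cong simp: mult_ac)
 also have "... = (NN s. NN j. hh (s, j) * r j * indicator {t..T} s \<partial>counting \<partial>lborel)"
 proof (rule nn_integral_swap[OF sigma_finite_count_countable sigma_finite_lborel])
  show "(%(j, s). hh (s, j) * r j * indicator {t..T} s) : borel_measurable (counting \<Otimes>\<^sub>M lborel)"
   by (rule measurable_pair_measure_countable1) auto
 qed
 finally show ?thesis by (simp add: nn_integral_multc)
qed

lemma measurable_count_integral:
 assumes [measurable]: "hh : borel_measurable (borel \<Otimes>\<^sub>M count_space (UNIV :: 's set))"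
 shows "(%s. NN j. hh (s, j) * r j \<partial>counting) : borel_measurable borel"
proof -
 interpret C: sigma_finite_measure "count_space (UNIV :: 's set)" by (rule sigma_finite_count_countable)
 show ?thesis by (rule C.borel_measurable_nn_integral) (measurable)
qed

lemma tail_w2:
 assumes "w2_bounded g C" "t : {0..T}"
 shows "tail (%x. ennreal (g x)) t j <= ennreal (C * T * w j ^ 2)"
proof -
 have "tail (%x. ennreal (g x)) t j <= ennreal (C * w j ^ 2 * T)"
  using assms by (intro tail_le_const) (auto simp: w2_bounded_def abs_le_iff intro!: ennreal_leI)
 then show ?thesis by (simp add: mult_ac)
qed

text \<open>For nonnegative \<open>g\<close> the sum over \<open>j\<close> is the inflow minus the
  diagonal term, both finite by the \<open>w ^ 2\<close> bound. The real dual term is thus the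
  difference of the two flow terms that occur in \<open>balance\<close>.\<close>

lemma dual_term_nonneg:
 assumes g: "w2_bounded g C" "!!x. 0 <= g x" and t: "t : {0..T}" and a: "a : A i"
 defines "hh \<equiv> %x. ennreal (g x)"
 shows "!!s. s : {0..T} ==> (%j. g (s, j) * q j i a) summable_on UNIV"
  and "set_integrable lborel {t..T} (%s. \<Sum>\<^sub>\<infinity>j. g (s, j) * q j i a)"
  and "dual_term g t i a = enn2real (NN j. tail hh t j * inrate i a j \<partial>counting) - enn2real (tail hh t i * outrate i a)"
proof -
 have C0: "0 <= C" using g by (simp add: w2_bounded_def)
 have gb: "g (s, j) <= C * w j ^ 2" if "s : {0..T}" for s j using g that by (auto simp: w2_bounded_def abs_le_iff)
 have [measurable]: "g : borel_measurable borel_counting" using g by (simp add: w2_bounded_def)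
 have hh[measurable]: "hh : borel_measurable borel_counting" unfolding hh_def by measurable
 have hs: "((%j. g (s, j) * q j i a) has_sum (enn2real (NN j. hh (s, j) * inrate i a j \<partial>counting) - enn2real (hh (s, i) * outrate i a))) UNIV"
  if s: "s : {0..T}" for s
 proof -
  let ?f = "%j. if j = i then 0 else g (s, j) * q j i a"
  have e: "(NN j. ennreal (?f j) \<partial>counting) = (NN j. hh (s, j) * inrate i a j \<partial>counting)"
   using a g(2) by (intro nn_integral_cong) (auto simp: hh_def inrate_def ennreal_mult')
  have "(?f has_sum enn2real (NN j. ennreal (?f j) \<partial>counting)) UNIV"
  proof (rule has_sum_nn_integral_count)
   have "(NN j. hh (s, j) * inrate i a j \<partial>counting) <= ennreal (C * (R + L)) * ennreal (w i ^ 3)"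
    using gb[OF s] by (intro w2_in_bound C0) (auto simp: hh_def intro: ennreal_leI)
   then show "(NN j. ennreal (?f j) \<partial>counting) < \<infinity>"
    unfolding e by (rule order.strict_trans1) (simp add: ennreal_mult_less_top)
  qed (use a g(2) q_nonneg in auto)
  moreover have "((%j. if j = i then g (s, i) * q i i a else 0) has_sum (g (s, i) * q i i a)) UNIV"
   by (subst has_sum_cong_neutral[where T = "{i}" and g = "%_. g (s, i) * q i i a"]) (auto intro: has_sum_finiteI)
  ultimately have "((%j. ?f j + (if j = i then g (s, i) * q i i a else 0)) has_sum
    (enn2real (NN j. hh (s, j) * inrate i a j \<partial>counting) + g (s, i) * q i i a)) UNIV"
   unfolding e by (rule has_sum_add)
  moreover have "enn2real (hh (s, i) * outrate i a) = - (g (s, i) * q i i a)"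
   using a g(2)[of "(s, i)"] q_diag_nonpos[OF a]
   by (simp add: hh_def outrate_def ennreal_mult'[symmetric] mult_nonneg_nonpos)
  moreover have "(%j. ?f j + (if j = i then g (s, i) * q i i a else 0)) = (%j. g (s, j) * q j i a)"
   by auto
  ultimately show ?thesis by simp
 qed
 then show "!!s. s : {0..T} ==> (%j. g (s, j) * q j i a) summable_on UNIV" by (auto simp: summable_on_def)
 let ?in = "%s. (NN j. hh (s, j) * inrate i a j \<partial>counting) * indicator {t..T} s"
 let ?out = "%s. hh (s, i) * outrate i a * indicator {t..T} s"
 have m: "?in : borel_measurable lborel" "?out : borel_measurable lborel"
  using measurable_count_integral[OF hh] by measurable
 have I: "(NN s. ?in s \<partial>lborel) = (NN j. tail hh t j * inrate i a j \<partial>counting)"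
  by (rule tail_swap[OF hh, symmetric])
 have O: "(NN s. ?out s \<partial>lborel) = tail hh t i * outrate i a"
  unfolding tail_def by (subst nn_integral_multc[symmetric]) (auto intro!: nn_integral_cong simp: mult_ac)
 have tb: "tail hh t j <= ennreal (C * T * w j ^ 2)" for j
  unfolding hh_def by (rule tail_w2[OF g(1) t])
 have CT: "0 <= C * T" using C0 T_pos by simp
 have "(NN j. tail hh t j * inrate i a j \<partial>counting) < \<infinity>"
  by (rule order.strict_trans1[OF w2_in_bound[OF CT tb]]) (simp add: ennreal_mult_less_top)
 then have "(NN s. ?in s \<partial>lborel) < \<infinity>" using I by simp
 note i1 = integral_enn2real[OF m(1) this]
 have "tail hh t i * outrate i a < \<infinity>"
  by (rule order.strict_trans1[OF w2_out_bound[OF CT tb]]) (simp add: ennreal_mult_less_top)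
 then have "(NN s. ?out s \<partial>lborel) < \<infinity>" using O by simp
 note i2 = integral_enn2real[OF m(2) this]
 have eq: "indicator {t..T} s *\<^sub>R (\<Sum>\<^sub>\<infinity>j. g (s, j) * q j i a) = enn2real (?in s) - enn2real (?out s)" for s
  using infsumI[OF hs[of s]] t by (auto simp: indicator_def)
 show "set_integrable lborel {t..T} (%s. \<Sum>\<^sub>\<infinity>j. g (s, j) * q j i a)"
  unfolding set_integrable_def eq using i1(1) i2(1) by (rule Bochner_Integration.integrable_diff)
 show "dual_term g t i a = enn2real (NN j. tail hh t j * inrate i a j \<partial>counting) - enn2real (tail hh t i * outrate i a)"
  unfolding dual_term_def set_lebesgue_integral_def eq Bochner_Integration.integral_diff[OF i1(1) i2(1)] i1(2) i2(2) I O ..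
qed

lemma init_w2_bound:
 assumes "0 <= C" "!!j. f j <= ennreal (C * w j ^ 2)"
 shows "(NN j. f j * ennreal (pmf \<gamma> j) \<partial>counting) <= ennreal C * w3_const"
proof -
 have "(NN j. f j * ennreal (pmf \<gamma> j) \<partial>counting) <= (NN j. ennreal C * ennreal (w j ^ 3 * pmf \<gamma> j) \<partial>counting)"
 proof (rule nn_integral_mono)
  fix j
  have "f j * ennreal (pmf \<gamma> j) <= ennreal (C * w j ^ 3) * ennreal (pmf \<gamma> j)"
   using assms(1) w_pow_le[of 2 3 j]
   by (intro mult_right_mono order_trans[OF assms(2)] ennreal_leI mult_left_mono) auto
  then show "f j * ennreal (pmf \<gamma> j) <= ennreal C * ennreal (w j ^ 3 * pmf \<gamma> j)"
   using assms(1) w_pos[of j] by (simp add: ennreal_mult'[symmetric] mult.assoc less_imp_le)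
 qed
 also have "... <= ennreal C * (1 * (NN j. ennreal (w j ^ 3 * pmf \<gamma> j) \<partial>counting))"
  by (simp add: nn_integral_cmult)
 also have "... <= ennreal C * w3_const"
  unfolding w3_const_def using R_pos T_pos by (intro mult_left_mono mult_right_mono) auto
 finally show ?thesis .
qed

lemma init_term_nonneg:
 assumes g: "w2_bounded g C" "!!x. 0 <= g x"
 defines "hh \<equiv> %x. ennreal (g x)"
 shows "!!t. t : {0..T} ==> (%j. g (t, j) * pmf \<gamma> j) summable_on UNIV"
  and "set_integrable lborel {0..T} (%t. \<Sum>\<^sub>\<infinity>j. g (t, j) * pmf \<gamma> j)"
  and "(LINT t:{0..T}|lborel. (\<Sum>\<^sub>\<infinity>j. g (t, j) * pmf \<gamma> j)) =
   enn2real (NN t. (NN j. hh (t, j) * ennreal (pmf \<gamma> j) * indicator {0..T} t \<partial>counting) \<partial>lborel)"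
  and "(NN t. (NN j. hh (t, j) * ennreal (pmf \<gamma> j) * indicator {0..T} t \<partial>counting) \<partial>lborel) < \<infinity>"
proof -
 have C0: "0 <= C" using g by (simp add: w2_bounded_def)
 have gb: "g (s, j) <= C * w j ^ 2" if "s : {0..T}" for s j using g that by (auto simp: w2_bounded_def abs_le_iff)
 have [measurable]: "g : borel_measurable borel_counting" using g by (simp add: w2_bounded_def)
 have hh[measurable]: "hh : borel_measurable borel_counting" unfolding hh_def by measurable
 let ?I = "%t. NN j. hh (t, j) * ennreal (pmf \<gamma> j) \<partial>counting"
 have Ib: "?I t <= ennreal C * w3_const" if "t : {0..T}" for t
  using gb[OF that] by (intro init_w2_bound C0) (auto simp: hh_def intro: ennreal_leI)
 have fin: "ennreal C * w3_const < \<infinity>" using w3_const_finite by (simp add: ennreal_mult_less_top)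
 have hs: "((%j. g (t, j) * pmf \<gamma> j) has_sum enn2real (?I t)) UNIV" if "t : {0..T}" for t
 proof -
  have e: "(NN j. ennreal (g (t, j) * pmf \<gamma> j) \<partial>counting) = ?I t"
   using g(2) by (simp add: hh_def ennreal_mult')
  show ?thesis unfolding e[symmetric]
   using g(2) Ib[OF that] fin e by (intro has_sum_nn_integral_count) auto
 qed
 then show "!!t. t : {0..T} ==> (%j. g (t, j) * pmf \<gamma> j) summable_on UNIV" by (auto simp: summable_on_def)
 have m: "(%t. ?I t * indicator {0..T} t) : borel_measurable lborel"
  using measurable_count_integral[OF hh] by measurable
 have e2: "(NN t. (NN j. hh (t, j) * ennreal (pmf \<gamma> j) * indicator {0..T} t \<partial>counting) \<partial>lborel) = (NN t. ?I t * indicator {0..T} t \<partial>lborel)"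
  by (simp add: nn_integral_multc)
 have "(NN t. ?I t * indicator {0..T} t \<partial>lborel) <= (NN t. ennreal C * w3_const * indicator {0..T} t \<partial>lborel)"
  using Ib by (intro nn_integral_mono) (auto simp: indicator_def)
 also have "... < \<infinity>" using fin T_pos by (simp add: nn_integral_cmult_indicator ennreal_mult_less_top)
 finally have f2: "(NN t. ?I t * indicator {0..T} t \<partial>lborel) < \<infinity>" .
 then show "(NN t. (NN j. hh (t, j) * ennreal (pmf \<gamma> j) * indicator {0..T} t \<partial>counting) \<partial>lborel) < \<infinity>"
  unfolding e2 .
 have eq: "indicator {0..T} t *\<^sub>R (\<Sum>\<^sub>\<infinity>j. g (t, j) * pmf \<gamma> j) = enn2real (?I t * indicator {0..T} t)" for t
  using infsumI[OF hs[of t]] by (auto simp: indicator_def)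
 show "set_integrable lborel {0..T} (%t. \<Sum>\<^sub>\<infinity>j. g (t, j) * pmf \<gamma> j)"
  unfolding set_integrable_def eq by (rule integral_enn2real[OF m f2])
 show "(LINT t:{0..T}|lborel. (\<Sum>\<^sub>\<infinity>j. g (t, j) * pmf \<gamma> j)) =
   enn2real (NN t. (NN j. hh (t, j) * ennreal (pmf \<gamma> j) * indicator {0..T} t \<partial>counting) \<partial>lborel)"
  unfolding set_lebesgue_integral_def eq e2 by (rule integral_enn2real[OF m f2])
qed

lemma enn2real_eq_iff: "a < top ==> b < top ==> enn2real a = enn2real b \<longleftrightarrow> a = b"
 by (metis ennreal_enn2real)

text \<open>All four terms are finite for a test function of order \<open>w ^ 2\<close>, so passing
  to real numbers loses nothing. The backward direction serves for limits of occupation measures,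
  where the real identity is what passes to the limit.\<close>

lemma balance_test_nonneg:
 assumes sets: "sets eta = sets Xs" and w3: "(NN (t, i, a). ennreal (w i ^ 3) \<partial>eta) < \<infinity>"
  and g: "w2_bounded g C" "!!x. 0 <= g x"
 shows "integrable eta (%(t, i, a). g (t, i))" "integrable eta (%(t, i, a). dual_term g t i a)"
  and "balance eta (%x. ennreal (g x)) \<longleftrightarrow> (\<integral>(t, i, a). g (t, i) \<partial>eta) = 1 / T * (LINT t:{0..T}|lborel. (\<Sum>\<^sub>\<infinity>j. g (t, j) * pmf \<gamma> j)) + (\<integral>(t, i, a). dual_term g t i a \<partial>eta)"
proof -
 define hh where "hh = (%x. ennreal (g x))"
 have C0: "0 <= C" using g by (simp add: w2_bounded_def)
 have CT: "0 <= C * T" using C0 T_pos by simp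
 have gb: "g (s, j) <= C * w j ^ 2" if "s : {0..T}" for s j using g that by (auto simp: w2_bounded_def abs_le_iff)
 have gm[measurable]: "g : borel_measurable borel_counting" using g by (simp add: w2_bounded_def)
 have hh[measurable]: "hh : borel_measurable borel_counting" unfolding hh_def by measurable
 have tb: "tail hh t j <= ennreal (C * T * w j ^ 2)" if "t : {0..T}" for t j
  unfolding hh_def by (rule tail_w2[OF g(1) that])
 let ?H = "%(t, i, a). hh (t, i)" and ?O = "%(t, i, a). tail hh t i * outrate i a"
  and ?I = "%(t, i, a). NN j. tail hh t j * inrate i a j \<partial>counting"
 have m: "?H : borel_measurable eta" "?O : borel_measurable eta" "?I : borel_measurable eta"
  by (rule measurable_ti_occ[OF sets hh] measurable_tail_out[OF sets hh] measurable_tail_in[OF sets hh])+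
 have fH: "(NN x. ?H x \<partial>eta) < \<infinity>"
 proof (rule nn_integral_w3_finite[OF sets w3, of _ C], simp only: prod.case)
  fix t i assume "t : {0..T}"
  then have "hh (t, i) <= ennreal (C * w i ^ 3)"
   unfolding hh_def using gb[of t i] C0 w_pow_le[of 2 3 i]
   by (intro ennreal_leI order_trans[OF gb] mult_left_mono) auto
  then show "hh (t, i) <= ennreal C * ennreal (w i ^ 3)" using C0 by (simp add: ennreal_mult')
 qed
 have fO: "(NN x. ?O x \<partial>eta) < \<infinity>"
  by (rule nn_integral_w3_finite[OF sets w3, of _ "C * T * L"]) (simp add: w2_out_bound[OF CT tb])
 have fI: "(NN x. ?I x \<partial>eta) < \<infinity>"
  by (rule nn_integral_w3_finite[OF sets w3, of _ "C * T * (R + L)"]) (simp add: w2_in_bound[OF CT tb])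
 note iH = integral_enn2real[OF m(1) fH] and iO = integral_enn2real[OF m(2) fO] and iI = integral_enn2real[OF m(3) fI]
 have gH: "(%(t, i, a). g (t, i)) = (%x. enn2real (?H x))" using g(2) by (auto simp: hh_def)
 show "integrable eta (%(t, i, a). g (t, i))" unfolding gH by (rule iH)
 have eq: "(case x of (t, i, a) => dual_term g t i a) = enn2real (?I x) - enn2real (?O x)" if "x : space eta" for x
  using that dual_term_nonneg(3)[OF g] unfolding space_occ[OF sets] by (auto simp: hh_def)
 show "integrable eta (%(t, i, a). dual_term g t i a)"
  by (subst Bochner_Integration.integrable_cong[OF refl eq]) (assumption, rule Bochner_Integration.integrable_diff[OF iI(1) iO(1)])
 have d: "(\<integral>(t, i, a). dual_term g t i a \<partial>eta) = enn2real (NN x. ?I x \<partial>eta) - enn2real (NN x. ?O x \<partial>eta)"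
  by (subst Bochner_Integration.integral_cong[OF refl eq]) (assumption, simp only: Bochner_Integration.integral_diff[OF iI(1) iO(1)] iI(2) iO(2))
 let ?G = "NN t. (NN j. hh (t, j) * ennreal (pmf \<gamma> j) * indicator {0..T} t \<partial>counting) \<partial>lborel"
 have fG: "?G < \<infinity>" unfolding hh_def by (rule init_term_nonneg(4)[OF g])
 have "balance eta hh \<longleftrightarrow> (NN x. ?H x \<partial>eta) + (NN x. ?O x \<partial>eta) = ennreal (1 / T) * ?G + (NN x. ?I x \<partial>eta)"
  by (simp add: balance_def)
 also have "... \<longleftrightarrow> enn2real ((NN x. ?H x \<partial>eta) + (NN x. ?O x \<partial>eta)) = enn2real (ennreal (1 / T) * ?G + (NN x. ?I x \<partial>eta))"
  using fH fO fG fI by (intro enn2real_eq_iff[symmetric]) (auto simp: ennreal_mult_less_top)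
 also have "... \<longleftrightarrow> enn2real (NN x. ?H x \<partial>eta) + enn2real (NN x. ?O x \<partial>eta) = 1 / T * enn2real ?G + enn2real (NN x. ?I x \<partial>eta)"
  using fH fO fG fI T_pos by (simp add: enn2real_plus ennreal_mult_less_top enn2real_mult)
 finally have fin_eq: "balance eta hh \<longleftrightarrow> enn2real (NN x. ?H x \<partial>eta) = 1 / T * enn2real ?G + (enn2real (NN x. ?I x \<partial>eta) - enn2real (NN x. ?O x \<partial>eta))"
  by linarith
 have Geq: "(LINT t:{0..T}|lborel. (\<Sum>\<^sub>\<infinity>j. g (t, j) * pmf \<gamma> j)) = enn2real ?G"
  unfolding hh_def by (rule init_term_nonneg(3)[OF g])
 show "balance eta (%x. ennreal (g x)) \<longleftrightarrow> (\<integral>(t, i, a). g (t, i) \<partial>eta) = 1 / T * (LINT t:{0..T}|lborel. (\<Sum>\<^sub>\<infinity>j. g (t, j) * pmf \<gamma> j)) + (\<integral>(t, i, a). dual_term g t i a \<partial>eta)"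
  unfolding gH iH(2) d Geq hh_def[symmetric] by (rule fin_eq)
qed

lemma occ_test_nonneg:
 assumes occ: "occ eta" and g: "w2_bounded g C" "!!x. 0 <= g x"
 shows "integrable eta (%(t, i, a). g (t, i))" "integrable eta (%(t, i, a). dual_term g t i a)"
  and "(\<integral>(t, i, a). g (t, i) \<partial>eta) = 1 / T * (LINT t:{0..T}|lborel. (\<Sum>\<^sub>\<infinity>j. g (t, j) * pmf \<gamma> j)) + (\<integral>(t, i, a). dual_term g t i a \<partial>eta)"
proof -
 note b = balance_test_nonneg[OF occ_sets[OF occ] occ_w3[OF occ] g]
 show "integrable eta (%(t, i, a). g (t, i))" "integrable eta (%(t, i, a). dual_term g t i a)" by (rule b)+
 have "balance eta (%x. ennreal (g x))"
  using g by (intro occ_balance[OF occ]) (simp add: w2_bounded_def)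
 then show "(\<integral>(t, i, a). g (t, i) \<partial>eta) = 1 / T * (LINT t:{0..T}|lborel. (\<Sum>\<^sub>\<infinity>j. g (t, j) * pmf \<gamma> j)) + (\<integral>(t, i, a). dual_term g t i a \<partial>eta)"
  unfolding b(3) .
qed

text \<open>Positive and negative parts of \<open>h\<close> inherit the \<open>w ^ 2\<close> bound,
  and every term is linear in \<open>h\<close>.\<close>

lemma occ_test:
 assumes occ: "occ eta" and h: "w2_bounded h C"
 shows "integrable eta (%(t, i, a). h (t, i))" "integrable eta (%(t, i, a). dual_term h t i a)"
  and "(\<integral>(t, i, a). h (t, i) \<partial>eta) = 1 / T * (LINT t:{0..T}|lborel. (\<Sum>\<^sub>\<infinity>j. h (t, j) * pmf \<gamma> j)) + (\<integral>(t, i, a). dual_term h t i a \<partial>eta)"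
proof -
 note sets = occ_sets[OF occ]
 let ?p = "%x. max 0 (h x)" and ?m = "%x. max 0 (- h x)"
 have p: "w2_bounded ?p C" "!!x. 0 <= ?p x" and m: "w2_bounded ?m C" "!!x. 0 <= ?m x"
  using h w_pos by (auto simp: w2_bounded_def abs_le_iff less_imp_le)
 have hpm: "h x = ?p x - ?m x" for x by auto
 have dt: "dual_term h t i a = dual_term ?p t i a - dual_term ?m t i a" if "t : {0..T}" "a : A i" for t i a
 proof -
  note P = dual_term_nonneg[OF p that] and M = dual_term_nonneg[OF m that]
  have "(LINT s:{t..T}|lborel. (\<Sum>\<^sub>\<infinity>j. h (s, j) * q j i a))
    = (LINT s:{t..T}|lborel. (\<Sum>\<^sub>\<infinity>j. ?p (s, j) * q j i a) - (\<Sum>\<^sub>\<infinity>j. ?m (s, j) * q j i a))"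
  proof (rule set_lebesgue_integral_cong, simp, intro allI impI)
   fix s assume "s : {t..T}"
   then have s: "s : {0..T}" using that by auto
   show "(\<Sum>\<^sub>\<infinity>j. h (s, j) * q j i a) = (\<Sum>\<^sub>\<infinity>j. ?p (s, j) * q j i a) - (\<Sum>\<^sub>\<infinity>j. ?m (s, j) * q j i a)"
    by (subst infsum_diff_real[symmetric, OF P(1)[OF s] M(1)[OF s]]) (simp add: hpm[symmetric] left_diff_distrib[symmetric])
  qed
  also have "... = dual_term ?p t i a - dual_term ?m t i a"
   unfolding dual_term_def by (rule set_integral_diff(2)[OF P(2) M(2)])
  finally show ?thesis unfolding dual_term_def .
 qed
 have eq: "(case x of (t, i, a) => dual_term h t i a) = (case x of (t, i, a) => dual_term ?p t i a) - (case x of (t, i, a) => dual_term ?m t i a)"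
  if "x : space eta" for x
  using that dt unfolding space_occ[OF sets] by auto
 have gi: "(LINT t:{0..T}|lborel. (\<Sum>\<^sub>\<infinity>j. h (t, j) * pmf \<gamma> j))
   = (LINT t:{0..T}|lborel. (\<Sum>\<^sub>\<infinity>j. ?p (t, j) * pmf \<gamma> j)) - (LINT t:{0..T}|lborel. (\<Sum>\<^sub>\<infinity>j. ?m (t, j) * pmf \<gamma> j))"
 proof -
  note P = init_term_nonneg[OF p] and M = init_term_nonneg[OF m]
  have "(LINT t:{0..T}|lborel. (\<Sum>\<^sub>\<infinity>j. h (t, j) * pmf \<gamma> j))
    = (LINT t:{0..T}|lborel. (\<Sum>\<^sub>\<infinity>j. ?p (t, j) * pmf \<gamma> j) - (\<Sum>\<^sub>\<infinity>j. ?m (t, j) * pmf \<gamma> j))"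
  proof (rule set_lebesgue_integral_cong, simp, intro allI impI)
   fix s assume s: "s : {0..T}"
   show "(\<Sum>\<^sub>\<infinity>j. h (s, j) * pmf \<gamma> j) = (\<Sum>\<^sub>\<infinity>j. ?p (s, j) * pmf \<gamma> j) - (\<Sum>\<^sub>\<infinity>j. ?m (s, j) * pmf \<gamma> j)"
    by (subst infsum_diff_real[symmetric, OF P(1)[OF s] M(1)[OF s]]) (simp add: hpm[symmetric] left_diff_distrib[symmetric])
  qed
  also have "... = (LINT t:{0..T}|lborel. (\<Sum>\<^sub>\<infinity>j. ?p (t, j) * pmf \<gamma> j)) - (LINT t:{0..T}|lborel. (\<Sum>\<^sub>\<infinity>j. ?m (t, j) * pmf \<gamma> j))"
   by (rule set_integral_diff(2)[OF P(2) M(2)])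
  finally show ?thesis .
 qed
 note TP = occ_test_nonneg[OF occ p] and TM = occ_test_nonneg[OF occ m]
 have hd: "(%(t, i, a). h (t, i)) = (%x. (case x of (t, i, a) => ?p (t, i)) - (case x of (t, i, a) => ?m (t, i)))"
  by auto
 show "integrable eta (%(t, i, a). h (t, i))"
  unfolding hd using TP(1) TM(1) by (rule Bochner_Integration.integrable_diff)
 show "integrable eta (%(t, i, a). dual_term h t i a)"
  by (subst Bochner_Integration.integrable_cong[OF refl eq]) (assumption, rule Bochner_Integration.integrable_diff[OF TP(2) TM(2)])
 have d: "(\<integral>(t, i, a). dual_term h t i a \<partial>eta) = (\<integral>(t, i, a). dual_term ?p t i a \<partial>eta) - (\<integral>(t, i, a). dual_term ?m t i a \<partial>eta)"
  by (subst Bochner_Integration.integral_cong[OF refl eq]) (assumption, rule Bochner_Integration.integral_diff[OF TP(2) TM(2)])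
 have "(\<integral>(t, i, a). h (t, i) \<partial>eta) = (\<integral>(t, i, a). ?p (t, i) \<partial>eta) - (\<integral>(t, i, a). ?m (t, i) \<partial>eta)"
  unfolding hd by (rule Bochner_Integration.integral_diff[OF TP(1) TM(1)])
 then show "(\<integral>(t, i, a). h (t, i) \<partial>eta) = 1 / T * (LINT t:{0..T}|lborel. (\<Sum>\<^sub>\<infinity>j. h (t, j) * pmf \<gamma> j)) + (\<integral>(t, i, a). dual_term h t i a \<partial>eta)"
  unfolding TP(3) TM(3) gi d by (simp add: right_diff_distrib)
qed

end

section \<open>Jump times and states along a path\<close>

lemma path_time_pos: "om : paths ==> 0 < snd (om l)"
 unfolding paths_def
proof (elim UnE CollectE exE conjE)
 fix m assume m: "1 <= m" "\<forall>l<m - 1. 0 < snd (om l) & snd (om l) < \<infinity>" "snd (om (m - 1)) = \<infinity>" "\<forall>l\<ge>m. om l = (None, \<infinity>)"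
 consider "l < m - 1" | "l = m - 1" | "l \<ge> m" by linarith
 then show ?thesis using m by cases auto
qed auto

lemma jump_time_0 [simp]: "jump_time 0 om = 0" by (simp add: jump_time_def)

lemma jump_time_Suc: "jump_time (Suc m) om = jump_time m om + snd (om m)" by (simp add: jump_time_def)

lemma jump_time_nonneg: "om : paths ==> 0 <= jump_time m om"
 unfolding jump_time_def using path_time_pos by (intro sum_nonneg) (auto intro: less_imp_le)

lemma jump_time_le_Suc: "om : paths ==> jump_time m om <= jump_time (Suc m) om"
 unfolding jump_time_Suc using path_time_pos[of om m] by (intro ereal_le_add_self) (auto intro: less_imp_le)

lemma jump_time_mono: "om : paths ==> l <= m ==> jump_time l om <= jump_time m om"
 by (rule lift_Suc_mono_le[of "%m. jump_time m om"]) (rule jump_time_le_Suc)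

lemma jump_time_less_Suc:
 assumes "om : paths" "jump_time m om < \<infinity>" shows "jump_time m om < jump_time (Suc m) om"
 unfolding jump_time_Suc using assms path_time_pos[of om m] jump_time_nonneg[of om m]
 by (cases "jump_time m om"; cases "snd (om m)") auto

lemma jump_time_strict:
 assumes "om : paths" "jump_time l om < \<infinity>" "l < m" shows "jump_time l om < jump_time m om"
 using jump_time_less_Suc[OF assms(1,2)] jump_time_mono[OF assms(1), of "Suc l" m] assms(3) by (auto intro: less_le_trans)

lemma jump_time_less_iff:
 assumes "om : paths" "jump_time l om < \<infinity>" shows "jump_time k om < jump_time l om \<longleftrightarrow> k < l"
proof
 assume "k < l"
 have "jump_time k om < \<infinity>" using jump_time_mono[OF assms(1) less_imp_le[OF \<open>k < l\<close>]] assms(2) by (rule le_less_trans)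
 then show "jump_time k om < jump_time l om" using jump_time_strict assms(1) \<open>k < l\<close> by blast
next
 assume "jump_time k om < jump_time l om"
 then show "k < l" using jump_time_mono[OF assms(1), of l k] by (meson leD linorder_not_less)
qed

lemma jump_state_Some:
 assumes "om : paths" "jump_time l om < \<infinity>" shows "\<exists>i. jump_state l om = Some i"
 using assms(1) unfolding paths_def
proof (elim UnE CollectE exE conjE)
 fix m assume m: "1 <= m" "\<forall>l<m. fst (om l) \<noteq> None" "snd (om (m - 1)) = \<infinity>"
 have "jump_time m om = \<infinity>"
  using jump_time_Suc[of "m - 1" om] m(1,3) jump_time_nonneg[OF assms(1), of "m - 1"] by (cases "jump_time (m - 1) om") auto
 then have "l < m" using jump_time_mono[OF assms(1), of m l] assms(2) by (auto simp: not_le[symmetric])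
 then show ?thesis using m(2) by (auto simp: jump_state_def)
qed (auto simp: jump_state_def)

lemma explosion_time_eq:
 assumes "om : paths" shows "explosion_time om = (SUP m. jump_time m om)"
 unfolding explosion_time_def
 by (intro limI LIMSEQ_SUP) (auto simp: incseq_def jump_time_mono[OF assms])

lemma less_explosion_iff:
 assumes "om : paths" shows "ereal t < explosion_time om \<longleftrightarrow> (\<exists>m. ereal t < jump_time m om)"
 unfolding explosion_time_eq[OF assms] by (auto simp: less_SUP_iff)

lemma state_before_eq:
 assumes "om : paths" "jump_time m om < ereal t" "ereal t <= jump_time (Suc m) om"
 shows "state_before om t = jump_state m om"
proof -
 have t: "0 < t" using jump_time_nonneg[OF assms(1), of m] assms(2) by (metis ereal_less(2) le_less_trans)
 have ex: "ereal t < explosion_time om"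
 proof (cases "jump_time (Suc m) om = \<infinity>")
  case False
  then have "jump_time (Suc m) om < jump_time (Suc (Suc m)) om" using assms(1) by (intro jump_time_less_Suc) auto
  then show ?thesis using assms by (auto simp: less_explosion_iff intro: le_less_trans)
 next
  case True then show ?thesis using assms(1) by (auto simp: less_explosion_iff intro!: exI[of _ "Suc m"])
 qed
 have "(THE m. jump_time m om < ereal t & ereal t <= jump_time (Suc m) om) = m"
 proof (rule the_equality)
  fix k assume k: "jump_time k om < ereal t & ereal t <= jump_time (Suc k) om"
  have "\<not> k < m" using jump_time_mono[OF assms(1), of "Suc k" m] k assms(2) by (auto simp: Suc_le_eq dest: le_less_trans)
  moreover have "\<not> m < k" using jump_time_mono[OF assms(1), of "Suc m" k] k assms(3) by (auto simp: Suc_le_eq dest: le_less_trans)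
  ultimately show "k = m" by simp
 qed (use assms in auto)
 then show ?thesis using t ex by (simp add: state_before_def)
qed

text \<open>Expresses the left limit through strict events \<open>T_m < t\<close> and their
  complements; these are the events shown to be predictable below.\<close>

lemma state_before_Some_iff:
 assumes "om : paths" "0 < t"
 shows "state_before om t = Some j \<longleftrightarrow>
  (\<exists>m. jump_time m om < ereal t & \<not> jump_time (Suc m) om < ereal t & jump_state m om = Some j)"
proof
 assume s: "state_before om t = Some j"
 then have "ereal t < explosion_time om" using assms(2) by (auto simp: state_before_def split: if_splits)
 then obtain k where "ereal t < jump_time k om" using assms(1) by (auto simp: less_explosion_iff)
 then have k: "ereal t <= jump_time k om" by simp
 \<comment> \<open>The first jump time reaching \<open>t\<close> has positive index because
   \<open>T_0 = 0 < t\<close>; its predecessor \<open>m\<close> starts the interval that contains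
   \<open>t\<close>.\<close>
 define n where "n = (LEAST k. ereal t <= jump_time k om)"
 have n: "ereal t <= jump_time n om" unfolding n_def using k by (rule LeastI)
 have "n \<noteq> 0" using n assms(2) by (intro notI) simp
 then obtain m where m: "n = Suc m" by (cases n) auto
 then have "\<not> ereal t <= jump_time m om" using not_less_Least[of m "%k. ereal t <= jump_time k om"] by (simp add: n_def)
 then have "jump_time m om < ereal t" by simp
 moreover from this have "state_before om t = jump_state m om" using n m by (intro state_before_eq[OF assms(1)]) auto
 ultimately show "\<exists>m. jump_time m om < ereal t & \<not> jump_time (Suc m) om < ereal t & jump_state m om = Some j"
  using s n m by (auto simp: not_less)
qed (auto simp: state_before_eq[OF assms(1)] not_less)

lemma state_at_0:
 assumes "om : paths" shows "state_at om 0 = jump_state 0 om"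
proof -
 have p: "0 < jump_time (Suc 0) om" using path_time_pos[OF assms, of 0] by (simp add: jump_time_Suc)
 then have "ereal 0 < explosion_time om" using less_explosion_iff[OF assms, of 0] by (auto simp: zero_ereal_def[symmetric])
 moreover have "(THE m. jump_time m om <= ereal 0 & ereal 0 < jump_time (Suc m) om) = 0"
 proof (rule the_equality)
  fix k assume k: "jump_time k om <= ereal 0 & ereal 0 < jump_time (Suc k) om"
  show "k = 0"
  proof (rule ccontr)
   assume "k \<noteq> 0"
   then have "jump_time (Suc 0) om <= jump_time k om" using assms by (intro jump_time_mono) auto
   then show False using k p by (auto simp: zero_ereal_def[symmetric])
  qed
 qed (use p in \<open>auto simp: zero_ereal_def[symmetric]\<close>)
 ultimately show ?thesis by (simp add: state_at_def)
qed

section \<open>Predictable sets\<close>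

lemma history_sets_gen:
 "sets (history t) = sigma_sets paths {{om : paths. jump_time m om <= ereal s & jump_state m om = Some j} | j s m. 0 <= s & s <= t}"
 unfolding history_def by (rule sets_measure_of) auto

lemma space_history: "space (history t) = paths"
 unfolding history_def by (rule space_measure_of) auto

lemma history_before_sets_gen: "sets (history_before s) = sigma_sets paths (\<Union>t\<in>{0..<s}. sets (history t))"
 unfolding history_before_def
 by (rule sets_measure_of) (use sets.sets_into_space[of _ "history _"] space_history in \<open>fastforce\<close>)

lemma space_history_before: "space (history_before t) = paths"
 unfolding history_before_def
 by (rule space_measure_of) (use sets.sets_into_space[of _ "history _"] space_history in \<open>fastforce\<close>)

lemma predictable_gen_Pow:
 "{B \<times> {0} | B. B : sets (history 0)} \<union> {B \<times> {s<..} | B s. 0 < s & B : sets (history_before s)} \<subseteq> Pow (paths \<times> {0 :: real..})"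
 using sets.sets_into_space[of _ "history 0"] sets.sets_into_space[of _ "history_before _"]
 by (fastforce simp: space_history space_history_before)

lemma space_predictable: "space predictable = paths \<times> {0..}"
 unfolding predictable_def by (rule space_measure_of[OF predictable_gen_Pow])

lemma sets_predictable: "sets predictable = sigma_sets (paths \<times> {0 :: real..})
 ({B \<times> {0} | B. B : sets (history 0)} \<union> {B \<times> {s<..} | B s. 0 < s & B : sets (history_before s)})"
 unfolding predictable_def by (rule sets_measure_of[OF predictable_gen_Pow])

lemma predictable_0: "B : sets (history 0) ==> B \<times> {0} : sets predictable"
 unfolding sets_predictable by (intro sigma_sets.Basic) auto

lemma predictable_gt: "0 < s ==> B : sets (history_before s) ==> B \<times> {s<..} : sets predictable"
 unfolding sets_predictable by (intro sigma_sets.Basic) auto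

text \<open>\<open>T_m < t\<close> holds iff there are rationals \<open>r < s\<close> with
  \<open>T_m <= r\<close> and \<open>s < t\<close>. The event at \<open>r\<close> belongs to the
  history strictly before \<open>s\<close>, so the set is a countable union of generating rectangles
  \<open>B \<times> {s<..}\<close>.\<close>

lemma predictable_jump:
 "{x : space predictable. jump_time m (fst x) < ereal (snd x) & jump_state m (fst x) = Some j} : sets predictable"
proof -
 let ?B = "%r. {om : paths. jump_time m om <= ereal r & jump_state m om = Some j}"
 have 1: "?B r \<times> {s<..} : sets predictable" if "0 <= r" "r < s" for r s
 proof (rule predictable_gt)
  show "0 < s" using that by simp
  have "?B r : sets (history r)" unfolding history_sets_gen using that by (intro sigma_sets.Basic) blast
  then show "?B r : sets (history_before s)"
   unfolding history_before_sets_gen using that by (intro sigma_sets.Basic) auto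
 qed
 let ?I = "{(r, s). (r :: real) : \<rat> & s : \<rat> & 0 <= r & r < (s :: real)}"
 have "countable ?I" by (rule countable_subset[of _ "\<rat> \<times> \<rat>"]) (auto simp: countable_rat)
 then have "(\<Union>(r, s)\<in>?I. ?B r \<times> {s<..}) : sets predictable"
  using 1 by (intro sets.countable_UN') auto
 also have "(\<Union>(r, s)\<in>?I. ?B r \<times> {s<..}) = {x : space predictable. jump_time m (fst x) < ereal (snd x) & jump_state m (fst x) = Some j}"
 proof (rule set_eqI, rule iffI)
  fix x assume "x : (\<Union>(r, s)\<in>?I. ?B r \<times> {s<..})"
  then obtain r s om t where x: "x = (om, t)" "0 <= r" "r < s" "s < t" "om : paths" "jump_time m om <= ereal r" "jump_state m om = Some j" by auto
  then have "ereal r < ereal t" by simp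
  with x(6) have "jump_time m om < ereal t" by (rule le_less_trans)
  then show "x : {x : space predictable. jump_time m (fst x) < ereal (snd x) & jump_state m (fst x) = Some j}"
   using x by (auto simp: space_predictable)
 next
  fix x assume "x : {x : space predictable. jump_time m (fst x) < ereal (snd x) & jump_state m (fst x) = Some j}"
  then obtain om t where a: "om : paths" "jump_time m om < ereal t" "0 <= t" "x = (om, t)" "jump_state m om = Some j"
   by (cases x) (auto simp: space_predictable)
  obtain tau where tau: "jump_time m om = ereal tau" "0 <= tau"
   using a jump_time_nonneg[OF a(1), of m] by (cases "jump_time m om") auto
  have "tau < t" using a tau by simp
  then obtain r where r: "r : \<rat>" "tau < r" "r < t" using Rats_dense_in_real by blast
  then obtain s where s: "s : \<rat>" "r < s" "s < t" using Rats_dense_in_real by blast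
  show "x : (\<Union>(r, s)\<in>?I. ?B r \<times> {s<..})"
   using r s tau a by (intro UN_I[of "(r, s)"]) auto
 qed
 finally show ?thesis .
qed

lemma predictable_jump_state [measurable]:
 "Measurable.pred predictable (%x. jump_time m (fst x) < ereal (snd x) & jump_state m (fst x) = Some (j :: 's :: countable))"
 using predictable_jump by (simp add: pred_def)

lemma predictable_jump_time [measurable]:
 "Measurable.pred predictable (%x :: 's :: countable path \<times> real. jump_time m (fst x) < ereal (snd x))"
proof -
 have "Measurable.pred predictable (%x :: 's path \<times> real. \<exists>j. jump_time m (fst x) < ereal (snd x) & jump_state m (fst x) = Some j)"
  by measurable
 also have "?this \<longleftrightarrow> ?thesis"
 proof (rule measurable_cong)
  fix x :: "'s path \<times> real" assume "x : space predictable"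
  then have "fst x : paths" by (auto simp: space_predictable)
  then show "(\<exists>j. jump_time m (fst x) < ereal (snd x) & jump_state m (fst x) = Some j) = (jump_time m (fst x) < ereal (snd x))"
   using jump_state_Some[of "fst x" m] by (cases "jump_time m (fst x)") auto
 qed
 finally show ?thesis .
qed

lemma predictable_snd [measurable]: "snd : borel_measurable predictable"
proof (rule borel_measurable_iff_greater[THEN iffD2], rule allI)
 fix a :: real
 have P0: "(paths :: 'a path set) : sets (history 0)" using sets.top[of "history 0"] by (simp add: space_history)
 have Ps: "(paths :: 'a path set) : sets (history_before s)" for s using sets.top[of "history_before s"] by (simp add: space_history_before)
 consider "a < 0" | "a = 0" | "0 < a" by linarith
 then show "{x : space (predictable :: ('a path \<times> real) measure). a < snd x} : sets predictable"
 proof cases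
  case 1
  then have "{x : space (predictable :: ('a path \<times> real) measure). a < snd x} = space predictable"
   by (auto simp: space_predictable)
  then show ?thesis by simp
 next
  case 2
  then have "{x : space (predictable :: ('a path \<times> real) measure). a < snd x} = space predictable - paths \<times> {0}"
   by (auto simp: space_predictable)
  then show ?thesis using predictable_0[OF P0] by auto
 next
  case 3
  then have "{x : space (predictable :: ('a path \<times> real) measure). a < snd x} = paths \<times> {a<..}"
   by (auto simp: space_predictable)
  then show ?thesis using predictable_gt[OF 3 Ps] by simp
 qed
qed

lemma predictable_state_before [measurable]:
 "(%x. state_before (fst x) (snd x)) : predictable \<rightarrow>\<^sub>M count_space (UNIV :: 's :: countable option set)"
proof -
 have S: "{x : space predictable. state_before (fst x) (snd x) = Some j} : sets predictable" for j :: 's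
 proof -
  let ?B = "{om : paths. jump_time 0 om <= ereal 0 & jump_state 0 om = Some j}"
  have "?B : sets (history 0)" unfolding history_sets_gen by (intro sigma_sets.Basic) blast
  then have B: "?B \<times> {0} : sets predictable" by (rule predictable_0)
  have C: "{x : space predictable. 0 < snd x & (\<exists>m. (jump_time m (fst x) < ereal (snd x) & jump_state m (fst x) = Some j) & \<not> jump_time (Suc m) (fst x) < ereal (snd x))} : sets predictable"
   by measurable
  have "{x : space predictable. state_before (fst x) (snd x) = Some j} = ?B \<times> {0} \<union>
    {x : space predictable. 0 < snd x & (\<exists>m. (jump_time m (fst x) < ereal (snd x) & jump_state m (fst x) = Some j) & \<not> jump_time (Suc m) (fst x) < ereal (snd x))}"
   (is "?L = ?R")
  proof (rule set_eqI, clarify)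
   fix om :: "'s path" and t :: real
   show "(om, t) : ?L \<longleftrightarrow> (om, t) : ?R"
   proof (cases "om : paths & 0 < t")
    case True then show ?thesis using state_before_Some_iff[of om t j] by (auto simp: space_predictable)
   next
    case False then show ?thesis using state_at_0[of om] by (auto simp: space_predictable state_before_def)
   qed
  qed
  then show ?thesis using B C by auto
 qed
 have "(%x. state_before (fst x) (snd x)) -` {y} \<inter> space predictable : sets predictable" for y :: "'s option"
 proof (cases y)
  case (Some j)
  have "(%x. state_before (fst x) (snd x)) -` {y} \<inter> space predictable = {x : space predictable. state_before (fst x) (snd x) = Some j}"
   using Some by auto
  then show ?thesis using S by simp
 next
  case None
  have "(%x. state_before (fst x) (snd x)) -` {y} \<inter> space predictable
    = space predictable - (\<Union>j. {x : space predictable. state_before (fst x) (snd x) = Some j})"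
   using None by auto
  then show ?thesis using S by auto
 qed
 then show ?thesis by (simp add: measurable_count_space_eq2_countable)
qed

text \<open>All states entered strictly before time \<open>t\<close> lie in \<open>F\<close>: a
  predictable localisation in place of a stopping time. For a level set of \<open>w\<close> it
  bounds the jump rates, so that expected jump counts are finite.\<close>

definition in_level :: "'s set => 's path \<times> real => bool" where
 "in_level F x \<longleftrightarrow> (\<forall>m. jump_time m (fst x) < ereal (snd x) --> (\<exists>j\<in>F. jump_state m (fst x) = Some j))"

lemma in_level_measurable [measurable]: "Measurable.pred predictable (in_level (F :: 's :: countable set))"
proof -
 have "in_level F = (%x. \<forall>m. jump_time m (fst x) < ereal (snd x) --> (\<exists>j\<in>F. jump_time m (fst x) < ereal (snd x) & jump_state m (fst x) = Some j))"
  by (auto simp: in_level_def fun_eq_iff)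
 moreover have "Measurable.pred predictable (%x. \<forall>m. jump_time m (fst x) < ereal (snd x) --> (\<exists>j\<in>F. jump_time m (fst x) < ereal (snd x) & jump_state m (fst x) = Some j))"
  by measurable
 ultimately show ?thesis by simp
qed

lemma space_path_space: "space path_space = paths"
 unfolding path_space_def space_restrict_space by (auto simp: space_PiM space_pair_measure)

lemma jump_state_measurable [measurable]: "jump_state m : path_space \<rightarrow>\<^sub>M count_space (UNIV :: 's :: countable option set)"
 unfolding path_space_def jump_state_def[abs_def] by (rule measurable_restrict_space1) measurable

lemma jump_time_measurable [measurable]: "jump_time m : borel_measurable (path_space :: 's :: countable path measure)"
 unfolding path_space_def jump_time_def[abs_def] by (rule measurable_restrict_space1) measurable

lemma history_le_path_space: "sets (history t) \<subseteq> sets (path_space :: 's :: countable path measure)"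
 unfolding history_sets_gen
proof (rule sets.sigma_sets_subset[of _ path_space, unfolded space_path_space], safe)
 fix j :: 's and s :: real and m
 have "{om : space path_space. jump_time m om <= ereal s & jump_state m om = Some j} : sets path_space" by measurable
 then show "{om : paths. jump_time m om <= ereal s & jump_state m om = Some j} : sets path_space" by (simp add: space_path_space)
qed

lemma history_before_le_path_space: "sets (history_before t) \<subseteq> sets (path_space :: 's :: countable path measure)"
 unfolding history_before_sets_gen
 by (rule sets.sigma_sets_subset[of _ path_space, unfolded space_path_space]) (use history_le_path_space in blast)

text \<open>The clamp sends the real line into the time axis \<open>[0, \<infinity>)\<close> on
  which predictable sets live. Time integrals carry an indicator of nonnegative times, so their
  values are unaffected.\<close>

lemma to_predictable:
 assumes "sets P = sets (path_space :: 's :: countable path measure)"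
 shows "(%x. (fst x, max 0 (snd x))) : P \<Otimes>\<^sub>M borel \<rightarrow>\<^sub>M predictable"
 unfolding predictable_def
proof (rule measurable_measure_of[OF predictable_gen_Pow])
 have sp: "space P = paths" using sets_eq_imp_space_eq[OF assms] by (simp add: space_path_space)
 show "(%x. (fst x, max 0 (snd x))) : space (P \<Otimes>\<^sub>M borel) \<rightarrow> paths \<times> {0 :: real..}"
  by (auto simp: space_pair_measure sp)
 fix y :: "('s path \<times> real) set"
 assume "y : {B \<times> {0} | B. B : sets (history 0)} \<union> {B \<times> {s<..} | B s. 0 < s & B : sets (history_before s)}"
 then consider B where "y = B \<times> {0}" "B : sets (history 0)" | B s where "y = B \<times> {s<..}" "0 < s" "B : sets (history_before s)"
  by blast
 then show "(%x. (fst x, max 0 (snd x))) -` y \<inter> space (P \<Otimes>\<^sub>M borel) : sets (P \<Otimes>\<^sub>M borel)"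
 proof cases
  case 1
  have B: "B : sets P" using subsetD[OF history_le_path_space 1(2)] assms by simp
  have "(%x. (fst x, max 0 (snd x))) -` y \<inter> space (P \<Otimes>\<^sub>M borel) = B \<times> {..0}"
   using sets.sets_into_space[OF B] 1(1) by (auto simp: space_pair_measure max_def split: if_splits)
  then show ?thesis using B by simp
 next
  case 2
  have B: "B : sets P" using subsetD[OF history_before_le_path_space 2(3)] assms by simp
  have "(%x. (fst x, max 0 (snd x))) -` y \<inter> space (P \<Otimes>\<^sub>M borel) = B \<times> {s<..}"
   using sets.sets_into_space[OF B] 2(1,2) by (auto simp: space_pair_measure max_def split: if_splits)
  then show ?thesis using B by simp
 qed
qed

section \<open>Counting the jumps within a finite level\<close>

lemma sets_ext_action_space: "sets (ext_action_space :: 'a :: topological_space option measure) = {B. Some -` B : sets borel}"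
proof -
 have "sigma_algebra UNIV {B :: 'a option set. Some -` B : sets borel}"
 proof (rule sigma_algebra_iff2[THEN iffD2], intro conjI ballI allI impI)
  fix F :: "nat => 'a option set" assume "range F \<subseteq> {B. Some -` B : sets borel}"
  then have "!!n. Some -` F n : sets borel" by auto
  then have "(\<Union>n. Some -` F n) : sets borel" by auto
  then show "\<Union> (range F) : {B. Some -` B : sets borel}" by (simp add: vimage_UN)
 qed (auto simp: vimage_Diff)
 then show ?thesis unfolding ext_action_space_def by (simp add: sigma_algebra.sigma_sets_eq)
qed

lemma space_ext_action_space [simp]: "space ext_action_space = UNIV"
 unfolding ext_action_space_def by (simp add: space_measure_of_conv)

lemma measurable_ext_action_space:
 assumes "f : UNIV \<rightarrow> space N" "(%a. f (Some a)) : borel \<rightarrow>\<^sub>M N"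
 shows "f : ext_action_space \<rightarrow>\<^sub>M N"
proof (rule measurableI)
 fix Y assume "Y : sets N"
 from measurable_sets[OF assms(2) this] show "f -` Y \<inter> space ext_action_space : sets ext_action_space"
  by (simp add: sets_ext_action_space vimage_def)
qed (use assms(1) in auto)

text \<open>Only the states before the \<open>l\<close>-th jump are required to lie in
  \<open>F\<close>; the jump that leaves \<open>F\<close> is therefore still counted.\<close>

definition jump_set :: "'s set => real => 's path => nat set" where
 "jump_set F t om = {l. 1 <= l & jump_time l om < ereal t & (\<forall>k<l. jump_state k om : Some ` F)}"

lemma in_level_state:
 assumes "in_level F (om, t)" "om : paths" "0 < t" "state_before om t = Some i"
 shows "i : F"
 using assms state_before_Some_iff[of om t i] by (auto simp: in_level_def)

text \<open>At the \<open>l\<close>-th jump time the left limit is the state before the jump, and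
  the predictable condition \<open>in_level\<close> becomes membership in \<open>jump_set\<close>.
  Integrals of localised integrands against the jump measure thereby become sums over
  \<open>jump_set\<close>.\<close>

lemma at_jump:
 assumes "om : paths" "1 <= l" "jump_time l om < \<infinity>"
 shows "0 < real_of_ereal (jump_time l om)" "ereal (real_of_ereal (jump_time l om)) = jump_time l om"
  "state_before om (real_of_ereal (jump_time l om)) = jump_state (l - 1) om"
  "(real_of_ereal (jump_time l om) < t & in_level F (om, real_of_ereal (jump_time l om))) \<longleftrightarrow> l : jump_set F t om"
proof -
 have "jump_time 0 om < jump_time l om" using assms by (intro jump_time_strict) auto
 then show "0 < real_of_ereal (jump_time l om)" and e: "ereal (real_of_ereal (jump_time l om)) = jump_time l om"
  using assms(3) by (cases "jump_time l om", auto)+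
 have "jump_time (l - 1) om < jump_time l om" using assms by (subst jump_time_less_iff) auto
 then show "state_before om (real_of_ereal (jump_time l om)) = jump_state (l - 1) om"
  using assms by (intro state_before_eq) (auto simp: e)
 have "in_level F (om, real_of_ereal (jump_time l om)) \<longleftrightarrow> (\<forall>k<l. jump_state k om : Some ` F)"
  unfolding in_level_def using jump_time_less_iff[OF assms(1,3)] by (auto simp: e)
 moreover have "real_of_ereal (jump_time l om) < t \<longleftrightarrow> jump_time l om < ereal t" by (subst e[symmetric]) simp
 ultimately show "(real_of_ereal (jump_time l om) < t & in_level F (om, real_of_ereal (jump_time l om))) \<longleftrightarrow> l : jump_set F t om"
  using assms(2) by (auto simp: jump_set_def)
qed

text \<open>Bookkeeping for the state \<open>j\<close>: initial presence plus arrivals equals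
  departures plus final presence. It telescopes over consecutive jumps, and finiteness excludes an
  accumulation of jumps before \<open>t\<close>. If the last counted jump leaves \<open>F\<close>,
  it cannot lead to \<open>j\<close>, and the final term vanishes too.\<close>

lemma jump_telescope:
 assumes om: "om : paths" and t: "0 < t" and fin: "finite (jump_set F t om)" and j: "j : F"
 shows "(if jump_state 0 om = Some j then 1 else 0) +
   (NN l. indicator (jump_set F t om) l * (if the (jump_state l om) = j then 1 else 0) \<partial>counting) =
   (NN l. indicator (jump_set F t om) l * (if jump_state (l - 1) om = Some j then 1 else 0) \<partial>counting) +
   (if in_level F (om, t) & state_before om t = Some j then 1 else 0 :: ennreal)"
proof (cases "jump_state 0 om : Some ` F")
 case False
 have "jump_set F t om = {}" using False by (auto simp: jump_set_def intro!: exI[of _ 0])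
 moreover have "\<not> in_level F (om, t)" using False t by (auto simp: in_level_def image_iff intro!: exI[of _ 0])
 ultimately show ?thesis using False j by auto
next
 case True
 let ?J = "jump_set F t om"
 \<comment> \<open>The last counted jump, zero if there is none; the set is closed downwards, hence
   equal to \<open>{1..K}\<close>.\<close>
 define K where "K = Max (insert 0 ?J)"
 have KJ: "K : insert 0 ?J" unfolding K_def using fin by (intro Max_in) auto
 have down: "l' : ?J" if "l : ?J" "1 <= l'" "l' <= l" for l l'
  using that jump_time_mono[OF om, of l' l] by (auto simp: jump_set_def)
 have J: "?J = {1..K}"
 proof (rule set_eqI, rule iffI)
  fix l assume "l : ?J"
  moreover have "l <= K" unfolding K_def using fin \<open>l : ?J\<close> by (intro Max_ge) auto
  ultimately show "l : {1..K}" by (auto simp: jump_set_def)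
 next
  fix l assume "l : {1..K}" then show "l : ?J" using KJ down[of K l] by auto
 qed
 have K: "jump_time K om < ereal t" "\<forall>k<K. jump_state k om : Some ` F"
  using KJ t by (auto simp: jump_set_def)
 have K': "jump_state K om : Some ` F ==> ereal t <= jump_time (Suc K) om"
 proof (rule ccontr)
  assume "jump_state K om : Some ` F" "\<not> ereal t <= jump_time (Suc K) om"
  then have "Suc K : ?J" using K(2) by (auto simp: jump_set_def less_Suc_eq)
  then show False using J by simp
 qed
 define f where "f l = (if jump_state l om = Some j then 1 else 0 :: ennreal)" for l
 have tel: "f 0 + (\<Sum>l\<in>{1..n}. f l) = (\<Sum>l\<in>{1..n}. f (l - 1)) + f n" for n
  by (induction n) (auto simp: add_ac)
 have s1: "(NN l. indicator ?J l * (if the (jump_state l om) = j then 1 else 0) \<partial>counting) = (\<Sum>l\<in>{1..K}. f l)"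
 proof (subst nn_integral_count_space'[where A = "{1..K}"])
  show "(\<Sum>l = 1..K. indicator ?J l * (if the (jump_state l om) = j then 1 else 0)) = (\<Sum>l = 1..K. f l)"
  proof (rule sum.cong[OF refl])
   fix l assume "l : {1..K}"
   then have l: "l : ?J" using J by simp
   then have "jump_time l om < \<infinity>" by (cases "jump_time l om") (auto simp: jump_set_def)
   from jump_state_Some[OF om this] l show "indicator ?J l * (if the (jump_state l om) = j then 1 else 0) = f l"
    by (auto simp: f_def)
  qed
 qed (auto simp: J)
 have s2: "(NN l. indicator ?J l * (if jump_state (l - 1) om = Some j then 1 else 0) \<partial>counting) = (\<Sum>l\<in>{1..K}. f (l - 1))"
  by (subst nn_integral_count_space'[where A = "{1..K}"]) (auto simp: J f_def intro!: sum.cong)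
 have "f K = (if in_level F (om, t) & state_before om t = Some j then 1 else 0)"
 proof (cases "jump_state K om : Some ` F")
  case True
  note t1 = K'[OF True]
  have sb: "state_before om t = jump_state K om" by (rule state_before_eq[OF om K(1) t1])
  have "in_level F (om, t)"
   unfolding in_level_def
  proof (intro allI impI, simp)
   fix m assume m: "jump_time m om < ereal t"
   have "m <= K"
   proof (rule ccontr)
    assume "\<not> m <= K"
    then have "jump_time (Suc K) om <= jump_time m om" by (intro jump_time_mono[OF om]) auto
    then show False using t1 m by (auto dest: order_trans simp: not_le[symmetric])
   qed
   then show "\<exists>j\<in>F. jump_state m om = Some j" using K(2)[rule_format, of m] True by (cases "m = K") auto
  qed
  then show ?thesis using sb by (simp add: f_def)
 next
  case False
  then have "\<not> in_level F (om, t)" using K(1) by (auto simp: in_level_def)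
  then show ?thesis using False j by (auto simp: f_def)
 qed
 then show ?thesis unfolding s1 s2 using tel[of K] by (simp add: f_def)
qed

section \<open>A policy, its path law and the compensator\<close>

locale controlled = ctmdp T A q \<gamma> w L R
 for T :: real and A :: "'s :: countable => 'a :: polish_space set"
  and q :: "'s => 's => 'a => real" and \<gamma> :: "'s pmf" and w :: "'s => real" and L R :: real +
 fixes \<pi> :: "'s path => real => 'a option measure" and P :: "'s path measure"
 assumes pol: "\<pi> : policies A" and law: "path_law A q \<gamma> \<pi> P"
begin

lemma P_prob: "prob_space P" and P_sets: "sets P = sets path_space"
 using law by (auto simp: path_law_def)

lemma P_space: "space P = paths" using sets_eq_imp_space_eq[OF P_sets] by (simp add: space_path_space)

sublocale P: prob_space P by (rule P_prob)

lemma kernel [measurable]: "(%x. \<pi> (fst x) (snd x)) : predictable \<rightarrow>\<^sub>M subprob_algebra ext_action_space"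
 using pol by (simp add: policies_def case_prod_beta' measurable_prob_algebraD)

lemma kernel_prob:
 assumes "om : paths" "0 <= t"
 shows "prob_space (\<pi> om t)" "sets (\<pi> om t) = sets ext_action_space" "emeasure (\<pi> om t) (ext_actions A (state_before om t)) = 1"
proof -
 have "(%x. \<pi> (fst x) (snd x)) : predictable \<rightarrow>\<^sub>M prob_algebra ext_action_space" using pol by (simp add: policies_def case_prod_beta')
 from measurable_space[OF this, of "(om, t)"] assms have "\<pi> om t : space (prob_algebra ext_action_space)"
  by (simp add: space_predictable)
 then show "prob_space (\<pi> om t)" "sets (\<pi> om t) = sets ext_action_space" by (auto simp: space_prob_algebra)
 show "emeasure (\<pi> om t) (ext_actions A (state_before om t)) = 1" using pol assms by (auto simp: policies_def)
qed

definition inr :: "'s option => 'a option => 's => ennreal" where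
 "inr s b j = (case s of None => 0 | Some i => (case b of None => 0 | Some a => inrate i a j))"

definition outr :: "'s option => 'a option => ennreal" where
 "outr s b = (case s of None => 0 | Some i => (case b of None => 0 | Some a => outrate i a))"

text \<open>The average of a rate over the action drawn by the policy, at the state just before the
  time in question. The jump intensity is \<open>ev\<close> of \<open>inr\<close>.\<close>

definition ev :: "('s option => 'a option => ennreal) => 's path \<times> real => ennreal" where
 "ev g x = (NN b. g (state_before (fst x) (snd x)) b \<partial>\<pi> (fst x) (snd x))"

lemma inr_measurable [measurable]: "(%b. inr s b j) : borel_measurable ext_action_space"
 by (rule measurable_ext_action_space) (cases s; simp add: inr_def)+

lemma outr_measurable [measurable]: "outr s : borel_measurable ext_action_space"
 by (rule measurable_ext_action_space) (cases s; simp add: outr_def)+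

lemma inr_on_K: "ennreal (on_K A (%i a. if j \<noteq> i then q j i a else 0) s b) = inr s b j"
 by (cases s; cases b) (auto simp: inr_def inrate_def)

lemma sum_inr: "(NN j. inr s b j \<partial>counting) = outr s b"
 by (cases s; cases b) (auto simp: inr_def outr_def sum_inrate)

lemma ev_measurable [measurable]:
 assumes "!!s. g s : borel_measurable ext_action_space"
 shows "ev g : borel_measurable predictable"
proof -
 have "(%x. (%s x. NN b. g s b \<partial>\<pi> (fst x) (snd x)) (state_before (fst x) (snd x)) x) : borel_measurable predictable"
  by (rule measurable_compose_countable[OF _ predictable_state_before],
    rule measurable_compose[OF kernel nn_integral_measurable_subprob_algebra[OF assms]])
 then show ?thesis by (simp add: ev_def[abs_def])
qed

lemma ev_inr_section: "(%(x, j). ev (%s b. inr s b j) x) : borel_measurable (predictable \<Otimes>\<^sub>M count_space (UNIV :: 's set))"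
 unfolding measurable_split_conv by (rule measurable_compose_countable[OF _ measurable_snd]) (rule measurable_compose[OF measurable_fst ev_measurable], simp)

lemma sum_ev_inr:
 assumes "om : paths" "0 <= t"
 shows "(NN j. ev (%s b. inr s b j) (om, t) \<partial>counting) = ev outr (om, t)"
proof -
 interpret K: prob_space "\<pi> om t" by (rule kernel_prob[OF assms])
 have "(NN j. ev (%s b. inr s b j) (om, t) \<partial>counting) = (NN b. NN j. inr (state_before om t) b j \<partial>counting \<partial>\<pi> om t)"
  unfolding ev_def fst_conv snd_conv
 proof (rule nn_integral_swap[OF sigma_finite_count_countable K.sigma_finite_measure_axioms])
  show "(%(j, b). inr (state_before om t) b j) : borel_measurable (counting \<Otimes>\<^sub>M \<pi> om t)"
  proof (rule measurable_pair_measure_countable1)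
   fix j :: 's
   show "(%b. case (j, b) of (j, b) => inr (state_before om t) b j) : borel_measurable (\<pi> om t)"
    unfolding measurable_cong_sets[OF kernel_prob(2)[OF assms] refl] prod.case by (rule inr_measurable)
  qed simp
 qed
 then show ?thesis by (simp add: sum_inr ev_def)
qed

lemma section_predictable:
 fixes om :: "'s path"
 assumes "om : paths" shows "(%t. (om, max 0 t)) : borel \<rightarrow>\<^sub>M predictable"
proof -
 have "(%t. (om, t)) : borel \<rightarrow>\<^sub>M P \<Otimes>\<^sub>M borel" using assms by (simp add: P_space)
 from measurable_compose[OF this to_predictable[OF P_sets]] show ?thesis by simp
qed

lemma jump_intensity_integral:
 assumes om: "om : paths" and W: "W : borel_measurable (predictable \<Otimes>\<^sub>M counting)"
 shows "(NN (t, j). W ((om, t), j) \<partial>jump_intensity A q \<pi> om) =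
  (NN t. (NN j. ev (%s b. inr s b j) (om, max 0 t) * W ((om, max 0 t), j) \<partial>counting) * indicator {0<..} t \<partial>lborel)"
proof -
 interpret C: sigma_finite_measure "count_space (UNIV :: 's set)" by (rule sigma_finite_count_countable)
 let ?N = "restrict_space lborel {0<..} \<Otimes>\<^sub>M count_space (UNIV :: 's set)"
 have s0: "(%t. (om, t)) : restrict_space lborel {0<..} \<rightarrow>\<^sub>M predictable"
 proof -
  have "(%t. (om, max 0 t)) : restrict_space lborel {0<..} \<rightarrow>\<^sub>M predictable"
   by (rule measurable_restrict_space1) (use section_predictable[OF om] in simp)
  then show ?thesis by (rule measurable_cong[THEN iffD1, rotated]) (simp add: space_restrict_space)
 qed
 have s1: "(%x. ((om, fst x), snd x)) : ?N \<rightarrow>\<^sub>M predictable \<Otimes>\<^sub>M counting"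
  by (rule measurable_Pair[OF measurable_compose[OF measurable_fst s0] measurable_snd])
 have m1: "(%(t, j). W ((om, t), j)) : borel_measurable ?N"
  using measurable_compose[OF s1 W] by (simp add: case_prod_beta')
 have m2: "(%(t, j). ev (%s b. inr s b j) (om, t)) : borel_measurable ?N"
  using measurable_compose[OF s1 ev_inr_section] by (simp add: case_prod_beta')
 have "jump_intensity A q \<pi> om = density ?N (%(t, j). ev (%s b. inr s b j) (om, t))"
  unfolding jump_intensity_def inr_on_K ev_def by simp
 then have "(NN (t, j). W ((om, t), j) \<partial>jump_intensity A q \<pi> om) = (NN x. (case x of (t, j) => ev (%s b. inr s b j) (om, t)) * (case x of (t, j) => W ((om, t), j)) \<partial>?N)"
  using nn_integral_density[OF m2 m1] by simp
 also have "... = (NN t. NN j. ev (%s b. inr s b j) (om, t) * W ((om, t), j) \<partial>counting \<partial>restrict_space lborel {0<..})"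
  by (subst C.nn_integral_fst[symmetric]) (use m1 m2 in \<open>auto intro!: borel_measurable_times\<close>)
 also have "... = (NN t. (NN j. ev (%s b. inr s b j) (om, t) * W ((om, t), j) \<partial>counting) * indicator {0<..} t \<partial>lborel)"
  by (subst nn_integral_restrict_space) auto
 also have "... = (NN t. (NN j. ev (%s b. inr s b j) (om, max 0 t) * W ((om, max 0 t), j) \<partial>counting) * indicator {0<..} t \<partial>lborel)"
  by (intro nn_integral_cong) (auto simp: indicator_def)
 finally show ?thesis .
qed

lemma jump_measure_integral:
 fixes om :: "'s path"
 assumes om: "om : paths" and W: "W : borel_measurable (predictable \<Otimes>\<^sub>M counting)"
 shows "(NN (t, j). W ((om, t), j) \<partial>jump_measure om) =
  (NN m. (if 1 <= m & jump_time m om < \<infinity> then W ((om, real_of_ereal (jump_time m om)), the (jump_state m om)) else 0) \<partial>counting)"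
proof -
 let ?I = "{m. 1 <= m & jump_time m om < \<infinity>}" and ?N = "restrict_space borel {0<..} \<Otimes>\<^sub>M count_space (UNIV :: 's set)"
 have s0: "(%t. (om, t)) : restrict_space borel {0<..} \<rightarrow>\<^sub>M predictable"
 proof -
  have "(%t. (om, max 0 t)) : restrict_space borel {0<..} \<rightarrow>\<^sub>M predictable"
   by (rule measurable_restrict_space1[OF section_predictable[OF om]])
  then show ?thesis by (rule measurable_cong[THEN iffD1, rotated]) (simp add: space_restrict_space)
 qed
 have s1: "(%x. ((om, fst x), snd x)) : ?N \<rightarrow>\<^sub>M predictable \<Otimes>\<^sub>M counting"
  by (rule measurable_Pair[OF measurable_compose[OF measurable_fst s0] measurable_snd])
 have m1: "(%(t, j). W ((om, t), j)) : borel_measurable ?N"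
  using measurable_compose[OF s1 W] by (simp add: case_prod_beta')
 have "(NN (t, j). W ((om, t), j) \<partial>jump_measure om) = (NN m. W ((om, real_of_ereal (jump_time m om)), the (jump_state m om)) \<partial>count_space ?I)"
  unfolding jump_measure_def
 proof (subst nn_integral_distr)
  show "(%m. (real_of_ereal (jump_time m om), the (jump_state m om))) : count_space ?I \<rightarrow>\<^sub>M ?N"
   using at_jump(1)[OF om] by (auto simp: space_pair_measure space_restrict_space)
 qed (use m1 in auto)
 also have "... = (NN m. (if 1 <= m & jump_time m om < \<infinity> then W ((om, real_of_ereal (jump_time m om)), the (jump_state m om)) else 0) \<partial>counting)"
  by (subst nn_integral_count_space_indicator) (auto intro!: nn_integral_cong simp: indicator_def)
 finally show ?thesis .
qed

end

lemma measurable_pair_count2: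
 assumes "!!j. (%x. f (x, j)) : M \<rightarrow>\<^sub>M N"
 shows "f : M \<Otimes>\<^sub>M count_space (UNIV :: 'j :: countable set) \<rightarrow>\<^sub>M N"
proof -
 have "(%y. (%j y. f (fst y, j)) (snd y) y) : M \<Otimes>\<^sub>M counting \<rightarrow>\<^sub>M N"
  by (rule measurable_compose_countable[OF _ measurable_snd]) (rule measurable_compose[OF measurable_fst assms])
 then show ?thesis by simp
qed

lemma nn_integral_exp_Icc:
 assumes "0 < c" "0 <= t"
 shows "(NN s. ennreal (exp (c * s)) * indicator {0..t} s \<partial>lborel) = ennreal ((exp (c * t) - 1) / c)"
proof -
 have "(NN s. ennreal (exp (c * s)) * indicator {0..t} s \<partial>lborel) = ennreal (exp (c * t) / c - exp (c * 0) / c)"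
  using assms by (intro nn_integral_FTC_Icc) (auto intro!: derivative_eq_intros)
 then show ?thesis by (simp add: diff_divide_distrib)
qed

text \<open>With the weight \<open>exp (- 2 * R * t)\<close> the integral operator has norm at most one half.\<close>

lemma gronwall_ennreal:
 fixes Y :: "real => ennreal"
 assumes R: "0 < R" and B: "!!t. 0 < t ==> t <= T ==> Y t <= ennreal B"
  and C: "0 <= C" and Y: "!!t. 0 < t ==> t <= T ==> Y t <= ennreal C + ennreal R * (NN s. Y s * indicator {0<..<t} s \<partial>lborel)"
  and t: "0 < t" "t <= T"
 shows "Y t <= ennreal (2 * C * exp (2 * R * t))"
proof -
 define M where "M = (SUP t\<in>{0<..T}. Y t * ennreal (exp (- 2 * R * t)))"
 have "M <= ennreal B"
  unfolding M_def
 proof (rule SUP_least)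
  fix t assume "t : {0<..T}"
  then have "Y t * ennreal (exp (- 2 * R * t)) <= ennreal B * ennreal 1"
   using R by (intro mult_mono B ennreal_leI) auto
  then show "Y t * ennreal (exp (- 2 * R * t)) <= ennreal B" by simp
 qed
 \<comment> \<open>A priori finiteness of the weighted supremum; it is what makes
   \<open>m <= C + m / 2\<close>, reached below, conclusive.\<close>
 then obtain m where m: "M = ennreal m" "0 <= m" by (cases M) (auto simp: top_unique)
 have e1: "ennreal (exp (- 2 * R * s)) * ennreal (exp (2 * R * s)) = 1" for s
  by (simp add: ennreal_mult[symmetric] mult_exp_exp)
 have YM: "Y s <= ennreal m * ennreal (exp (2 * R * s))" if "0 < s" "s <= T" for s
 proof -
  have "Y s * ennreal (exp (- 2 * R * s)) <= M" unfolding M_def using that by (intro SUP_upper) auto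
  then have "Y s * ennreal (exp (- 2 * R * s)) * ennreal (exp (2 * R * s)) <= ennreal m * ennreal (exp (2 * R * s))"
   by (intro mult_right_mono) (auto simp: m)
  moreover have "Y s * ennreal (exp (- 2 * R * s)) * ennreal (exp (2 * R * s)) = Y s"
   by (subst mult.assoc, subst e1) simp
  ultimately show ?thesis by simp
 qed
 have step: "Y t <= ennreal (C + m / 2 * exp (2 * R * t))" if t: "0 < t" "t <= T" for t
 proof -
  have "(NN s. Y s * indicator {0<..<t} s \<partial>lborel) <= (NN s. ennreal m * (ennreal (exp (2 * R * s)) * indicator {0..t} s) \<partial>lborel)"
   using YM t by (intro nn_integral_mono) (auto simp: indicator_def)
  also have "... = ennreal (m * ((exp (2 * R * t) - 1) / (2 * R)))"
   using nn_integral_exp_Icc[of "2 * R" t] R t m by (subst nn_integral_cmult) (simp_all add: ennreal_mult'[symmetric])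
  finally have "Y t <= ennreal C + ennreal R * ennreal (m * ((exp (2 * R * t) - 1) / (2 * R)))"
   using Y[OF t] by (meson add_left_mono mult_left_mono order_trans zero_le)
  also have "... = ennreal (C + R * (m * ((exp (2 * R * t) - 1) / (2 * R))))"
   using R m C t by (simp add: ennreal_mult'[symmetric])
  also have "R * (m * ((exp (2 * R * t) - 1) / (2 * R))) = m / 2 * (exp (2 * R * t) - 1)" using R by simp
  also have "ennreal (C + m / 2 * (exp (2 * R * t) - 1)) <= ennreal (C + m / 2 * exp (2 * R * t))"
   using m by (intro ennreal_leI add_left_mono mult_left_mono) auto
  finally show ?thesis .
 qed
 have "M <= ennreal (C + m / 2)"
  unfolding M_def
 proof (rule SUP_least)
  fix t assume t: "t : {0<..T}"
  have "Y t * ennreal (exp (- 2 * R * t)) <= ennreal (C + m / 2 * exp (2 * R * t)) * ennreal (exp (- 2 * R * t))"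
   using t step by (intro mult_right_mono) auto
  also have "... = ennreal ((C + m / 2 * exp (2 * R * t)) * exp (- 2 * R * t))" using C m by (simp add: ennreal_mult)
  also have "(C + m / 2 * exp (2 * R * t)) * exp (- 2 * R * t) = C * exp (- 2 * R * t) + m / 2"
   by (simp add: distrib_right mult.assoc mult_exp_exp)
  also have "ennreal (C * exp (- 2 * R * t) + m / 2) <= ennreal (C + m / 2)"
   using C R t by (intro ennreal_leI add_right_mono) (auto intro!: mult_left_le)
  finally show "Y t * ennreal (exp (- 2 * R * t)) <= ennreal (C + m / 2)" .
 qed
 then have "ennreal m <= ennreal (C + m / 2)" by (simp only: m)
 then have "m <= C + m / 2" by (rule ennreal_le_iff[THEN iffD1, rotated]) (use m C in simp)
 then have "m <= 2 * C" by simp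
 have "Y t <= ennreal (C + m / 2 * exp (2 * R * t))" using step t by simp
 also have "... <= ennreal (C * exp (2 * R * t) + C * exp (2 * R * t))"
  using C R t \<open>m <= 2 * C\<close> by (intro ennreal_leI add_mono mult_right_mono) (auto simp: mult_le_cancel_left1)
 finally show ?thesis by (simp add: mult_ac)
qed

section \<open>Forward equations inside a level\<close>

context controlled
begin

text \<open>The expected integral over the open interval, matching the jumps strictly before
  \<open>t\<close> that \<open>jump_set\<close> counts.\<close>

definition EI :: "real => ('s path \<times> real => ennreal) => ennreal" where
 "EI t Q = (NN om. (NN s. Q (om, max 0 s) * indicator {0<..<t} s \<partial>lborel) \<partial>P)"

lemma product_measurable:
 assumes "Q : borel_measurable predictable"
 shows "(%x. Q (fst x, max 0 (snd x))) : borel_measurable (P \<Otimes>\<^sub>M borel)"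
 using measurable_compose[OF to_predictable[OF P_sets] assms] .

lemma product_measurable':
 fixes Q :: "'s path \<times> real => ennreal"
 assumes "Q : borel_measurable predictable"
 shows "(%(om, s). Q (om, max 0 s) * indicator {0<..<t} s) : borel_measurable (P \<Otimes>\<^sub>M lborel)"
proof -
 have "(%x. Q (fst x, max 0 (snd x)) * indicator {0<..<t} (snd x)) : borel_measurable (P \<Otimes>\<^sub>M borel)"
  by (intro borel_measurable_times_ennreal product_measurable[OF assms] measurable_compose[OF measurable_snd borel_measurable_indicator]) simp
 then show ?thesis by (simp add: case_prod_beta')
qed

lemma EI_inner_measurable:
 assumes "Q : borel_measurable predictable"
 shows "(%om. NN s. Q (om, max 0 s) * indicator {0<..<t} s \<partial>lborel) : borel_measurable P"
 using lborel.borel_measurable_nn_integral[OF product_measurable'[OF assms]] by simp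

lemma section_measurable:
 fixes om :: "'s path" and Q :: "'s path \<times> real => ennreal"
 assumes "Q : borel_measurable predictable" "om : paths"
 shows "(%s. Q (om, max 0 s) * indicator {0<..<t} s) : borel_measurable lborel"
proof -
 have "(%s. Q (om, max 0 s)) : borel_measurable lborel"
  using measurable_compose[OF section_predictable[OF assms(2)] assms(1)] by simp
 then show ?thesis by (intro borel_measurable_times_ennreal borel_measurable_indicator) auto
qed

lemma EI_add:
 assumes "Q : borel_measurable predictable" "Q' : borel_measurable predictable"
 shows "EI t (%x. Q x + Q' x) = EI t Q + EI t Q'"
proof -
 have "EI t (%x. Q x + Q' x) = (NN om. (NN s. Q (om, max 0 s) * indicator {0<..<t} s \<partial>lborel) + (NN s. Q' (om, max 0 s) * indicator {0<..<t} s \<partial>lborel) \<partial>P)"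
  unfolding EI_def distrib_right
  by (intro nn_integral_cong nn_integral_add section_measurable assms) (simp_all add: P_space)
 then show ?thesis by (simp add: nn_integral_add EI_inner_measurable assms EI_def)
qed

lemma EI_cmult:
 assumes "Q : borel_measurable predictable"
 shows "EI t (%x. c * Q x) = c * EI t Q"
proof -
 have "EI t (%x. c * Q x) = (NN om. c * (NN s. Q (om, max 0 s) * indicator {0<..<t} s \<partial>lborel) \<partial>P)"
  unfolding EI_def mult.assoc
  by (intro nn_integral_cong nn_integral_cmult section_measurable assms) (simp_all add: P_space)
 then show ?thesis by (simp add: nn_integral_cmult EI_inner_measurable assms EI_def)
qed

lemma EI_sum:
 assumes "finite F" "!!j. j : F ==> Q j : borel_measurable predictable"
 shows "EI t (%x. \<Sum>j\<in>F. Q j x) = (\<Sum>j\<in>F. EI t (Q j))"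
 using assms
proof (induction F rule: finite_induct)
 case empty then show ?case by (simp add: EI_def)
next
 case (insert j F)
 then have "EI t (%x. Q j x + (\<Sum>j\<in>F. Q j x)) = EI t (Q j) + EI t (%x. \<Sum>j\<in>F. Q j x)"
  by (intro EI_add) auto
 then show ?case using insert by simp
qed

lemma EI_mono:
 assumes "!!om s. om : paths ==> 0 < s ==> s < t ==> Q (om, s) <= Q' (om, s)"
 shows "EI t Q <= EI t Q'"
 unfolding EI_def using assms by (intro nn_integral_mono) (auto simp: P_space indicator_def)

lemma EI_cong:
 assumes "!!om s. om : paths ==> 0 < s ==> s < t ==> Q (om, s) = Q' (om, s)"
 shows "EI t Q = EI t Q'"
 using assms by (intro antisym EI_mono) auto

lemma EI_const_bound:
 assumes "!!om s. om : paths ==> 0 < s ==> s < t ==> Q (om, s) <= ennreal c" "0 <= t"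
 shows "EI t Q < \<infinity>"
proof -
 have "EI t Q <= EI t (%_. ennreal c)" by (rule EI_mono) (rule assms)
 also have "... = ennreal c * ennreal t" using assms(2) by (simp add: EI_def nn_integral_cmult_indicator P.emeasure_space_1)
 also have "... < \<infinity>" by (simp add: ennreal_mult_less_top)
 finally show ?thesis .
qed

lemma EI_SUP:
 assumes "!!n. Q n : borel_measurable predictable" "!!x. incseq (%n. Q n x)"
 shows "EI t (%x. SUP n. Q n x) = (SUP n. EI t (Q n))"
proof -
 have "EI t (%x. SUP n. Q n x) = (NN om. (SUP n. NN s. Q n (om, max 0 s) * indicator {0<..<t} s \<partial>lborel) \<partial>P)"
  unfolding EI_def
 proof (rule nn_integral_cong)
  fix om assume "om : space P"
  then have om: "om : paths" by (simp add: P_space)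
  have "(NN s. (SUP n. Q n (om, max 0 s)) * indicator {0<..<t} s \<partial>lborel) = (NN s. (SUP n. Q n (om, max 0 s) * indicator {0<..<t} s) \<partial>lborel)"
   by (simp add: SUP_mult_right_ennreal)
  also have "... = (SUP n. NN s. Q n (om, max 0 s) * indicator {0<..<t} s \<partial>lborel)"
   by (rule nn_integral_monotone_convergence_SUP[OF _ section_measurable[OF assms(1) om]])
     (use assms(2) in \<open>auto simp: incseq_def le_fun_def intro!: mult_right_mono\<close>)
  finally show "(NN s. (SUP n. Q n (om, max 0 s)) * indicator {0<..<t} s \<partial>lborel) = (SUP n. NN s. Q n (om, max 0 s) * indicator {0<..<t} s \<partial>lborel)" .
 qed
 also have "... = (SUP n. EI t (Q n))"
  unfolding EI_def
  by (rule nn_integral_monotone_convergence_SUP[OF _ EI_inner_measurable[OF assms(1)]])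
    (use assms(2) in \<open>auto simp: incseq_def le_fun_def intro!: nn_integral_mono mult_right_mono\<close>)
 finally show ?thesis .
qed

lemma jump_set_measurable: "{om : paths. l : jump_set F t om} : sets P"
proof -
 have "{om : space path_space. 1 <= l & jump_time l om < ereal t & (\<forall>k<l. jump_state k om : Some ` F)} : sets path_space"
  by measurable
 then show ?thesis by (simp only: jump_set_def P_sets space_path_space mem_Collect_eq)
qed

lemma jump_sum_measurable:
 "(%om. NN l. indicator (jump_set F t om) l * k (jump_state (l - 1) om) (the (jump_state l om)) \<partial>counting) : borel_measurable P"
proof -
 interpret N: sigma_finite_measure "count_space (UNIV :: nat set)" by (rule sigma_finite_count_countable)
 have [measurable_cong]: "sets P = sets path_space" by (rule P_sets)
 have 1: "(%om. (if l : jump_set F t om then 1 else 0) * k (jump_state (l - 1) om) (the (jump_state l om))) : borel_measurable P" for l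
 proof -
  have [measurable]: "Measurable.pred P (%om. l : jump_set F t om)"
   using jump_set_measurable by (simp add: pred_def P_space)
  have "(%om. (%s om. (%s' om. k s (the s')) (jump_state l om) om) (jump_state (l - 1) om) om) : borel_measurable P"
   by (rule measurable_compose_countable, rule measurable_compose_countable, rule measurable_const, simp, measurable)
  then have "(%om. k (jump_state (l - 1) om) (the (jump_state l om))) : borel_measurable P" by simp
  then show ?thesis by (intro borel_measurable_times_ennreal) simp_all
 qed
 have "(%om. NN l. (if l : jump_set F t om then 1 else 0) * k (jump_state (l - 1) om) (the (jump_state l om)) \<partial>counting) : borel_measurable P"
  by (rule N.borel_measurable_nn_integral) (rule measurable_pair_count2, use 1 in auto)
 then show ?thesis by (simp add: indicator_def of_bool_def)
qed

text \<open>The compensator identity for a predictable integrand cut off at time \<open>t\<close>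
  and on leaving the level. The factor \<open>k\<close> sees the states before and after the jump,
  so both arrivals and departures can be counted.\<close>

lemma dpp_level:
 assumes "0 < t"
 shows "(NN om. (NN l. indicator (jump_set F t om) l * k (jump_state (l - 1) om) (the (jump_state l om)) \<partial>counting) \<partial>P) =
  EI t (%x. if in_level F x then (NN j. ev (%s b. inr s b j) x * k (state_before (fst x) (snd x)) j \<partial>counting) else 0)"
proof -
 define W where "W = (%(x, j). if 0 < snd x & snd x < t & in_level F x then k (state_before (fst x) (snd x)) j else 0 :: ennreal)"
 have W: "W : borel_measurable (predictable \<Otimes>\<^sub>M counting)"
  unfolding W_def
 proof (rule measurable_pair_count2)
  fix j :: 's
  have "(%x. k (state_before (fst x) (snd x)) j) : borel_measurable predictable"
   by (rule measurable_compose[OF predictable_state_before]) simp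
  then have "(%x. if 0 < snd x & snd x < t & in_level F x then k (state_before (fst x) (snd x)) j else 0) : borel_measurable predictable"
   by measurable
  then show "(%x. case (x, j) of (x, j) => if 0 < snd x & snd x < t & in_level F x then k (state_before (fst x) (snd x)) j else 0) : borel_measurable predictable"
   by simp
 qed
 have e0: "(NN om. (NN (t, j). W ((om, t), j) \<partial>jump_measure om) \<partial>P) = (NN om. (NN (t, j). W ((om, t), j) \<partial>jump_intensity A q \<pi> om) \<partial>P)"
  using law W by (simp add: path_law_def dual_predictable_projection_def)
 have eA: "(NN (t, j). W ((om, t), j) \<partial>jump_measure om) = (NN l. indicator (jump_set F t om) l * k (jump_state (l - 1) om) (the (jump_state l om)) \<partial>counting)"
  if om: "om : paths" for om
  unfolding jump_measure_integral[OF om W]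
 proof (rule nn_integral_cong)
  fix l
  show "(if 1 <= l & jump_time l om < \<infinity> then W ((om, real_of_ereal (jump_time l om)), the (jump_state l om)) else 0) = indicator (jump_set F t om) l * k (jump_state (l - 1) om) (the (jump_state l om))"
  proof (cases "1 <= l & jump_time l om < \<infinity>")
   case True
   then show ?thesis using at_jump[OF om, of l] by (auto simp: W_def)
  next
   case False
   then have "l \<notin> jump_set F t om" by (auto simp: jump_set_def)
   then show ?thesis using False by auto
  qed
 qed
 have eB: "(NN (t, j). W ((om, t), j) \<partial>jump_intensity A q \<pi> om) =
   (NN s. (if in_level F (om, max 0 s) then (NN j. ev (%s b. inr s b j) (om, max 0 s) * k (state_before (fst (om, max 0 s)) (snd (om, max 0 s))) j \<partial>counting) else 0) * indicator {0<..<t} s \<partial>lborel)"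
  if om: "om : paths" for om
  unfolding jump_intensity_integral[OF om W] by (intro nn_integral_cong) (auto simp: W_def indicator_def)
 show ?thesis
  unfolding EI_def
  by (subst nn_integral_cong[OF eA[symmetric]], simp add: P_space, subst e0, rule nn_integral_cong, rule eB, simp add: P_space)
qed

abbreviation level :: "nat => 's set" where "level n \<equiv> {i. w i <= real n}"

lemma ev_outr_le:
 assumes "om : paths" "0 < s" "in_level (level n) (om, s)"
 shows "ev outr (om, s) <= ennreal (L * real n)"
proof -
 interpret K: prob_space "\<pi> om s" by (rule kernel_prob) (use assms in auto)
 have "ev outr (om, s) <= (NN b. ennreal (L * real n) \<partial>\<pi> om s)"
  unfolding ev_def fst_conv snd_conv
 proof (rule nn_integral_mono)
  fix b
  show "outr (state_before om s) b <= ennreal (L * real n)"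
  proof (cases "state_before om s")
   case (Some i)
   have "i : level n" using in_level_state[OF assms(3,1,2) Some] .
   then have "ennreal (L * w i) <= ennreal (L * real n)" using L_pos by (intro ennreal_leI) auto
   then show ?thesis using Some order_trans[OF outrate_le] by (auto simp: outr_def split: option.split)
  qed (simp add: outr_def)
 qed
 also have "... = ennreal (L * real n)" by (simp add: K.emeasure_space_1)
 finally show ?thesis .
qed

text \<open>With \<open>k = 1\<close> the expected number of counted jumps is an integral of total
  rates, which \<open>in_level\<close> bounds by \<open>L * n\<close>; hence the number is almost
  surely finite.\<close>

lemma finite_jumps:
 assumes "0 < t" shows "AE om in P. finite (jump_set (level n) t om)"
proof -
 let ?N = "%om. NN l. indicator (jump_set (level n) t om) l * 1 \<partial>counting"
 have "(NN om. ?N om \<partial>P) = EI t (%x. if in_level (level n) x then (NN j. ev (%s b. inr s b j) x * 1 \<partial>counting) else 0)"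
  by (rule dpp_level[OF assms, where k = "%_ _. 1"])
 also have "... < \<infinity>"
  by (rule EI_const_bound[of _ _ "L * real n"]) (use assms in \<open>auto simp: sum_ev_inr ev_outr_le\<close>)
 finally have "AE om in P. ?N om \<noteq> \<infinity>"
  using jump_sum_measurable[where k = "%_ _. 1"] by (intro nn_integral_PInf_AE) auto
 then show ?thesis
 proof eventually_elim
  case (elim om)
  then have "emeasure (counting) (jump_set (level n) t om) \<noteq> \<infinity>" by simp
  then show ?case by (auto simp: emeasure_count_space split: if_splits)
 qed
qed

definition stayprob :: "nat => real => 's => ennreal" where
 "stayprob n t j = (NN om. (if in_level (level n) (om, max 0 t) & state_before om (max 0 t) = Some j then 1 else 0) \<partial>P)"

lemma init_prob: "(NN om. (if jump_state 0 om = Some j then 1 else 0) \<partial>P) = ennreal (pmf \<gamma> j)"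
proof -
 have "(NN om. (if jump_state 0 om = Some j then 1 else 0) \<partial>P) = (NN om. indicator {om : space P. state_at om 0 = Some j} om \<partial>P)"
  by (intro nn_integral_cong) (auto simp: P_space state_at_0 indicator_def)
 also have "... = emeasure P {om : space P. state_at om 0 = Some j}"
 proof (rule nn_integral_indicator)
  have "{om : space path_space. jump_state 0 om = Some j} : sets path_space" by measurable
  then show "{om : space P. state_at om 0 = Some j} : sets P"
   by (simp add: P_sets P_space space_path_space state_at_0 cong: conj_cong)
 qed
 also have "... = ennreal (pmf \<gamma> j)" using law by (simp add: path_law_def P.emeasure_eq_measure)
 finally show ?thesis .
qed

lemma level_pred_measurable:
 "(%om. if in_level (level n) (om, max 0 t) & state_before om (max 0 t) = Some j then 1 else 0 :: ennreal) : borel_measurable P"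
proof -
 have "(%x. if in_level (level n) x & state_before (fst x) (snd x) = Some j then 1 else 0 :: ennreal) : borel_measurable predictable"
  by measurable
 from measurable_compose[OF measurable_Pair2'[of t borel P] product_measurable[OF this]]
 show ?thesis by simp
qed

text \<open>The expectation of \<open>jump_telescope\<close>, with arrivals and departures turned
  into rate integrals by the compensator: the forward equation of the process killed on leaving the
  level.\<close>

lemma forward_level:
 assumes t: "0 < t" and j: "j : level n"
 shows "ennreal (pmf \<gamma> j) + EI t (%x. if in_level (level n) x then ev (%s b. inr s b j) x else 0) =
   EI t (%x. if in_level (level n) x & state_before (fst x) (snd x) = Some j then ev outr x else 0) + stayprob n t j"
proof -
 let ?F = "level n"
 let ?N1 = "%om. NN l. indicator (jump_set ?F t om) l * (if the (jump_state l om) = j then 1 else 0) \<partial>counting"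
 let ?N2 = "%om. NN l. indicator (jump_set ?F t om) l * (if jump_state (l - 1) om = Some j then 1 else 0) \<partial>counting"
 let ?i = "%om. if jump_state 0 om = Some j then 1 else 0 :: ennreal"
 let ?e = "%om. if in_level ?F (om, t) & state_before om t = Some j then 1 else 0 :: ennreal"
 have m1: "?N1 : borel_measurable P" by (rule jump_sum_measurable[where k = "%_ j'. if j' = j then 1 else 0"])
 have m2: "?N2 : borel_measurable P" by (rule jump_sum_measurable[where k = "%s _. if s = Some j then 1 else 0"])
 have [measurable_cong]: "sets P = sets path_space" by (rule P_sets)
 have m3: "?i : borel_measurable P" by measurable
 have m4: "?e : borel_measurable P" using level_pred_measurable[of n t j] t by simp
 have e1: "(NN om. ?N1 om \<partial>P) = EI t (%x. if in_level ?F x then ev (%s b. inr s b j) x else 0)"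
 proof -
  have "(NN om. ?N1 om \<partial>P) = EI t (%x. if in_level ?F x then (NN j'. ev (%s b. inr s b j') x * (if j' = j then 1 else 0) \<partial>counting) else 0)"
   by (rule dpp_level[OF t, where k = "%_ j'. if j' = j then 1 else 0"])
  moreover have "(NN j'. ev (%s b. inr s b j') x * (if j' = j then 1 else 0) \<partial>counting) = ev (%s b. inr s b j) x" for x
   by (subst nn_integral_count_space'[where A = "{j}"]) auto
  ultimately show ?thesis by (simp only:)
 qed
 have e2: "(NN om. ?N2 om \<partial>P) = EI t (%x. if in_level ?F x & state_before (fst x) (snd x) = Some j then ev outr x else 0)"
 proof -
  have "(NN om. ?N2 om \<partial>P) = EI t (%x. if in_level ?F x then (NN j'. ev (%s b. inr s b j') x * (if state_before (fst x) (snd x) = Some j then 1 else 0) \<partial>counting) else 0)"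
   by (rule dpp_level[OF t, where k = "%s _. if s = Some j then 1 else 0"])
  also have "... = EI t (%x. if in_level ?F x & state_before (fst x) (snd x) = Some j then ev outr x else 0)"
   by (rule EI_cong) (auto simp: sum_ev_inr)
  finally show ?thesis .
 qed
 have "(NN om. ?i om + ?N1 om \<partial>P) = (NN om. ?N2 om + ?e om \<partial>P)"
 proof (rule nn_integral_cong_AE)
  have "AE om in P. om : paths" using AE_space[of P] by (simp add: P_space)
  with finite_jumps[OF t, of n] show "AE om in P. ?i om + ?N1 om = ?N2 om + ?e om"
   by eventually_elim (rule jump_telescope[OF _ t _ j])
 qed
 then show ?thesis
  using t unfolding nn_integral_add[OF m3 m1] nn_integral_add[OF m2 m4] e1 e2 init_prob by (simp add: stayprob_def)
qed

end

section \<open>Removing the level, and the third moment\<close>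

context controlled
begin

lemma in_level_mono: "in_level F x ==> F \<subseteq> F' ==> in_level F' x"
 by (auto simp: in_level_def)

text \<open>A path that has not exploded at \<open>s\<close> has made only finitely many jumps
  before, so the largest weight met so far gives a level.\<close>

lemma in_level_exists:
 assumes om: "om : paths" "0 < s" "state_before om s = Some i"
 shows "\<exists>n\<ge>n0. in_level (level n) (om, s)"
proof -
 obtain m where m: "jump_time m om < ereal s" "\<not> jump_time (Suc m) om < ereal s"
  using state_before_Some_iff[OF om(1,2), of i] om(3) by auto
 have le: "k <= m" if "jump_time k om < ereal s" for k
 proof (rule ccontr)
  assume "\<not> k <= m"
  then have "jump_time (Suc m) om <= jump_time k om" by (intro jump_time_mono[OF om(1)]) auto
  then have "jump_time (Suc m) om < ereal s" using that by (rule le_less_trans)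
  then show False using m(2) by simp
 qed
 define c where "c = Max ((%k. w (the (jump_state k om))) ` {..m})"
 define n where "n = max n0 (nat \<lceil>c\<rceil>)"
 have "in_level (level n) (om, s)"
  unfolding in_level_def fst_conv snd_conv
 proof (intro allI impI)
  fix k assume k: "jump_time k om < ereal s"
  then have "jump_time k om < \<infinity>" by (cases "jump_time k om") auto
  then obtain i where i: "jump_state k om = Some i" using jump_state_Some[OF om(1)] by blast
  have "w i <= c" unfolding c_def using le[OF k] i by (intro Max_ge) (auto intro!: image_eqI[of _ _ k])
  also have "c <= real n" unfolding n_def by linarith
  finally show "\<exists>j\<in>level n. jump_state k om = Some j" using i by auto
 qed
 then show ?thesis by (auto simp: n_def intro!: exI[of _ n])
qed

lemma level_incseq: "incseq (%n. if in_level (level (n + n0)) x then c else (0 :: ennreal))"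
 unfolding incseq_def
proof (intro allI impI)
 fix m n :: nat assume "m <= n"
 then have "in_level (level (m + n0)) x ==> in_level (level (n + n0)) x"
  by (rule_tac in_level_mono) auto
 then show "(if in_level (level (m + n0)) x then c else 0) <= (if in_level (level (n + n0)) x then c else 0)" by auto
qed

lemma level_SUP:
 assumes "om : paths" "0 < s" "state_before om s = None ==> c = 0"
 shows "(SUP n. if in_level (level (n + n0)) (om, s) then c else (0 :: ennreal)) = c"
proof (rule antisym)
 show "(SUP n. if in_level (level (n + n0)) (om, s) then c else 0) <= c" by (rule SUP_least) auto
 show "c <= (SUP n. if in_level (level (n + n0)) (om, s) then c else 0)"
 proof (cases "state_before om s")
  case None then show ?thesis using assms(3) by simp
 next
  case (Some i)
  then obtain n where "n \<ge> n0" "in_level (level n) (om, s)" using in_level_exists[OF assms(1,2)] by blast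
  then show ?thesis by (intro SUP_upper2[of "n - n0"]) auto
 qed
qed

lemma EI_level_SUP:
 assumes [measurable]: "Q : borel_measurable predictable"
  and Q0: "!!x. state_before (fst x) (snd x) = None ==> Q x = 0"
 shows "(SUP n. EI t (%x. if in_level (level (n + n0)) x then Q x else 0)) = EI t Q"
proof -
 have "(SUP n. EI t (%x. if in_level (level (n + n0)) x then Q x else 0)) = EI t (%x. SUP n. if in_level (level (n + n0)) x then Q x else 0)"
  by (rule EI_SUP[symmetric]) (measurable, rule level_incseq)
 also have "... = EI t Q"
  by (rule EI_cong, rule level_SUP) (auto intro: Q0)
 finally show ?thesis .
qed

lemma P_section_measurable:
 fixes Q :: "'s path \<times> real => ennreal"
 assumes "Q : borel_measurable predictable"
 shows "(%om. Q (om, max 0 t)) : borel_measurable P"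
 using measurable_compose[OF measurable_Pair2'[of t borel P] product_measurable[OF assms]] by simp

definition stateprob :: "real => 's => ennreal" where
 "stateprob t j = (NN om. (if state_before om (max 0 t) = Some j then 1 else 0) \<partial>P)"

lemma P_level_SUP:
 fixes Q :: "'s path \<times> real => ennreal"
 assumes Q[measurable]: "Q : borel_measurable predictable"
  and Q0: "!!x. state_before (fst x) (snd x) = None ==> Q x = 0" and t: "0 < t"
 shows "(SUP n. NN om. (if in_level (level (n + n0)) (om, max 0 t) then Q (om, max 0 t) else 0) \<partial>P) = (NN om. Q (om, max 0 t) \<partial>P)"
proof -
 have "(%x. if in_level (level (n + n0)) x then Q x else 0) : borel_measurable predictable" for n by measurable
 from P_section_measurable[OF this]
 have "(SUP n. NN om. (if in_level (level (n + n0)) (om, max 0 t) then Q (om, max 0 t) else 0) \<partial>P)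
   = (NN om. (SUP n. if in_level (level (n + n0)) (om, max 0 t) then Q (om, max 0 t) else 0) \<partial>P)"
  by (intro nn_integral_monotone_convergence_SUP[symmetric]) (use level_incseq in \<open>auto simp: incseq_def le_fun_def\<close>)
 also have "... = (NN om. Q (om, max 0 t) \<partial>P)"
  by (intro nn_integral_cong level_SUP) (use t in \<open>auto simp: P_space intro: Q0\<close>)
 finally show ?thesis .
qed

lemma SUP_add_ennreal:
 fixes f g :: "nat => ennreal"
 assumes "incseq f" "incseq g" shows "(SUP n. f n + g n) = (SUP n. f n) + (SUP n. g n)"
 using assms by (rule ennreal_SUP_add)

text \<open>Monotone convergence as the levels exhaust the paths that have not exploded. Exploded
  paths sit in \<open>None\<close>, where all rates vanish, and contribute to neither side.\<close>

lemma forward_limit: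
 assumes t: "0 < t"
 shows "ennreal (pmf \<gamma> j) + EI t (ev (%s b. inr s b j)) =
  EI t (%x. if state_before (fst x) (snd x) = Some j then ev outr x else 0) + stateprob t j"
proof -
 \<comment> \<open>The levels start high enough to contain \<open>j\<close>, as
   \<open>forward_level\<close> demands.\<close>
 define n0 where "n0 = nat \<lceil>w j\<rceil>"
 have j: "j : level (n + n0)" for n unfolding n0_def by simp linarith
 let ?a = "%n. EI t (%x. if in_level (level (n + n0)) x then ev (%s b. inr s b j) x else 0)"
 let ?b = "%n. EI t (%x. if in_level (level (n + n0)) x then (if state_before (fst x) (snd x) = Some j then ev outr x else 0) else 0)"
 let ?c = "%n. NN om. (if in_level (level (n + n0)) (om, max 0 t) then (%x. if state_before (fst x) (snd x) = Some j then 1 else 0) (om, max 0 t) else 0) \<partial>P"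
 have eq: "ennreal (pmf \<gamma> j) + ?a n = ?b n + ?c n" for n
 proof -
  have "(%x. if in_level (level (n + n0)) x then (if state_before (fst x) (snd x) = Some j then ev outr x else 0) else 0)
   = (%x. if in_level (level (n + n0)) x & state_before (fst x) (snd x) = Some j then ev outr x else 0)" by auto
  moreover have "?c n = stayprob (n + n0) t j"
   unfolding stayprob_def by (intro nn_integral_cong) auto
  ultimately show ?thesis using forward_level[OF t j] by simp
 qed
 have ia: "incseq ?a" and ib: "incseq ?b"
  by (rule incseq_SucI, rule EI_mono, rule incseq_SucD[OF level_incseq])+
 have ic: "incseq ?c"
  by (rule incseq_SucI, rule nn_integral_mono, rule incseq_SucD[OF level_incseq])
 have "ennreal (pmf \<gamma> j) + (SUP n. ?a n) = (SUP n. ennreal (pmf \<gamma> j) + ?a n)"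
  by (subst SUP_add_ennreal[OF incseq_const ia]) simp
 also have "... = (SUP n. ?b n + ?c n)" by (simp only: eq)
 also have "... = (SUP n. ?b n) + (SUP n. ?c n)" by (rule SUP_add_ennreal[OF ib ic])
 also have "(SUP n. ?a n) = EI t (ev (%s b. inr s b j))"
  by (rule EI_level_SUP, rule ev_measurable, rule inr_measurable, simp add: ev_def inr_def)
 also have "(SUP n. ?b n) = EI t (%x. if state_before (fst x) (snd x) = Some j then ev outr x else 0)"
  by (rule EI_level_SUP) auto
 also have "(SUP n. ?c n) = (NN om. (%x. if state_before (fst x) (snd x) = Some j then 1 else 0) (om, max 0 t) \<partial>P)"
  by (rule P_level_SUP[OF _ _ t]) auto
 finally show ?thesis by (simp add: stateprob_def)
qed

definition wst :: "'s path \<times> real => ennreal" where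
 "wst x = (case state_before (fst x) (snd x) of None => 0 | Some i => ennreal (w i ^ 3))"

lemma wst_measurable [measurable]: "wst : borel_measurable predictable"
 unfolding wst_def[abs_def] by (rule measurable_compose[OF predictable_state_before]) simp

definition stay_moment :: "nat => real => ennreal" where
 "stay_moment n t = (NN om. (if in_level (level n) (om, max 0 t) then wst (om, max 0 t) else 0) \<partial>P)"

lemma level_sum_point:
 assumes "om : paths" "0 < s" "in_level (level n) (om, s)"
 shows "(\<Sum>j\<in>level n. ennreal (w j ^ 3) * (if state_before om s = Some j then c else 0)) = wst (om, s) * c"
proof (cases "state_before om s")
 case (Some i)
 have i: "i : level n" using in_level_state[OF assms(3,1,2) Some] .
 have "(\<Sum>j\<in>level n. ennreal (w j ^ 3) * (if state_before om s = Some j then c else 0)) = (\<Sum>j\<in>level n. if j = i then ennreal (w i ^ 3) * c else 0)"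
  using Some by (intro sum.cong) auto
 also have "... = ennreal (w i ^ 3) * c" using i finite_level by (subst sum.delta) auto
 finally show ?thesis using Some by (simp add: wst_def)
qed (simp add: wst_def)

lemma level_sum_in:
 assumes "om : paths" "0 < s"
 shows "(\<Sum>j\<in>level n. ennreal (w j ^ 3) * ev (%s b. inr s b j) (om, s)) <= ennreal R * wst (om, s) + wst (om, s) * ev outr (om, s)"
proof -
 interpret K: prob_space "\<pi> om s" by (rule kernel_prob) (use assms in auto)
 note ks = kernel_prob(2)[OF assms(1) less_imp_le[OF assms(2)]]
 have m: "(%b. inr o' b j) : borel_measurable (\<pi> om s)" "outr o' : borel_measurable (\<pi> om s)" for o' j
  unfolding measurable_cong_sets[OF ks refl] by (rule inr_measurable outr_measurable)+
 let ?x = "state_before om s"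
 have "(\<Sum>j\<in>level n. ennreal (w j ^ 3) * ev (%s b. inr s b j) (om, s)) = (NN b. (\<Sum>j\<in>level n. ennreal (w j ^ 3) * inr ?x b j) \<partial>\<pi> om s)"
  unfolding ev_def by (subst nn_integral_sum) (auto simp: nn_integral_cmult m intro!: borel_measurable_times_ennreal)
 also have "... <= (NN b. ennreal R * wst (om, s) + wst (om, s) * outr ?x b \<partial>\<pi> om s)"
 proof (rule nn_integral_mono)
  fix b
  have "(\<Sum>j\<in>level n. ennreal (w j ^ 3) * inr ?x b j) = (NN j. ennreal (w j ^ 3) * inr ?x b j * indicator (level n) j \<partial>counting)"
   by (subst nn_integral_count_space'[where A = "level n"]) (auto simp: finite_level)
  also have "... <= (NN j. ennreal (w j ^ 3) * inr ?x b j \<partial>counting)"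
   by (intro nn_integral_mono) (auto simp: indicator_def)
  also have "... <= ennreal R * wst (om, s) + wst (om, s) * outr ?x b"
  proof (cases ?x)
   case (Some i)
   show ?thesis
   proof (cases b)
    case (Some a)
    show ?thesis using sum_w_inrate[of 3 i a] \<open>?x = Some i\<close> Some R_pos by (simp add: inr_def outr_def wst_def ennreal_mult')
   qed (simp add: inr_def \<open>?x = Some i\<close>)
  qed (simp add: inr_def)
  finally show "(\<Sum>j\<in>level n. ennreal (w j ^ 3) * inr ?x b j) <= ennreal R * wst (om, s) + wst (om, s) * outr ?x b" .
 qed
 also have "... = ennreal R * wst (om, s) + wst (om, s) * ev outr (om, s)"
  by (subst nn_integral_add) (auto simp: nn_integral_cmult m ev_def K.emeasure_space_1 intro!: borel_measurable_times_ennreal)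
 finally show ?thesis .
qed

lemma wst_level_le:
 assumes "om : paths" "0 < s" "in_level (level n) (om, s)"
 shows "wst (om, s) <= ennreal (real n ^ 3)"
proof (cases "state_before om s")
 case (Some i)
 have "i : level n" using in_level_state[OF assms(3,1,2) Some] .
 then show ?thesis using Some w_pos[of i] by (auto simp: wst_def intro!: ennreal_leI power_mono)
qed (simp add: wst_def)

lemma init_w3_le: "finite F ==> (\<Sum>j\<in>F. ennreal (w j ^ 3) * ennreal (pmf \<gamma> j)) <= w3_const"
proof -
 assume F: "finite F"
 have "(\<Sum>j\<in>F. ennreal (w j ^ 3) * ennreal (pmf \<gamma> j)) = (NN j. ennreal (w j ^ 3 * pmf \<gamma> j) * indicator F j \<partial>counting)"
  using w_pos by (subst nn_integral_count_space'[OF F]) (auto simp: ennreal_mult' less_imp_le)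
 also have "... <= 1 * (NN j. ennreal (w j ^ 3 * pmf \<gamma> j) \<partial>counting)"
  by (simp, intro nn_integral_mono) (auto simp: indicator_def)
 also have "... <= w3_const"
  unfolding w3_const_def using R_pos T_pos by (intro mult_right_mono) auto
 finally show ?thesis .
qed

text \<open>\<open>forward_level\<close> summed against \<open>w ^ 3\<close> over the finite level.
  The drift bounds the weighted arrivals by the weighted departures plus \<open>R\<close> times the
  moment; on the level the departures are bounded, so they cancel and an integral inequality of
  Gronwall type remains.\<close>

lemma stay_moment_bound:
 assumes t: "0 < t"
 shows "stay_moment n t <= w3_const + ennreal R * (NN s. stay_moment n s * indicator {0<..<t} s \<partial>lborel)"
proof -
 let ?F = "level n"
 note fin = finite_level[of n]
 let ?In = "%j x. if in_level ?F x then ev (%s b. inr s b j) x else 0"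
 let ?Out = "%j x. if in_level ?F x & state_before (fst x) (snd x) = Some j then ev outr x else 0"
 let ?B = "%x. if in_level ?F x then wst x * ev outr x else 0"
 let ?V = "%x. if in_level ?F x then wst x else 0"
 have sm: "(\<Sum>j\<in>?F. ennreal (w j ^ 3) * stayprob n t j) = stay_moment n t"
 proof -
  have "(\<Sum>j\<in>?F. ennreal (w j ^ 3) * stayprob n t j) =
   (NN om. (\<Sum>j\<in>?F. ennreal (w j ^ 3) * (if in_level ?F (om, max 0 t) & state_before om (max 0 t) = Some j then 1 else 0)) \<partial>P)"
   unfolding stayprob_def using level_pred_measurable by (subst nn_integral_sum) (auto simp: nn_integral_cmult)
  also have "... = stay_moment n t"
   unfolding stay_moment_def
  proof (rule nn_integral_cong)
   fix om assume "om : space P"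
   then have om: "om : paths" by (simp add: P_space)
   show "(\<Sum>j\<in>?F. ennreal (w j ^ 3) * (if in_level ?F (om, max 0 t) & state_before om (max 0 t) = Some j then 1 else 0)) = (if in_level ?F (om, max 0 t) then wst (om, max 0 t) else 0)"
    using level_sum_point[OF om, of t n 1] t by auto
  qed
  finally show ?thesis .
 qed
 have so: "(\<Sum>j\<in>?F. ennreal (w j ^ 3) * EI t (?Out j)) = EI t ?B"
 proof -
  have "(\<Sum>j\<in>?F. ennreal (w j ^ 3) * EI t (?Out j)) = EI t (%x. \<Sum>j\<in>?F. ennreal (w j ^ 3) * ?Out j x)"
   by (subst EI_sum[OF fin]) (auto simp: EI_cmult)
  also have "... = EI t ?B"
   using level_sum_point by (intro EI_cong) auto
  finally show ?thesis .
 qed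
 have si: "(\<Sum>j\<in>?F. ennreal (w j ^ 3) * EI t (?In j)) <= ennreal R * EI t ?V + EI t ?B"
 proof -
  have "(\<Sum>j\<in>?F. ennreal (w j ^ 3) * EI t (?In j)) = EI t (%x. \<Sum>j\<in>?F. ennreal (w j ^ 3) * ?In j x)"
   by (subst EI_sum[OF fin]) (auto simp: EI_cmult)
  also have "... <= EI t (%x. ennreal R * ?V x + ?B x)"
   using level_sum_in by (intro EI_mono) auto
  also have "... = ennreal R * EI t ?V + EI t ?B" by (simp add: EI_add EI_cmult)
  finally show ?thesis .
 qed
 have Bfin: "EI t ?B < \<infinity>"
 proof (rule EI_const_bound[of _ _ "real n ^ 3 * (L * real n)"])
  fix om :: "'s path" and s :: real assume *: "om : paths" "0 < s"
  show "?B (om, s) <= ennreal (real n ^ 3 * (L * real n))"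
   using * L_pos by (subst ennreal_mult) (auto intro!: mult_mono wst_level_le ev_outr_le simp del: ennreal_mult'')
 qed (use t in simp)
 have "stay_moment n t + EI t ?B = (\<Sum>j\<in>?F. ennreal (w j ^ 3) * (EI t (?Out j) + stayprob n t j))"
  by (simp add: distrib_left sum.distrib sm so add.commute)
 also have "... = (\<Sum>j\<in>?F. ennreal (w j ^ 3) * (ennreal (pmf \<gamma> j) + EI t (?In j)))"
  using forward_level[OF t] by (intro sum.cong refl) simp
 also have "... <= w3_const + (ennreal R * EI t ?V + EI t ?B)"
  unfolding distrib_left sum.distrib by (intro add_mono init_w3_le fin si)
 finally have "stay_moment n t <= w3_const + ennreal R * EI t ?V"
  using nn_integral_diff_bound[of "stay_moment n t" "EI t ?B" "w3_const + ennreal R * EI t ?V" "EI t ?B"] Bfin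
  by (simp add: add.assoc)
 also have "EI t ?V = (NN s. stay_moment n s * indicator {0<..<t} s \<partial>lborel)"
 proof -
  have V: "?V : borel_measurable predictable" by measurable
  have "EI t ?V = (NN s. NN om. ?V (om, max 0 s) * indicator {0<..<t} s \<partial>P \<partial>lborel)"
   unfolding EI_def by (rule nn_integral_swap[OF P.sigma_finite_measure_axioms sigma_finite_lborel product_measurable'[OF V]])
  then show ?thesis by (simp add: nn_integral_multc P_section_measurable[OF V] stay_moment_def)
 qed
 finally show ?thesis .
qed

lemma moment_bound:
 obtains C where "0 <= C" "!!t. 0 < t ==> t <= T ==> (NN om. wst (om, max 0 t) \<partial>P) <= ennreal C"
proof -
 obtain c where c: "w3_const = ennreal c" "0 <= c" using w3_const_finite by (cases w3_const) auto
 show ?thesis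
 proof (rule that)
  show "0 <= 2 * c * exp (2 * R * T)" using c by simp
  fix t assume t: "0 < t" "t <= T"
  have b: "stay_moment n t <= ennreal (2 * c * exp (2 * R * T))" for n
  proof -
   have "stay_moment n t <= ennreal (2 * c * exp (2 * R * t))"
   \<comment> \<open>The crude bound \<open>n ^ 3\<close> only supplies the finiteness that the
     Gronwall estimate starts from; its conclusion does not involve \<open>n\<close>, which allows
     the limit over levels.\<close>
   proof (rule gronwall_ennreal[where T = T and B = "real n ^ 3"])
    fix t :: real assume t: "0 < t"
    have "stay_moment n t <= (NN om. ennreal (real n ^ 3) \<partial>P)"
     unfolding stay_moment_def using t wst_level_le by (intro nn_integral_mono) (auto simp: P_space)
    then show "stay_moment n t <= ennreal (real n ^ 3)" by (simp add: P.emeasure_space_1)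
   qed (use R_pos c t stay_moment_bound[of _ n] in auto)
   also have "... <= ennreal (2 * c * exp (2 * R * T))" using t c R_pos by (intro ennreal_leI mult_left_mono) auto
   finally show ?thesis .
  qed
  have "(NN om. wst (om, max 0 t) \<partial>P) = (SUP n. stay_moment (n + 0) t)"
   unfolding stay_moment_def by (rule P_level_SUP[symmetric]) (auto simp: wst_def t)
  also have "... <= ennreal (2 * c * exp (2 * R * T))" by (rule SUP_least) (rule b)
  finally show "(NN om. wst (om, max 0 t) \<partial>P) <= ennreal (2 * c * exp (2 * R * T))" .
 qed
qed

end

section \<open>The occupation measure of a policy\<close>

context controlled
begin

definition dflt :: "'s => 'a" where "dflt i = (SOME a. a : A i)"

lemma dflt: "dflt i : A i" unfolding dflt_def using A_nonempty[of i] by (auto intro: someI)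

text \<open>Actions outside \<open>A i\<close>, of probability zero in state \<open>i\<close>, are
  redirected to a fixed admissible one, so that the kernel built from it always lands in
  \<open>X_space\<close>.\<close>

definition sel :: "'s => 'a option => 'a" where
 "sel i b = (case b of None => dflt i | Some a => if a : A i then a else dflt i)"

lemma sel_in: "sel i b : A i" by (auto simp: sel_def dflt split: option.split)

lemma sel_measurable [measurable]: "sel i : ext_action_space \<rightarrow>\<^sub>M borel"
 by (rule measurable_ext_action_space) (auto simp: sel_def)

text \<open>The clamped time and the arbitrary value of \<open>the None\<close> make this a measure
  on \<open>Xs\<close> at every point; \<open>base\<close> gives no mass to times after
  \<open>T\<close> or to the exploded state.\<close>

definition kern :: "'s path \<times> real => (real \<times> 's \<times> 'a) measure" where
 "kern x = distr (\<pi> (fst x) (snd x)) Xs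
   (%b. (max 0 (min T (snd x)), the (state_before (fst x) (snd x)), sel (the (state_before (fst x) (snd x))) b))"

lemma kern_map_measurable:
 "(%(x, b). (max 0 (min T (snd x)), the (state_before (fst x) (snd x)), sel (the (state_before (fst x) (snd x))) b))
   : predictable \<Otimes>\<^sub>M ext_action_space \<rightarrow>\<^sub>M Xs"
 unfolding X_space_def
proof (rule measurable_restrict_space2)
 show "(%(x, b). (max 0 (min T (snd x)), the (state_before (fst x) (snd x)), sel (the (state_before (fst x) (snd x))) b))
   : space (predictable \<Otimes>\<^sub>M ext_action_space) \<rightarrow> {(t, i, a). t : {0..T} & a : A i}"
  using T_pos sel_in by auto
 have s: "(%y :: ('s path \<times> real) \<times> 'a option. state_before (fst (fst y)) (snd (fst y))) : predictable \<Otimes>\<^sub>M ext_action_space \<rightarrow>\<^sub>M counting"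
  by (rule measurable_compose[OF measurable_fst predictable_state_before])
 have "(%y. (%s y. sel (the s) (snd y)) (state_before (fst (fst y)) (snd (fst y))) y) : predictable \<Otimes>\<^sub>M ext_action_space \<rightarrow>\<^sub>M borel"
  by (rule measurable_compose_countable[OF _ s]) (rule measurable_compose[OF measurable_snd sel_measurable])
 moreover have "(%y :: ('s path \<times> real) \<times> 'a option. the (state_before (fst (fst y)) (snd (fst y)))) : predictable \<Otimes>\<^sub>M ext_action_space \<rightarrow>\<^sub>M counting"
  by (rule measurable_compose[OF s]) simp
 moreover have "(%y :: ('s path \<times> real) \<times> 'a option. max 0 (min T (snd (fst y)))) : predictable \<Otimes>\<^sub>M ext_action_space \<rightarrow>\<^sub>M borel"
  by measurable
 ultimately show "(%(x, b). (max 0 (min T (snd x)), the (state_before (fst x) (snd x)), sel (the (state_before (fst x) (snd x))) b))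
   : predictable \<Otimes>\<^sub>M ext_action_space \<rightarrow>\<^sub>M Zs"
  by (simp add: case_prod_beta')
qed

lemma kern_measurable: "kern : predictable \<rightarrow>\<^sub>M subprob_algebra Xs"
 unfolding kern_def[abs_def] using kern_map_measurable kernel by (rule measurable_distr2)

lemma kern_section_measurable:
 assumes "x : space predictable"
 shows "(%b. (max 0 (min T (snd x)), the (state_before (fst x) (snd x)), sel (the (state_before (fst x) (snd x))) b)) : \<pi> (fst x) (snd x) \<rightarrow>\<^sub>M Xs"
proof -
 have "sets (\<pi> (fst x) (snd x)) = sets ext_action_space"
  using kernel_prob(2)[of "fst x" "snd x"] assms by (auto simp: space_predictable)
 then show ?thesis
  using measurable_compose[OF measurable_Pair1'[OF assms] kern_map_measurable]
  by (simp cong: measurable_cong_sets)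
qed

text \<open>\<open>P\<close> times the uniform law on \<open>[0, T]\<close>, pushed to the
  predictable sigma-algebra and stripped of exploded states. Binding it with \<open>kern\<close>
  adds the state and the action.\<close>

definition base :: "('s path \<times> real) measure" where
 "base = density (distr (density (P \<Otimes>\<^sub>M lborel) (%x. ennreal (1 / T) * indicator {0..T} (snd x))) predictable (%x. (fst x, max 0 (snd x))))
   (%x. if state_before (fst x) (snd x) = None then 0 else 1)"

lemma sets_base [measurable_cong]: "sets base = sets predictable" by (simp add: base_def)

lemma space_base: "space base = paths \<times> {0..}" using sets_eq_imp_space_eq[OF sets_base] by (simp add: space_predictable)

definition EJ :: "('s path \<times> real => ennreal) => ennreal" where
 "EJ Q = (NN om. (NN s. Q (om, max 0 s) * indicator {0..T} s \<partial>lborel) \<partial>P)"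

lemma product_measurable_closed:
 fixes Q :: "'s path \<times> real => ennreal"
 assumes "Q : borel_measurable predictable"
 shows "(%x. Q (fst x, max 0 (snd x)) * indicator {0..T} (snd x)) : borel_measurable (P \<Otimes>\<^sub>M lborel)"
proof -
 have "(%x. Q (fst x, max 0 (snd x)) * indicator {0..T} (snd x)) : borel_measurable (P \<Otimes>\<^sub>M borel)"
  by (intro borel_measurable_times_ennreal product_measurable[OF assms] measurable_compose[OF measurable_snd borel_measurable_indicator]) simp
 then show ?thesis by simp
qed

lemma base_integral:
 assumes Q[measurable]: "Q : borel_measurable predictable"
 shows "(NN x. Q x \<partial>base) = ennreal (1 / T) * EJ (%x. if state_before (fst x) (snd x) = None then 0 else Q x)"
proof -
 let ?Q = "%x. if state_before (fst x) (snd x) = None then 0 else Q x"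
 have Q': "?Q : borel_measurable predictable" by measurable
 have mi: "(%x. ennreal (1 / T) * indicator {0..T} (snd x)) : borel_measurable (P \<Otimes>\<^sub>M lborel)"
  using borel_measurable_times_ennreal[OF borel_measurable_const[of "ennreal (1 / T)"] measurable_compose[OF measurable_snd borel_measurable_indicator[of "{0..T}" lborel]]] by simp
 have mt: "(%x. (fst x, max 0 (snd x))) : density (P \<Otimes>\<^sub>M lborel) (%x. ennreal (1 / T) * indicator {0..T} (snd x)) \<rightarrow>\<^sub>M predictable"
  using to_predictable[OF P_sets] by simp
 have "(NN x. Q x \<partial>base) = (NN x. (if state_before (fst x) (snd x) = None then 0 else 1) * Q x
  \<partial>distr (density (P \<Otimes>\<^sub>M lborel) (%x. ennreal (1 / T) * indicator {0..T} (snd x))) predictable (%x. (fst x, max 0 (snd x))))"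
  unfolding base_def by (rule nn_integral_density; simp only: measurable_distr_eq1; measurable)
 also have "... = (NN x. ?Q x
  \<partial>distr (density (P \<Otimes>\<^sub>M lborel) (%x. ennreal (1 / T) * indicator {0..T} (snd x))) predictable (%x. (fst x, max 0 (snd x))))"
  by (intro nn_integral_cong) auto
 also have "... = (NN x. ?Q (fst x, max 0 (snd x)) \<partial>density (P \<Otimes>\<^sub>M lborel) (%x. ennreal (1 / T) * indicator {0..T} (snd x)))"
  by (rule nn_integral_distr[OF mt]) (use Q' in simp)
 also have "... = (NN x. ennreal (1 / T) * indicator {0..T} (snd x) * ?Q (fst x, max 0 (snd x)) \<partial>(P \<Otimes>\<^sub>M lborel))"
  by (rule nn_integral_density[OF mi]) (use product_measurable[OF Q'] in simp)
 also have "... = (NN x. ennreal (1 / T) * (?Q (fst x, max 0 (snd x)) * indicator {0..T} (snd x)) \<partial>(P \<Otimes>\<^sub>M lborel))"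
  by (intro nn_integral_cong) (simp only: mult_ac)
 also have "... = ennreal (1 / T) * (NN x. ?Q (fst x, max 0 (snd x)) * indicator {0..T} (snd x) \<partial>(P \<Otimes>\<^sub>M lborel))"
  by (rule nn_integral_cmult[OF product_measurable_closed[OF Q']])
 also have "(NN x. ?Q (fst x, max 0 (snd x)) * indicator {0..T} (snd x) \<partial>(P \<Otimes>\<^sub>M lborel)) = EJ ?Q"
  unfolding EJ_def by (subst lborel.nn_integral_fst[OF product_measurable_closed[OF Q'], symmetric]) (simp only: fst_conv snd_conv)
 finally show ?thesis .
qed

definition occm :: "(real \<times> 's \<times> 'a) measure" where "occm = base \<bind> kern"

lemma sets_occm: "sets occm = sets Xs"
 unfolding occm_def
proof (rule sets_bind)
 fix x assume "x : space base" then show "sets (kern x) = sets Xs" by (simp add: kern_def)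
next
 show "space base \<noteq> {}" using P.not_empty by (auto simp: space_base P_space)
qed

definition lift :: "(real \<times> 's \<times> 'a => ennreal) => 's path \<times> real => 'a option => ennreal" where
 "lift f x b = (case state_before (fst x) (snd x) of None => 0
   | Some i => (case b of None => 0 | Some a => if a : A i then f (snd x, i, a) else 0))"

lemma kernel_AE:
 assumes "om : paths" "0 <= t" "state_before om t = Some i"
 shows "AE b in \<pi> om t. \<exists>a\<in>A i. b = Some a"
proof -
 interpret K: prob_space "\<pi> om t" by (rule kernel_prob[OF assms(1,2)])
 have "Some ` A i : sets (\<pi> om t)"
  unfolding kernel_prob(2)[OF assms(1,2)] sets_ext_action_space by (simp add: inj_vimage_image_eq)
 moreover have "emeasure (\<pi> om t) (Some ` A i) = 1" using kernel_prob(3)[OF assms(1,2)] assms(3) by simp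
 ultimately have "AE b in \<pi> om t. b : Some ` A i"
  by (subst K.AE_in_set_eq_1) (auto simp: K.emeasure_eq_measure)
 then show ?thesis by (rule AE_mp) (auto intro!: AE_I2)
qed

lemma occm_integral:
 assumes f: "f : borel_measurable Xs"
 shows "(NN x. f x \<partial>occm) = ennreal (1 / T) * EJ (%x. NN b. lift f x b \<partial>\<pi> (fst x) (snd x))"
proof -
 have km: "kern : base \<rightarrow>\<^sub>M subprob_algebra Xs" using kern_measurable by (simp cong: measurable_cong_sets add: sets_base)
 have gm: "(%x. NN y. f y \<partial>kern x) : borel_measurable predictable"
  by (rule measurable_compose[OF kern_measurable nn_integral_measurable_subprob_algebra[OF f]])
 have "(NN x. f x \<partial>occm) = (NN x. NN y. f y \<partial>kern x \<partial>base)"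
  unfolding occm_def by (rule nn_integral_bind[OF f km])
 also have "... = ennreal (1 / T) * EJ (%x. if state_before (fst x) (snd x) = None then 0 else NN y. f y \<partial>kern x)"
  by (rule base_integral[OF gm])
 also have "EJ (%x. if state_before (fst x) (snd x) = None then 0 else NN y. f y \<partial>kern x) = EJ (%x. NN b. lift f x b \<partial>\<pi> (fst x) (snd x))"
  unfolding EJ_def
 proof (intro nn_integral_cong)
  fix om :: "'s path" and s :: real assume "om : space P"
  then have om: "om : paths" by (simp add: P_space)
  show "(if state_before (fst (om, max 0 s)) (snd (om, max 0 s)) = None then 0 else NN y. f y \<partial>kern (om, max 0 s)) * indicator {0..T} s =
    (NN b. lift f (om, max 0 s) b \<partial>\<pi> (fst (om, max 0 s)) (snd (om, max 0 s))) * indicator {0..T} s"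
  proof (cases "s : {0..T}")
   case True
   then have s: "0 <= s" "max 0 s = s" "max 0 (min T s) = s" by auto
   show ?thesis
   proof (cases "state_before om s")
    case (Some i)
    have "(NN y. f y \<partial>kern (om, s)) = (NN b. f (s, i, sel i b) \<partial>\<pi> om s)"
     unfolding kern_def using kern_section_measurable[of "(om, s)"] om s f
     by (subst nn_integral_distr) (auto simp: space_predictable Some)
    also have "... = (NN b. lift f (om, s) b \<partial>\<pi> om s)"
     by (rule nn_integral_cong_AE, rule AE_mp[OF kernel_AE[OF om s(1) Some]]) (auto simp: lift_def Some sel_def intro!: AE_I2)
    finally show ?thesis using s Some by simp
   qed (simp add: s lift_def)
  qed simp
 qed
 finally show ?thesis .
qed

lemma EJ_mono_AE:
 assumes "!!om s. om : paths ==> 0 < s ==> s <= T ==> Q (om, s) <= Q' (om, s)"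
 shows "EJ Q <= EJ Q'"
 unfolding EJ_def
proof (rule nn_integral_mono, rule nn_integral_mono_AE)
 fix om assume om: "om : space P"
 have "AE s in lborel. s \<noteq> (0 :: real)" by (rule AE_lborel_singleton)
 then show "AE s in lborel. Q (om, max 0 s) * indicator {0..T} s <= Q' (om, max 0 s) * indicator {0..T} s"
  by eventually_elim (use om assms in \<open>auto simp: P_space indicator_def\<close>)
qed

lemma EJ_cong_AE:
 assumes "!!om s. om : paths ==> 0 < s ==> s <= T ==> Q (om, s) = Q' (om, s)"
 shows "EJ Q = EJ Q'"
 using assms by (intro antisym EJ_mono_AE) auto

lemma EJ_swap:
 assumes Q: "Q : borel_measurable predictable"
 shows "EJ Q = (NN s. (NN om. Q (om, max 0 s) \<partial>P) * indicator {0..T} s \<partial>lborel)"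
proof -
 have "(%(om, s). Q (om, max 0 s) * indicator {0..T} s) : borel_measurable (P \<Otimes>\<^sub>M lborel)"
  using product_measurable_closed[OF Q] by (simp add: case_prod_beta')
 from nn_integral_swap[OF P.sigma_finite_measure_axioms sigma_finite_lborel this]
 show ?thesis unfolding EJ_def by (simp add: nn_integral_multc P_section_measurable[OF Q])
qed

lemma EJ_EI:
 assumes "0 < t" "t <= T"
 shows "EJ (%x. indicator {..t} (snd x) * Q x) = EI t Q"
 unfolding EJ_def EI_def
proof (rule nn_integral_cong, rule nn_integral_cong_AE)
 fix om
 have "AE s in lborel. s \<noteq> (0 :: real)" "AE s in lborel. s \<noteq> t" by (rule AE_lborel_singleton)+
 then show "AE s in lborel. indicator {..t} (snd (om, max 0 s)) * Q (om, max 0 s) * indicator {0..T} s = Q (om, max 0 s) * indicator {0<..<t} s"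
  by eventually_elim (use assms in \<open>auto simp: indicator_def\<close>)
qed

lemma lift_const:
 assumes "om : paths" "0 <= s" "state_before om s = Some i" "!!a. a : A i ==> f (s, i, a) = c"
 shows "(NN b. lift f (om, s) b \<partial>\<pi> om s) = c"
proof -
 interpret K: prob_space "\<pi> om s" by (rule kernel_prob[OF assms(1,2)])
 have "(NN b. lift f (om, s) b \<partial>\<pi> om s) = (NN b. c \<partial>\<pi> om s)"
  by (rule nn_integral_cong_AE, rule AE_mp[OF kernel_AE[OF assms(1-3)]]) (auto simp: lift_def assms intro!: AE_I2)
 then show ?thesis by (simp add: K.emeasure_space_1)
qed

lemma EJ_wst: "EJ wst < \<infinity>"
proof -
 obtain C where C: "0 <= C" "!!t. 0 < t ==> t <= T ==> (NN om. wst (om, max 0 t) \<partial>P) <= ennreal C"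
  using moment_bound by metis
 have "EJ wst = (NN s. (NN om. wst (om, max 0 s) \<partial>P) * indicator {0..T} s \<partial>lborel)" by (rule EJ_swap[OF wst_measurable])
 also have "... <= (NN s. ennreal C * indicator {0..T} s \<partial>lborel)"
 proof (rule nn_integral_mono_AE)
  have "AE s in lborel. s \<noteq> (0 :: real)" by (rule AE_lborel_singleton)
  then show "AE s in lborel. (NN om. wst (om, max 0 s) \<partial>P) * indicator {0..T} s <= ennreal C * indicator {0..T} s"
   by eventually_elim (use C(2) in \<open>auto simp: indicator_def\<close>)
 qed
 also have "... = ennreal C * ennreal T" using T_pos by (simp add: nn_integral_cmult_indicator)
 also have "... < \<infinity>" by (simp add: ennreal_mult_less_top)
 finally show ?thesis .
qed

text \<open>The density in \<open>occ_forwardI\<close> is the state distribution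
  \<open>stateprob\<close>. Its forward equation is \<open>forward_limit\<close>, rewritten through
  the integral formula of \<open>occm\<close>, and the third moment is finite by
  \<open>EJ_wst\<close>.\<close>

lemma occm_occ: "occ occm"
proof (rule occ_forwardI[OF sets_occm])
 have w3m: "(%(t, i, a). ennreal (w i ^ 3)) : borel_measurable Xs" by (rule measurable_w_occ) simp
 have "(NN (t, i, a). ennreal (w i ^ 3) \<partial>occm) = ennreal (1 / T) * EJ (%x. NN b. lift (%(t, i, a). ennreal (w i ^ 3)) x b \<partial>\<pi> (fst x) (snd x))"
  by (rule occm_integral[OF w3m])
 also have "EJ (%x. NN b. lift (%(t, i, a). ennreal (w i ^ 3)) x b \<partial>\<pi> (fst x) (snd x)) = EJ wst"
 proof (rule EJ_cong_AE)
  fix om :: "'s path" and s :: real assume *: "om : paths" "0 < s"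
  show "(NN b. lift (%(t, i, a). ennreal (w i ^ 3)) (om, s) b \<partial>\<pi> (fst (om, s)) (snd (om, s))) = wst (om, s)"
  proof (cases "state_before om s")
   case (Some i) then show ?thesis using * lift_const[of om s i "%(t, i, a). ennreal (w i ^ 3)"] by (auto simp: wst_def)
  qed (simp add: lift_def wst_def)
 qed
 finally have "(NN (t, i, a). ennreal (w i ^ 3) \<partial>occm) = ennreal (1 / T) * EJ wst" .
 then show "(NN (t, i, a). ennreal (w i ^ 3) \<partial>occm) < \<infinity>"
  using EJ_wst by (simp add: ennreal_mult_less_top)
next
 have ind: "(%x :: 's path \<times> real. if state_before (fst x) (snd x) = Some j then 1 else 0 :: ennreal) : borel_measurable predictable" for j by measurable
 have pm: "(%(om, t, j). if state_before om (max 0 t) = Some j then 1 else 0 :: ennreal) : borel_measurable (P \<Otimes>\<^sub>M borel \<Otimes>\<^sub>M counting)"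
  by (rule measurable_over_countable) (use product_measurable[OF ind] in \<open>simp add: case_prod_beta'\<close>)
 show "(%(t, j). stateprob t j) : borel_measurable borel_counting"
  unfolding stateprob_def by (rule measurable_swap3_inner[OF P.sigma_finite_measure_axioms pm])
 fix f :: "real \<times> 's => ennreal" assume f[measurable]: "f : borel_measurable borel_counting"
 have fm: "(%(t, i, a). f (t, i)) : borel_measurable Xs" by (rule measurable_ti_occ[OF refl f])
 have "EJ (%x. NN b. lift (%(t, i, a). f (t, i)) x b \<partial>\<pi> (fst x) (snd x)) =
   (NN om. (NN s. NN j. f (s, j) * indicator {0..T} s * (if state_before om (max 0 s) = Some j then 1 else 0) \<partial>counting \<partial>lborel) \<partial>P)"
  unfolding EJ_def
 proof (intro nn_integral_cong)
  fix om :: "'s path" and s :: real assume "om : space P"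
  then have om: "om : paths" by (simp add: P_space)
  show "(NN b. lift (%(t, i, a). f (t, i)) (om, max 0 s) b \<partial>\<pi> (fst (om, max 0 s)) (snd (om, max 0 s))) * indicator {0..T} s =
    (NN j. f (s, j) * indicator {0..T} s * (if state_before om (max 0 s) = Some j then 1 else 0) \<partial>counting)"
  proof (cases "s : {0..T}")
   case True
   then have s: "0 <= s" "max 0 s = s" by auto
   show ?thesis
   proof (cases "state_before om s")
    case (Some i)
    have "(NN b. lift (%(t, i, a). f (t, i)) (om, s) b \<partial>\<pi> om s) = f (s, i)"
     by (rule lift_const[OF om s(1) Some]) simp
    moreover have "(NN j. f (s, j) * indicator {0..T} s * (if state_before om s = Some j then 1 else 0) \<partial>counting) = f (s, i)"
     using Some True by (subst nn_integral_count_space'[where A = "{i}"]) auto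
    ultimately show ?thesis using True s by simp
   qed (simp add: s lift_def)
  qed simp
 qed
 also have "... = (NN s. NN j. NN om. f (s, j) * indicator {0..T} s * (if state_before om (max 0 s) = Some j then 1 else 0) \<partial>P \<partial>counting \<partial>lborel)"
 proof (rule nn_integral_swap3[OF P.sigma_finite_measure_axioms], rule measurable_over_countable)
  fix j
  have "(%y. f (snd y, j) * indicator {0..T} (snd y) * (if state_before (fst y) (max 0 (snd y)) = Some j then 1 else 0)) : borel_measurable (P \<Otimes>\<^sub>M borel)"
   using product_measurable[OF ind[of j]]
   by (intro borel_measurable_times_ennreal measurable_compose[OF measurable_snd borel_measurable_indicator]) auto
  then show "(%(om, s). f (s, j) * indicator {0..T} s * (if state_before om (max 0 s) = Some j then 1 else 0)) : borel_measurable (P \<Otimes>\<^sub>M borel)"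
   by (simp add: case_prod_beta')
 qed
 also have "... = (NN t. NN j. f (t, j) * stateprob t j * indicator {0..T} t \<partial>counting \<partial>lborel)"
 proof (intro nn_integral_cong)
  fix t j
  have "(%om. if state_before om (max 0 t) = Some j then 1 else 0 :: ennreal) : borel_measurable P"
   using P_section_measurable[OF ind[of j], of t] by simp
  then show "(NN om. f (t, j) * indicator {0..T} t * (if state_before om (max 0 t) = Some j then 1 else 0) \<partial>P) = f (t, j) * stateprob t j * indicator {0..T} t"
   by (simp add: nn_integral_cmult stateprob_def mult_ac)
 qed
 finally show "(NN (t, i, a). f (t, i) \<partial>occm) = ennreal (1 / T) * (NN t. NN j. f (t, j) * stateprob t j * indicator {0..T} t \<partial>counting \<partial>lborel)"
  unfolding occm_integral[OF fm] by simp
next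
 fix t j assume t: "0 < t" "t <= T"
 have T1: "ennreal T * (ennreal (1 / T) * c) = c" for c
  using T_pos by (simp add: mult.assoc[symmetric] ennreal_mult[symmetric])
 have mr: "(%(s, i, a). indicator {..t} s * r i a) : borel_measurable Xs" if "!!i. r i : borel_measurable borel" for r :: "'s => 'a => ennreal"
  by (rule measurable_Xs_I, rule measurable_by_state) (use that in measurable)
 have lf: "(NN b. lift (%(s, i, a). indicator {..t} s * r i a) x b \<partial>\<pi> (fst x) (snd x)) = indicator {..t} (snd x) * (NN b. lift (%(s, i, a). r i a) x b \<partial>\<pi> (fst x) (snd x))" for r x
 proof -
  have "lift (%(s, i, a). indicator {..t} s * r i a) x = (%b. indicator {..t} (snd x) * lift (%(s, i, a). r i a) x b)"
   by (auto simp: lift_def fun_eq_iff split: option.split)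
  then show ?thesis by (cases "snd x <= t") simp_all
 qed
 have "ennreal T * occ_in occm t j = EJ (%x. indicator {..t} (snd x) * (NN b. lift (%(s, i, a). inrate i a j) x b \<partial>\<pi> (fst x) (snd x)))"
  unfolding occ_in_def by (subst occm_integral[OF mr]) (simp_all add: T1 lf)
 also have "... = EI t (%x. NN b. lift (%(s, i, a). inrate i a j) x b \<partial>\<pi> (fst x) (snd x))"
  by (rule EJ_EI[OF t])
 also have "... = EI t (ev (%s b. inr s b j))"
  unfolding ev_def by (intro EI_cong nn_integral_cong) (auto simp: lift_def inr_def inrate_def split: option.split)
 finally have i: "ennreal T * occ_in occm t j = EI t (ev (%s b. inr s b j))" .
 have "ennreal T * occ_out occm t j = EJ (%x. indicator {..t} (snd x) * (NN b. lift (%(s, i, a). if i = j then outrate i a else 0) x b \<partial>\<pi> (fst x) (snd x)))"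
  unfolding occ_out_def by (subst occm_integral[OF mr]) (simp_all add: T1 lf)
 also have "... = EI t (%x. NN b. lift (%(s, i, a). if i = j then outrate i a else 0) x b \<partial>\<pi> (fst x) (snd x))"
  by (rule EJ_EI[OF t])
 also have "... = EI t (%x. if state_before (fst x) (snd x) = Some j then ev outr x else 0)"
 proof (rule EI_cong)
  fix om :: "'s path" and s :: real
  have "lift (%(s, i, a). if i = j then outrate i a else 0) (om, s) b = (if state_before om s = Some j then outr (state_before om s) b else 0)" for b
   by (auto simp: lift_def outr_def outrate_def split: option.split)
  then show "(NN b. lift (%(s, i, a). if i = j then outrate i a else 0) (om, s) b \<partial>\<pi> (fst (om, s)) (snd (om, s))) = (if state_before (fst (om, s)) (snd (om, s)) = Some j then ev outr (om, s) else 0)"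
   by (simp add: ev_def)
 qed
 finally have o: "ennreal T * occ_out occm t j = EI t (%x. if state_before (fst x) (snd x) = Some j then ev outr x else 0)" .
 show "stateprob t j + ennreal T * occ_out occm t j = ennreal (pmf \<gamma> j) + ennreal T * occ_in occm t j"
  unfolding i o using forward_limit[OF t(1), of j] by (simp add: add.commute)
qed

text \<open>The positive and negative parts of the cost are treated as nonnegative integrals. Both
  are finite because the cost is of order \<open>w\<close> and the third moment of the state is
  integrable over \<open>[0, T]\<close>, so Fubini applies to their difference.\<close>

lemma expected_cost_occm:
 assumes f_cont: "!!i. continuous_on (A i) (f i)" and f_bound: "!!i a. a : A i ==> \<bar>f i a\<bar> <= M * w i" and M: "0 <= M"
 shows "expected_cost T A f \<pi> P = T * (\<integral>(t, i, a). f i a \<partial>occm)"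
proof -
 have onK_m: "(%b. on_K A f s b) : borel_measurable ext_action_space" for s
 proof (cases s)
  case (Some i)
  have "(%a. on_K A f s (Some a)) = (%a. indicator (A i) a *\<^sub>R f i a)" using Some by (auto simp: fun_eq_iff)
  then show ?thesis using borel_measurable_continuous_on_indicator[OF A_sets f_cont[of i]]
   by (intro measurable_ext_action_space) auto
 qed (auto intro: measurable_ext_action_space)
 have onK_b: "\<bar>on_K A f s b\<bar> <= (case s of None => 0 | Some i => M * w i)" for s b
  using f_bound M w_pos by (cases s; cases b) (auto simp: less_imp_le)
 define Ip where "Ip = ev (%s b. ennreal (on_K A f s b))"
 define Im where "Im = ev (%s b. ennreal (- on_K A f s b))"
 have Ip_m: "Ip : borel_measurable predictable" and Im_m: "Im : borel_measurable predictable"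
  unfolding Ip_def Im_def using onK_m by (auto intro!: ev_measurable)
 have le: "ev (%s b. ennreal (sig * on_K A f s b)) (om, s) <= ennreal M * wst (om, s)"
  if "om : paths" "0 <= s" "\<bar>sig\<bar> = 1" for om s sig
 proof -
  interpret K: prob_space "\<pi> om s" by (rule kernel_prob[OF that(1,2)])
  have "ev (%s b. ennreal (sig * on_K A f s b)) (om, s) <= (NN b. ennreal M * wst (om, s) \<partial>\<pi> om s)"
   unfolding ev_def fst_conv snd_conv
  proof (rule nn_integral_mono)
   fix b
   have "sig * on_K A f (state_before om s) b <= (case state_before om s of None => 0 | Some i => M * w i)"
    by (rule order_trans[OF abs_ge_self]) (simp add: abs_mult that(3) onK_b)
   also have "... <= (case state_before om s of None => 0 | Some i => M * w i ^ 3)"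
    using M w_pow_le[of 1 3] by (auto split: option.split intro: mult_left_mono)
   finally show "ennreal (sig * on_K A f (state_before om s) b) <= ennreal M * wst (om, s)"
    using M by (auto simp: wst_def ennreal_mult'[symmetric] intro: ennreal_leI split: option.splits)
  qed
  then show ?thesis by (simp add: K.emeasure_space_1)
 qed
 have Ip_le: "Ip (om, s) <= ennreal M * wst (om, s)" and Im_le: "Im (om, s) <= ennreal M * wst (om, s)"
  if "om : paths" "0 <= s" for om s
  using le[OF that, of 1] le[OF that, of "-1"] by (simp_all add: Ip_def Im_def)
 have EJb: "EJ Q < \<infinity>" if "!!om s. om : paths ==> 0 <= s ==> Q (om, s) <= ennreal M * wst (om, s)" for Q
 proof -
  have "EJ Q <= EJ (%x. ennreal M * wst x)" by (rule EJ_mono_AE) (use that in auto)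
  also have "... = ennreal M * EJ wst"
   using EJ_swap[OF wst_measurable] EJ_swap[of "%x. ennreal M * wst x"] P_section_measurable[OF wst_measurable]
    P.borel_measurable_nn_integral[OF measurable_pair_swap[OF product_measurable[OF wst_measurable]]]
   by (simp add: nn_integral_cmult mult.assoc case_prod_beta')
  also have "... < \<infinity>" using EJ_wst by (simp add: ennreal_mult_less_top)
  finally show ?thesis .
 qed
 have inner: "(\<integral>b. on_K A f (state_before om s) b \<partial>\<pi> om s) = enn2real (Ip (om, s)) - enn2real (Im (om, s))"
  if "om : paths" "0 <= s" for om s
 proof -
  interpret K: prob_space "\<pi> om s" by (rule kernel_prob[OF that(1,2)])
  have "(%b. on_K A f (state_before om s) b) : borel_measurable (\<pi> om s)"
   unfolding measurable_cong_sets[OF kernel_prob(2)[OF that] refl] by (rule onK_m)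
  then have "integrable (\<pi> om s) (%b. on_K A f (state_before om s) b)"
   using onK_b by (intro K.integrable_const_bound[where B = "case state_before om s of None => 0 | Some i => M * w i"]) auto
  from real_lebesgue_integral_def[OF this] show ?thesis by (simp add: Ip_def Im_def ev_def)
 qed
 let ?g = "%Q x. Q (fst x, max 0 (snd x)) * indicator {0..T} (snd x) :: ennreal"
 have gEJ: "(NN x. ?g Q x \<partial>(P \<Otimes>\<^sub>M lborel)) = EJ Q" if "Q : borel_measurable predictable" for Q
  unfolding EJ_def by (subst lborel.nn_integral_fst[OF product_measurable_closed[OF that], symmetric]) (simp only: fst_conv snd_conv)
 have EJfin: "EJ Ip < \<infinity>" "EJ Im < \<infinity>"
  by (rule EJb, rule Ip_le, assumption+) (rule EJb, rule Im_le, assumption+)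
 have fp: "(NN x. ?g Ip x \<partial>(P \<Otimes>\<^sub>M lborel)) < \<infinity>" and fm: "(NN x. ?g Im x \<partial>(P \<Otimes>\<^sub>M lborel)) < \<infinity>"
  unfolding gEJ[OF Ip_m] gEJ[OF Im_m] by (rule EJfin)+
 note ip = integral_enn2real[OF product_measurable_closed[OF Ip_m] fp] and im = integral_enn2real[OF product_measurable_closed[OF Im_m] fm]
 interpret PL: pair_sigma_finite P lborel by (simp add: pair_sigma_finite_def P.sigma_finite_measure_axioms sigma_finite_lborel)
 let ?D = "%x. enn2real (?g Ip x) - enn2real (?g Im x)"
 have Di: "integrable (P \<Otimes>\<^sub>M lborel) ?D" by (rule Bochner_Integration.integrable_diff[OF ip(1) im(1)])
 have "expected_cost T A f \<pi> P = (\<integral>om. (\<integral>s. ?D (om, s) \<partial>lborel) \<partial>P)"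
  unfolding expected_cost_def set_lebesgue_integral_def
 proof (intro Bochner_Integration.integral_cong refl)
  fix om s assume "om : space P"
  then have om: "om : paths" by (simp add: P_space)
  show "indicator {0..T} s *\<^sub>R (\<integral>b. on_K A f (state_before om s) b \<partial>\<pi> om s) = ?D (om, s)"
   using inner[OF om, of s] by (auto simp: indicator_def)
 qed
 also have "... = integral\<^sup>L (P \<Otimes>\<^sub>M lborel) ?D" by (rule PL.integral_fst'[OF Di])
 also have "... = enn2real (EJ Ip) - enn2real (EJ Im)"
  unfolding Bochner_Integration.integral_diff[OF ip(1) im(1)] ip(2) im(2) gEJ[OF Ip_m] gEJ[OF Im_m] ..
 finally have E: "expected_cost T A f \<pi> P = enn2real (EJ Ip) - enn2real (EJ Im)" .
 have f_meas: "(%(t, i, a). f i a) : borel_measurable Xs"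
 proof -
  have "(%(t, i, a). indicator (A i) a *\<^sub>R f i a) : borel_measurable Zs"
  proof (rule measurable_by_state)
   fix i
   show "(%(t, a). indicator (A i) a *\<^sub>R f i a) : borel_measurable (borel \<Otimes>\<^sub>M borel)"
    using measurable_compose[OF measurable_snd borel_measurable_continuous_on_indicator[OF A_sets f_cont[of i]]] by (simp add: case_prod_beta')
  qed
  from measurable_Xs_I[OF this] show ?thesis
   by (rule measurable_cong[THEN iffD1, rotated]) (auto simp: space_Xs)
 qed
 have lift_eq: "(NN x. ennreal (sig * (case x of (t, i, a) => f i a)) \<partial>occm) = ennreal (1 / T) * EJ (ev (%s b. ennreal (sig * on_K A f s b)))" for sig
 proof -
  have "(%x. ennreal (sig * (case x of (t, i, a) => f i a))) : borel_measurable Xs" using f_meas by measurable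
  from occm_integral[OF this] have "(NN x. ennreal (sig * (case x of (t, i, a) => f i a)) \<partial>occm) =
    ennreal (1 / T) * EJ (%x. NN b. lift (%x. ennreal (sig * (case x of (t, i, a) => f i a))) x b \<partial>\<pi> (fst x) (snd x))" .
  moreover have "lift (%x. ennreal (sig * (case x of (t, i, a) => f i a))) x b = ennreal (sig * on_K A f (state_before (fst x) (snd x)) b)" for x b
   by (auto simp: lift_def split: option.split)
  ultimately show ?thesis by (simp add: ev_def[abs_def])
 qed
 have np: "(NN x. ennreal (case x of (t, i, a) => f i a) \<partial>occm) = ennreal (1 / T) * EJ Ip"
  and nm: "(NN x. ennreal (- (case x of (t, i, a) => f i a)) \<partial>occm) = ennreal (1 / T) * EJ Im"
  using lift_eq[of 1] lift_eq[of "-1"] by (simp_all add: Ip_def Im_def)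
 have fo: "(%(t, i, a). f i a) : borel_measurable occm"
  using f_meas measurable_cong_sets[OF sets_occm refl] by blast
 have "integrable occm (%(t, i, a). f i a)"
  unfolding real_integrable_def using fo np nm EJfin
  by (auto simp: ennreal_mult_eq_top_iff)
 from real_lebesgue_integral_def[OF this]
 have "(\<integral>(t, i, a). f i a \<partial>occm) = (enn2real (EJ Ip) - enn2real (EJ Im)) / T"
  unfolding np nm using T_pos by (simp add: enn2real_mult diff_divide_distrib)
 then show ?thesis using E T_pos by simp
qed

end

section \<open>Linear comparison for the Hamilton-Jacobi-Bellman equation\<close>

lemma infsum_integral_count:
 fixes f :: "'s => real"
 assumes "f summable_on UNIV"
 shows "integrable (counting) f" "(\<Sum>\<^sub>\<infinity>j. f j) = (\<integral>j. f j \<partial>counting)"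
proof -
 have "Infinite_Sum.abs_summable_on f UNIV"
  using assms by (rule summable_on_iff_abs_summable_on_real[THEN iffD1])
 then have ab: "Infinite_Set_Sum.abs_summable_on f UNIV" by (simp only: abs_summable_equivalent)
 then show "integrable (counting) f" by (simp add: Infinite_Set_Sum.abs_summable_on_def)
 show "(\<Sum>\<^sub>\<infinity>j. f j) = (\<integral>j. f j \<partial>counting)"
  using infsetsum_infsum[OF ab] by (simp only: infsetsum_def)
qed

lemma summable_on_real_comparison:
 fixes f g :: "'s => real"
 assumes "g summable_on UNIV" "!!j. \<bar>f j\<bar> <= g j"
 shows "f summable_on UNIV"
proof -
 have "(%j. \<bar>f j\<bar>) summable_on UNIV"
  by (rule summable_on_comparison_test[OF assms(1)]) (use assms(2) in auto)
 then have "Infinite_Sum.abs_summable_on f UNIV" by simp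
 then show ?thesis by (rule summable_on_iff_abs_summable_on_real[THEN iffD2])
qed

text \<open>Duhamel's formula for \<open>P' + c * P = b\<close> with zero initial value; the
  application has \<open>c = L * w i\<close>.\<close>

lemma exp_convolution_derivative:
 fixes b :: "real => real" and c :: real
 assumes b: "continuous_on {0..T} b" and tau: "tau : {0..T}"
 defines "P \<equiv> %tau. exp (- c * tau) * integral {0..tau} (%sig. exp (c * sig) * b sig)"
 shows "(P has_real_derivative - c * P tau + b tau) (at tau within {0..T})"
proof -
 have "((%u. integral {0..u} (%sig. exp (c * sig) * b sig)) has_vector_derivative exp (c * tau) * b tau) (at tau within {0..T})"
  by (rule integral_has_vector_derivative[OF _ tau]) (intro continuous_intros b)
 then have 1: "((%u. integral {0..u} (%sig. exp (c * sig) * b sig)) has_real_derivative exp (c * tau) * b tau) (at tau within {0..T})"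
  by (simp add: has_real_derivative_iff_has_vector_derivative)
 have 2: "((%tau. exp (- c * tau)) has_real_derivative - c * exp (- c * tau)) (at tau within {0..T})"
  by (auto intro!: derivative_eq_intros)
 have "exp (c * tau) * b tau * exp (- c * tau) = exp (c * tau) * exp (- c * tau) * b tau" by (simp only: mult_ac)
 also have "... = b tau" by (simp add: mult_exp_exp)
 finally have e: "exp (c * tau) * b tau * exp (- c * tau) = b tau" .
 show ?thesis
  unfolding P_def by (rule DERIV_cong[OF DERIV_mult[OF 2 1]], subst e) simp
qed

text \<open>A comparison principle: \<open>u\<close> is itself the Duhamel integral of
  \<open>u' + c * u\<close>, and that integral is monotone in the right-hand side.\<close>

lemma exp_convolution_bound:
 fixes b u u' :: "real => real"
 assumes b: "continuous_on {0..T} b" and u: "!!s. (u has_real_derivative u' s) (at s)" "u 0 = 0" "continuous_on UNIV u'"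
  and le: "!!sig. sig : {0..T} ==> b sig <= u' sig + c * u sig" and tau: "tau : {0..T}"
 shows "exp (- c * tau) * integral {0..tau} (%sig. exp (c * sig) * b sig) <= u tau"
proof -
 have "((%sig. exp (c * sig) * (u' sig + c * u sig)) has_integral (exp (c * tau) * u tau - exp (c * 0) * u 0)) {0..tau}"
 proof (rule fundamental_theorem_of_calculus)
  fix x
  have "((%sig. exp (c * sig) * u sig) has_real_derivative exp (c * x) * (u' x + c * u x)) (at x within {0..tau})"
   by (rule derivative_eq_intros DERIV_subset[OF u(1)] refl subset_UNIV)+ (simp add: algebra_simps)
  then show "((%sig. exp (c * sig) * u sig) has_vector_derivative exp (c * x) * (u' x + c * u x)) (at x within {0..tau})"
   by (simp add: has_real_derivative_iff_has_vector_derivative)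
 qed (use tau in auto)
 then have I: "integral {0..tau} (%sig. exp (c * sig) * (u' sig + c * u sig)) = exp (c * tau) * u tau"
  and II: "(%sig. exp (c * sig) * (u' sig + c * u sig)) integrable_on {0..tau}" using u(2) by (auto simp: has_integral_iff)
 have "integral {0..tau} (%sig. exp (c * sig) * b sig) <= exp (c * tau) * u tau"
  unfolding I[symmetric]
 proof (rule integral_le[OF _ II])
  show "(%sig. exp (c * sig) * b sig) integrable_on {0..tau}"
   using tau by (intro integrable_continuous_interval continuous_intros continuous_on_subset[OF b]) auto
 qed (use le tau in auto)
 then have "exp (- c * tau) * integral {0..tau} (%sig. exp (c * sig) * b sig) <= exp (- c * tau) * (exp (c * tau) * u tau)"
  by (intro mult_left_mono) auto
 also have "... = u tau" by (simp add: mult.assoc[symmetric] mult_exp_exp)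
 finally show ?thesis .
qed

section \<open>The generator on functions of polynomial order in the weight\<close>

context ctmdp
begin

definition qs :: "('s => real) => 's => 'a => real" where
 "qs f i a = (\<Sum>\<^sub>\<infinity>j. f j * q j i a)"

text \<open>Only the diagonal entry is negative, so passing to absolute values adds twice the
  diagonal term; this is the origin of \<open>2 * L\<close> and of the additional power of
  \<open>w\<close>.\<close>

lemma w_abs_q:
 assumes a: "a : A i" and k: "k : {1, 2, 3}"
 shows "(%j. w j ^ k * \<bar>q j i a\<bar>) summable_on UNIV" "(\<Sum>\<^sub>\<infinity>j. w j ^ k * \<bar>q j i a\<bar>) <= (R + 2 * L) * w i ^ (k + 1)"
proof -
 have s: "((%j. w j ^ k * q j i a) has_sum (\<Sum>\<^sub>\<infinity>j. w j ^ k * q j i a)) UNIV"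
  using w_drift[OF k a] by (intro has_sum_infsum) auto
 let ?d = "2 * w i ^ k * (- q i i a)"
 have "((%j. if j = i then ?d else 0) has_sum ?d) UNIV"
  by (subst has_sum_cong_neutral[where T = "{i}" and g = "%_. ?d"]) (auto intro: has_sum_finiteI)
 from has_sum_add[OF s this]
 have h: "((%j. w j ^ k * q j i a + (if j = i then ?d else 0)) has_sum ((\<Sum>\<^sub>\<infinity>j. w j ^ k * q j i a) + ?d)) UNIV" .
 have eq: "(%j. w j ^ k * q j i a + (if j = i then ?d else 0)) = (%j. w j ^ k * \<bar>q j i a\<bar>)"
 proof
  fix j
  show "w j ^ k * q j i a + (if j = i then ?d else 0) = w j ^ k * \<bar>q j i a\<bar>"
   using q_nonneg[OF a, of j] q_diag_nonpos[OF a] by (cases "j = i") (auto simp: abs_if)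
 qed
 show "(%j. w j ^ k * \<bar>q j i a\<bar>) summable_on UNIV" using h unfolding eq by (auto simp: summable_on_def)
 have "(\<Sum>\<^sub>\<infinity>j. w j ^ k * \<bar>q j i a\<bar>) = (\<Sum>\<^sub>\<infinity>j. w j ^ k * q j i a) + ?d" using h unfolding eq by (rule infsumI)
 also have "... <= R * w i ^ k + 2 * w i ^ k * (L * w i)"
  using w_drift[OF k a] q_diag[OF a] w_pos[of i] by (intro add_mono mult_left_mono) auto
 also have "... <= R * w i ^ (k + 1) + 2 * w i ^ k * (L * w i)"
  using w_pow_le[of k "k + 1" i] R_pos by (intro add_right_mono mult_left_mono) auto
 also have "... = (R + 2 * L) * w i ^ (k + 1)" by (simp add: algebra_simps)
 finally show "(\<Sum>\<^sub>\<infinity>j. w j ^ k * \<bar>q j i a\<bar>) <= (R + 2 * L) * w i ^ (k + 1)" .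
qed

lemma qs_summable:
 assumes a: "a : A i" and k: "k : {1, 2, 3}" and f: "!!j. \<bar>f j\<bar> <= C * w j ^ k"
 shows "(%j. f j * q j i a) summable_on UNIV"
proof (rule summable_on_real_comparison)
 show "(%j. C * (w j ^ k * \<bar>q j i a\<bar>)) summable_on UNIV"
  by (rule summable_on_cmult_right[OF w_abs_q(1)[OF a k]])
 show "\<bar>f j * q j i a\<bar> <= C * (w j ^ k * \<bar>q j i a\<bar>)" for j
  using mult_right_mono[OF f[of j], of "\<bar>q j i a\<bar>"] by (simp add: abs_mult mult.assoc)
qed

lemma qs_bound:
 assumes a: "a : A i" and k: "k : {1, 2, 3}" and f: "!!j. \<bar>f j\<bar> <= C * w j ^ k" and C: "0 <= C"
 shows "\<bar>qs f i a\<bar> <= C * ((R + 2 * L) * w i ^ (k + 1))"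
proof -
 have s: "(%j. C * (w j ^ k * \<bar>q j i a\<bar>)) summable_on UNIV"
  by (rule summable_on_cmult_right[OF w_abs_q(1)[OF a k]])
 have le: "\<bar>f j * q j i a\<bar> <= C * (w j ^ k * \<bar>q j i a\<bar>)" for j
  using mult_right_mono[OF f[of j], of "\<bar>q j i a\<bar>"] by (simp add: abs_mult mult.assoc)
 have "\<bar>qs f i a\<bar> <= (\<Sum>\<^sub>\<infinity>j. C * (w j ^ k * \<bar>q j i a\<bar>))"
 proof (rule abs_leI)
  show "qs f i a <= (\<Sum>\<^sub>\<infinity>j. C * (w j ^ k * \<bar>q j i a\<bar>))"
   unfolding qs_def using le by (intro infsum_mono qs_summable[OF a k f] s) (auto simp: abs_le_iff)
  have "- qs f i a = (\<Sum>\<^sub>\<infinity>j. - (f j * q j i a))" unfolding qs_def by (simp add: infsum_uminus)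
  also have "... <= (\<Sum>\<^sub>\<infinity>j. C * (w j ^ k * \<bar>q j i a\<bar>))"
   using le by (intro infsum_mono s summable_on_uminus[THEN iffD2] qs_summable[OF a k f]) (auto simp: abs_le_iff)
  finally show "- qs f i a <= (\<Sum>\<^sub>\<infinity>j. C * (w j ^ k * \<bar>q j i a\<bar>))" .
 qed
 also have "... = C * (\<Sum>\<^sub>\<infinity>j. w j ^ k * \<bar>q j i a\<bar>)" by (simp add: infsum_cmult_right')
 also have "... <= C * ((R + 2 * L) * w i ^ (k + 1))" using w_abs_q(2)[OF a k] C by (rule mult_left_mono)
 finally show ?thesis .
qed

lemma qs_diff:
 assumes a: "a : A i" and k: "k : {1, 2, 3}" and f: "!!j. \<bar>f j\<bar> <= C * w j ^ k" "!!j. \<bar>f' j\<bar> <= C * w j ^ k"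
 shows "qs f i a - qs f' i a = qs (%j. f j - f' j) i a"
 unfolding qs_def left_diff_distrib by (rule infsum_diff_real[symmetric]) (rule qs_summable[OF a k f(1)], rule qs_summable[OF a k f(2)])

text \<open>Adding \<open>L * w i\<close> to the diagonal makes every coefficient nonnegative, by
  \<open>q_diag\<close>; the shifted generator is therefore monotone.\<close>

lemma qs_mono:
 assumes a: "a : A i" and k: "k : {1, 2, 3}" and f: "!!j. \<bar>f j\<bar> <= C * w j ^ k" "!!j. \<bar>f' j\<bar> <= C * w j ^ k"
  and le: "!!j. f j <= f' j"
 shows "qs f i a + L * w i * f i <= qs f' i a + L * w i * f' i"
proof -
 have hs: "((%j. f j * (q j i a + (if j = i then L * w i else 0))) has_sum (qs f i a + L * w i * f i)) UNIV"
  if "!!j. \<bar>f j\<bar> <= C * w j ^ k" for f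
 proof -
  have "((%j. f j * q j i a) has_sum qs f i a) UNIV" unfolding qs_def by (rule has_sum_infsum[OF qs_summable[OF a k that]])
  moreover have "((%j. if j = i then L * w i * f i else 0) has_sum (L * w i * f i)) UNIV"
   by (subst has_sum_cong_neutral[where T = "{i}" and g = "%_. L * w i * f i"]) (auto intro: has_sum_finiteI)
  ultimately have "((%j. f j * q j i a + (if j = i then L * w i * f i else 0)) has_sum (qs f i a + L * w i * f i)) UNIV"
   by (rule has_sum_add)
  moreover have "(%j. f j * q j i a + (if j = i then L * w i * f i else 0)) = (%j. f j * (q j i a + (if j = i then L * w i else 0)))"
   by (auto simp: distrib_left)
  ultimately show ?thesis by simp
 qed
 show ?thesis
 proof (rule has_sum_mono[OF hs[OF f(1)] hs[OF f(2)]])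
  fix j
  have "0 <= q j i a + (if j = i then L * w i else 0)"
   using q_nonneg[OF a, of j] q_diag[OF a] by (auto simp: abs_le_iff)
  then show "f j * (q j i a + (if j = i then L * w i else 0)) <= f' j * (q j i a + (if j = i then L * w i else 0))"
   by (rule mult_right_mono[OF le])
 qed
qed

lemma qs_w_le: "a : A i ==> 0 <= c ==> qs (%j. c * w j) i a <= c * (R * w i)"
 using w_drift[of 1 a i] unfolding qs_def by (simp add: mult.assoc infsum_cmult_right' mult_left_mono)

lemma qs_w_uminus: "qs (%j. - (c * w j)) i a = - qs (%j. c * w j) i a"
 unfolding qs_def by (simp add: infsum_uminus)

lemma qs_tendsto:
 assumes a: "a : A i" and k: "k : {1, 2, 3}" and f: "!!n j. \<bar>f n j\<bar> <= C * w j ^ k" and lim: "!!j. (%n. f n j) \<longlonglongrightarrow> f' j"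
 shows "(%n. qs (f n) i a) \<longlonglongrightarrow> qs f' i a"
proof -
 have f': "\<bar>f' j\<bar> <= C * w j ^ k" for j
  by (rule LIMSEQ_le_const2[OF tendsto_rabs[OF lim]]) (use f in auto)
 have e: "qs f i a = (\<integral>j. f j * q j i a \<partial>counting)" if "!!j. \<bar>f j\<bar> <= C * w j ^ k" for f
  unfolding qs_def by (rule infsum_integral_count(2)[OF qs_summable[OF a k that]])
 show ?thesis
  unfolding e[OF f] e[OF f']
 proof (rule integral_dominated_convergence[where w = "%j. C * (w j ^ k * \<bar>q j i a\<bar>)"])
  show "integrable (counting) (%j. C * (w j ^ k * \<bar>q j i a\<bar>))"
   by (rule infsum_integral_count(1)[OF summable_on_cmult_right[OF w_abs_q(1)[OF a k]]])
  show "AE j in counting. (%n. f n j * q j i a) \<longlonglongrightarrow> f' j * q j i a"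
   using lim by (auto intro!: tendsto_intros)
  show "AE j in counting. norm (f n j * q j i a) <= C * (w j ^ k * \<bar>q j i a\<bar>)" for n
   using mult_right_mono[OF f[of n], of "\<bar>q _ i a\<bar>"] by (auto simp: abs_mult mult.assoc)
 qed auto
qed

definition Ham :: "('s => 'a => real) => ('s => real) => 's => real" where
 "Ham g f i = (INF a\<in>A i. g i a + qs f i a)"

end

section \<open>Solving the Hamilton-Jacobi-Bellman equation by monotone iteration\<close>

locale hjb = ctmdp T A q \<gamma> w L R
 for T :: real and A :: "'s :: countable => 'a :: polish_space set"
  and q :: "'s => 's => 'a => real" and \<gamma> :: "'s pmf" and w :: "'s => real" and L R :: real +
 fixes g :: "'s => 'a => real" and G :: real
 assumes G: "0 <= G" and g_bound: "!!i a. a : A i ==> \<bar>g i a\<bar> <= G * w i"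
begin

lemma Ham_bdd_below:
 assumes k: "k : {1, 2, 3}" and f: "!!j. \<bar>f j\<bar> <= C * w j ^ k" and C: "0 <= C"
 shows "bdd_below ((%a. g i a + qs f i a) ` A i)"
proof (rule bdd_belowI2)
 fix a assume a: "a : A i"
 show "- (G * w i) - C * ((R + 2 * L) * w i ^ (k + 1)) <= g i a + qs f i a"
  using g_bound[OF a] qs_bound[OF a k f C] by (simp add: abs_le_iff)
qed

lemma Ham_le:
 assumes k: "k : {1, 2, 3}" and f: "!!j. \<bar>f j\<bar> <= C * w j ^ k" and C: "0 <= C" and a: "a : A i"
 shows "Ham g f i <= g i a + qs f i a"
 unfolding Ham_def by (rule cINF_lower[OF Ham_bdd_below[OF k f C] a])

lemma Ham_ge:
 assumes "!!a. a : A i ==> c <= g i a + qs f i a" shows "c <= Ham g f i"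
 unfolding Ham_def using assms A_nonempty by (intro cINF_greatest) auto

text \<open>Infima of two families that differ by at most a constant differ by at most that
  constant. The exponents are separate because the candidates below are of order \<open>w\<close>
  while their time increments are of order \<open>w ^ 2\<close>.\<close>

lemma Ham_diff:
 assumes k: "k : {1, 2, 3}" and f: "!!j. \<bar>f j\<bar> <= C * w j ^ k" "!!j. \<bar>f' j\<bar> <= C * w j ^ k" and C: "0 <= C"
  and l: "l : {1, 2, 3}" and d: "!!j. \<bar>f j - f' j\<bar> <= e * w j ^ l" and e: "0 <= e"
 shows "\<bar>Ham g f i - Ham g f' i\<bar> <= e * ((R + 2 * L) * w i ^ (l + 1))"
proof -
 have one: "Ham g f i - e * ((R + 2 * L) * w i ^ (l + 1)) <= Ham g f' i"
  if f: "!!j. \<bar>f j\<bar> <= C * w j ^ k" "!!j. \<bar>f' j\<bar> <= C * w j ^ k" and d: "!!j. \<bar>f j - f' j\<bar> <= e * w j ^ l" for f f'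
 proof (rule Ham_ge)
  fix a assume a: "a : A i"
  have "Ham g f i <= g i a + qs f i a" by (rule Ham_le[OF k f(1) C a])
  moreover have "qs f i a - qs f' i a <= e * ((R + 2 * L) * w i ^ (l + 1))"
   unfolding qs_diff[OF a k f] using qs_bound[OF a l d e] by (simp add: abs_le_iff)
  ultimately show "Ham g f i - e * ((R + 2 * L) * w i ^ (l + 1)) <= g i a + qs f' i a" by simp
 qed
 have d': "\<bar>f' j - f j\<bar> <= e * w j ^ l" for j using d[of j] by (simp add: abs_minus_commute)
 show ?thesis using one[OF f d] one[OF f(2,1) d'] by (simp add: abs_le_iff)
qed

lemma Ham_mono:
 assumes k: "k : {1, 2, 3}" and f: "!!j. \<bar>f j\<bar> <= C * w j ^ k" "!!j. \<bar>f' j\<bar> <= C * w j ^ k" and C: "0 <= C"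
  and le: "!!j. f j <= f' j"
 shows "Ham g f i + L * w i * f i <= Ham g f' i + L * w i * f' i"
proof -
 have "Ham g f i + L * w i * f i - L * w i * f' i <= Ham g f' i"
 proof (rule Ham_ge)
  fix a assume a: "a : A i"
  show "Ham g f i + L * w i * f i - L * w i * f' i <= g i a + qs f' i a"
   using Ham_le[OF k f(1) C a] qs_mono[OF a k f le] by linarith
 qed
 then show ?thesis by simp
qed

text \<open>The solution of \<open>u' = G + R * u\<close> with \<open>u 0 = 0\<close>, in time to go
  \<open>tau\<close>. By the drift of \<open>w\<close>, the functions \<open>u * w\<close> and
  \<open>- u * w\<close> are a supersolution and a subsolution.\<close>

definition u :: "real => real" where "u tau = G * (exp (R * tau) - 1) / R"
definition cu :: real where "cu = u T"
text \<open>Bounds the time derivative of every iterate in units of \<open>w ^ 2\<close>, see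
  \<open>rate_bound\<close>. One of the two terms \<open>L * cu\<close> comes from the damping
  \<open>- L * w i * Phi\<close>, the other from the shift inside \<open>BB\<close>.\<close>

definition Lam :: real where "Lam = G + R * cu + 2 * L * cu"

lemma u_deriv: "(u has_real_derivative G + R * u tau) (at tau)"
 unfolding u_def[abs_def] using R_pos by (auto intro!: derivative_eq_intros simp: field_simps)

lemma u_0: "u 0 = 0" by (simp add: u_def)

lemma u_bounds: "tau : {0..T} ==> 0 <= u tau & u tau <= cu"
 unfolding cu_def u_def using G R_pos by (auto intro!: divide_right_mono mult_left_mono)

lemma cu_nonneg: "0 <= cu" using u_bounds[of T] T_pos by simp

lemma Lam_nonneg: "0 <= Lam" using cu_nonneg G R_pos L_pos by (simp add: Lam_def)

text \<open>The class preserved by the iteration: values between the barriers, and time increments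
  of order \<open>w ^ 2\<close>. The second condition makes the Hamiltonian continuous in
  time.\<close>

definition Adm :: "(real => 's => real) => bool" where
 "Adm K \<longleftrightarrow> (\<forall>tau\<in>{0..T}. \<forall>i. \<bar>K tau i\<bar> <= u tau * w i) &
   (\<forall>tau\<in>{0..T}. \<forall>sig\<in>{0..T}. \<forall>i. \<bar>K tau i - K sig i\<bar> <= Lam * w i ^ 2 * \<bar>tau - sig\<bar>)"

lemma Adm_bound:
 assumes "Adm K" "tau : {0..T}" shows "\<bar>K tau j\<bar> <= cu * w j ^ 1"
proof -
 have "\<bar>K tau j\<bar> <= u tau * w j" using assms by (simp add: Adm_def)
 also have "... <= cu * w j" using u_bounds[OF assms(2)] w_pos[of j] by (intro mult_right_mono) auto
 finally show ?thesis by simp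
qed

text \<open>The Hamiltonian shifted by \<open>L * w i\<close>, hence monotone in \<open>K\<close>.
  \<open>Phi\<close> is the mild form of \<open>K' = Ham g K\<close>: the shift is compensated by
  the exponential damping.\<close>

definition BB :: "(real => 's => real) => 's => real => real" where
 "BB K i sig = Ham g (K sig) i + L * w i * K sig i"

definition Phi :: "(real => 's => real) => real => 's => real" where
 "Phi K tau i = exp (- (L * w i) * tau) * integral {0..tau} (%sig. exp (L * w i * sig) * BB K i sig)"

lemma lipschitz_continuous_on:
 assumes "!!x y. x : S ==> y : S ==> \<bar>f x - f y\<bar> <= B * \<bar>x - y\<bar>" "0 <= B"
 shows "continuous_on S (f :: real => real)"
proof (rule uniformly_continuous_imp_continuous, rule lipschitz_on_uniformly_continuous)
 show "B-lipschitz_on S f" using assms by (auto simp: lipschitz_on_def dist_real_def)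
qed

lemma Ham_Adm_lipschitz:
 assumes K: "Adm K" and t: "tau : {0..T}" "sig : {0..T}"
 shows "\<bar>Ham g (K tau) i - Ham g (K sig) i\<bar> <= Lam * (R + 2 * L) * w i ^ 3 * \<bar>tau - sig\<bar>"
proof -
 have "\<bar>K tau j - K sig j\<bar> <= (Lam * \<bar>tau - sig\<bar>) * w j ^ 2" for j
  using K t by (simp add: Adm_def mult_ac)
 then have "\<bar>Ham g (K tau) i - Ham g (K sig) i\<bar> <= (Lam * \<bar>tau - sig\<bar>) * ((R + 2 * L) * w i ^ (2 + 1))"
  using Adm_bound[OF K] t cu_nonneg Lam_nonneg
  by (intro Ham_diff[where k = 1 and C = cu]) auto
 then show ?thesis by (simp add: mult_ac numeral_3_eq_3 numeral_2_eq_2)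
qed

lemma Ham_Adm_continuous: "Adm K ==> continuous_on {0..T} (%tau. Ham g (K tau) i)"
 using Lam_nonneg R_pos L_pos w_pos[of i]
 by (intro lipschitz_continuous_on[where B = "Lam * (R + 2 * L) * w i ^ 3"] Ham_Adm_lipschitz) auto

lemma Adm_continuous: "Adm K ==> continuous_on {0..T} (%tau. K tau i)"
 using Lam_nonneg w_pos[of i]
 by (intro lipschitz_continuous_on[where B = "Lam * w i ^ 2"]) (auto simp: Adm_def)

lemma BB_continuous: "Adm K ==> continuous_on {0..T} (BB K i)"
 unfolding BB_def[abs_def] by (intro continuous_intros Ham_Adm_continuous Adm_continuous)

text \<open>By monotonicity \<open>K\<close> may be replaced by the barriers, on which the drift
  condition evaluates the generator. One action suffices for the upper bound; the lower bound needs
  every action.\<close>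

lemma BB_bounds:
 assumes K: "Adm K" and t: "sig : {0..T}"
 shows "BB K i sig <= (G + R * u sig) * w i + L * w i * (u sig * w i)"
  and "- ((G + R * u sig) * w i + L * w i * (u sig * w i)) <= BB K i sig"
proof -
 note ub = u_bounds[OF t]
 have b: "\<bar>K sig j\<bar> <= u sig * w j ^ 1" for j using K t by (simp add: Adm_def)
 have bu: "\<bar>u sig * w j\<bar> <= u sig * w j ^ 1" "\<bar>- (u sig * w j)\<bar> <= u sig * w j ^ 1" for j
  using ub w_pos[of j] by (auto simp: abs_mult)
 obtain a where a: "a : A i" using A_nonempty by blast
 have "BB K i sig <= Ham g (%j. u sig * w j) i + L * w i * (u sig * w i)"
  unfolding BB_def using b ub by (intro Ham_mono[OF _ b bu(1)]) (auto simp: abs_le_iff)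
 also have "Ham g (%j. u sig * w j) i <= g i a + qs (%j. u sig * w j) i a"
  using ub by (intro Ham_le[OF _ bu(1) _ a]) auto
 also have "... <= (G + R * u sig) * w i"
  using g_bound[OF a] qs_w_le[OF a, of "u sig"] ub by (simp add: algebra_simps abs_le_iff)
 finally show "BB K i sig <= (G + R * u sig) * w i + L * w i * (u sig * w i)" by simp
 have "- ((G + R * u sig) * w i) <= Ham g (%j. - (u sig * w j)) i"
 proof (rule Ham_ge)
  fix a assume a: "a : A i"
  show "- ((G + R * u sig) * w i) <= g i a + qs (%j. - (u sig * w j)) i a"
   using g_bound[OF a] qs_w_le[OF a, of "u sig"] ub unfolding qs_w_uminus by (simp add: algebra_simps abs_le_iff)
 qed
 also have "Ham g (%j. - (u sig * w j)) i + L * w i * (- (u sig * w i)) <= BB K i sig"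
 proof -
  have "- (u sig * w j) <= K sig j" for j using b[of j] by simp
  then show ?thesis unfolding BB_def using ub by (intro Ham_mono[OF _ bu(2) b]) auto
 qed
 finally show "- ((G + R * u sig) * w i + L * w i * (u sig * w i)) <= BB K i sig" by simp
qed

lemma BB_abs:
 assumes "Adm K" "sig : {0..T}"
 shows "\<bar>BB K i sig\<bar> <= (G + R * u sig) * w i + L * w i * (u sig * w i)"
 using BB_bounds[OF assms, of i] by linarith

lemma Phi_deriv:
 assumes "Adm K" "tau : {0..T}"
 shows "((%tau. Phi K tau i) has_real_derivative - (L * w i) * Phi K tau i + BB K i tau) (at tau within {0..T})"
 unfolding Phi_def by (rule exp_convolution_derivative[OF BB_continuous[OF assms(1)] assms(2)])

lemma Phi_bound:
 assumes K: "Adm K" and t: "tau : {0..T}"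
 shows "\<bar>Phi K tau i\<bar> <= u tau * w i"
proof (rule abs_leI)
 have ud: "((%s. u s * w i) has_real_derivative (G + R * u s) * w i) (at s)" for s
  by (rule DERIV_cmult_right[OF u_deriv])
 have uc: "continuous_on UNIV (%s. (G + R * u s) * w i)"
  unfolding u_def[abs_def] using R_pos by (intro continuous_intros) auto
 show "Phi K tau i <= u tau * w i"
  unfolding Phi_def using BB_bounds(1)[OF K] t
  by (intro exp_convolution_bound[OF BB_continuous[OF K] ud _ uc]) (auto simp: u_0)
 have "exp (- (L * w i) * tau) * integral {0..tau} (%sig. exp (L * w i * sig) * (- BB K i sig)) <= u tau * w i"
 proof (rule exp_convolution_bound[OF _ ud _ uc _ t])
  show "continuous_on {0..T} (%sig. - BB K i sig)" by (intro continuous_intros BB_continuous[OF K])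
  show "- BB K i sig <= (G + R * u sig) * w i + L * w i * (u sig * w i)" if "sig : {0..T}" for sig
   using BB_bounds(2)[OF K that, of i] by linarith
 qed (simp add: u_0)
 then show "- Phi K tau i <= u tau * w i" by (simp add: Phi_def)
qed

lemma rate_bound:
 assumes "tau : {0..T}" "\<bar>x\<bar> <= u tau * w i" "\<bar>b\<bar> <= (G + R * u tau) * w i + L * w i * (u tau * w i)"
 shows "\<bar>- (L * w i) * x + b\<bar> <= Lam * w i ^ 2"
proof -
 note ub = u_bounds[OF assms(1)]
 have "\<bar>- (L * w i) * x + b\<bar> <= L * w i * \<bar>x\<bar> + \<bar>b\<bar>"
  using L_pos w_pos[of i] abs_triangle_ineq[of "- (L * w i) * x" b] by (simp add: abs_mult)
 also have "... <= L * w i * (u tau * w i) + ((G + R * u tau) * w i + L * w i * (u tau * w i))"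
  using assms L_pos w_pos[of i] by (intro add_mono mult_left_mono) auto
 also have "... = 2 * L * u tau * w i ^ 2 + (G + R * u tau) * w i" by (simp add: power2_eq_square algebra_simps)
 also have "... <= 2 * L * cu * w i ^ 2 + (G + R * cu) * w i ^ 2"
  using ub L_pos R_pos G w_pow_le[of 1 2 i] w_pos[of i]
  by (intro add_mono mult_right_mono mult_mono) auto
 also have "... = Lam * w i ^ 2" by (simp add: Lam_def algebra_simps)
 finally show ?thesis .
qed

lemma Phi_Adm:
 assumes K: "Adm K" shows "Adm (Phi K)"
 unfolding Adm_def
proof (intro conjI ballI allI)
 fix tau i assume "tau : {0..T}" then show "\<bar>Phi K tau i\<bar> <= u tau * w i" by (rule Phi_bound[OF K])
next
 fix tau sig i assume t: "tau : {0..T}" "sig : {0..T}"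
 have "norm (Phi K tau i - Phi K sig i) <= Lam * w i ^ 2 * norm (tau - sig)"
 proof (rule field_differentiable_bound[of "{0..T}"])
  fix z assume z: "z : {0..T}"
  show "((%tau. Phi K tau i) has_real_derivative - (L * w i) * Phi K z i + BB K i z) (at z within {0..T})"
   by (rule Phi_deriv[OF K z])
  show "norm (- (L * w i) * Phi K z i + BB K i z) <= Lam * w i ^ 2"
   unfolding real_norm_def by (rule rate_bound[OF z Phi_bound[OF K z] BB_abs[OF K z]])
 qed (use t in auto)
 then show "\<bar>Phi K tau i - Phi K sig i\<bar> <= Lam * w i ^ 2 * \<bar>tau - sig\<bar>" by simp
qed

lemma BB_mono:
 assumes K: "Adm K" "Adm K'" and t: "sig : {0..T}" and le: "!!j. K sig j <= K' sig j"
 shows "BB K i sig <= BB K' i sig"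
 unfolding BB_def using Adm_bound[OF K(1) t] Adm_bound[OF K(2) t] cu_nonneg le
 by (intro Ham_mono[where k = 1 and C = cu]) auto

lemma Phi_mono:
 assumes K: "Adm K" "Adm K'" and le: "!!sig j. sig : {0..T} ==> K sig j <= K' sig j" and t: "tau : {0..T}"
 shows "Phi K tau i <= Phi K' tau i"
proof -
 have "integral {0..tau} (%sig. exp (L * w i * sig) * BB K i sig) <= integral {0..tau} (%sig. exp (L * w i * sig) * BB K' i sig)"
  using t le BB_mono[OF K] by (intro integral_le integrable_continuous_interval continuous_intros continuous_on_subset[OF BB_continuous] K) auto
 then show ?thesis unfolding Phi_def by (intro mult_left_mono) auto
qed

text \<open>Starting from the supersolution makes the first step go down, and monotonicity of
  \<open>Phi\<close> propagates this to all steps.\<close>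

primrec Kseq :: "nat => real => 's => real" where
 "Kseq 0 = (%tau i. u tau * w i)"
| "Kseq (Suc n) = Phi (Kseq n)"

lemma Kseq_Adm: "Adm (Kseq n)"
proof (induction n)
 case 0
 show ?case
  unfolding Adm_def
 proof (intro conjI ballI allI)
  fix tau i assume "tau : {0..T}"
  then show "\<bar>Kseq 0 tau i\<bar> <= u tau * w i" using u_bounds w_pos[of i] by (auto simp: abs_mult)
 next
  fix tau sig i assume t: "tau : {0..T}" "sig : {0..T}"
  have "norm (u tau * w i - u sig * w i) <= Lam * w i ^ 2 * norm (tau - sig)"
  proof (rule field_differentiable_bound[of "{0..T}"])
   fix z assume z: "z : {0..T}"
   show "((%s. u s * w i) has_real_derivative (G + R * u z) * w i) (at z within {0..T})"
    by (rule DERIV_subset[OF DERIV_cmult_right[OF u_deriv]]) simp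
   have "(G + R * u z) * w i <= Lam * w i ^ 2"
    using u_bounds[OF z] cu_nonneg G R_pos L_pos w_pow_le[of 1 2 i] w_pos[of i] unfolding Lam_def
    by (intro mult_mono) (auto simp: add_increasing2)
   then show "norm ((G + R * u z) * w i) <= Lam * w i ^ 2"
    using u_bounds[OF z] G R_pos w_pos[of i] by (auto simp: abs_mult)
  qed (use t in auto)
  then show "\<bar>Kseq 0 tau i - Kseq 0 sig i\<bar> <= Lam * w i ^ 2 * \<bar>tau - sig\<bar>" by simp
 qed
next
 case (Suc n) then show ?case by (simp add: Phi_Adm)
qed

lemma Kseq_antimono:
 assumes "tau : {0..T}" shows "Kseq (Suc n) tau i <= Kseq n tau i"
 using assms
proof (induction n arbitrary: tau i)
 case 0 then show ?case using Phi_bound[OF Kseq_Adm[of 0], of tau i] by (simp add: abs_le_iff)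
next
 case (Suc n)
 have "Phi (Kseq (Suc n)) tau i <= Phi (Kseq n) tau i"
  by (rule Phi_mono[OF Kseq_Adm Kseq_Adm Suc.IH Suc.prems])
 then show ?case by simp
qed

definition KK :: "real => 's => real" where "KK tau i = lim (%n. Kseq n tau i)"

lemma Kseq_tendsto:
 assumes "tau : {0..T}" shows "(%n. Kseq n tau i) \<longlonglongrightarrow> KK tau i" "KK tau i <= Kseq n tau i"
proof -
 have d: "decseq (%n. Kseq n tau i)" using Kseq_antimono[OF assms] by (rule decseq_SucI)
 have "bdd_below (range (%n. Kseq n tau i))"
  using Kseq_Adm assms by (intro bdd_belowI2[of _ "- (u tau * w i)"]) (auto simp: Adm_def abs_le_iff minus_le_iff)
 from LIMSEQ_decseq_INF[OF this d] have "convergent (%n. Kseq n tau i)" by (auto simp: convergent_def)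
 then show l: "(%n. Kseq n tau i) \<longlonglongrightarrow> KK tau i" by (simp add: convergent_LIMSEQ_iff KK_def)
 show "KK tau i <= Kseq n tau i" by (rule decseq_ge[OF d l])
qed

lemma KK_Adm: "Adm KK"
 unfolding Adm_def
proof (intro conjI ballI allI)
 fix tau i assume t: "tau : {0..T}"
 show "\<bar>KK tau i\<bar> <= u tau * w i"
  by (rule LIMSEQ_le_const2[OF tendsto_rabs[OF Kseq_tendsto(1)[OF t]]]) (use Kseq_Adm t in \<open>auto simp: Adm_def\<close>)
next
 fix tau sig i assume t: "tau : {0..T}" "sig : {0..T}"
 show "\<bar>KK tau i - KK sig i\<bar> <= Lam * w i ^ 2 * \<bar>tau - sig\<bar>"
  by (rule LIMSEQ_le_const2[OF tendsto_rabs[OF tendsto_diff[OF Kseq_tendsto(1)[OF t(1)] Kseq_tendsto(1)[OF t(2)]]]])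
    (use Kseq_Adm t in \<open>auto simp: Adm_def\<close>)
qed

text \<open>An infimum commutes with a decreasing limit. Monotonicity gives the lower estimate; for
  the upper one a nearly minimal action for the limit is fixed, along which \<open>qs\<close>
  converges by domination.\<close>

lemma BB_tendsto:
 assumes t: "sig : {0..T}"
 shows "(%n. BB (Kseq n) i sig) \<longlonglongrightarrow> BB KK i sig"
proof (rule order_tendstoI)
 fix y assume y: "y < BB KK i sig"
 have "BB KK i sig <= BB (Kseq n) i sig" for n
  by (rule BB_mono[OF KK_Adm Kseq_Adm t Kseq_tendsto(2)[OF t]])
 then show "\<forall>\<^sub>F n in sequentially. y < BB (Kseq n) i sig" using y by (auto intro!: always_eventually intro: less_le_trans)
next
 fix y assume y: "BB KK i sig < y"
 then have "Ham g (KK sig) i < y - L * w i * KK sig i" by (simp add: BB_def)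
 then obtain a where a: "a : A i" "g i a + qs (KK sig) i a < y - L * w i * KK sig i"
  unfolding Ham_def using A_nonempty
  by (subst (asm) cINF_less_iff) (auto intro: Ham_bdd_below[where k = 1 and C = cu] simp: cu_nonneg Adm_bound[OF KK_Adm t, simplified])
 have "(%n. g i a + qs (Kseq n sig) i a + L * w i * Kseq n sig i) \<longlonglongrightarrow> g i a + qs (KK sig) i a + L * w i * KK sig i"
  using Adm_bound[OF Kseq_Adm t] Kseq_tendsto(1)[OF t]
  by (intro tendsto_intros qs_tendsto[OF a(1), where k = 1 and C = cu]) auto
 from order_tendstoD(2)[OF this, of y] a have "\<forall>\<^sub>F n in sequentially. g i a + qs (Kseq n sig) i a + L * w i * Kseq n sig i < y" by simp
 then show "\<forall>\<^sub>F n in sequentially. BB (Kseq n) i sig < y"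
 proof eventually_elim
  case (elim n)
  have "Ham g (Kseq n sig) i <= g i a + qs (Kseq n sig) i a"
   by (rule Ham_le[OF _ Adm_bound[OF Kseq_Adm t] cu_nonneg a(1)]) simp
  then show ?case using elim by (simp add: BB_def)
 qed
qed

lemma KK_fixpoint:
 assumes t: "tau : {0..T}" shows "KK tau i = Phi KK tau i"
proof -
 let ?M = "(G + R * cu) * w i + L * w i * (cu * w i)"
 have sub: "{0..tau} \<subseteq> {0..T}" using t by auto
 have cont: "continuous_on {0..tau} (%sig. exp (L * w i * sig) * BB K i sig)" if "Adm K" for K
  using continuous_on_subset[OF BB_continuous[OF that] sub] by (intro continuous_intros)
 have "(%n. integral {0..tau} (%sig. exp (L * w i * sig) * BB (Kseq n) i sig)) \<longlonglongrightarrow> integral {0..tau} (%sig. exp (L * w i * sig) * BB KK i sig)"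
 proof (rule dominated_convergence(2))
  show "(%sig. exp (L * w i * sig) * BB (Kseq n) i sig) integrable_on {0..tau}" for n
   by (rule integrable_continuous_interval[OF cont[OF Kseq_Adm]])
  show "(%sig. exp (L * w i * sig) * ?M) integrable_on {0..tau}"
   by (intro integrable_continuous_interval continuous_intros)
  fix sig assume "sig : {0..tau}"
  then have s: "sig : {0..T}" using sub by auto
  have "(G + R * u sig) * w i + L * w i * (u sig * w i) <= ?M"
   using u_bounds[OF s] R_pos L_pos w_pos[of i] by (intro add_mono mult_right_mono mult_left_mono) auto
  then have "\<bar>BB (Kseq n) i sig\<bar> <= ?M" for n using BB_bounds[OF Kseq_Adm[of n] s, of i] by (simp add: abs_le_iff)
  then show "norm (exp (L * w i * sig) * BB (Kseq n) i sig) <= exp (L * w i * sig) * ?M" for n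
   by (simp add: abs_mult)
  show "(%n. exp (L * w i * sig) * BB (Kseq n) i sig) \<longlonglongrightarrow> exp (L * w i * sig) * BB KK i sig"
   by (intro tendsto_intros BB_tendsto[OF s])
 qed
 then have "(%n. Phi (Kseq n) tau i) \<longlonglongrightarrow> Phi KK tau i" unfolding Phi_def by (intro tendsto_intros)
 moreover have "(%n. Phi (Kseq n) tau i) \<longlonglongrightarrow> KK tau i" using LIMSEQ_Suc[OF Kseq_tendsto(1)[OF t]] by simp
 ultimately show ?thesis using LIMSEQ_unique by blast
qed

text \<open>At the fixed point the damping and the shift cancel, and the Hamiltonian alone
  remains.\<close>

lemma KK_deriv:
 assumes t: "tau : {0..T}"
 shows "((%tau. KK tau i) has_real_derivative Ham g (KK tau) i) (at tau within {0..T})"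
proof -
 have "((%tau. KK tau i) has_real_derivative - (L * w i) * Phi KK tau i + BB KK i tau) (at tau within {0..T})"
  by (rule has_field_derivative_transform_within[OF Phi_deriv[OF KK_Adm t], of 1]) (use t KK_fixpoint in auto)
 then show ?thesis using KK_fixpoint[OF t, of i] by (simp add: BB_def)
qed

lemma KK_0: "KK 0 i = 0"
 using KK_Adm T_pos by (auto simp: Adm_def u_0 dest!: bspec[of _ _ 0])

lemma Ham_KK_bound:
 assumes t: "tau : {0..T}" shows "\<bar>Ham g (KK tau) i\<bar> <= Lam * w i ^ 2"
proof -
 have "Ham g (KK tau) i = - (L * w i) * KK tau i + BB KK i tau" by (simp add: BB_def)
 also have "\<bar>...\<bar> <= Lam * w i ^ 2"
  using KK_Adm t by (intro rate_bound[OF t _ BB_abs[OF KK_Adm t]]) (auto simp: Adm_def)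
 finally show ?thesis .
qed

end

section \<open>The dual feasible function\<close>

context hjb
begin

definition hh :: "real \<times> 's => real" where
 "hh = (%(t, i). if t : {0..T} then Ham g (KK (T - t)) i else 0)"

lemma hh_bounded: "w2_bounded hh Lam"
 unfolding w2_bounded_def
proof (intro conjI ballI allI Lam_nonneg)
 show "hh : borel_measurable borel_counting"
 proof (rule measurable_pair_count2)
  fix i
  have "continuous_on {0..T} (%t. Ham g (KK (T - t)) i)"
   by (rule continuous_on_compose2[OF Ham_Adm_continuous[OF KK_Adm]]) (auto intro!: continuous_intros)
  from borel_measurable_continuous_on_indicator[OF _ this]
  have "(%t. indicator {0..T} t *\<^sub>R Ham g (KK (T - t)) i) : borel_measurable borel" by simp
  also have "(%t. indicator {0..T} t *\<^sub>R Ham g (KK (T - t)) i) = (%t. hh (t, i))"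
   by (auto simp: hh_def fun_eq_iff indicator_def)
  finally show "(%t. hh (t, i)) : borel_measurable borel" .
 qed
 fix t i assume "t : {0..T}" then show "\<bar>hh (t, i)\<bar> <= Lam * w i ^ 2"
  using Ham_KK_bound[of "T - t" i] by (simp add: hh_def)
qed

lemma hh_integral:
 assumes t: "t : {0..T}"
 shows "(\<integral>s. indicator {t..T} s * hh (s, j) \<partial>lborel) = KK (T - t) j"
proof -
 have "(\<integral>s. indicator {t..T} s *\<^sub>R Ham g (KK (T - s)) j \<partial>lborel) = - KK (T - T) j - (- KK (T - t) j)"
 proof (rule integral_FTC_Icc)
  show "continuous_on {t..T} (%s. Ham g (KK (T - s)) j)"
   using t by (intro continuous_on_compose2[OF Ham_Adm_continuous[OF KK_Adm]]) (auto intro!: continuous_intros)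
  fix s assume s: "t <= s" "s <= T"
  have "((%tau. KK tau j) \<circ> (%s. T - s) has_real_derivative Ham g (KK (T - s)) j * (- 1)) (at s within {t..T})"
  proof (rule DERIV_image_chain)
   show "((%tau. KK tau j) has_real_derivative Ham g (KK (T - s)) j) (at (T - s) within (%s. T - s) ` {t..T})"
    by (rule DERIV_subset[OF KK_deriv]) (use s t in auto)
  qed (auto intro!: derivative_eq_intros)
  from DERIV_minus[OF this] show "((%s. - KK (T - s) j) has_vector_derivative Ham g (KK (T - s)) j) (at s within {t..T})"
   by (simp add: o_def has_real_derivative_iff_has_vector_derivative)
 qed (use t in auto)
 moreover have "(\<integral>s. indicator {t..T} s * hh (s, j) \<partial>lborel) = (\<integral>s. indicator {t..T} s *\<^sub>R Ham g (KK (T - s)) j \<partial>lborel)"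
  using t by (intro Bochner_Integration.integral_cong) (auto simp: hh_def indicator_def)
 ultimately show ?thesis by (simp add: KK_0)
qed

text \<open>The sum over states and the time integral are exchanged, with the dominating function
  \<open>Lam * w ^ 2 * |q|\<close>; the inner time integral of \<open>hh\<close> is then
  \<open>KK (T - t)\<close>. The dual constraint thereby becomes the defining inequality of the
  infimum in \<open>Ham\<close>.\<close>

lemma dual_term_hh:
 assumes t: "t : {0..T}" and a: "a : A i"
 shows "dual_term hh t i a = qs (KK (T - t)) i a"
proof -
 interpret PS: pair_sigma_finite lborel "count_space (UNIV :: 's set)"
  by (simp add: pair_sigma_finite_def sigma_finite_lborel sigma_finite_count_countable)
 let ?F = "%s j. indicator {t..T} s * (hh (s, j) * q j i a)"
 have [measurable]: "hh : borel_measurable borel_counting" using hh_bounded by (simp add: w2_bounded_def)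
 have m: "case_prod ?F : borel_measurable (lborel \<Otimes>\<^sub>M counting)"
  by (rule measurable_pair_count2) (auto intro!: borel_measurable_times)
 have hb: "\<bar>hh (s, j)\<bar> <= Lam * w j ^ 2" if "s : {t..T}" for s j using hh_bounded that t by (auto simp: w2_bounded_def)
 have s: "(%j. ?F s j) summable_on UNIV" and ab: "(\<Sum>\<^sub>\<infinity>j. ?F s j) = indicator {t..T} s * (\<Sum>\<^sub>\<infinity>j. hh (s, j) * q j i a)" for s
 proof -
  show "(%j. ?F s j) summable_on UNIV"
   using qs_summable[OF a, of 2 "%j. hh (s, j)" Lam] hb by (cases "s : {t..T}") auto
  show "(\<Sum>\<^sub>\<infinity>j. ?F s j) = indicator {t..T} s * (\<Sum>\<^sub>\<infinity>j. hh (s, j) * q j i a)"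
   by (rule infsum_cmult_right')
 qed
 have integrable_F: "integrable (lborel \<Otimes>\<^sub>M counting) (case_prod ?F)"
 proof (rule integrableI_bounded[OF m])
  have ws: "(%j. Lam * (w j ^ 2 * \<bar>q j i a\<bar>)) summable_on UNIV"
   by (rule summable_on_cmult_right[OF w_abs_q(1)[OF a]]) simp
  have "(NN x. ennreal (norm (case_prod ?F x)) \<partial>(lborel \<Otimes>\<^sub>M counting)) = (NN s. NN j. ennreal (norm (?F s j)) \<partial>counting \<partial>lborel)"
   by (subst PS.M2.nn_integral_fst[symmetric]) (use m in auto)
  also have "... <= (NN s. (NN j. ennreal (Lam * (w j ^ 2 * \<bar>q j i a\<bar>)) \<partial>counting) * indicator {t..T} s \<partial>lborel)"
  proof (rule nn_integral_mono)
   fix s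
   show "(NN j. ennreal (norm (?F s j)) \<partial>counting) <= (NN j. ennreal (Lam * (w j ^ 2 * \<bar>q j i a\<bar>)) \<partial>counting) * indicator {t..T} s"
   proof (cases "s : {t..T}")
    case True
    have "norm (?F s j) <= Lam * (w j ^ 2 * \<bar>q j i a\<bar>)" for j
     using mult_right_mono[OF hb[OF True, of j], of "\<bar>q j i a\<bar>"] True by (simp add: abs_mult mult.assoc)
    then show ?thesis using True by (auto intro!: nn_integral_mono ennreal_leI)
   qed simp
  qed
  also have "... < \<infinity>"
  proof -
   have "(NN j. ennreal (Lam * (w j ^ 2 * \<bar>q j i a\<bar>)) \<partial>counting) < \<infinity>"
    using infsum_integral_count(1)[OF ws] Lam_nonneg by (subst nn_integral_eq_integral) (auto simp: abs_mult)
   then show ?thesis using t by (simp add: nn_integral_cmult_indicator ennreal_mult_less_top)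
  qed
  finally show "(NN x. ennreal (norm (case_prod ?F x)) \<partial>(lborel \<Otimes>\<^sub>M counting)) < \<infinity>" .
 qed
 have "dual_term hh t i a = (\<integral>s. \<integral>j. ?F s j \<partial>counting \<partial>lborel)"
  unfolding dual_term_def set_lebesgue_integral_def
  by (intro Bochner_Integration.integral_cong refl) (simp add: ab[symmetric] infsum_integral_count(2)[OF s])
 also have "... = (\<integral>j. \<integral>s. ?F s j \<partial>lborel \<partial>counting)"
  by (rule PS.Fubini_integral[OF integrable_F, symmetric])
 also have "... = (\<integral>j. KK (T - t) j * q j i a \<partial>counting)"
 proof (intro Bochner_Integration.integral_cong refl)
  fix j
  have "(\<integral>s. ?F s j \<partial>lborel) = (\<integral>s. indicator {t..T} s * hh (s, j) * q j i a \<partial>lborel)" by (simp only: mult.assoc)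
  also have "... = KK (T - t) j * q j i a" by (simp add: hh_integral[OF t])
  finally show "(\<integral>s. ?F s j \<partial>lborel) = KK (T - t) j * q j i a" .
 qed
 also have "... = qs (KK (T - t)) i a"
  unfolding qs_def using t Adm_bound[OF KK_Adm]
  by (intro infsum_integral_count(2)[symmetric] qs_summable[OF a, of 1 _ cu]) auto
 finally show ?thesis .
qed

lemma hh_dual_ineq:
 assumes t: "t : {0..T}" and a: "a : A i"
 shows "0 <= g i a - hh (t, i) + dual_term hh t i a"
proof -
 have "Ham g (KK (T - t)) i <= g i a + qs (KK (T - t)) i a"
  using t by (intro Ham_le[OF _ Adm_bound[OF KK_Adm] cu_nonneg a]) auto
 moreover have "hh (t, i) = Ham g (KK (T - t)) i" using t by (simp add: hh_def)
 ultimately show ?thesis by (simp only: dual_term_hh[OF t a])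
qed

end

section \<open>The forward equation of a Markov control\<close>

lemma nn_integral_exp_decay:
 assumes "0 < c" "v <= t"
 shows "(NN s. ennreal (c * exp (- c * (s - v))) * indicator {v..t} s \<partial>lborel) = ennreal (1 - exp (- c * (t - v)))"
proof -
 have "(NN s. ennreal (c * exp (- c * (s - v))) * indicator {v..t} s \<partial>lborel) = ennreal (- exp (- c * (t - v)) - - exp (- c * (v - v)))"
  using assms by (intro nn_integral_FTC_Icc) (auto intro!: derivative_eq_intros)
 then show ?thesis by simp
qed

text \<open>The linear equation with damping \<open>c\<close>, integrated in time and stated for
  nonnegative quantities. In the double integral the inner exponential integrates to
  \<open>1 - exp (- c * (t - v))\<close>, which complements the kernel in \<open>p t\<close> to
  one.\<close>

lemma variation_of_constants:
 fixes r :: "real => ennreal"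
 assumes c: "0 < c" and r[measurable]: "r : borel_measurable borel" and t: "0 <= t" and x: "0 <= x"
 defines "p \<equiv> %t. ennreal (x * exp (- c * t)) + (NN s. ennreal (exp (- c * (t - s))) * r s * indicator {0..t} s \<partial>lborel)"
 shows "p t + ennreal c * (NN s. p s * indicator {0..t} s \<partial>lborel) = ennreal x + (NN s. r s * indicator {0..t} s \<partial>lborel)"
  and "p : borel_measurable borel"
proof -
 let ?k = "%s v. ennreal (exp (- c * (s - v))) * r v * indicator {0..s} v :: ennreal"
 have k: "case_prod ?k : borel_measurable (lborel \<Otimes>\<^sub>M lborel)"
 proof -
  have "(%(s, v). ennreal (exp (- c * (s - v))) * r v * (if 0 <= v & v <= s then 1 else 0)) : borel_measurable (lborel \<Otimes>\<^sub>M lborel)"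
   by measurable
  also have "(%(s, v). ennreal (exp (- c * (s - v))) * r v * (if 0 <= v & v <= s then 1 else 0)) = case_prod ?k"
   by (auto simp: fun_eq_iff indicator_def)
  finally show ?thesis .
 qed
 have J[measurable]: "(%s. NN v. ?k s v \<partial>lborel) : borel_measurable borel"
  using lborel.borel_measurable_nn_integral[OF k] by simp
 show pm: "p : borel_measurable borel" unfolding p_def using J by measurable
 have "ennreal c * (NN s. p s * indicator {0..t} s \<partial>lborel)
   = (NN s. ennreal c * (p s * indicator {0..t} s) \<partial>lborel)"
  by (rule nn_integral_cmult[symmetric]) (use pm in measurable)
 also have "... = (NN s. ennreal x * (ennreal (c * exp (- c * (s - 0))) * indicator {0..t} s) +
   (NN v. ennreal c * ?k s v \<partial>lborel) * indicator {0..t} s \<partial>lborel)"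
 proof (rule nn_integral_cong)
  fix s
  have 1: "ennreal c * ennreal (x * exp (- c * s)) = ennreal x * ennreal (c * exp (- c * (s - 0)))"
   using c x by (simp add: ennreal_mult'[symmetric] mult_ac)
  have 2: "(NN v. ennreal c * ?k s v \<partial>lborel) = ennreal c * (NN v. ?k s v \<partial>lborel)"
   by (rule nn_integral_cmult) (use measurable_compose[OF measurable_Pair1'[of s lborel lborel] k] in simp)
  show "ennreal c * (p s * indicator {0..t} s) = ennreal x * (ennreal (c * exp (- c * (s - 0))) * indicator {0..t} s) +
   (NN v. ennreal c * ?k s v \<partial>lborel) * indicator {0..t} s"
  proof -
   have "ennreal c * (p s * indicator {0..t} s) = (ennreal c * ennreal (x * exp (- c * s))) * indicator {0..t} s + (ennreal c * (NN v. ?k s v \<partial>lborel)) * indicator {0..t} s"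
    unfolding p_def by (simp only: distrib_left distrib_right mult.assoc)
   then show ?thesis unfolding 1 2 by (simp only: mult.assoc)
  qed
 qed
 also have "... = (NN s. ennreal x * (ennreal (c * exp (- c * (s - 0))) * indicator {0..t} s) \<partial>lborel) +
   (NN s. (NN v. ennreal c * ?k s v \<partial>lborel) * indicator {0..t} s \<partial>lborel)"
 proof (rule nn_integral_add)
  have "(%s. NN v. ennreal c * ?k s v \<partial>lborel) = (%s. ennreal c * (NN v. ?k s v \<partial>lborel))"
   by (intro ext nn_integral_cmult) (use measurable_compose[OF measurable_Pair1'[of _ lborel lborel] k] in simp)
  then have "(%s. NN v. ennreal c * ?k s v \<partial>lborel) : borel_measurable lborel" using J by simp
  then show "(%s. (NN v. ennreal c * ?k s v \<partial>lborel) * indicator {0..t} s) : borel_measurable lborel"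
   by (intro borel_measurable_times_ennreal borel_measurable_indicator) auto
 qed measurable
 also have "(NN s. ennreal x * (ennreal (c * exp (- c * (s - 0))) * indicator {0..t} s) \<partial>lborel) = ennreal x * ennreal (1 - exp (- c * t))"
  using nn_integral_exp_decay[OF c t] by (subst nn_integral_cmult) auto
 also have "(NN s. (NN v. ennreal c * ?k s v \<partial>lborel) * indicator {0..t} s \<partial>lborel)
   = (NN s. NN v. ennreal c * ?k s v * indicator {0..t} s \<partial>lborel \<partial>lborel)"
  by (intro nn_integral_cong nn_integral_multc[symmetric])
    (use measurable_compose[OF measurable_Pair1'[of _ lborel lborel] k] in \<open>simp\<close>)
 also have "... = (NN v. NN s. ennreal c * ?k s v * indicator {0..t} s \<partial>lborel \<partial>lborel)"
 proof (rule nn_integral_swap[OF sigma_finite_lborel sigma_finite_lborel])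
  have "(%x. ennreal c * case_prod ?k x * indicator {0..t} (fst x)) : borel_measurable (lborel \<Otimes>\<^sub>M lborel)"
   by (intro borel_measurable_times_ennreal k measurable_compose[OF measurable_fst borel_measurable_indicator]) auto
  then show "(%(s, v). ennreal c * ?k s v * indicator {0..t} s) : borel_measurable (lborel \<Otimes>\<^sub>M lborel)"
   by (simp add: case_prod_beta')
 qed
 also have "... = (NN v. r v * indicator {0..t} v * ennreal (1 - exp (- c * (t - v))) \<partial>lborel)"
 proof (rule nn_integral_cong)
  fix v
  show "(NN s. ennreal c * ?k s v * indicator {0..t} s \<partial>lborel) = r v * indicator {0..t} v * ennreal (1 - exp (- c * (t - v)))"
  proof (cases "v : {0..t}")
   case True
   have "(NN s. ennreal c * ?k s v * indicator {0..t} s \<partial>lborel) = (NN s. r v * (ennreal (c * exp (- c * (s - v))) * indicator {v..t} s) \<partial>lborel)"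
    using True c by (intro nn_integral_cong) (auto simp: indicator_def ennreal_mult' mult_ac)
   also have "... = r v * ennreal (1 - exp (- c * (t - v)))"
    using nn_integral_exp_decay[OF c, of v t] True by (subst nn_integral_cmult) auto
   finally show ?thesis using True by simp
  next
   case False
   then have "(NN s. ennreal c * ?k s v * indicator {0..t} s \<partial>lborel) = (NN s. 0 \<partial>(lborel :: real measure))"
    by (intro nn_integral_cong) (auto simp: indicator_def)
   then show ?thesis using False by simp
  qed
 qed
 finally have I: "ennreal c * (NN s. p s * indicator {0..t} s \<partial>lborel) =
   ennreal x * ennreal (1 - exp (- c * t)) + (NN v. r v * indicator {0..t} v * ennreal (1 - exp (- c * (t - v))) \<partial>lborel)" .
 have "p t + ennreal c * (NN s. p s * indicator {0..t} s \<partial>lborel) =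
  (ennreal (x * exp (- c * t)) + ennreal x * ennreal (1 - exp (- c * t))) +
  ((NN s. ?k t s \<partial>lborel) + (NN v. r v * indicator {0..t} v * ennreal (1 - exp (- c * (t - v))) \<partial>lborel))"
  unfolding I unfolding p_def by (simp only: add_ac)
 also have "(NN s. ?k t s \<partial>lborel) + (NN v. r v * indicator {0..t} v * ennreal (1 - exp (- c * (t - v))) \<partial>lborel)
  = (NN s. ?k t s + r s * indicator {0..t} s * ennreal (1 - exp (- c * (t - s))) \<partial>lborel)"
  by (rule nn_integral_add[symmetric]) measurable
 also have "... = (NN s. r s * indicator {0..t} s \<partial>lborel)"
 proof (rule nn_integral_cong)
  fix s
  show "?k t s + r s * indicator {0..t} s * ennreal (1 - exp (- c * (t - s))) = r s * indicator {0..t} s"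
  proof (cases "s : {0..t}")
   case True
   then have "0 <= 1 - exp (- c * (t - s))" using c by simp
   then have "ennreal (exp (- c * (t - s))) + ennreal (1 - exp (- c * (t - s))) = ennreal 1"
    by (subst ennreal_plus[symmetric]) auto
   then have "r s * (ennreal (exp (- c * (t - s))) + ennreal (1 - exp (- c * (t - s)))) = r s" by simp
   then show ?thesis using True by (simp add: distrib_left mult.commute)
  qed simp
 qed
 also have "ennreal (x * exp (- c * t)) + ennreal x * ennreal (1 - exp (- c * t)) = ennreal x"
 proof -
  have "0 <= 1 - exp (- c * t)" using c t by simp
  then have "ennreal (x * exp (- c * t)) + ennreal x * ennreal (1 - exp (- c * t)) = ennreal (x * exp (- c * t) + x * (1 - exp (- c * t)))"
   using x by (simp add: ennreal_mult ennreal_plus)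
  then show ?thesis by (simp add: algebra_simps)
 qed
 finally show "p t + ennreal c * (NN s. p s * indicator {0..t} s \<partial>lborel) = ennreal x + (NN s. r s * indicator {0..t} s \<partial>lborel)" .
qed

text \<open>As \<open>nn_integral_diff_bound\<close>, but with the smaller of the two terms known to
  be finite: in the induction below only the earlier iterate is under control.\<close>

lemma nn_integral_cancel_le:
 fixes a b c d :: ennreal
 assumes "a + b <= c + d" "d <= b" "d < top"
 shows "a <= c"
proof -
 have "a + d <= c + d" using assms(1,2) by (meson add_left_mono order_trans)
 then show ?thesis using assms(3) by (simp add: ennreal_add_left_cancel_le add.commute[of _ d]) auto
qed

locale markov = ctmdp T A q \<gamma> w L R
 for T :: real and A :: "'s :: countable => 'a :: polish_space set"
  and q :: "'s => 's => 'a => real" and \<gamma> :: "'s pmf" and w :: "'s => real" and L R :: real +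
 fixes \<alpha> :: "real => 's => 'a"
 assumes \<alpha>_measurable [measurable]: "!!i. (%t. \<alpha> t i) : borel_measurable borel"
  and \<alpha>_in: "!!t i. \<alpha> t i : A i"
begin

definition diagp :: "real => 's => ennreal" where "diagp s i = ennreal (L * w i + q i i (\<alpha> s i))"

text \<open>Uniformised rates: fictitious jumps from \<open>i\<close> to itself at rate
  \<open>diagp\<close> fill the total rate up to \<open>L * w i\<close>, independent of time and
  action. The damping in the forward equation thus has a constant exponent.\<close>

definition rp :: "real => 's => 's => ennreal" where
 "rp s i j = inrate i (\<alpha> s i) j + (if j = i then diagp s i else 0)"

definition lev :: "nat => 's set" where "lev n = {i. w i <= real n}"

lemma diag_out: "diagp s i + outrate i (\<alpha> s i) = ennreal (L * w i)"
proof -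
 have "0 <= L * w i + q i i (\<alpha> s i)" "q i i (\<alpha> s i) <= 0"
  using q_diag[OF \<alpha>_in[of s i]] q_diag_nonpos[OF \<alpha>_in[of s i]] by linarith+
 then show ?thesis using \<alpha>_in[of s i] by (simp add: diagp_def outrate_def ennreal_plus[symmetric] del: ennreal_plus)
qed

lemma diagp_measurable [measurable]: "(%s. diagp s i) : borel_measurable borel"
proof -
 have "(%s. indicator (A i) (\<alpha> s i) * q i i (\<alpha> s i)) : borel_measurable borel"
  by (rule measurable_compose[OF \<alpha>_measurable qz_measurable])
 moreover have "(%s. indicator (A i) (\<alpha> s i) * q i i (\<alpha> s i)) = (%s. q i i (\<alpha> s i))" using \<alpha>_in by auto
 ultimately show ?thesis unfolding diagp_def by simp
qed

lemma inrate_\<alpha>_measurable [measurable]: "(%s. inrate i (\<alpha> s i) j) : borel_measurable borel"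
 by (rule measurable_compose[OF \<alpha>_measurable inrate_measurable])

lemma outrate_\<alpha>_measurable [measurable]: "(%s. outrate i (\<alpha> s i)) : borel_measurable borel"
 by (rule measurable_compose[OF \<alpha>_measurable outrate_measurable])

lemma rp_measurable [measurable]: "(%s. rp s i j) : borel_measurable borel"
 unfolding rp_def by measurable

lemma w3_rp: "(NN j. ennreal (w j ^ 3) * rp s i j \<partial>counting) <= ennreal R * ennreal (w i ^ 3) + ennreal (w i ^ 3) * ennreal (L * w i)"
proof -
 have "(NN j. ennreal (w j ^ 3) * rp s i j \<partial>counting) =
   (NN j. ennreal (w j ^ 3) * inrate i (\<alpha> s i) j \<partial>counting) + (NN j. ennreal (w j ^ 3) * (if j = i then diagp s i else 0) \<partial>counting)"
  unfolding rp_def distrib_left by (rule nn_integral_add) auto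
 also have "(NN j. ennreal (w j ^ 3) * (if j = i then diagp s i else 0) \<partial>counting) = ennreal (w i ^ 3) * diagp s i"
  by (subst nn_integral_count_space'[where A = "{i}"]) auto
 also have "(NN j. ennreal (w j ^ 3) * inrate i (\<alpha> s i) j \<partial>counting) <= ennreal (R * w i ^ 3) + ennreal (w i ^ 3) * outrate i (\<alpha> s i)"
  by (rule sum_w_inrate) simp
 finally have "(NN j. ennreal (w j ^ 3) * rp s i j \<partial>counting) <= ennreal (R * w i ^ 3) + ennreal (w i ^ 3) * (diagp s i + outrate i (\<alpha> s i))"
  by (simp add: distrib_left add_ac)
 then show ?thesis unfolding diag_out using R_pos by (simp add: ennreal_mult')
qed

text \<open>Picard iterates in Duhamel form, started at zero and hence increasing. The cut-off at
  \<open>lev n\<close> keeps the rates bounded for each single iterate; it is relaxed as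
  \<open>n\<close> grows, so the sequence stays increasing.\<close>

primrec PP :: "nat => real => 's => ennreal" where
 "PP 0 t j = 0"
| "PP (Suc n) t j = (if j : lev n then ennreal (pmf \<gamma> j * exp (- (L * w j) * t)) +
   (NN s. ennreal (exp (- (L * w j) * (t - s))) * (NN i. PP n s i * rp s i j \<partial>counting) * indicator {0..t} s \<partial>lborel) else 0)"

definition PI :: "nat => real => 's => ennreal" where
 "PI n s j = (NN i. PP n s i * rp s i j \<partial>counting)"

lemma Lw_pos: "0 < L * w i" using L_pos w_pos[of i] by simp

lemma count_measurable:
 assumes [measurable]: "!!i. (%s. f s i) : borel_measurable borel"
 shows "(%s. NN i. f s i \<partial>count_space (UNIV :: 's set)) : borel_measurable borel"
proof -
 interpret C: sigma_finite_measure "count_space (UNIV :: 's set)" by (rule sigma_finite_count_countable)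
 show ?thesis by (rule C.borel_measurable_nn_integral, rule measurable_pair_count2) simp
qed

lemma PP_measurable [measurable]: "(%t. PP n t j) : borel_measurable borel"
proof (induction n arbitrary: j)
 case (Suc n)
 have "(%s. NN i. PP n s i * rp s i j \<partial>counting) : borel_measurable borel"
  by (rule count_measurable) (use Suc in measurable)
 from variation_of_constants(2)[OF Lw_pos this, of 0 "pmf \<gamma> j" j] show ?case
  by (cases "j : lev n") simp_all
qed simp

lemma PI_measurable [measurable]: "(%s. PI n s j) : borel_measurable borel"
 unfolding PI_def by (rule count_measurable) measurable

lemma PP_eq:
 assumes "0 <= t"
 shows "PP (Suc n) t j + ennreal (L * w j) * (NN s. PP (Suc n) s j * indicator {0..t} s \<partial>lborel)
  = (if j : lev n then ennreal (pmf \<gamma> j) + (NN s. PI n s j * indicator {0..t} s \<partial>lborel) else 0)"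
 using variation_of_constants(1)[OF Lw_pos PI_measurable[of n j] assms, of "pmf \<gamma> j" j]
 by (cases "j : lev n") (simp_all add: PI_def)

lemma lev_mono: "m <= n ==> lev m \<subseteq> lev n" by (auto simp: lev_def)

lemma PP_Suc: "PP (Suc n) t j = (if j : lev n then ennreal (pmf \<gamma> j * exp (- (L * w j) * t)) +
   (NN s. ennreal (exp (- (L * w j) * (t - s))) * PI n s j * indicator {0..t} s \<partial>lborel) else 0)"
 by (simp add: PI_def)

lemma PP_mono_Suc: "PP n t j <= PP (Suc n) t j"
proof (induction n arbitrary: t j)
 case (Suc n)
 have "PI n s j <= PI (Suc n) s j" for s
  unfolding PI_def using Suc by (intro nn_integral_mono mult_right_mono) auto
 then have "(NN s. ennreal (exp (- (L * w j) * (t - s))) * PI n s j * indicator {0..t} s \<partial>lborel)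
   <= (NN s. ennreal (exp (- (L * w j) * (t - s))) * PI (Suc n) s j * indicator {0..t} s \<partial>lborel)"
  by (intro nn_integral_mono mult_right_mono mult_left_mono) auto
 then show ?case using lev_mono[of n "Suc n"] unfolding PP_Suc[of n] PP_Suc[of "Suc n"] by (auto intro: add_left_mono)
qed simp

lemma PP_incseq: "incseq (%n. PP n t j)" by (rule incseq_SucI) (rule PP_mono_Suc)

lemma PP_support: "j \<notin> lev n ==> PP n t j = 0"
 using lev_mono[of "n - 1" n] by (cases n) auto

text \<open>The third moment of an iterate; \<open>ZZ\<close> is the same with the uniformised rate
  as an additional weight, so of fourth order.\<close>

definition YY :: "nat => real => ennreal" where
 "YY n t = (NN j. ennreal (w j ^ 3) * PP n t j \<partial>counting)"
definition ZZ :: "nat => real => ennreal" where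
 "ZZ n t = (NN j. ennreal (w j ^ 3) * (ennreal (L * w j) * PP n t j) \<partial>counting)"

lemma YY_measurable [measurable]: "YY n : borel_measurable borel"
 unfolding YY_def[abs_def] by (rule count_measurable) measurable
lemma ZZ_measurable [measurable]: "ZZ n : borel_measurable borel"
 unfolding ZZ_def[abs_def] by (rule count_measurable) measurable

lemma ZZ_le_YY: "ZZ n t <= ennreal (L * real n) * YY n t"
proof -
 have "ZZ n t <= (NN j. ennreal (L * real n) * (ennreal (w j ^ 3) * PP n t j) \<partial>counting)"
  unfolding ZZ_def
 proof (rule nn_integral_mono)
  fix j
  show "ennreal (w j ^ 3) * (ennreal (L * w j) * PP n t j) <= ennreal (L * real n) * (ennreal (w j ^ 3) * PP n t j)"
  proof (cases "j : lev n")
   case True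
   then have "ennreal (L * w j) <= ennreal (L * real n)" using L_pos by (intro ennreal_leI) (simp add: lev_def)
   then have "ennreal (L * w j) * (ennreal (w j ^ 3) * PP n t j) <= ennreal (L * real n) * (ennreal (w j ^ 3) * PP n t j)"
    by (rule mult_right_mono) simp
   then show ?thesis by (simp only: mult_ac)
  qed (simp add: PP_support)
 qed
 then show ?thesis by (simp add: nn_integral_cmult YY_def)
qed

text \<open>\<open>PP_eq\<close> is summed against \<open>w ^ 3\<close>. By \<open>w3_rp\<close> the
  inflow contributes \<open>R * YY n + ZZ n\<close>, while the left side carries
  \<open>ZZ (Suc n)\<close>. The fourth-order terms have no bound uniform in \<open>n\<close>, but
  they cancel because the iterates increase.\<close>

lemma YY_step:
 assumes t: "0 <= t" and fin: "(NN s. ZZ n s * indicator {0..t} s \<partial>lborel) < \<infinity>"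
 shows "YY (Suc n) t <= w3_const + ennreal R * (NN s. YY n s * indicator {0..t} s \<partial>lborel)"
proof -
 have swap: "(NN j. (NN s. f s j * indicator {0..t} s \<partial>lborel) \<partial>counting) = (NN s. (NN j. f s j \<partial>counting) * indicator {0..t} s \<partial>lborel)"
  if [measurable]: "!!j. (%s. f s j) : borel_measurable borel" for f :: "real => 's => ennreal"
 proof -
  have "(NN j. (NN s. f s j * indicator {0..t} s \<partial>lborel) \<partial>counting) = (NN s. (NN j. f s j * indicator {0..t} s \<partial>counting) \<partial>lborel)"
   by (rule nn_integral_swap[OF sigma_finite_count_countable sigma_finite_lborel]) (rule measurable_pair_measure_countable1; simp)
  then show ?thesis by (simp add: nn_integral_multc)
 qed
 have "YY (Suc n) t + (NN s. ZZ (Suc n) s * indicator {0..t} s \<partial>lborel)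
  = (NN j. ennreal (w j ^ 3) * PP (Suc n) t j \<partial>counting) + (NN j. (NN s. ennreal (w j ^ 3) * (ennreal (L * w j) * PP (Suc n) s j) * indicator {0..t} s \<partial>lborel) \<partial>counting)"
  unfolding YY_def ZZ_def by (subst swap) (auto simp del: PP.simps)
 also have "... = (NN j. ennreal (w j ^ 3) * PP (Suc n) t j + (NN s. ennreal (w j ^ 3) * (ennreal (L * w j) * PP (Suc n) s j) * indicator {0..t} s \<partial>lborel) \<partial>counting)"
  by (rule nn_integral_add[symmetric]) auto
 also have "... <= (NN j. ennreal (w j ^ 3) * ennreal (pmf \<gamma> j) + (NN s. ennreal (w j ^ 3) * PI n s j * indicator {0..t} s \<partial>lborel) \<partial>counting)"
 proof (rule nn_integral_mono)
  fix j
  have "ennreal (w j ^ 3) * PP (Suc n) t j + (NN s. ennreal (w j ^ 3) * (ennreal (L * w j) * PP (Suc n) s j) * indicator {0..t} s \<partial>lborel)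
   = ennreal (w j ^ 3) * (PP (Suc n) t j + ennreal (L * w j) * (NN s. PP (Suc n) s j * indicator {0..t} s \<partial>lborel))"
   by (simp add: nn_integral_cmult distrib_left mult.assoc del: PP.simps)
  also have "... <= ennreal (w j ^ 3) * (ennreal (pmf \<gamma> j) + (NN s. PI n s j * indicator {0..t} s \<partial>lborel))"
   unfolding PP_eq[OF t] by (intro mult_left_mono) auto
  also have "... = ennreal (w j ^ 3) * ennreal (pmf \<gamma> j) + (NN s. ennreal (w j ^ 3) * PI n s j * indicator {0..t} s \<partial>lborel)"
   by (simp add: nn_integral_cmult distrib_left mult.assoc)
  finally show "ennreal (w j ^ 3) * PP (Suc n) t j + (NN s. ennreal (w j ^ 3) * (ennreal (L * w j) * PP (Suc n) s j) * indicator {0..t} s \<partial>lborel)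
   <= ennreal (w j ^ 3) * ennreal (pmf \<gamma> j) + (NN s. ennreal (w j ^ 3) * PI n s j * indicator {0..t} s \<partial>lborel)" .
 qed
 also have "... = (NN j. ennreal (w j ^ 3) * ennreal (pmf \<gamma> j) \<partial>counting) + (NN j. (NN s. ennreal (w j ^ 3) * PI n s j * indicator {0..t} s \<partial>lborel) \<partial>counting)"
  by (rule nn_integral_add) auto
 also have "(NN j. (NN s. ennreal (w j ^ 3) * PI n s j * indicator {0..t} s \<partial>lborel) \<partial>counting) = (NN s. (NN j. ennreal (w j ^ 3) * PI n s j \<partial>counting) * indicator {0..t} s \<partial>lborel)"
  by (rule swap) measurable
 also have "... <= (NN s. (ennreal R * YY n s + ZZ n s) * indicator {0..t} s \<partial>lborel)"
 proof (intro nn_integral_mono mult_right_mono)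
  fix s
  have "(NN j. ennreal (w j ^ 3) * PI n s j \<partial>counting) = (NN j. NN i. PP n s i * (ennreal (w j ^ 3) * rp s i j) \<partial>counting \<partial>counting)"
   unfolding PI_def by (subst nn_integral_cmult[symmetric]) (auto simp: mult_ac)
  also have "... = (NN i. NN j. PP n s i * (ennreal (w j ^ 3) * rp s i j) \<partial>counting \<partial>counting)"
   by (rule nn_integral_swap[OF sigma_finite_count_countable sigma_finite_count_countable]) (simp add: pair_measure_countable)
  also have "... <= (NN i. ennreal R * (ennreal (w i ^ 3) * PP n s i) + ennreal (w i ^ 3) * (ennreal (L * w i) * PP n s i) \<partial>counting)"
  proof (rule nn_integral_mono)
   fix i
   have "(NN j. PP n s i * (ennreal (w j ^ 3) * rp s i j) \<partial>counting) = PP n s i * (NN j. ennreal (w j ^ 3) * rp s i j \<partial>counting)"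
    by (rule nn_integral_cmult) simp
   also have "... <= PP n s i * (ennreal R * ennreal (w i ^ 3) + ennreal (w i ^ 3) * ennreal (L * w i))"
    by (intro mult_left_mono w3_rp) simp
   also have "... = ennreal R * (ennreal (w i ^ 3) * PP n s i) + ennreal (w i ^ 3) * (ennreal (L * w i) * PP n s i)"
    by (simp only: distrib_left mult_ac)
   finally show "(NN j. PP n s i * (ennreal (w j ^ 3) * rp s i j) \<partial>counting) <= ennreal R * (ennreal (w i ^ 3) * PP n s i) + ennreal (w i ^ 3) * (ennreal (L * w i) * PP n s i)" .
  qed
  also have "... = ennreal R * YY n s + ZZ n s"
   unfolding YY_def ZZ_def by (simp add: nn_integral_add nn_integral_cmult)
  finally show "(NN j. ennreal (w j ^ 3) * PI n s j \<partial>counting) <= ennreal R * YY n s + ZZ n s" .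
 qed simp
 also have "... = ennreal R * (NN s. YY n s * indicator {0..t} s \<partial>lborel) + (NN s. ZZ n s * indicator {0..t} s \<partial>lborel)"
  by (simp add: distrib_right nn_integral_add nn_integral_cmult mult.assoc)
 also have "(NN j. ennreal (w j ^ 3) * ennreal (pmf \<gamma> j) \<partial>counting) <= w3_const"
 proof -
  have "(NN j. ennreal (w j ^ 3) * ennreal (pmf \<gamma> j) \<partial>counting) = 1 * (NN j. ennreal (w j ^ 3 * pmf \<gamma> j) \<partial>counting)"
   using w_pos by (simp add: ennreal_mult' less_imp_le)
  also have "... <= w3_const" unfolding w3_const_def using R_pos T_pos by (intro mult_right_mono) auto
  finally show ?thesis .
 qed
 finally have "YY (Suc n) t + (NN s. ZZ (Suc n) s * indicator {0..t} s \<partial>lborel)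
   <= (w3_const + ennreal R * (NN s. YY n s * indicator {0..t} s \<partial>lborel)) + (NN s. ZZ n s * indicator {0..t} s \<partial>lborel)"
  by (simp add: add.assoc)
 then show ?thesis
 proof (rule nn_integral_cancel_le)
  show "(NN s. ZZ n s * indicator {0..t} s \<partial>lborel) <= (NN s. ZZ (Suc n) s * indicator {0..t} s \<partial>lborel)"
   unfolding ZZ_def by (intro nn_integral_mono mult_right_mono mult_left_mono PP_mono_Suc) auto
 qed (use fin in simp)
qed

text \<open>The bound reproduces itself in the recursion: \<open>c\<close> plus \<open>R\<close>
  times the integral of \<open>c * exp (R * s)\<close> over \<open>[0, t]\<close> is
  \<open>c * exp (R * t)\<close>. The cut-off supplies the finiteness of the cancelled term.\<close>

lemma YY_bound:
 assumes c: "w3_const = ennreal c" "0 <= c" and t: "0 <= t"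
 shows "YY n t <= ennreal (c * exp (R * t))"
 using t
proof (induction n arbitrary: t)
 case 0 then show ?case by (simp add: YY_def)
next
 case (Suc n)
 have Yi: "(NN s. YY n s * indicator {0..t} s \<partial>lborel) <= ennreal (c * ((exp (R * t) - 1) / R))"
 proof -
  have "(NN s. YY n s * indicator {0..t} s \<partial>lborel) <= (NN s. ennreal c * (ennreal (exp (R * s)) * indicator {0..t} s) \<partial>lborel)"
   using Suc.IH c by (intro nn_integral_mono) (auto simp: indicator_def ennreal_mult)
  also have "... = ennreal c * ennreal ((exp (R * t) - 1) / R)"
   using nn_integral_exp_Icc[OF R_pos Suc.prems] by (subst nn_integral_cmult) auto
  finally show ?thesis using c by (simp only: ennreal_mult')
 qed
 have "(NN s. ZZ n s * indicator {0..t} s \<partial>lborel) <= (NN s. ennreal (L * real n) * (YY n s * indicator {0..t} s) \<partial>lborel)"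
  using ZZ_le_YY by (intro nn_integral_mono) (auto simp: indicator_def)
 also have "... = ennreal (L * real n) * (NN s. YY n s * indicator {0..t} s \<partial>lborel)"
  by (rule nn_integral_cmult) measurable
 also have "... < \<infinity>" using le_less_trans[OF Yi] by (simp add: ennreal_mult_less_top)
 finally have fin: "(NN s. ZZ n s * indicator {0..t} s \<partial>lborel) < \<infinity>" .
 have "YY (Suc n) t <= ennreal c + ennreal R * ennreal (c * ((exp (R * t) - 1) / R))"
  using YY_step[OF Suc.prems fin] mult_left_mono[OF Yi, of "ennreal R"] unfolding c(1) by (meson add_left_mono order_trans zero_le)
 also have "... = ennreal (c + R * (c * ((exp (R * t) - 1) / R)))"
  using c R_pos Suc.prems by (simp add: ennreal_mult'[symmetric])
 also have "c + R * (c * ((exp (R * t) - 1) / R)) = c * exp (R * t)" using R_pos by (simp add: field_simps)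
 finally show ?case .
qed

end

lemma incseq_SUP_shift:
 fixes f :: "nat => ennreal"
 assumes "incseq f" shows "(SUP n. f (n + k)) = (SUP n. f n)"
proof (rule antisym)
 show "(SUP n. f n) <= (SUP n. f (n + k))"
 proof (rule SUP_least)
  fix n
  have "f n <= f (n + k)" using assms by (rule incseqD) simp
  then show "f n <= (SUP n. f (n + k))" by (rule SUP_upper2[OF UNIV_I])
 qed
qed (auto intro!: SUP_least SUP_upper)

section \<open>The limit of the iterates and its occupation measure\<close>

context markov
begin

definition Pinf :: "real => 's => ennreal" where "Pinf t j = (SUP n. PP n t j)"

lemma Pinf_measurable [measurable]: "(%t. Pinf t j) : borel_measurable borel"
 unfolding Pinf_def by measurable

lemma Pinf_integral:
 "(NN s. Pinf s j * indicator {0..t} s \<partial>lborel) = (SUP n. NN s. PP n s j * indicator {0..t} s \<partial>lborel)"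
proof -
 have "(NN s. (SUP n. PP n s j * indicator {0..t} s) \<partial>lborel) = (SUP n. NN s. PP n s j * indicator {0..t} s \<partial>lborel)"
  by (rule nn_integral_monotone_convergence_SUP)
    (use PP_mono_Suc in \<open>auto simp: incseq_Suc_iff le_fun_def intro!: mult_right_mono simp del: PP.simps\<close>)
 then show ?thesis by (simp add: Pinf_def SUP_mult_right_ennreal)
qed

lemma Pinf_in_integral:
 "(NN s. (NN i. Pinf s i * rp s i j \<partial>counting) * indicator {0..t} s \<partial>lborel) = (SUP n. NN s. PI n s j * indicator {0..t} s \<partial>lborel)"
proof -
 have PIi: "PI n s j <= PI (Suc n) s j" for n s
  unfolding PI_def by (intro nn_integral_mono mult_right_mono PP_mono_Suc) simp
 have "(NN i. Pinf s i * rp s i j \<partial>counting) = (SUP n. PI n s j)" for s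
 proof -
  have "(NN i. (SUP n. PP n s i * rp s i j) \<partial>counting) = (SUP n. PI n s j)"
   unfolding PI_def by (rule nn_integral_monotone_convergence_SUP)
    (use PP_mono_Suc in \<open>auto simp: incseq_Suc_iff le_fun_def intro!: mult_right_mono simp del: PP.simps\<close>)
  then show ?thesis by (simp add: Pinf_def SUP_mult_right_ennreal)
 qed
 then have "(NN s. (NN i. Pinf s i * rp s i j \<partial>counting) * indicator {0..t} s \<partial>lborel) = (NN s. (SUP n. PI n s j * indicator {0..t} s) \<partial>lborel)"
  by (simp add: SUP_mult_right_ennreal)
 also have "... = (SUP n. NN s. PI n s j * indicator {0..t} s \<partial>lborel)"
  by (rule nn_integral_monotone_convergence_SUP)
    (use PIi in \<open>auto simp: incseq_Suc_iff le_fun_def intro!: mult_right_mono\<close>)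
 finally show ?thesis .
qed

lemma Pinf_eq:
 assumes t: "0 <= t"
 shows "Pinf t j + ennreal (L * w j) * (NN s. Pinf s j * indicator {0..t} s \<partial>lborel)
  = ennreal (pmf \<gamma> j) + (NN s. (NN i. Pinf s i * rp s i j \<partial>counting) * indicator {0..t} s \<partial>lborel)"
proof -
 \<comment> \<open>From this index on the level contains \<open>j\<close> and the cut-off in
   \<open>PP_eq\<close> is inactive. The shift by one more reflects that iterate
   \<open>Suc n\<close> is driven by the inflow of iterate \<open>n\<close>.\<close>
 define k where "k = nat \<lceil>w j\<rceil>"
 have j: "j : lev (n + k)" for n unfolding k_def lev_def by simp linarith
 let ?a = "%n. PP n t j" and ?b = "%n. ennreal (L * w j) * (NN s. PP n s j * indicator {0..t} s \<partial>lborel)"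
  and ?c = "%n. NN s. PI n s j * indicator {0..t} s \<partial>lborel"
 have ia: "incseq ?a" by (rule PP_incseq)
 have ib: "incseq ?b"
  by (rule incseq_SucI) (intro mult_left_mono nn_integral_mono mult_right_mono PP_mono_Suc; simp)
 have ic: "incseq ?c"
  unfolding PI_def by (rule incseq_SucI) (intro nn_integral_mono mult_right_mono PP_mono_Suc; simp)
 have eq: "?a (n + Suc k) + ?b (n + Suc k) = ennreal (pmf \<gamma> j) + ?c (n + k)" for n
  using PP_eq[OF t, of "n + k" j] j[of n] by (simp only: add_Suc_right if_True)
 have "(SUP n. ?a (n + Suc k) + ?b (n + Suc k)) = (SUP n. ?a n) + (SUP n. ?b n)"
  using incseq_SUP_shift[of "%n. ?a n + ?b n" "Suc k"] ennreal_SUP_add[OF ia ib] ia ib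
  by (simp only: incseq_def) (metis (no_types, lifting) add_mono)
 moreover have "(SUP n. ennreal (pmf \<gamma> j) + ?c (n + k)) = ennreal (pmf \<gamma> j) + (SUP n. ?c n)"
 proof -
  have "incseq (%n. ?c (n + k))" using ic by (auto simp: incseq_def)
  then have "(SUP n. ennreal (pmf \<gamma> j) + ?c (n + k)) = (SUP n :: nat. ennreal (pmf \<gamma> j)) + (SUP n. ?c (n + k))"
   by (intro ennreal_SUP_add incseq_const)
  then show ?thesis by (simp add: incseq_SUP_shift[OF ic])
 qed
 ultimately have "(SUP n. ?a n) + (SUP n. ?b n) = ennreal (pmf \<gamma> j) + (SUP n. ?c n)" by (simp only: eq)
 moreover have "(SUP n. ?b n) = ennreal (L * w j) * (NN s. Pinf s j * indicator {0..t} s \<partial>lborel)"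
  unfolding Pinf_integral by (rule SUP_mult_left_ennreal[symmetric])
 ultimately show ?thesis unfolding Pinf_in_integral by (simp only: Pinf_def)
qed

lemma Pinf_moment:
 obtains C where "0 <= C" "!!t. t : {0..T} ==> (NN j. ennreal (w j ^ 3) * Pinf t j \<partial>counting) <= ennreal C"
proof -
 obtain c where c: "w3_const = ennreal c" "0 <= c" using w3_const_finite by (cases w3_const) auto
 show ?thesis
 proof (rule that)
  show "0 <= c * exp (R * T)" using c by simp
  fix t assume t: "t : {0..T}"
  have "(NN j. (SUP n. ennreal (w j ^ 3) * PP n t j) \<partial>counting) = (SUP n. YY n t)"
   unfolding YY_def by (rule nn_integral_monotone_convergence_SUP)
    (use PP_mono_Suc in \<open>auto simp: incseq_Suc_iff le_fun_def intro!: mult_left_mono simp del: PP.simps\<close>)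
  also have "... <= ennreal (c * exp (R * T))"
  proof (rule SUP_least)
   fix n
   have "YY n t <= ennreal (c * exp (R * t))" using t by (intro YY_bound[OF c]) auto
   also have "... <= ennreal (c * exp (R * T))" using t c R_pos by (intro ennreal_leI mult_left_mono) auto
   finally show "YY n t <= ennreal (c * exp (R * T))" .
  qed
  finally show "(NN j. ennreal (w j ^ 3) * Pinf t j \<partial>counting) <= ennreal (c * exp (R * T))"
   by (simp add: Pinf_def SUP_mult_left_ennreal)
 qed
qed

text \<open>The fictitious self-jumps contribute the same integral to both sides of
  \<open>Pinf_eq\<close>. It is finite because the third moment bounds \<open>Pinf\<close>, and so
  it can be removed.\<close>

lemma Pinf_forward:
 assumes t: "0 <= t" "t <= T"
 shows "Pinf t j + (NN s. Pinf s j * outrate j (\<alpha> s j) * indicator {0..t} s \<partial>lborel)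
  = ennreal (pmf \<gamma> j) + (NN s. (NN i. Pinf s i * inrate i (\<alpha> s i) j \<partial>counting) * indicator {0..t} s \<partial>lborel)"
proof -
 let ?D = "NN s. Pinf s j * diagp s j * indicator {0..t} s \<partial>lborel"
 let ?O = "NN s. Pinf s j * outrate j (\<alpha> s j) * indicator {0..t} s \<partial>lborel"
 let ?I = "NN s. (NN i. Pinf s i * inrate i (\<alpha> s i) j \<partial>counting) * indicator {0..t} s \<partial>lborel"
 have mI: "(%s. NN i. Pinf s i * inrate i (\<alpha> s i) j \<partial>counting) : borel_measurable borel"
  by (rule count_measurable) measurable
 have O: "ennreal (L * w j) * (NN s. Pinf s j * indicator {0..t} s \<partial>lborel) = ?D + ?O"
 proof -
  have "ennreal (L * w j) * (NN s. Pinf s j * indicator {0..t} s \<partial>lborel) = (NN s. ennreal (L * w j) * (Pinf s j * indicator {0..t} s) \<partial>lborel)"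
   by (rule nn_integral_cmult[symmetric]) measurable
  also have "... = (NN s. Pinf s j * diagp s j * indicator {0..t} s + Pinf s j * outrate j (\<alpha> s j) * indicator {0..t} s \<partial>lborel)"
  proof (rule nn_integral_cong)
   fix s
   show "ennreal (L * w j) * (Pinf s j * indicator {0..t} s) = Pinf s j * diagp s j * indicator {0..t} s + Pinf s j * outrate j (\<alpha> s j) * indicator {0..t} s"
    unfolding diag_out[of s j, symmetric] by (simp only: distrib_right distrib_left mult_ac)
  qed
  also have "... = ?D + ?O" by (rule nn_integral_add) measurable
  finally show ?thesis .
 qed
 have I: "(NN s. (NN i. Pinf s i * rp s i j \<partial>counting) * indicator {0..t} s \<partial>lborel) = ?I + ?D"
 proof -
  have "(NN i. Pinf s i * rp s i j \<partial>counting) = (NN i. Pinf s i * inrate i (\<alpha> s i) j \<partial>counting) + Pinf s j * diagp s j" for s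
  proof -
   have "(NN i. Pinf s i * rp s i j \<partial>counting) = (NN i. Pinf s i * inrate i (\<alpha> s i) j \<partial>counting) + (NN i. Pinf s i * (if j = i then diagp s i else 0) \<partial>counting)"
    unfolding rp_def distrib_left by (rule nn_integral_add) auto
   also have "(NN i. Pinf s i * (if j = i then diagp s i else 0) \<partial>counting) = Pinf s j * diagp s j"
    by (subst nn_integral_count_space'[where A = "{j}"]) auto
   finally show ?thesis .
  qed
  then have "(NN s. (NN i. Pinf s i * rp s i j \<partial>counting) * indicator {0..t} s \<partial>lborel)
   = (NN s. (NN i. Pinf s i * inrate i (\<alpha> s i) j \<partial>counting) * indicator {0..t} s + Pinf s j * diagp s j * indicator {0..t} s \<partial>lborel)"
   by (simp only: distrib_right)
  also have "... = ?I + ?D"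
   using mI by (intro nn_integral_add borel_measurable_times_ennreal) auto
  finally show ?thesis .
 qed
 obtain C where C: "0 <= C" "!!t. t : {0..T} ==> (NN j. ennreal (w j ^ 3) * Pinf t j \<partial>counting) <= ennreal C"
  using Pinf_moment by metis
 have Pj: "Pinf s j <= ennreal C" if "s : {0..T}" for s
 proof -
  have "Pinf s j <= ennreal (w j ^ 3) * Pinf s j"
   using mult_right_mono[of 1 "ennreal (w j ^ 3)" "Pinf s j"] w_ge_1[of j] by (simp add: one_le_power)
  also have "... = (NN i. ennreal (w i ^ 3) * Pinf s i * indicator {j} i \<partial>counting)" by simp
  also have "... <= (NN i. ennreal (w i ^ 3) * Pinf s i \<partial>counting)"
   by (intro nn_integral_mono) (auto simp: indicator_def)
  also have "... <= ennreal C" by (rule C(2)[OF that])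
  finally show ?thesis .
 qed
 have "?D <= (NN s. ennreal C * ennreal (L * w j) * indicator {0..t} s \<partial>lborel)"
 proof (rule nn_integral_mono)
  fix s
  have d: "diagp s j <= ennreal (L * w j)" unfolding diag_out[of s j, symmetric] by (simp add: add_increasing2)
  show "Pinf s j * diagp s j * indicator {0..t} s <= ennreal C * ennreal (L * w j) * indicator {0..t} s"
  proof (cases "s : {0..t}")
   case True
   then show ?thesis using mult_mono[OF Pj d, of s] t by (auto simp: indicator_def)
  qed simp
 qed
 also have "... < \<infinity>" using t by (simp add: nn_integral_cmult_indicator ennreal_mult_less_top)
 finally have Dfin: "?D < \<infinity>" .
 have "?D + (Pinf t j + ?O) = ?D + (ennreal (pmf \<gamma> j) + ?I)"
  using Pinf_eq[OF t(1), of j] unfolding O I by (simp only: add_ac)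
 then show ?thesis using Dfin ennreal_add_left_cancel[of ?D] by auto
qed

definition mocc :: "(real \<times> 's \<times> 'a) measure" where
 "mocc = distr (density (lborel \<Otimes>\<^sub>M counting) (%x. ennreal (1 / T) * Pinf (fst x) (snd x) * indicator {0..T} (fst x))) Xs
   (%x. (max 0 (min T (fst x)), snd x, \<alpha> (fst x) (snd x)))"

lemma Pinf_pair_measurable: "(%x. Pinf (fst x) (snd x)) : borel_measurable (lborel \<Otimes>\<^sub>M counting)"
 by (rule measurable_pair_count2) simp

lemma mdens_measurable:
 "(%x. ennreal (1 / T) * Pinf (fst x) (snd x) * indicator {0..T} (fst x)) : borel_measurable (lborel \<Otimes>\<^sub>M count_space (UNIV :: 's set))"
 by (rule measurable_pair_count2) simp

lemma mmap_measurable: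
 "(%x. (max 0 (min T (fst x)), snd x, \<alpha> (fst x) (snd x))) : lborel \<Otimes>\<^sub>M counting \<rightarrow>\<^sub>M Xs"
 unfolding X_space_def
proof (rule measurable_restrict_space2)
 show "(%x. (max 0 (min T (fst x)), snd x, \<alpha> (fst x) (snd x))) : space (lborel \<Otimes>\<^sub>M counting) \<rightarrow> {(t, i, a). t : {0..T} & a : A i}"
  using T_pos \<alpha>_in by auto
 have "(%x. \<alpha> (fst x) (snd x)) : lborel \<Otimes>\<^sub>M counting \<rightarrow>\<^sub>M borel"
  by (rule measurable_pair_count2) simp
 then show "(%x. (max 0 (min T (fst x)), snd x, \<alpha> (fst x) (snd x))) : lborel \<Otimes>\<^sub>M counting \<rightarrow>\<^sub>M Zs"
  by measurable
qed

lemma sets_mocc: "sets mocc = sets Xs" by (simp add: mocc_def)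

lemma mocc_integral:
 assumes f: "f : borel_measurable Xs"
 shows "(NN x. f x \<partial>mocc) = ennreal (1 / T) * (NN t. (NN j. f (t, j, \<alpha> t j) * Pinf t j * indicator {0..T} t \<partial>counting) \<partial>lborel)"
proof -
 interpret C: sigma_finite_measure "count_space (UNIV :: 's set)" by (rule sigma_finite_count_countable)
 let ?N = "lborel \<Otimes>\<^sub>M count_space (UNIV :: 's set)"
 let ?m = "%x. (max 0 (min T (fst x)), snd x, \<alpha> (fst x) (snd x))"
 have fm: "(%x. f (?m x)) : borel_measurable ?N" by (rule measurable_compose[OF mmap_measurable f])
 have "(NN x. f x \<partial>mocc) = (NN x. f (?m x) \<partial>density ?N (%x. ennreal (1 / T) * Pinf (fst x) (snd x) * indicator {0..T} (fst x)))"
  unfolding mocc_def by (rule nn_integral_distr) (use mmap_measurable f in simp_all)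
 also have "... = (NN x. ennreal (1 / T) * Pinf (fst x) (snd x) * indicator {0..T} (fst x) * f (?m x) \<partial>?N)"
  by (rule nn_integral_density[OF mdens_measurable fm])
 also have "... = (NN x. ennreal (1 / T) * (f (?m x) * Pinf (fst x) (snd x) * indicator {0..T} (fst x)) \<partial>?N)"
  by (intro nn_integral_cong) (simp only: mult_ac)
 also have "... = ennreal (1 / T) * (NN x. f (?m x) * Pinf (fst x) (snd x) * indicator {0..T} (fst x) \<partial>?N)"
 proof (rule nn_integral_cmult)
  show "(%x. f (?m x) * Pinf (fst x) (snd x) * indicator {0..T} (fst x)) : borel_measurable ?N"
   by (intro borel_measurable_times_ennreal fm Pinf_pair_measurable measurable_compose[OF measurable_fst borel_measurable_indicator]) simp
 qed
 also have "(NN x. f (?m x) * Pinf (fst x) (snd x) * indicator {0..T} (fst x) \<partial>?N) = (NN t. (NN j. f (?m (t, j)) * Pinf t j * indicator {0..T} t \<partial>counting) \<partial>lborel)"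
 proof (subst C.nn_integral_fst[symmetric])
  show "(%x. f (?m x) * Pinf (fst x) (snd x) * indicator {0..T} (fst x)) : borel_measurable ?N"
   by (intro borel_measurable_times_ennreal fm Pinf_pair_measurable measurable_compose[OF measurable_fst borel_measurable_indicator]) simp
 qed simp
 also have "... = (NN t. (NN j. f (t, j, \<alpha> t j) * Pinf t j * indicator {0..T} t \<partial>counting) \<partial>lborel)"
  by (intro nn_integral_cong) (auto simp: indicator_def)
 finally show ?thesis .
qed

lemma mocc_rate:
 assumes r: "!!i. r i : borel_measurable borel" and t: "0 <= t" "t <= T"
 shows "ennreal T * (NN (s, i, a). indicator {..t} s * r i a \<partial>mocc) = (NN s. (NN i. Pinf s i * r i (\<alpha> s i) \<partial>counting) * indicator {0..t} s \<partial>lborel)"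
proof -
 have T1: "ennreal T * (ennreal (1 / T) * c) = c" for c
  using T_pos by (simp add: mult.assoc[symmetric] ennreal_mult[symmetric])
 have "(%(s, i, a). indicator {..t} s * r i a) : borel_measurable Xs"
  by (rule measurable_Xs_I, rule measurable_by_state) (use r in measurable)
 from mocc_integral[OF this]
 have "ennreal T * (NN (s, i, a). indicator {..t} s * r i a \<partial>mocc) = (NN s. (NN i. indicator {..t} s * r i (\<alpha> s i) * Pinf s i * indicator {0..T} s \<partial>counting) \<partial>lborel)"
  by (simp add: T1)
 also have "... = (NN s. (NN i. Pinf s i * r i (\<alpha> s i) \<partial>counting) * indicator {0..t} s \<partial>lborel)"
 proof (rule nn_integral_cong)
  fix s
  have "(NN i. indicator {..t} s * r i (\<alpha> s i) * Pinf s i * indicator {0..T} s \<partial>counting) = (NN i. Pinf s i * r i (\<alpha> s i) * indicator {0..t} s \<partial>counting)"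
   using t by (intro nn_integral_cong) (auto simp: indicator_def mult.commute)
  then show "(NN i. indicator {..t} s * r i (\<alpha> s i) * Pinf s i * indicator {0..T} s \<partial>counting) = (NN i. Pinf s i * r i (\<alpha> s i) \<partial>counting) * indicator {0..t} s"
   by (simp add: nn_integral_multc)
 qed
 finally show ?thesis .
qed

lemma mocc_occ: "occ mocc"
proof (rule occ_forwardI[OF sets_mocc, where p = Pinf])
 obtain C where C: "0 <= C" "!!t. t : {0..T} ==> (NN j. ennreal (w j ^ 3) * Pinf t j \<partial>counting) <= ennreal C"
  using Pinf_moment by metis
 have "(%(t, i, a). ennreal (w i ^ 3)) : borel_measurable Xs" by (rule measurable_w_occ) simp
 from mocc_integral[OF this]
 have "(NN (t, i, a). ennreal (w i ^ 3) \<partial>mocc) = ennreal (1 / T) * (NN t. (NN j. ennreal (w j ^ 3) * Pinf t j \<partial>counting) * indicator {0..T} t \<partial>lborel)"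
  by (simp add: nn_integral_multc)
 also have "... <= ennreal (1 / T) * (NN t. ennreal C * indicator {0..T} t \<partial>lborel)"
  using C(2) by (intro mult_left_mono nn_integral_mono) (auto simp: indicator_def)
 also have "... < \<infinity>" using T_pos by (simp add: nn_integral_cmult_indicator ennreal_mult_less_top)
 finally show "(NN (t, i, a). ennreal (w i ^ 3) \<partial>mocc) < \<infinity>" .
next
 show "(%(t, j). Pinf t j) : borel_measurable borel_counting"
  using Pinf_pair_measurable by (simp add: case_prod_beta')
next
 fix f :: "real \<times> 's => ennreal" assume f: "f : borel_measurable borel_counting"
 show "(NN (t, i, a). f (t, i) \<partial>mocc) = ennreal (1 / T) * (NN t. NN j. f (t, j) * Pinf t j * indicator {0..T} t \<partial>counting \<partial>lborel)"
  by (subst mocc_integral[OF measurable_ti_occ[OF refl f]]) simp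
next
 fix t j assume t: "0 < t" "t <= T"
 have i: "ennreal T * occ_in mocc t j = (NN s. (NN i. Pinf s i * inrate i (\<alpha> s i) j \<partial>counting) * indicator {0..t} s \<partial>lborel)"
  unfolding occ_in_def by (rule mocc_rate) (use t in auto)
 have "ennreal T * occ_out mocc t j = (NN s. (NN i. Pinf s i * (if i = j then outrate i (\<alpha> s i) else 0) \<partial>counting) * indicator {0..t} s \<partial>lborel)"
  unfolding occ_out_def by (rule mocc_rate) (use t in \<open>auto cong: if_cong\<close>)
 moreover have "(NN i. Pinf s i * (if i = j then outrate i (\<alpha> s i) else 0) \<partial>counting) = Pinf s j * outrate j (\<alpha> s j)" for s
  by (subst nn_integral_count_space'[where A = "{j}"]) auto
 ultimately have o: "ennreal T * occ_out mocc t j = (NN s. Pinf s j * outrate j (\<alpha> s j) * indicator {0..t} s \<partial>lborel)" by (simp only:)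
 show "Pinf t j + ennreal T * occ_out mocc t j = ennreal (pmf \<gamma> j) + ennreal T * occ_in mocc t j"
  unfolding i o using t by (intro Pinf_forward) auto
qed

text \<open>The measure sits on the graph of the control, so estimates along the control suffice for
  integrals against it.\<close>

lemma mocc_AE: "AE x in mocc. case x of (t, i, a) => a = \<alpha> t i"
proof -
 let ?N = "lborel \<Otimes>\<^sub>M count_space (UNIV :: 's set)"
 have S: "{x : space Xs. case x of (t, i, a) => a = \<alpha> t i} : sets Xs"
 proof -
  have "(%(t, i, a). dist a (\<alpha> t i)) : borel_measurable Zs"
   by (rule measurable_by_state) measurable
  from measurable_Xs_I[OF this] have "{x : space Xs. (case x of (t, i, a) => dist a (\<alpha> t i)) = 0} : sets Xs"
   by measurable
  moreover have "{x : space Xs. (case x of (t, i, a) => dist a (\<alpha> t i)) = 0} = {x : space Xs. case x of (t, i, a) => a = \<alpha> t i}"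
   by (auto split: prod.splits)
  ultimately show ?thesis by simp
 qed
 show ?thesis
  unfolding mocc_def
 proof (subst AE_distr_iff[OF _ S])
  show "(%x. (max 0 (min T (fst x)), snd x, \<alpha> (fst x) (snd x))) : density ?N (%x. ennreal (1 / T) * Pinf (fst x) (snd x) * indicator {0..T} (fst x)) \<rightarrow>\<^sub>M Xs"
   using mmap_measurable by simp
  show "AE x in density ?N (%x. ennreal (1 / T) * Pinf (fst x) (snd x) * indicator {0..T} (fst x)).
    case (max 0 (min T (fst x)), snd x, \<alpha> (fst x) (snd x)) of (t, i, a) => a = \<alpha> t i"
   unfolding AE_density[OF mdens_measurable]
  proof (rule AE_I2, rule impI)
   fix x :: "real \<times> 's" assume "0 < ennreal (1 / T) * Pinf (fst x) (snd x) * indicator {0..T} (fst x)"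
   then have "fst x : {0..T}" by (cases "fst x : {0..T}") auto
   then show "case (max 0 (min T (fst x)), snd x, \<alpha> (fst x) (snd x)) of (t, i, a) => a = \<alpha> t i" by simp
  qed
 qed
qed

end

section \<open>Lagrange multipliers\<close>

text \<open>A multiplier has to lie above all slopes \<open>(p - f x) / g x\<close> of violating
  points and below all slopes \<open>(f y - p) / (- g y)\<close> of strictly feasible points. The
  mixture of \<open>x\<close> and \<open>y\<close> on the boundary \<open>g = 0\<close> shows that
  each lower slope is at most each upper slope; the Slater point supplies one upper slope, so the
  supremum of the lower ones is finite.\<close>

lemma lagrange_multiplier_one:
 fixes f g :: "'x => real"
 assumes mix: "!!x y s. x : D ==> y : D ==> 0 <= s ==> s <= 1 ==>
   \<exists>z\<in>D. f z = s * f x + (1 - s) * f y & g z = s * g x + (1 - s) * g y"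
  and slater: "x0 : D" "g x0 < 0"
  and p: "!!x. x : D ==> g x <= 0 ==> p <= f x"
 shows "\<exists>l\<ge>0. \<forall>x\<in>D. p <= f x + l * g x"
proof -
 have key: "(p - f x) / g x <= (f y - p) / (- g y)" if "x : D" "y : D" "0 < g x" "g y < 0" for x y
 proof -
  note xy = that
  \<comment> \<open>The weight for which the mixture satisfies \<open>g z = 0\<close>.\<close>
  define s where "s = - g y / (g x - g y)"
  have gp: "0 < g x - g y" using that by simp
  have s: "0 <= s" "s <= 1" using that gp by (auto simp: s_def divide_simps)
  obtain z where z: "z : D" "f z = s * f x + (1 - s) * f y" "g z = s * g x + (1 - s) * g y"
   using mix[OF xy(1,2) s] by blast
  have s1: "1 - s = g x / (g x - g y)" using gp by (simp add: s_def field_simps)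
  have "g z = 0" unfolding z(3) s1 using gp by (simp add: s_def field_simps)
  then have "p <= s * f x + (1 - s) * f y" using p[OF z(1)] z(2) by simp
  then have "p * (g x - g y) <= (s * f x + (1 - s) * f y) * (g x - g y)" using gp by (intro mult_right_mono) auto
  also have "... = f x * (s * (g x - g y)) + f y * ((1 - s) * (g x - g y))" by (simp add: algebra_simps)
  also have "... = - g y * f x + g x * f y" unfolding s1 using gp by (simp add: s_def)
  finally have "(p - f x) * (- g y) <= (f y - p) * g x" by (simp add: algebra_simps)
  then have "(p - f x) * (- g y) / g x <= f y - p" using that by (subst pos_divide_le_eq) auto
  then have "(p - f x) / g x * (- g y) <= f y - p" by simp
  then show ?thesis using that by (subst pos_le_divide_eq) auto
 qed
 \<comment> \<open>Zero makes the set nonempty and its supremum nonnegative.\<close>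
 define S where "S = insert 0 {(p - f x) / g x | x. x : D & 0 < g x}"
 have ub: "v <= (f y - p) / (- g y)" if "v : S" "y : D" "g y < 0" for v y
 proof (cases "v = 0")
  case True
  have "p <= f y" using p that by simp
  then show ?thesis using True that by (simp add: divide_nonneg_neg)
 next
  case False
  then show ?thesis using that key unfolding S_def by auto
 qed
 have bdd: "bdd_above S" using ub[OF _ slater] by (rule bdd_aboveI)
 have S0: "S \<noteq> {}" by (simp add: S_def)
 show ?thesis
 proof (intro exI[of _ "Sup S"] conjI ballI)
  show "0 <= Sup S" by (rule cSup_upper[OF _ bdd]) (simp add: S_def)
  fix x assume x: "x : D"
  consider "g x = 0" | "0 < g x" | "g x < 0" by linarith
  then show "p <= f x + Sup S * g x"
  proof cases
   case 1 then show ?thesis using p[OF x] by simp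
  next
   case 2
   have "(p - f x) / g x <= Sup S" by (rule cSup_upper[OF _ bdd]) (use 2 x in \<open>auto simp: S_def\<close>)
   then show ?thesis using 2 by (simp add: divide_simps mult.commute)
  next
   case 3
   have "Sup S <= (f x - p) / (- g x)" by (rule cSup_least[OF S0 ub[OF _ x 3]])
   then have "Sup S * (- g x) <= f x - p" using pos_le_divide_eq[of "- g x" "Sup S" "f x - p"] 3 by (simp only: neg_0_less_iff_less)
   then show ?thesis by simp
  qed
 qed
qed

text \<open>Constraints are removed one at a time. The multiplier of \<open>k\<close> is found on
  the set where the remaining constraints hold, then \<open>l * g k\<close> is absorbed into the
  objective and the induction hypothesis handles the others.\<close>

lemma lagrange_multipliers:
 fixes f :: "'x => real" and g :: "nat => 'x => real"
 assumes "finite I"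
  and mix: "!!x y s. x : D ==> y : D ==> 0 <= s ==> s <= 1 ==>
   \<exists>z\<in>D. f z = s * f x + (1 - s) * f y & (\<forall>n\<in>I. g n z = s * g n x + (1 - s) * g n y)"
  and slater: "x0 : D" "!!n. n : I ==> g n x0 < 0"
  and p: "!!x. x : D ==> (!!n. n : I ==> g n x <= 0) ==> p <= f x"
 shows "\<exists>l. (\<forall>n\<in>I. 0 <= l n) & (\<forall>x\<in>D. p <= f x + (\<Sum>n\<in>I. l n * g n x))"
 using assms
proof (induction I arbitrary: f rule: finite_induct)
 case empty then show ?case by auto
next
 case (insert k I)
 let ?D = "{x : D. \<forall>n\<in>I. g n x <= 0}"
 have "\<exists>l\<ge>0. \<forall>x\<in>?D. p <= f x + l * g k x"
 proof (rule lagrange_multiplier_one)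
  fix x y s :: _ assume *: "x : ?D" "y : ?D" "0 <= s" "s <= (1 :: real)"
  then obtain z where z: "z : D" "f z = s * f x + (1 - s) * f y" "\<forall>n\<in>insert k I. g n z = s * g n x + (1 - s) * g n y"
   using insert.prems(1)[of x y s] by blast
  have "g n z <= 0" if "n : I" for n
  proof -
   have "s * g n x <= 0" "(1 - s) * g n y <= 0" using * that by (auto intro: mult_nonneg_nonpos)
   then show ?thesis using z(3) that by auto
  qed
  then show "\<exists>z\<in>?D. f z = s * f x + (1 - s) * f y & g k z = s * g k x + (1 - s) * g k y"
   using z by (intro bexI[of _ z]) auto
 next
  show "x0 : ?D" "g k x0 < 0" using insert.prems(2,3) by (auto intro: less_imp_le)
  show "p <= f x" if "x : ?D" "g k x <= 0" for x
   using that by (intro insert.prems(4)) auto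
 qed
 then obtain l where l: "0 <= l" "!!x. x : ?D ==> p <= f x + l * g k x" by blast
 have "\<exists>l'. (\<forall>n\<in>I. 0 <= l' n) & (\<forall>x\<in>D. p <= (f x + l * g k x) + (\<Sum>n\<in>I. l' n * g n x))"
 proof (rule insert.IH)
  fix x y s :: _ assume *: "x : D" "y : D" "0 <= s" "s <= (1 :: real)"
  then obtain z where z: "z : D" "f z = s * f x + (1 - s) * f y" "\<forall>n\<in>insert k I. g n z = s * g n x + (1 - s) * g n y"
   using insert.prems(1)[of x y s] by blast
  have gk: "g k z = s * g k x + (1 - s) * g k y" using z(3) by simp
  have "f z + l * g k z = s * (f x + l * g k x) + (1 - s) * (f y + l * g k y)"
   unfolding z(2) gk by (simp add: algebra_simps)
  then show "\<exists>z\<in>D. f z + l * g k z = s * (f x + l * g k x) + (1 - s) * (f y + l * g k y) & (\<forall>n\<in>I. g n z = s * g n x + (1 - s) * g n y)"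
   using z by (intro bexI[of _ z]) auto
 qed (use insert.prems l in auto)
 then obtain l' where l': "\<forall>n\<in>I. 0 <= l' n" "\<forall>x\<in>D. p <= (f x + l * g k x) + (\<Sum>n\<in>I. l' n * g n x)" by blast
 have "(\<Sum>n\<in>insert k I. (l'(k := l)) n * g n x) = l * g k x + (\<Sum>n\<in>I. l' n * g n x)" for x
  using insert.hyps by (simp, intro sum.cong) auto
 then show ?case using l l' insert.hyps by (intro exI[of _ "l'(k := l)"]) (auto simp: add.assoc)
qed

section \<open>Near-optimal controls for a single cost rate\<close>

context ctmdp
begin

lemma occ_integrable:
 assumes occ: "occ eta" and f: "f : borel_measurable Xs"
  and b: "!!t i a. t : {0..T} ==> a : A i ==> \<bar>f (t, i, a)\<bar> <= C * w i ^ 3"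
 shows "integrable eta f"
proof (rule integrableI_bounded)
 show "f : borel_measurable eta" using f measurable_cong_sets[OF occ_sets[OF occ] refl] by blast
 show "(NN x. ennreal (norm (f x)) \<partial>eta) < \<infinity>"
 proof (rule nn_integral_finite_of_bound[OF occ])
  fix t i a assume "t : {0..T}" "a : A i"
  then show "ennreal (norm (f (t, i, a))) <= ennreal C * ennreal (w i ^ 3)"
   using b[of t a i] w_pos[of i] by (simp add: ennreal_mult''[symmetric] less_imp_le ennreal_leI)
 qed
qed

end

context hjb
begin

definition init_value :: real where
 "init_value = 1 / T * (LINT t:{0..T}|lborel. (\<Sum>\<^sub>\<infinity>j. hh (t, j) * pmf \<gamma> j))"

lemma g_integrable:
 assumes "occ eta" "(%(t, i, a). g i a) : borel_measurable Xs"
 shows "integrable eta (%(t, i, a). g i a)"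
proof (rule occ_integrable[OF assms, where C = G])
 fix t i a assume "a : A i"
 have "\<bar>g i a\<bar> <= G * w i ^ 1" using g_bound[OF \<open>a : A i\<close>] by simp
 also have "... <= G * w i ^ 3" using G w_pow_le[of 1 3 i] by (intro mult_left_mono) auto
 finally show "\<bar>case (t, i, a) of (t, i, a) => g i a\<bar> <= G * w i ^ 3" by simp
qed

text \<open>Testing with \<open>hh\<close> writes the cost of any occupation measure as the dual
  value plus the integral of the slack in the dual constraint.\<close>

lemma g_integral_eq:
 assumes occ: "occ eta" and gm: "(%(t, i, a). g i a) : borel_measurable Xs"
 shows "(\<integral>(t, i, a). g i a \<partial>eta) = init_value + (\<integral>(t, i, a). g i a - hh (t, i) + dual_term hh t i a \<partial>eta)"
  and "integrable eta (%(t, i, a). g i a - hh (t, i) + dual_term hh t i a)"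
proof -
 note t = occ_test[OF occ hh_bounded] and gi = g_integrable[OF occ gm]
 have e: "(%(t, i, a). g i a - hh (t, i) + dual_term hh t i a) =
   (%x. (case x of (t, i, a) => g i a) - (case x of (t, i, a) => hh (t, i)) + (case x of (t, i, a) => dual_term hh t i a))"
  by auto
 note d = Bochner_Integration.integrable_diff[OF gi t(1)]
 show "integrable eta (%(t, i, a). g i a - hh (t, i) + dual_term hh t i a)"
  unfolding e by (rule Bochner_Integration.integrable_add[OF d t(2)])
 show "(\<integral>(t, i, a). g i a \<partial>eta) = init_value + (\<integral>(t, i, a). g i a - hh (t, i) + dual_term hh t i a \<partial>eta)"
  unfolding e Bochner_Integration.integral_add[OF d t(2)] Bochner_Integration.integral_diff[OF gi t(1)]
  using t(3) by (simp add: init_value_def)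
qed

text \<open>Nearly minimal actions are chosen only at the grid points of mesh
  \<open>\<delta> i\<close> in time to go. For each state the control then depends on time through
  an integer, which makes it measurable, and the Lipschitz dependence of \<open>KK\<close> and
  \<open>Ham\<close> on time bounds the error between grid points.\<close>

lemma near_optimal_selector:
 assumes \<epsilon>: "0 < \<epsilon>"
 shows "\<exists>\<alpha>. (\<forall>i. (%t. \<alpha> t i) : borel_measurable borel) & (\<forall>t i. \<alpha> t i : A i) &
   (\<forall>t\<in>{0..T}. \<forall>i. g i (\<alpha> t i) - hh (t, i) + dual_term hh t i (\<alpha> t i) <= \<epsilon>)"
proof -
 have ex: "\<exists>a. a : A i & (sig : {0..T} --> g i a + qs (KK sig) i a < Ham g (KK sig) i + \<epsilon> / 2)" for sig i
 proof (cases "sig : {0..T}")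
  case True
  have "Ham g (KK sig) i < Ham g (KK sig) i + \<epsilon> / 2" using \<epsilon> by simp
  then obtain a where "a : A i" "g i a + qs (KK sig) i a < Ham g (KK sig) i + \<epsilon> / 2"
   unfolding Ham_def using A_nonempty
   by (subst (asm) (1) cINF_less_iff) (auto intro: Ham_bdd_below[where k = 1 and C = cu] simp: cu_nonneg Adm_bound[OF KK_Adm True, simplified])
  then show ?thesis by blast
 next
  case False then show ?thesis using A_nonempty by blast
 qed
 define b where "b sig i = (SOME a. a : A i & (sig : {0..T} --> g i a + qs (KK sig) i a < Ham g (KK sig) i + \<epsilon> / 2))" for sig i
 have b: "b sig i : A i" "sig : {0..T} ==> g i (b sig i) + qs (KK sig) i (b sig i) < Ham g (KK sig) i + \<epsilon> / 2" for sig i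
  using someI_ex[OF ex[of i sig]] unfolding b_def by auto
 define kap where "kap i = Lam * (R + 2 * L) * w i ^ 3" for i
 have k0: "0 <= kap i" for i using Lam_nonneg R_pos L_pos w_pos[of i] by (simp add: kap_def)
 \<comment> \<open>The rounding error enters twice, through \<open>qs\<close> and through
   \<open>Ham\<close>, each time with at most \<open>kap i * \<delta> i\<close>; together they take
   half of \<open>\<epsilon>\<close>, the choice at the grid points the other half. The added one
   covers \<open>kap i = 0\<close>.\<close>
 define \<delta> where "\<delta> i = \<epsilon> / (4 * (kap i + 1))" for i
 have d0: "0 < \<delta> i" for i using \<epsilon> k0[of i] by (simp add: \<delta>_def add_nonneg_pos)
 have kd: "2 * kap i * \<delta> i <= \<epsilon> / 2" for i
 proof -
  have "0 < 4 * (kap i + 1)" using k0[of i] by simp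
  then have "2 * kap i * \<delta> i <= \<epsilon> / 2 \<longleftrightarrow> 4 * (kap i * \<epsilon>) <= \<epsilon> * (4 * (kap i + 1))"
   unfolding \<delta>_def by (simp add: field_simps)
  then show ?thesis using \<epsilon> by (simp add: algebra_simps)
 qed
 \<comment> \<open>The time to go is rounded down, so the grid point stays in
   \<open>[0, T]\<close>.\<close>
 define \<alpha> where "\<alpha> t i = b (\<delta> i * real_of_int \<lfloor>(T - t) / \<delta> i\<rfloor>) i" for t i
 have m: "(%t. \<alpha> t i) : borel_measurable borel" for i
 proof -
  have m1: "(%t. \<lfloor>(T - t) / \<delta> i\<rfloor>) : borel \<rightarrow>\<^sub>M counting" by measurable
  have m2: "(%n :: int. b (\<delta> i * real_of_int n) i) : counting \<rightarrow>\<^sub>M borel" by simp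
  show ?thesis unfolding \<alpha>_def by (rule measurable_compose[OF m1 m2])
 qed
 have "g i (\<alpha> t i) - hh (t, i) + dual_term hh t i (\<alpha> t i) <= \<epsilon>" if t: "t : {0..T}" for t i
 proof -
  let ?sig = "\<delta> i * real_of_int \<lfloor>(T - t) / \<delta> i\<rfloor>" and ?tau = "T - t"
  have fl: "real_of_int \<lfloor>?tau / \<delta> i\<rfloor> <= ?tau / \<delta> i" "?tau / \<delta> i < real_of_int \<lfloor>?tau / \<delta> i\<rfloor> + 1" "0 <= \<lfloor>?tau / \<delta> i\<rfloor>"
   using t d0[of i] by (auto simp: divide_nonneg_pos)
  have s: "?sig <= ?tau" "?tau < ?sig + \<delta> i" "0 <= ?sig"
   using mult_left_mono[OF fl(1), of "\<delta> i"] mult_strict_left_mono[OF fl(2) d0[of i]] fl(3) d0[of i] by (auto simp: distrib_left)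
  have sig: "?sig : {0..T}" and tau: "?tau : {0..T}" using s t by auto
  have ab: "\<bar>?sig - ?tau\<bar> <= \<delta> i" using s by (simp add: abs_le_iff)
  have a: "\<alpha> t i : A i" by (simp add: \<alpha>_def b(1))
  have q: "qs (KK ?tau) i (\<alpha> t i) - qs (KK ?sig) i (\<alpha> t i) <= kap i * \<delta> i"
  proof -
   have "\<bar>qs (%j. KK ?tau j - KK ?sig j) i (\<alpha> t i)\<bar> <= (Lam * \<delta> i) * ((R + 2 * L) * w i ^ (2 + 1))"
   proof (rule qs_bound[OF a])
    fix j
    have "\<bar>KK ?tau j - KK ?sig j\<bar> <= Lam * w j ^ 2 * \<bar>?tau - ?sig\<bar>" using KK_Adm sig tau by (simp add: Adm_def)
    also have "... <= Lam * w j ^ 2 * \<delta> i" using ab Lam_nonneg by (intro mult_left_mono) (auto simp: abs_minus_commute)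
    finally show "\<bar>KK ?tau j - KK ?sig j\<bar> <= (Lam * \<delta> i) * w j ^ 2" by (simp only: mult_ac)
   qed (use Lam_nonneg d0[of i] in auto)
   moreover have "(Lam * \<delta> i) * ((R + 2 * L) * w i ^ (2 + 1)) = kap i * \<delta> i" by (simp add: kap_def)
   moreover have "qs (KK ?tau) i (\<alpha> t i) - qs (KK ?sig) i (\<alpha> t i) = qs (%j. KK ?tau j - KK ?sig j) i (\<alpha> t i)"
    by (rule qs_diff[OF a _ Adm_bound[OF KK_Adm tau] Adm_bound[OF KK_Adm sig]]) simp
   ultimately show ?thesis by linarith
  qed
  have "\<bar>Ham g (KK ?sig) i - Ham g (KK ?tau) i\<bar> <= kap i * \<bar>?sig - ?tau\<bar>"
   unfolding kap_def by (rule Ham_Adm_lipschitz[OF KK_Adm sig tau])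
  also have "... <= kap i * \<delta> i" using ab k0 by (rule mult_left_mono)
  finally have h: "Ham g (KK ?sig) i - Ham g (KK ?tau) i <= kap i * \<delta> i" by (simp add: abs_le_iff)
  have e: "g i (\<alpha> t i) + qs (KK ?sig) i (\<alpha> t i) < Ham g (KK ?sig) i + \<epsilon> / 2" unfolding \<alpha>_def by (rule b(2)[OF sig])
  have "hh (t, i) = Ham g (KK ?tau) i" using t by (simp add: hh_def)
  then show ?thesis unfolding dual_term_hh[OF t a] using q h e kd[of i] by linarith
 qed
 then show ?thesis using m b(1) by (intro exI[of _ \<alpha>]) (auto simp: \<alpha>_def)
qed

lemma near_optimal:
 assumes \<epsilon>: "0 < \<epsilon>" and gm: "(%(t, i, a). g i a) : borel_measurable Xs"
 shows "\<exists>eta. occ eta & (\<integral>(t, i, a). g i a \<partial>eta) <= init_value + \<epsilon>"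
proof -
 obtain \<alpha> where \<alpha>: "!!i. (%t. \<alpha> t i) : borel_measurable borel" "!!t i. \<alpha> t i : A i"
   "!!t i. t : {0..T} ==> g i (\<alpha> t i) - hh (t, i) + dual_term hh t i (\<alpha> t i) <= \<epsilon>"
  using near_optimal_selector[OF \<epsilon>] by blast
 interpret M: markov T A q \<gamma> w L R \<alpha> by unfold_locales (use \<alpha> in auto)
 note occ = M.mocc_occ
 interpret P: prob_space M.mocc by (rule occ_prob[OF occ])
 have "(\<integral>(t, i, a). g i a - hh (t, i) + dual_term hh t i a \<partial>M.mocc) <= (\<integral>x. \<epsilon> \<partial>M.mocc)"
 proof (rule integral_mono_AE[OF g_integral_eq(2)[OF occ gm]])
  show "AE x in M.mocc. (case x of (t, i, a) => g i a - hh (t, i) + dual_term hh t i a) <= \<epsilon>"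
   using M.mocc_AE AE_space
  proof eventually_elim
   case (elim x)
   then show ?case using \<alpha>(3) unfolding space_occ[OF occ_sets[OF occ]] by auto
  qed
 qed simp
 also have "... = \<epsilon>" by (simp add: P.prob_space)
 finally show ?thesis using g_integral_eq(1)[OF occ gm] occ by (intro exI[of _ M.mocc]) simp
qed

end

section \<open>Prokhorov's theorem\<close>

text \<open>The point of the Cantor set with ternary digits 0 and 2. Unlike in binary expansions,
  closeness of two values forces equality of the leading digits. The code carries measures to the
  real line, where Helly's selection theorem gives weak limits.\<close>

definition cantor_code :: "(nat => bool) => real" where
 "cantor_code b = (\<Sum>k. (if b k then 2 else 0) * (1 / 3) ^ Suc k)"

lemma cantor_code_summable: "summable (%k. (if b k then 2 else 0) * (1 / 3 :: real) ^ Suc k)"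
 by (rule summable_comparison_test'[of "%k. 2 * (1 / 3) ^ Suc k"])
   (auto intro!: summable_mult summable_geometric simp: summable_Suc_iff)

lemma cantor_code_bounds: "0 <= cantor_code b" "cantor_code b <= 1"
proof -
 show "0 <= cantor_code b" unfolding cantor_code_def by (intro suminf_nonneg cantor_code_summable) auto
 have s: "(%k. 2 * (1 / 3 :: real) ^ Suc k) sums 1"
  using sums_mult[OF geometric_sums[of "1 / 3 :: real"], of "2 / 3"] by simp
 have "cantor_code b <= (\<Sum>k. 2 * (1 / 3 :: real) ^ Suc k)"
  unfolding cantor_code_def using s by (intro suminf_le cantor_code_summable) (auto simp: sums_iff)
 then show "cantor_code b <= 1" using s by (simp add: sums_iff)
qed

lemma cantor_code_rec: "cantor_code b = (if b 0 then 2 / 3 else 0) + cantor_code (%k. b (Suc k)) / 3"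
proof -
 let ?t = "%b :: nat => bool. %k. (if b k then 2 else 0) * (1 / 3 :: real) ^ Suc k"
 have "cantor_code b = ?t b 0 + (\<Sum>k. ?t b (Suc k))"
  unfolding cantor_code_def using suminf_split_head[OF cantor_code_summable, of b] by linarith
 also have "(\<Sum>k. ?t b (Suc k)) = (\<Sum>k. ?t (%k. b (Suc k)) k / 3)" by (simp add: field_simps)
 also have "... = cantor_code (%k. b (Suc k)) / 3"
  unfolding cantor_code_def by (rule suminf_divide[OF cantor_code_summable])
 finally show ?thesis by simp
qed

text \<open>If the leading digits differ, they contribute \<open>2 / 3\<close> while the tails
  change the value by at most \<open>1 / 3\<close>; otherwise the leading digit is dropped and the
  distance triples.\<close>

lemma cantor_code_close:
 assumes "\<bar>cantor_code b - cantor_code c\<bar> < (1 / 3) ^ n" "k < n"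
 shows "b k \<longleftrightarrow> c k"
 using assms
proof (induction n arbitrary: b c k)
 case (Suc n)
 let ?b = "%k. b (Suc k)" and ?c = "%k. c (Suc k)"
 note bd = cantor_code_bounds[of ?b] cantor_code_bounds[of ?c]
 have "(1 / 3 :: real) ^ n <= 1" by (intro power_le_one) auto
 then have eq: "b 0 \<longleftrightarrow> c 0"
  using Suc.prems(1) bd unfolding cantor_code_rec[of b] cantor_code_rec[of c] by (auto split: if_splits)
 have "\<bar>cantor_code ?b - cantor_code ?c\<bar> = 3 * \<bar>cantor_code b - cantor_code c\<bar>"
 proof -
  have "cantor_code ?b - cantor_code ?c = 3 * (cantor_code b - cantor_code c)"
   using eq unfolding cantor_code_rec[of b] cantor_code_rec[of c] by (auto split: if_splits)
  then show ?thesis by (simp only: abs_mult abs_numeral)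
 qed
 then have "\<bar>cantor_code ?b - cantor_code ?c\<bar> < (1 / 3) ^ n" using Suc.prems(1) by simp
 from Suc.IH[OF this, of "k - 1"] show ?case using Suc.prems(2) eq by (cases k) simp_all
qed simp

text \<open>The code records membership in the sets of a countable base and need not be continuous,
  but its inverse on a compact set is uniformly continuous: finitely many base sets of radius
  \<open>e / 4\<close> cover \<open>K\<close>, and sufficiently close codes agree on all of them.
  Uniform continuity then extends the inverse to the closure.\<close>

lemma compact_code_inverse:
 fixes U :: "nat => 'b :: complete_space set"
 assumes U: "!!n. open (U n)" "!!S x. open S ==> x : S ==> \<exists>n. x : U n & U n \<subseteq> S" and K: "compact K"
 defines "f \<equiv> %x. cantor_code (%k. x : U k)"
 shows "\<exists>g. continuous_on (closure (f ` K)) g & (\<forall>x\<in>K. g (f x) = x)"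
proof -
 have uc: "\<exists>d>0. \<forall>x\<in>K. \<forall>y\<in>K. \<bar>f x - f y\<bar> < d --> dist x y < e" if "0 < e" for e
 proof -
  have "\<exists>n. x : U n & U n \<subseteq> ball x (e / 4)" for x using U(2)[of "ball x (e / 4)" x] \<open>0 < e\<close> by auto
  then obtain n where n: "!!x. x : U (n x)" "!!x. U (n x) \<subseteq> ball x (e / 4)" by metis
  obtain F where F: "F \<subseteq> K" "finite F" "K \<subseteq> (\<Union>x\<in>F. U (n x))"
   using compactE_image[OF K, of K "%x. U (n x)"] U(1) n(1) by blast
  \<comment> \<open>Larger than every index in the finite cover, so codes closer than
    \<open>(1 / 3) ^ m\<close> agree on membership in each of its sets.\<close>
  define m where "m = Suc (Max (n ` F \<union> {0}))"
  have m: "n x < m" if "x : F" for x using F(2) that by (simp add: m_def less_Suc_eq_le)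
  show ?thesis
  proof (intro exI[of _ "(1 / 3) ^ m"] conjI ballI impI)
   fix x y assume "x : K" "y : K" "\<bar>f x - f y\<bar> < (1 / 3) ^ m"
   obtain z where z: "z : F" "x : U (n z)" using F(3) \<open>x : K\<close> by blast
   have "y : U (n z)"
    using cantor_code_close[OF \<open>\<bar>f x - f y\<bar> < (1 / 3) ^ m\<close>[unfolded f_def] m[OF z(1)]] z(2) by simp
   then have "dist z x < e / 4" "dist z y < e / 4" using n(2)[of z] z(2) by auto
   then show "dist x y < e" using dist_triangle3[of x y z] \<open>0 < e\<close> by linarith
  qed simp
 qed
 define h where "h = inv_into K f"
 have inj: "inj_on f K"
 proof (rule inj_onI)
  fix x y assume "x : K" "y : K" "f x = f y"
  then have "dist x y < e" if "0 < e" for e using uc[OF that] by force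
  then show "x = y" by (metis dist_pos_lt less_irrefl)
 qed
 then have h: "h (f x) = x" if "x : K" for x using that by (simp add: h_def)
 have "uniformly_continuous_on (f ` K) h"
  unfolding uniformly_continuous_on_def
 proof (intro allI impI)
  fix e :: real assume "0 < e"
  then obtain d where "0 < d" "!!x y. x : K ==> y : K ==> \<bar>f x - f y\<bar> < d ==> dist x y < e" using uc by blast
  then show "\<exists>d>0. \<forall>x\<in>f ` K. \<forall>x'\<in>f ` K. dist x' x < d --> dist (h x') (h x) < e"
   by (intro exI[of _ d]) (auto simp: h dist_real_def)
 qed
 then obtain g where "uniformly_continuous_on (closure (f ` K)) g" "!!y. y : f ` K ==> h y = g y"
  by (rule uniformly_continuous_on_extension_on_closure) blast
 then show ?thesis using h by (intro exI[of _ g]) (auto intro: uniformly_continuous_imp_continuous)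
qed

lemma integral_small_off:
 fixes h :: "'x => real"
 assumes "prob_space P" "h : borel_measurable P" "K : sets P" "1 - e <= measure P K"
  and "!!x. x : K ==> h x = 0" "!!x. \<bar>h x\<bar> <= B"
 shows "\<bar>\<integral>x. h x \<partial>P\<bar> <= B * e"
proof -
 interpret prob_space P by fact
 have B: "0 <= B" using assms(6)[of undefined] by linarith
 have "\<bar>\<integral>x. h x \<partial>P\<bar> <= (\<integral>x. \<bar>h x\<bar> \<partial>P)" using integral_abs_bound[of P h] by simp
 also have "... <= (\<integral>x. B * indicator (space P - K) x \<partial>P)"
 proof (rule integral_mono)
  show "integrable P (%x. \<bar>h x\<bar>)" by (rule integrable_const_bound[where B = B]) (use assms in auto)
  show "integrable P (%x. B * indicator (space P - K) x)"
   using assms(3) by (intro integrable_mult_right integrable_real_indicator) (auto simp: emeasure_eq_measure)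
  show "\<bar>h x\<bar> <= B * indicator (space P - K) x" if "x : space P" for x using assms(5,6) that by (auto simp: indicator_def)
 qed
 also have "... = B * (1 - measure P K)" using assms(3) by (simp add: prob_compl)
 also have "... <= B * e" using assms(4) B by (intro mult_left_mono) auto
 finally show ?thesis .
qed

text \<open>The portmanteau inequality for closed sets, from continuous functions
  \<open>ch k\<close> that decrease to the indicator of \<open>C\<close>.\<close>

lemma weak_conv_closed_set:
 assumes M: "!!n. real_distribution (M n)" and N: "real_distribution \<nu>" and weak: "weak_conv_m M \<nu>"
  and C: "closed C" and le: "!!n. c <= measure (M n) C"
 shows "c <= measure \<nu> C"
\<comment> \<open>\<open>infdist\<close> to the empty set is zero by convention, so
  \<open>ch k\<close> would then not tend to the indicator.\<close>
proof (cases "C = {}")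
 case False
 note C = C False
 interpret M: real_distribution "M n" for n by (rule M)
 interpret N: real_distribution \<nu> by (rule N)
 define ch where "ch = (%k y. max 0 (1 - real k * infdist y C))"
 have cont: "isCont (ch k) y" for k y unfolding ch_def by (intro continuous_intros)
 have meas[measurable]: "ch k : borel_measurable borel" for k
  using cont by (intro borel_measurable_continuous_onI) (simp add: continuous_at_imp_continuous_on)
 have bd: "0 <= ch k y" "ch k y <= 1" for k y by (auto simp: ch_def infdist_nonneg)
 have ch1: "y : C ==> ch k y = 1" for k y by (simp add: ch_def)
 have C_meas[measurable]: "C : sets borel" using C by simp
 have k: "c <= (\<integral>y. ch k y \<partial>\<nu>)" for k
 proof (rule LIMSEQ_le_const)
  show "(%n. \<integral>y. ch k y \<partial>M n) \<longlonglongrightarrow> (\<integral>y. ch k y \<partial>\<nu>)"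
   using bd by (intro weak_conv_imp_integral_bdd_continuous_conv[OF M N weak, where B = 1] cont) auto
  have "measure (M n) C <= (\<integral>y. ch k y \<partial>M n)" for n
  proof -
   have "measure (M n) C = (\<integral>y. indicator C y \<partial>M n)" by simp
   also have "... <= (\<integral>y. ch k y \<partial>M n)"
    using bd by (intro integral_mono integrable_real_indicator M.integrable_const_bound[where B = 1])
     (auto simp: indicator_def ch1)
   finally show ?thesis .
  qed
  then show "\<exists>N. \<forall>n\<ge>N. c <= (\<integral>y. ch k y \<partial>M n)" using le order_trans by blast
 qed
 have "(%k. \<integral>y. ch k y \<partial>\<nu>) \<longlonglongrightarrow> (\<integral>y. indicator C y \<partial>\<nu>)"
 proof (rule integral_dominated_convergence[where w = "%_. 1"])
  show "AE y in \<nu>. (%k. ch k y) \<longlonglongrightarrow> indicator C y"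
  proof (rule AE_I2)
   fix y
   show "(%k. ch k y) \<longlonglongrightarrow> indicator C y"
   proof (cases "y : C")
    case True then show ?thesis by (simp add: ch_def)
   next
    case False
    then have p: "0 < infdist y C" using C infdist_pos_not_in_closed[of C y] by simp
    obtain k0 where k0: "1 < real k0 * infdist y C" using reals_Archimedean3[OF p] by blast
    have "ch k y = 0" if "k0 <= k" for k
    proof -
     have "real k0 * infdist y C <= real k * infdist y C" using that p by (intro mult_right_mono) auto
     then show ?thesis using k0 by (simp add: ch_def)
    qed
    then show ?thesis using False by (intro tendsto_eventually) (auto simp: eventually_sequentially)
   qed
  qed
 qed (use bd in auto)
 then have "(%k. \<integral>y. ch k y \<partial>\<nu>) \<longlonglongrightarrow> measure \<nu> C" by simp
 then show ?thesis by (rule LIMSEQ_le_const) (use k in auto)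
qed (use le in simp)

text \<open>The measures are transported to \<open>[0, 1]\<close> by the code, a weak limit is taken
  there and carried back by the inverse \<open>g\<close>, glued from the inverses on an increasing
  sequence of compacts. Since the code may be discontinuous, convergence is not transported
  directly: \<open>phi \<circ> g\<close> is extended from the closed set \<open>C m\<close> to a
  continuous function on the line, and the error is controlled by the small mass outside
  \<open>K m\<close> and \<open>C m\<close>.\<close>

theorem prokhorov_subsequence:
 fixes \<mu> :: "nat => 'b :: {complete_space, second_countable_topology} measure"
 assumes prob: "!!n. prob_space (\<mu> n)" and sets: "!!n. sets (\<mu> n) = sets borel"
  and tight: "!!m :: nat. \<exists>K. compact K & (\<forall>n. 1 - 1 / real (Suc m) <= measure (\<mu> n) K)"
 obtains r \<nu> where "strict_mono (r :: nat => nat)" "prob_space \<nu>" "sets \<nu> = sets borel"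
  "!!phi B. continuous_on UNIV (phi :: 'b => real) ==> (!!x. \<bar>phi x\<bar> <= B) ==> (%n. \<integral>x. phi x \<partial>\<mu> (r n)) \<longlonglongrightarrow> (\<integral>x. phi x \<partial>\<nu>)"
proof -
 interpret \<mu>: prob_space "\<mu> n" for n by (rule prob)
 note [measurable_cong] = sets
 obtain K0 where K0: "!!m. compact (K0 m)" "!!m n. 1 - 1 / real (Suc m) <= measure (\<mu> n) (K0 m)" using tight by metis
 \<comment> \<open>Finite unions make the compacts increasing, so that the inverses on them can be
   glued.\<close>
 define K where "K m = (\<Union>k\<le>m. K0 k)" for m
 have K: "compact (K m)" for m unfolding K_def by (intro compact_UN K0) auto
 have [measurable]: "K m : sets borel" for m using K by (simp add: borel_closed compact_imp_closed)
 have K_mass: "1 - 1 / real (Suc m) <= measure (\<mu> n) (K m)" for m n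
 proof -
  have "measure (\<mu> n) (K0 m) <= measure (\<mu> n) (K m)" by (rule \<mu>.finite_measure_mono) (simp add: K_def UN_upper, measurable)
  then show ?thesis using K0(2)[of m n] by linarith
 qed
 have K_mono: "k <= m ==> K k \<subseteq> K m" for k m by (auto simp: K_def intro: order_trans)
 obtain \<B> :: "'b set set" where \<B>: "countable \<B>" "topological_basis \<B>" using ex_countable_basis by blast
 have "\<B> \<noteq> {}" using topological_basisE[OF \<B>(2) open_UNIV, of undefined] by auto
 define U where "U = from_nat_into \<B>"
 have rU: "range U = \<B>" unfolding U_def using range_from_nat_into[OF \<open>\<B> \<noteq> {}\<close> \<B>(1)] .
 have U: "open (U n)" for n using rU topological_basis_open[OF \<B>(2)] by blast
 have U': "\<exists>n. x : U n & U n \<subseteq> S" if "open S" "x : S" for S x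
  using topological_basisE[OF \<B>(2) that] rU by (metis imageE)
 define f where "f = (%x. cantor_code (%k. x : U k))"
 have [measurable]: "U k : sets borel" for k using U by simp
 have f_meas[measurable]: "f : borel_measurable borel"
  unfolding f_def cantor_code_def by (intro borel_measurable_suminf) measurable
 have "\<exists>g. continuous_on (closure (f ` K m)) g & (\<forall>x\<in>K m. g (f x) = x)" for m
  unfolding f_def using compact_code_inverse[OF U U' K] .
 then obtain G where G: "!!m. continuous_on (closure (f ` K m)) (G m)" "!!m x. x : K m ==> G m (f x) = x" by metis
 define C where "C m = closure (f ` K m)" for m
 have C_mono: "k <= m ==> C k \<subseteq> C m" for k m unfolding C_def by (intro closure_mono image_mono K_mono)
 have [measurable]: "C m : sets borel" for m by (simp add: C_def)
 \<comment> \<open>Both sides are continuous on \<open>C k\<close> and agree on its dense subset of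
   codes of points in \<open>K k\<close>.\<close>
 have agree: "G k y = G m y" if "k <= m" "y : C k" for k m y
 proof -
  obtain s where s: "!!n. s n : f ` K k" "s \<longlonglongrightarrow> y" using \<open>y : C k\<close> unfolding C_def closure_sequential by blast
  have "s n : closure (f ` K k)" "s n : closure (f ` K m)" "G k (s n) = G m (s n)" for n
  proof -
   obtain x where x: "x : K k" "s n = f x" using s(1) by blast
   then have "x : K m" using K_mono[OF that(1)] by blast
   then show "s n : closure (f ` K k)" "s n : closure (f ` K m)" "G k (s n) = G m (s n)"
    using x G(2) by (auto intro: closure_subset[THEN subsetD])
  qed
  moreover have "y : closure (f ` K k)" "y : closure (f ` K m)" using C_mono[OF that(1)] that(2) by (auto simp: C_def)
  ultimately have "(%n. G k (s n)) \<longlonglongrightarrow> G k y" "(%n. G k (s n)) \<longlonglongrightarrow> G m y"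
   using continuous_on_tendsto_compose[OF G(1) s(2), of k] continuous_on_tendsto_compose[OF G(1) s(2), of m] by auto
  then show ?thesis by (rule LIMSEQ_unique)
 qed
 define g where "g y = (if \<exists>m. y : C m then G (LEAST m. y : C m) y else undefined)" for y
 have g: "g y = G m y" if "y : C m" for m y
  using that agree[of "LEAST m. y : C m" m y] LeastI[of "%m. y : C m" m] Least_le[of "%m. y : C m" m] by (auto simp: g_def)
 have g_cont: "continuous_on (C m) g" for m
  using G(1)[of m] g by (simp add: C_def cong: continuous_on_cong)
 have g_meas[measurable]: "g : borel_measurable borel"
 proof (rule measurable_piecewise_restrict[where C = "insert (- (\<Union>m. C m)) (range C)"])
  fix \<Omega> assume "\<Omega> : insert (- (\<Union>m. C m)) (range C)"
  then consider "\<Omega> = - (\<Union>m. C m)" | m where "\<Omega> = C m" by blast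
  then show "g : restrict_space borel \<Omega> \<rightarrow>\<^sub>M borel"
  proof cases
   case 1
   have "(%_. undefined) : restrict_space borel \<Omega> \<rightarrow>\<^sub>M (borel :: 'b measure)" by simp
   moreover have "g y = undefined" if "y : space (restrict_space borel \<Omega>)" for y
    using that 1 by (auto simp: g_def space_restrict_space)
   ultimately show ?thesis by (simp cong: measurable_cong)
  qed (simp add: borel_measurable_continuous_on_restrict g_cont)
 qed auto
 define M where "M n = distr (\<mu> n) borel f" for n
 have M: "real_distribution (M n)" for n unfolding M_def by (intro \<mu>.real_distribution_distr) simp
 interpret M: real_distribution "M n" for n by (rule M)
 have f01: "0 <= f x" "f x <= 1" for x unfolding f_def by (rule cantor_code_bounds)+
 have "tight M"
  unfolding tight_def
 proof (intro conjI allI impI M)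
  fix e :: real assume "0 < e"
  have "measure (M n) {-1<..2} = measure (\<mu> n) (space (\<mu> n))" for n
   unfolding M_def using f01 by (subst measure_distr) (auto intro!: arg_cong[where f = "measure (\<mu> n)"] simp: order.strict_trans2[of "-1" 0] order_trans[of _ 1 2])
  then show "\<exists>a b. a < b & (\<forall>n. 1 - e < measure (M n) {a<..b})"
   using \<open>0 < e\<close> by (intro exI[of _ "-1"] exI[of _ 2]) (simp add: \<mu>.prob_space)
 qed
 from tight_imp_convergent_subsubsequence[OF this strict_mono_id] obtain r N
  where r: "strict_mono r" and N: "real_distribution N" and weak: "weak_conv_m (M \<circ> id \<circ> r) N" by blast
 define Mr where "Mr = (%n. M (r n))"
 have Mr: "!!n. real_distribution (Mr n)" and weak: "weak_conv_m Mr N" using M weak by (auto simp: Mr_def comp_def)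
 interpret N: real_distribution N by (rule N)
 have C_mass: "1 - 1 / real (Suc m) <= measure N (C m)" for m
 proof (rule weak_conv_closed_set[OF Mr N weak])
  show "closed (C m)" by (simp add: C_def)
  show le: "1 - 1 / real (Suc m) <= measure (Mr n) (C m)" for n
  proof -
   have "measure (\<mu> (r n)) (K m) <= measure (\<mu> (r n)) (f -` C m \<inter> space (\<mu> (r n)))"
   proof (rule \<mu>.finite_measure_mono)
    show "K m \<subseteq> f -` C m \<inter> space (\<mu> (r n))"
     using closure_subset[of "f ` K m"] unfolding C_def sets_eq_imp_space_eq[OF sets] by auto
    show "f -` C m \<inter> space (\<mu> (r n)) : \<mu>.events (r n)" by (rule measurable_sets[of _ _ borel]) simp_all
   qed
   also have "... = measure (Mr n) (C m)" unfolding Mr_def M_def by (subst measure_distr) simp_all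
   finally have "measure (\<mu> (r n)) (K m) <= measure (Mr n) (C m)" .
   then show ?thesis using K_mass[of m "r n"] by linarith
  qed
 qed
 define \<nu> where "\<nu> = distr N borel g"
 have conv: "(%n. \<integral>x. phi x \<partial>\<mu> (r n)) \<longlonglongrightarrow> (\<integral>x. phi x \<partial>\<nu>)"
  if phi: "continuous_on UNIV (phi :: 'b => real)" "!!x. \<bar>phi x\<bar> <= B" for phi B
 proof (rule LIMSEQ_I)
  fix e :: real assume e: "0 < e"
  have B: "0 <= B" using phi(2)[of undefined] by linarith
  have [measurable]: "phi : borel_measurable borel" using phi(1) by (rule borel_measurable_continuous_onI)
  \<comment> \<open>Leaving \<open>K m\<close> and leaving \<open>C m\<close> each cost at most
    \<open>2 * B / (m + 1)\<close>, less than a third of \<open>e\<close>; the remaining third is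
    for weak convergence on the line.\<close>
  obtain m where m: "6 * B / e < real (Suc m)" using reals_Archimedean2[of "6 * B / e"] by (metis less_trans lessI of_nat_less_iff)
  then have small: "2 * B * (1 / real (Suc m)) < e / 3" using e by (simp add: field_simps)
  have "continuous_on (C m) (phi \<circ> g)" using g_cont phi(1) by (intro continuous_on_compose continuous_on_subset[OF phi(1)]) auto
  then obtain \<psi> where \<psi>: "continuous_on UNIV \<psi>" "!!y. y : C m ==> \<psi> y = phi (g y)" "!!y. \<bar>\<psi> y\<bar> <= B"
   using Tietze[of "C m" "phi \<circ> g" UNIV B] B phi(2) by (auto simp: C_def)
  have [measurable]: "\<psi> : borel_measurable borel" using \<psi>(1) by (rule borel_measurable_continuous_onI)
  have ib: "\<bar>phi x - \<psi> y\<bar> <= 2 * B" for x y using phi(2)[of x] \<psi>(3)[of y] by linarith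
  have "(%n. \<integral>y. \<psi> y \<partial>Mr n) \<longlonglongrightarrow> (\<integral>y. \<psi> y \<partial>N)"
   using \<psi> by (intro weak_conv_imp_integral_bdd_continuous_conv[OF Mr N weak, where B = B]) (auto simp: continuous_on_eq_continuous_at)
  moreover have "0 < e / 3" using e by simp
  ultimately obtain n0 where n0: "\<forall>n\<ge>n0. norm ((\<integral>y. \<psi> y \<partial>Mr n) - (\<integral>y. \<psi> y \<partial>N)) < e / 3"
   by (rule LIMSEQ_D[THEN exE])
  have 1: "\<bar>\<integral>x. phi x - \<psi> (f x) \<partial>\<mu> (r n)\<bar> <= 2 * B * (1 / real (Suc m))" for n
  proof (rule integral_small_off[OF prob, where K = "K m"])
   fix x assume x: "x : K m"
   then have "f x : C m" unfolding C_def by (intro closure_subset[THEN subsetD] imageI)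
   then have "\<psi> (f x) = phi (G m (f x))" using \<psi>(2) g by simp
   then show "phi x - \<psi> (f x) = 0" using G(2)[OF x] by simp
  qed (use K_mass ib sets in simp_all)
  have 2: "\<bar>\<integral>y. phi (g y) - \<psi> y \<partial>N\<bar> <= 2 * B * (1 / real (Suc m))"
   by (rule integral_small_off[OF N.prob_space_axioms _ _ C_mass[of m] _ ib]) (simp_all add: \<psi>(2))
  have "norm ((\<integral>x. phi x \<partial>\<mu> (r n)) - (\<integral>x. phi x \<partial>\<nu>)) < e" if "n0 <= n" for n
  proof -
   have "(\<integral>x. phi x - \<psi> (f x) \<partial>\<mu> (r n)) = (\<integral>x. phi x \<partial>\<mu> (r n)) - (\<integral>y. \<psi> y \<partial>Mr n)"
    unfolding Mr_def M_def using phi(2) \<psi>(3)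
    by (subst integral_distr, measurable, intro Bochner_Integration.integral_diff \<mu>.integrable_const_bound[where B = B]) auto
   moreover have "(\<integral>y. phi (g y) - \<psi> y \<partial>N) = (\<integral>x. phi x \<partial>\<nu>) - (\<integral>y. \<psi> y \<partial>N)"
    unfolding \<nu>_def using phi(2) \<psi>(3)
    by (subst integral_distr, measurable, intro Bochner_Integration.integral_diff N.integrable_const_bound[where B = B]) auto
   ultimately show ?thesis using 1[of n] 2 n0[rule_format, OF that] small unfolding real_norm_def by linarith
  qed
  then show "\<exists>n0. \<forall>n\<ge>n0. norm ((\<integral>x. phi x \<partial>\<mu> (r n)) - (\<integral>x. phi x \<partial>\<nu>)) < e" by blast
 qed
 have "prob_space \<nu>" unfolding \<nu>_def by (intro N.prob_space_distr) simp
 then show ?thesis using r conv by (intro that[of r \<nu>]) (auto simp: \<nu>_def)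
qed

section \<open>Tightness of occupation measures\<close>

context ctmdp
begin

text \<open>An embedding into a complete separable metric space: states become integers on the line,
  so distinct states are at distance at least one and each state contributes the compact slice
  \<open>[0, T] \<times> A i\<close>.\<close>

definition state_code :: "real \<times> 's \<times> 'a => real \<times> real \<times> 'a" where
 "state_code x = (fst x, real (to_nat (fst (snd x))), snd (snd x))"

definition state_decode :: "real \<times> real \<times> 'a => real \<times> 's \<times> 'a" where
 "state_decode x = (fst x, from_nat (nat \<lfloor>fst (snd x)\<rfloor>), snd (snd x))"

lemma state_decode_code [simp]: "state_decode (state_code x) = x"
 by (simp add: state_code_def state_decode_def)

lemma state_code_measurable [measurable]: "state_code : Xs \<rightarrow>\<^sub>M borel"
proof (rule measurable_Xs_I)
 show "state_code : Zs \<rightarrow>\<^sub>M borel"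
  unfolding state_code_def borel_prod[symmetric] by measurable
qed

lemma state_decode_measurable [measurable]: "state_decode : borel \<rightarrow>\<^sub>M Zs"
 unfolding state_decode_def borel_prod[symmetric] by measurable

lemma state_code_near:
 assumes "x : state_code ` space Xs" "y : state_code ` space Xs" "dist x y < 1"
 shows "fst (snd x) = fst (snd y)"
proof -
 have "dist (fst (snd x)) (fst (snd y)) < 1"
  using dist_fst_le[of "snd x" "snd y"] dist_snd_le[of x y] assms(3) by linarith
 moreover obtain i j :: 's where ij: "fst (snd x) = real (to_nat i)" "fst (snd y) = real (to_nat j)"
  using assms(1,2) by (auto simp: state_code_def)
 ultimately have "\<bar>real (to_nat i) - real (to_nat j)\<bar> < 1" by (simp add: dist_real_def)
 then have "to_nat i = to_nat j" by linarith
 then show ?thesis using ij by simp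
qed

lemma state_code_slice:
 "{x : state_code ` space Xs. fst (snd x) = real (to_nat i)} = {0..T} \<times> {real (to_nat i)} \<times> A i"
 by (force simp: state_code_def space_Xs image_iff)

text \<open>Coded points at distance less than one share their state, so a limit point is already a
  limit of points of a single compact slice.\<close>

lemma state_code_closed: "closed (state_code ` space Xs)"
proof -
 let ?S = "state_code ` space Xs"
 have "x : ?S" if x: "x : closure ?S" for x
 proof -
  obtain p where p: "p : ?S" "dist p x < 1 / 2" using x unfolding closure_approachable by (meson half_gt_zero_iff zero_less_one)
  then obtain z where "p = state_code z" by blast
  then obtain i :: 's where i: "fst (snd p) = real (to_nat i)" by (metis fst_conv snd_conv state_code_def)
  have "x : closure {y : ?S. fst (snd y) = real (to_nat i)}"
   unfolding closure_approachable
  proof (intro allI impI)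
   fix e :: real assume "0 < e"
   then obtain y where y: "y : ?S" "dist y x < min e (1 / 2)"
    using x unfolding closure_approachable by (meson half_gt_zero_iff min_less_iff_conj zero_less_one)
   have "dist p y < 1" using dist_triangle2[of p y x] p(2) y(2) by simp
   then show "\<exists>y\<in>{y : ?S. fst (snd y) = real (to_nat i)}. dist y x < e"
    using state_code_near[OF p(1) y(1)] y i by auto
  qed
  then have "x : {y : ?S. fst (snd y) = real (to_nat i)}"
   unfolding state_code_slice using A_compact[of i] by (subst (asm) closure_closed) (auto intro!: closed_Times compact_imp_closed compact_Times)
  then show ?thesis by blast
 qed
 then show ?thesis using closure_subset_eq by blast
qed

lemma slice_continuous:
 assumes "!!i. continuous_on ({0..T} \<times> A i) (%(t, a). Phi (t, i, a))"
 shows "continuous_on (state_code ` space Xs) (%x. Phi (state_decode x) :: real)"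
 unfolding continuous_on_iff
proof (intro ballI allI impI)
 let ?S = "state_code ` space Xs"
 fix x and e :: real assume x: "x : ?S" and "0 < e"
 then obtain t i a where xi: "x = state_code (t, i, a)" "t : {0..T}" "a : A i" by (auto simp: space_Xs)
 then obtain d where d: "0 < d" "!!y. y : {0..T} \<times> A i ==> dist y (t, a) < d ==> dist (Phi (fst y, i, snd y)) (Phi (t, i, a)) < e"
  using assms[of i] \<open>0 < e\<close> unfolding continuous_on_iff case_prod_beta' by (metis SigmaI fst_conv snd_conv)
 show "\<exists>d>0. \<forall>y\<in>?S. dist y x < d --> dist (Phi (state_decode y)) (Phi (state_decode x)) < e"
 proof (intro exI[of _ "min d 1"] conjI ballI impI)
  fix y assume y: "y : ?S" "dist y x < min d 1"
  then have "fst (snd y) = real (to_nat i)" using state_code_near[OF y(1) x] xi(1) by (simp add: state_code_def)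
  then obtain s b where yi: "y = state_code (s, i, b)" "s : {0..T}" "b : A i"
   using y(1) by (auto simp: space_Xs state_code_def)
  have "dist (s, b) (t, a) = dist y x" by (simp add: xi(1) yi(1) state_code_def dist_Pair_Pair)
  then show "dist (Phi (state_decode y)) (Phi (state_decode x)) < e"
   using d(2)[of "(s, b)"] y(2) yi by (simp add: xi(1))
 qed (use d in simp)
qed

text \<open>Markov's inequality with the uniform third-moment bound, since \<open>w ^ 3 >= n\<close>
  off the level.\<close>

lemma occ_level_mass:
 assumes "occ eta" and n: "enn2real w3_const * real k <= real n" "0 < k" "0 < n"
 shows "1 - 1 / real k <= measure eta {x : space eta. w (fst (snd x)) <= real n}"
proof -
 interpret prob_space eta by (rule occ_prob[OF assms(1)])
 note sets = occ_sets[OF assms(1)]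
 let ?G = "{x : space eta. w (fst (snd x)) <= real n}"
 have G: "?G : sets eta"
  using measurable_sets[OF measurable_w_occ[OF sets, of "%x. x"], of "{..real n}"]
  by (simp add: vimage_def Int_def case_prod_beta' conj_commute)
 have "ennreal (real n) * emeasure eta (space eta - ?G) = (NN x. ennreal (real n) * indicator (space eta - ?G) x \<partial>eta)"
  using G by (simp add: nn_integral_cmult_indicator)
 also have "... <= (NN (t, i, a). ennreal (w i ^ 3) \<partial>eta)"
 proof (rule nn_integral_mono)
  fix x assume x: "x : space eta"
  have "real n < w i ==> real n <= w i ^ 3" for i using w_pow_le[of 1 3 i] by simp
  then show "ennreal (real n) * indicator (space eta - ?G) x <= (case x of (t, i, a) => ennreal (w i ^ 3))"
   using x by (auto simp: indicator_def not_le split: prod.split intro!: ennreal_leI)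
 qed
 also have "... <= ennreal (enn2real w3_const)" using occ_w3_bound[OF assms(1)] w3_const_finite by simp
 finally have "real n * measure eta (space eta - ?G) <= enn2real w3_const"
  by (simp add: emeasure_eq_measure ennreal_mult'[symmetric])
 then have "real n * (1 - measure eta ?G) * real k <= real n"
  using n(1) mult_right_mono[of _ _ "real k"] G by (fastforce simp: prob_compl)
 then have "(1 - measure eta ?G) * real k <= 1" using n(3) by (simp add: mult.assoc)
 then show ?thesis using n(2) by (simp add: field_simps)
qed

text \<open>A level set of \<open>w\<close> is a finite union of compact slices and carries nearly
  all mass uniformly in \<open>n\<close>; this is the tightness needed for the coded
  measures.\<close>

lemma occ_subsequence:
 assumes occ: "!!n. occ (eta n)"
 obtains r eta' where "strict_mono (r :: nat => nat)" "sets eta' = sets Xs" "prob_space eta'"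
  "!!Phi B. (!!i. continuous_on ({0..T} \<times> A i) (%(t, a). Phi (t, i, a))) ==> (!!x. x : space Xs ==> \<bar>Phi x\<bar> <= (B :: real)) ==>
    Phi : borel_measurable Xs & (%n. \<integral>x. Phi x \<partial>eta (r n)) \<longlonglongrightarrow> (\<integral>x. Phi x \<partial>eta')"
proof -
 interpret eta: prob_space "eta n" for n by (rule occ_prob[OF occ])
 note sets = occ_sets[OF occ]
 note [measurable_cong] = sets
 have sp: "space (eta n) = space Xs" for n by (rule sets_eq_imp_space_eq[OF sets])
 define \<mu> where "\<mu> n = distr (eta n) borel state_code" for n
 let ?S = "state_code ` space Xs"
 have pm: "prob_space (\<mu> n)" for n unfolding \<mu>_def by (intro eta.prob_space_distr) simp
 have sm: "Sigma_Algebra.sets (\<mu> n) = Sigma_Algebra.sets borel" for n by (simp add: \<mu>_def)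
 have tight: "\<exists>K. compact K & (\<forall>n. 1 - 1 / real (Suc m) <= measure (\<mu> n) K)" for m
 proof -
  obtain l where l: "enn2real w3_const * real (Suc m) <= real l" using real_arch_simple by blast
  define k where "k = Suc l"
  define K where "K = (\<Union>i\<in>{i. w i <= real k}. {0..T} \<times> {real (to_nat i)} \<times> A i)"
  have K: "compact K" unfolding K_def using finite_level A_compact by (intro compact_UN compact_Times) auto
  have "1 - 1 / real (Suc m) <= measure (\<mu> n) K" for n
  proof -
   have "1 - 1 / real (Suc m) <= measure (eta n) {x : space (eta n). w (fst (snd x)) <= real k}"
    using l by (intro occ_level_mass[OF occ]) (auto simp: k_def)
   also have "{x : space (eta n). w (fst (snd x)) <= real k} = state_code -` K \<inter> space (eta n)"
    by (auto simp: K_def sp space_Xs state_code_def)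
   also have "measure (eta n) ... = measure (\<mu> n) K"
    unfolding \<mu>_def using K by (subst measure_distr) (auto simp: borel_closed compact_imp_closed)
   finally show ?thesis .
  qed
  then show ?thesis using K by blast
 qed
 obtain r \<nu> where r: "strict_mono (r :: nat => nat)" and \<nu>: "prob_space \<nu>" "Sigma_Algebra.sets \<nu> = Sigma_Algebra.sets borel"
  and conv: "!!phi B. continuous_on UNIV phi ==> (!!x. \<bar>phi x\<bar> <= B) ==> (%n. \<integral>x. phi x \<partial>\<mu> (r n)) \<longlonglongrightarrow> (\<integral>x. phi x \<partial>\<nu> :: real)"
  by (rule prokhorov_subsequence[OF pm sm tight]) blast
 interpret \<nu>: prob_space \<nu> by (rule \<nu>)
 note [measurable_cong] = \<nu>(2)
 obtain x0 where x0: "x0 : space Xs" using A_nonempty T_pos by (force simp: space_Xs)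
 have S_meas[measurable]: "?S : Sigma_Algebra.sets borel" using state_code_closed by simp
 \<comment> \<open>The capped distance to the image is a bounded continuous test function with
   integral zero along the sequence, hence also in the limit; since the image is closed, it carries
   the limit.\<close>
 have AE_S: "AE x in \<nu>. x : ?S"
 proof -
  let ?d = "%x. min 1 (infdist x ?S)"
  have [measurable]: "?d : borel_measurable borel" by (intro borel_measurable_continuous_onI continuous_intros)
  have "(%n. \<integral>x. ?d x \<partial>\<mu> (r n)) \<longlonglongrightarrow> (\<integral>x. ?d x \<partial>\<nu>)"
   by (rule conv[of _ 1]) (auto intro!: continuous_intros simp: infdist_nonneg abs_le_iff order_trans[of "-1" 0])
  moreover have "(\<integral>x. ?d x \<partial>\<mu> n) = 0" for n
   unfolding \<mu>_def by (subst integral_distr, simp, simp) (auto intro!: integral_eq_zero_AE simp: sp)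
  ultimately have "(\<integral>x. ?d x \<partial>\<nu>) = 0" by (simp add: LIMSEQ_const_iff)
  then have "AE x in \<nu>. ?d x = 0"
   by (subst (asm) integral_nonneg_eq_0_iff_AE)
    (auto simp: infdist_nonneg intro!: \<nu>.integrable_const_bound[where B = 1])
  then show ?thesis
  proof eventually_elim
   case (elim x)
   then have "infdist x ?S = 0" by (simp add: min_def split: if_splits)
   then show ?case using in_closed_iff_infdist_zero[OF state_code_closed] x0 by blast
  qed
 qed
 \<comment> \<open>The value \<open>x0\<close> is taken on a null set only and makes the decoding a
   map into \<open>Xs\<close>.\<close>
 define D where "D x = (if x : ?S then state_decode x else x0)" for x
 have [measurable]: "D : borel \<rightarrow>\<^sub>M Xs"
  unfolding X_space_def
 proof (rule measurable_restrict_space2)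
  have "x0 : space Zs" by (simp add: space_pair_measure)
  then show "D : borel \<rightarrow>\<^sub>M Zs" unfolding D_def by measurable
  have "D : space borel \<rightarrow> space Xs" using x0 by (auto simp: D_def)
  then show "D : space borel \<rightarrow> {(t, i, a). t : {0..T} & a : A i}" unfolding space_Xs .
 qed
 define eta' where "eta' = distr \<nu> Xs D"
 have "Phi : borel_measurable Xs & (%n. \<integral>x. Phi x \<partial>eta (r n)) \<longlonglongrightarrow> (\<integral>x. Phi x \<partial>eta')"
  if Phi: "!!i. continuous_on ({0..T} \<times> A i) (%(t, a). Phi (t, i, a))" "!!x. x : space Xs ==> \<bar>Phi x\<bar> <= B" for Phi :: "real \<times> 's \<times> 'a => real" and B
 proof -
  have "0 <= B" using Phi(2)[OF x0] by linarith
  moreover have "closedin (top_of_set UNIV) ?S" using state_code_closed by simp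
  moreover have "norm (Phi (state_decode x)) <= B" if "x : ?S" for x using that Phi(2) by auto
  ultimately obtain phi where phi: "continuous_on UNIV phi" "!!x. x : ?S ==> phi x = Phi (state_decode x)" "!!x. x : UNIV ==> norm (phi x) <= B"
   using Tietze[OF slice_continuous[OF Phi(1)]] by blast
  then have phi3: "\<bar>phi x\<bar> <= B" for x by simp
  have [measurable]: "phi : borel_measurable borel" using phi(1) by (rule borel_measurable_continuous_onI)
  have eq: "phi (state_code x) = Phi x" if "x : space Xs" for x using phi(2) that by simp
  have "(%x. phi (state_code x)) : borel_measurable Xs" by measurable
  then have m[measurable]: "Phi : borel_measurable Xs" using eq by (simp cong: measurable_cong)
  have "(\<integral>x. phi x \<partial>\<mu> n) = (\<integral>x. Phi x \<partial>eta n)" for n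
   unfolding \<mu>_def by (subst integral_distr, simp, simp) (auto intro!: Bochner_Integration.integral_cong simp: eq sp)
  moreover have "(\<integral>x. phi x \<partial>\<nu>) = (\<integral>x. Phi x \<partial>eta')"
   unfolding eta'_def
  proof (subst integral_distr, simp, simp, rule integral_cong_AE)
   show "AE x in \<nu>. phi x = Phi (D x)" using AE_S by eventually_elim (simp add: D_def phi(2))
  qed measurable
  ultimately show ?thesis using conv[OF phi(1) phi3] m by simp
 qed
 moreover have "prob_space eta'" unfolding eta'_def by (intro \<nu>.prob_space_distr) simp
 ultimately show ?thesis using r by (intro that[of r eta']) (auto simp: eta'_def)
qed

end

section \<open>Limits of occupation measures\<close>

text \<open>The pi-lambda argument for a sum of two measures on each side: the balance identity
  compares such sums, not single measures.\<close>

lemma finite_measures_sum_eqI: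
 fixes M1 M2 N1 N2 :: "real measure"
 assumes fin: "finite_measure M1" "finite_measure M2" "finite_measure N1" "finite_measure N2"
  and sets: "sets M1 = sets borel" "sets M2 = sets borel" "sets N1 = sets borel" "sets N2 = sets borel"
  and eq: "!!s. emeasure M1 {..s} + emeasure M2 {..s} = emeasure N1 {..s} + emeasure N2 {..s}"
   "emeasure M1 UNIV + emeasure M2 UNIV = emeasure N1 UNIV + emeasure N2 UNIV"
  and B: "B : sets borel"
 shows "emeasure M1 B + emeasure M2 B = emeasure N1 B + emeasure N2 B"
proof -
 interpret M1: finite_measure M1 by fact
 interpret M2: finite_measure M2 by fact
 interpret N1: finite_measure N1 by fact
 interpret N2: finite_measure N2 by fact
 note em = M1.emeasure_eq_measure M2.emeasure_eq_measure N1.emeasure_eq_measure N2.emeasure_eq_measure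
 note sp = sets_eq_imp_space_eq[OF sets(1)] sets_eq_imp_space_eq[OF sets(2)] sets_eq_imp_space_eq[OF sets(3)] sets_eq_imp_space_eq[OF sets(4)]
 let ?P = "%B. measure M1 B + measure M2 B = measure N1 B + measure N2 B"
 have conv: "emeasure M1 B + emeasure M2 B = emeasure N1 B + emeasure N2 B \<longleftrightarrow> ?P B" for B
  by (simp add: em ennreal_plus[symmetric] del: ennreal_plus)
 have borel: "sets (borel :: real measure) = sigma_sets UNIV (range atMost)"
  unfolding borel_eq_atMost by (simp add: sets_measure_of)
 have "Int_stable (range (atMost :: real => _))" by (auto simp: Int_stable_def)
 then have "?P B"
 proof (rule sigma_sets_induct_disjoint[where A = B and \<Omega> = UNIV])
  show "B : sigma_sets UNIV (range atMost)" using B by (simp add: borel)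
  show "?P {}" by simp
  show "?P A" if "A : range atMost" for A using that eq(1) by (auto simp: conv)
  show "?P (UNIV - A)" if "A : sigma_sets UNIV (range atMost)" "?P A" for A
  proof -
   have "A : sets borel" using that(1) by (simp add: borel)
   then show ?thesis
    using M1.finite_measure_compl[of A] M2.finite_measure_compl[of A] N1.finite_measure_compl[of A] N2.finite_measure_compl[of A]
     that(2) eq(2) unfolding conv sets sp by simp
  qed
  show "?P (\<Union>i. F i)" if "disjoint_family F" "range F \<subseteq> sigma_sets UNIV (range atMost)" "!!i. ?P (F i)" for F :: "nat => _"
  proof -
   have F: "range F \<subseteq> sets borel" using that(2) by (simp add: borel)
   have "(%i. measure M1 (F i) + measure M2 (F i)) sums (measure M1 (\<Union>i. F i) + measure M2 (\<Union>i. F i))"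
    "(%i. measure N1 (F i) + measure N2 (F i)) sums (measure N1 (\<Union>i. F i) + measure N2 (\<Union>i. F i))"
    using that(1) F by (auto intro!: sums_add M1.finite_measure_UNION M2.finite_measure_UNION N1.finite_measure_UNION N2.finite_measure_UNION simp: sets)
   then show ?thesis using that(3) by (simp add: sums_iff)
  qed
 qed auto
 then show ?thesis by (simp add: conv)
qed

lemma nn_integral_sum_eqI:
 assumes sets: "sets M1 = sets M" "sets M2 = sets M" "sets N1 = sets M" "sets N2 = sets M"
  and eq: "!!B. B : sets M ==> emeasure M1 B + emeasure M2 B = emeasure N1 B + emeasure N2 B"
  and f: "f : borel_measurable M"
 shows "(NN x. f x \<partial>M1) + (NN x. f x \<partial>M2) = (NN x. f x \<partial>N1) + (NN x. f x \<partial>N2)"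
 using f
proof (induction rule: borel_measurable_induct)
 note [measurable_cong] = sets
 note sp = sets_eq_imp_space_eq[OF sets(1)] sets_eq_imp_space_eq[OF sets(2)] sets_eq_imp_space_eq[OF sets(3)] sets_eq_imp_space_eq[OF sets(4)]
 {
  case (cong f g)
  then have "(NN x. f x \<partial>K) = (NN x. g x \<partial>K)" if "space K = space M" for K
   using that by (intro nn_integral_cong) auto
  then show ?case using cong.IH sp cong by metis
 next
  case (set A) then show ?case using eq sets by simp
 next
  case (mult u c)
  then show ?case by (simp add: nn_integral_cmult distrib_left[symmetric])
 next
  case (add u v)
  then show ?case by (simp add: nn_integral_add ac_simps)
 next
  case (seq U)
  have "(NN x. (SUP i. U i) x \<partial>K) = (SUP i. NN x. U i x \<partial>K)" if "sets K = sets M" for K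
  proof -
   note [measurable_cong] = that
   show ?thesis using seq by (simp add: SUP_apply[abs_def] image_image nn_integral_monotone_convergence_SUP)
  qed
  note S = this[OF sets(1)] this[OF sets(2)] this[OF sets(3)] this[OF sets(4)]
  have inc: "incseq (%i. NN x. U i x \<partial>K)" for K
   using seq(3) by (auto simp: incseq_def le_fun_def intro!: nn_integral_mono)
  show ?case unfolding S ennreal_SUP_add[OF inc inc, symmetric] by (simp only: seq.IH)
 }
qed

context ctmdp
begin

text \<open>Tested with \<open>f\<close> at a fixed state \<open>j\<close>, the balance identity
  compares integrals of \<open>f\<close> against four measures on the time axis: this one for the
  marginal, and \<open>rate_mass\<close> for the initial term and the two flow terms.\<close>

definition state_mass :: "(real \<times> 's \<times> 'a) measure => 's => real measure" where
 "state_mass eta j = distr (density eta (%x. indicator {j} (fst (snd x)))) borel fst"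

definition rate_mass :: "(real => ennreal) => real measure" where
 "rate_mass r = density lborel (%t. indicator {0..T} t * r t)"

lemma measurable_fst_occ:
 assumes "sets eta = sets Xs"
 shows "fst : eta \<rightarrow>\<^sub>M borel" "(%x. indicator {j} (fst (snd x)) :: ennreal) : borel_measurable eta"
 by (rule measurable_occ[OF assms], measurable)+

lemma sets_state_mass [simp]: "sets (state_mass eta j) = sets borel" and sets_rate_mass [simp]: "sets (rate_mass r) = sets borel"
 by (simp_all add: state_mass_def rate_mass_def)

lemma nn_integral_state_mass:
 assumes "sets eta = sets Xs" "f : borel_measurable borel"
 shows "(NN t. f t \<partial>state_mass eta j) = (NN (t, i, a). f t * indicator {j} i \<partial>eta)"
proof -
 note [measurable] = measurable_fst_occ[OF assms(1)] assms(2)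
 show ?thesis unfolding state_mass_def
  by (subst nn_integral_distr, simp, simp, subst nn_integral_density) (auto simp: case_prod_beta' mult.commute)
qed

lemma nn_integral_rate_mass:
 assumes [measurable]: "r : borel_measurable borel" "f : borel_measurable borel"
 shows "(NN t. f t \<partial>rate_mass r) = (NN t. f t * indicator {0..T} t * r t \<partial>lborel)"
 unfolding rate_mass_def by (subst nn_integral_density) (auto simp: mult_ac)

lemma occ_rate_measurable:
 assumes "sets eta = sets Xs" "finite_measure eta"
 shows "(%t. occ_out eta t j) : borel_measurable borel" "(%t. occ_in eta t j) : borel_measurable borel"
proof -
 have "(%t. (t, j)) : borel \<rightarrow>\<^sub>M borel \<Otimes>\<^sub>M counting" by simp
 from measurable_compose[OF this occ_out_measurable[OF assms]] measurable_compose[OF this occ_in_measurable[OF assms]]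
 show "(%t. occ_out eta t j) : borel_measurable borel" "(%t. occ_in eta t j) : borel_measurable borel" by simp_all
qed

lemma count_integral_single:
 "(NN k. f k * indicator {j} k * g k \<partial>counting) = f j * g j"
proof -
 have "(NN k. f k * indicator {j} k * g k \<partial>counting) = (NN k. (f j * g j) * indicator {j} k \<partial>counting)"
  by (intro nn_integral_cong) (simp add: indicator_def)
 then show ?thesis by (simp add: nn_integral_cmult_indicator)
qed

lemma balance_single:
 assumes sets: "sets eta = sets Xs" and fin: "finite_measure eta" and f[measurable]: "f : borel_measurable borel"
 shows "balance eta (%x. f (fst x) * indicator {j} (snd x)) \<longleftrightarrow>
  (NN t. f t \<partial>state_mass eta j) + (NN t. f t \<partial>rate_mass (%t. occ_out eta t j)) =
  (NN t. f t \<partial>rate_mass (%t. ennreal (pmf \<gamma> j / T))) + (NN t. f t \<partial>rate_mass (%t. occ_in eta t j))"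
proof -
 have hm: "(%x. f (fst x) * indicator {j} (snd x)) : borel_measurable borel_counting" by measurable
 note [measurable] = occ_rate_measurable[OF sets fin]
 have a: "(NN k. f t * indicator {j} k * indicator {0..T} t * g k \<partial>counting) = f t * indicator {0..T} t * g j" for t g
  using count_integral_single[of "%_. f t" j "%k. indicator {0..T} t * g k"] by (simp add: mult_ac)
 have b: "(NN k. f t * indicator {j} k * ennreal (pmf \<gamma> k) * indicator {0..T} t \<partial>counting) = f t * indicator {0..T} t * ennreal (pmf \<gamma> j)" for t
  using a[of t "%k. ennreal (pmf \<gamma> k)"] by (simp add: mult_ac)
 have "ennreal (1 / T) * (NN t. f t * indicator {0..T} t * ennreal (pmf \<gamma> j) \<partial>lborel) = (NN t. f t \<partial>rate_mass (%t. ennreal (pmf \<gamma> j / T)))"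
 proof -
  have "ennreal (pmf \<gamma> j / T) = ennreal (1 / T) * ennreal (pmf \<gamma> j)" using T_pos by (simp add: ennreal_mult'[symmetric])
  then show ?thesis
   by (subst nn_integral_cmult[symmetric]) (auto simp: nn_integral_rate_mass mult_ac intro!: nn_integral_cong)
 qed
 then show ?thesis
  unfolding balance_iff[OF sets fin hm] by (simp add: a b nn_integral_state_mass[OF sets] nn_integral_rate_mass)
qed

text \<open>The states are countable, so a test function splits into its slices
  \<open>h (_, j)\<close>, and equality of the measures on the time axis for every \<open>j\<close>
  implies balance.\<close>

lemma occI_marginals:
 assumes sets: "sets eta = sets Xs" and w3: "(NN (t, i, a). ennreal (w i ^ 3) \<partial>eta) < \<infinity>"
  and eq: "!!j B. B : Sigma_Algebra.sets borel ==>
   emeasure (state_mass eta j) B + emeasure (rate_mass (%t. occ_out eta t j)) B =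
   emeasure (rate_mass (%t. ennreal (pmf \<gamma> j / T))) B + emeasure (rate_mass (%t. occ_in eta t j)) B"
 shows "occ eta"
 unfolding occ_def
proof (intro conjI ballI sets w3)
 fix h :: "real \<times> 's => ennreal" assume h[measurable]: "h : borel_measurable (borel \<Otimes>\<^sub>M count_space (UNIV :: 's set))"
 note fin = finite_if_w_integrable[OF sets w3]
 interpret finite_measure eta by (rule fin)
 note m[measurable] = occ_rate_measurable[OF sets fin]
 let ?f = "%j t. h (t, j)"
 have hj[measurable]: "?f j : borel_measurable borel" for j by measurable
 have swap: "(NN t. NN j. h (t, j) * indicator {0..T} t * r t j \<partial>counting \<partial>lborel) = (NN j. (NN t. ?f j t \<partial>rate_mass (%t. r t j)) \<partial>counting)"
  if r[measurable]: "!!j. (%t. r t j) : borel_measurable borel" for r :: "real => 's => ennreal"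
 proof -
  have "(%(t, j). h (t, j) * indicator {0..T} t * r t j) : borel_measurable (lborel \<Otimes>\<^sub>M counting)"
   by (rule measurable_pair_count2) auto
  then show ?thesis by (subst nn_integral_swap[OF sigma_finite_lborel sigma_finite_count_countable]) (simp_all add: nn_integral_rate_mass)
 qed
 have mass: "(NN (t, i, a). h (t, i) \<partial>eta) = (NN j. (NN t. ?f j t \<partial>state_mass eta j) \<partial>counting)"
 proof -
  have "(NN j. (NN t. ?f j t \<partial>state_mass eta j) \<partial>counting) = (NN j. (NN x. h (fst x, j) * indicator {j} (fst (snd x)) \<partial>eta) \<partial>counting)"
   by (simp add: nn_integral_state_mass[OF sets] case_prod_beta')
  also have "... = (NN x. (NN j. h (fst x, j) * indicator {j} (fst (snd x)) \<partial>counting) \<partial>eta)"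
  proof (rule nn_integral_swap[OF sigma_finite_count_countable])
   show "sigma_finite_measure eta" ..
   show "(%(j, x). h (fst x, j) * indicator {j} (fst (snd x))) : borel_measurable (counting \<Otimes>\<^sub>M eta)"
    by (rule measurable_pair_measure_countable1) (auto intro!: borel_measurable_times_ennreal measurable_fst_occ[OF sets] measurable_compose[OF measurable_fst_occ(1)[OF sets] hj])
  qed
  also have "... = (NN x. h (fst x, fst (snd x)) \<partial>eta)"
  proof (intro nn_integral_cong)
   fix x :: "real \<times> 's \<times> 'a"
   have "(NN j. h (fst x, j) * indicator {j} (fst (snd x)) \<partial>counting) = (NN j. h (fst x, j) * indicator {fst (snd x)} j * 1 \<partial>counting)"
    by (intro nn_integral_cong) (auto simp: indicator_def)
   then show "(NN j. h (fst x, j) * indicator {j} (fst (snd x)) \<partial>counting) = h (fst x, fst (snd x))"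
    by (simp only: count_integral_single) simp
  qed
  finally show ?thesis by (simp add: case_prod_beta')
 qed
 have init: "ennreal (1 / T) * (NN t. (NN j. h (t, j) * ennreal (pmf \<gamma> j) * indicator {0..T} t \<partial>counting) \<partial>lborel) =
   (NN j. (NN t. ?f j t \<partial>rate_mass (%t. ennreal (pmf \<gamma> j / T))) \<partial>counting)"
 proof -
  have "(%t. NN j. h (t, j) * ennreal (pmf \<gamma> j) * indicator {0..T} t \<partial>counting) : borel_measurable lborel"
   using measurable_count_integral[OF h, of "%j. ennreal (pmf \<gamma> j)"] by (simp add: nn_integral_multc)
  then have "ennreal (1 / T) * (NN t. (NN j. h (t, j) * ennreal (pmf \<gamma> j) * indicator {0..T} t \<partial>counting) \<partial>lborel) =
   (NN t. (NN j. ennreal (1 / T) * (h (t, j) * ennreal (pmf \<gamma> j) * indicator {0..T} t) \<partial>counting) \<partial>lborel)"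
   by (simp add: nn_integral_cmult)
  also have "... = (NN t. NN j. h (t, j) * indicator {0..T} t * ennreal (pmf \<gamma> j / T) \<partial>counting \<partial>lborel)"
  proof (intro nn_integral_cong)
   fix t j
   have "ennreal (pmf \<gamma> j / T) = ennreal (1 / T) * ennreal (pmf \<gamma> j)" using T_pos by (simp add: ennreal_mult'[symmetric])
   then show "ennreal (1 / T) * (h (t, j) * ennreal (pmf \<gamma> j) * indicator {0..T} t) = h (t, j) * indicator {0..T} t * ennreal (pmf \<gamma> j / T)"
    by (simp only: mult_ac)
  qed
  finally show ?thesis by (simp add: swap)
 qed
 have nm: "(%j. F j) : borel_measurable (counting)" for F :: "'s => ennreal" by simp
 show "balance eta h"
  unfolding balance_iff[OF sets fin h] mass init swap[OF m(1)] swap[OF m(2)] nn_integral_add[OF nm nm, symmetric]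
  by (intro nn_integral_cong nn_integral_sum_eqI[where M = borel]) (auto simp: eq)
qed

lemma inrate_le_outrate: "inrate i a j <= outrate i a"
 using nn_integral_ge_point[of j UNIV "inrate i a"] by (simp add: sum_inrate)

lemma outrate_le_w3: "outrate i a <= ennreal L * ennreal (w i ^ 3)"
proof -
 have "L * w i <= L * w i ^ 3" using w_pow_le[of 1 3 i] L_pos by (intro mult_left_mono) auto
 then show ?thesis using outrate_le[of i a] L_pos w_pos[of i] by (auto simp: ennreal_mult'[symmetric] intro: order_trans ennreal_leI)
qed

lemma abs_q_le:
 assumes "a : A i" shows "\<bar>q j i a\<bar> <= L * w i"
proof (cases "j = i")
 case False
 then have "ennreal (q j i a) <= ennreal (L * w i)"
  using order_trans[OF inrate_le_outrate outrate_le, of i a j] assms by (simp add: inrate_def)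
 then show ?thesis using q_nonneg[OF assms False] L_pos w_pos[of i] by (simp add: ennreal_le_iff)
qed (use q_diag assms in simp)

lemma occ_rate_le:
 assumes sets: "sets eta = sets Xs"
 shows "occ_out eta t j <= ennreal L * (NN (t, i, a). ennreal (w i ^ 3) \<partial>eta)"
  and "occ_in eta t j <= ennreal L * (NN (t, i, a). ennreal (w i ^ 3) \<partial>eta)"
proof -
 have "ennreal L * (NN (t, i, a). ennreal (w i ^ 3) \<partial>eta) = (NN x. ennreal L * (case x of (t, i, a) => ennreal (w i ^ 3)) \<partial>eta)"
  by (intro nn_integral_cmult[symmetric] measurable_w_occ[OF sets])
 then show "occ_out eta t j <= ennreal L * (NN (t, i, a). ennreal (w i ^ 3) \<partial>eta)"
  and "occ_in eta t j <= ennreal L * (NN (t, i, a). ennreal (w i ^ 3) \<partial>eta)"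
  unfolding occ_out_def occ_in_def using outrate_le_w3 order_trans[OF inrate_le_outrate outrate_le_w3]
  by (auto intro!: nn_integral_mono simp: indicator_def split: prod.split)
qed

lemma finite_state_mass:
 assumes "sets eta = sets Xs" "finite_measure eta"
 shows "finite_measure (state_mass eta j)"
proof
 interpret finite_measure eta by fact
 have "emeasure (state_mass eta j) UNIV = (NN (t, i, a). 1 * indicator {j} i \<partial>eta)"
  using nn_integral_state_mass[OF assms(1), of "%_. 1" j] sets_eq_imp_space_eq[OF sets_state_mass, of eta j] by simp
 also have "... <= (NN x. 1 \<partial>eta)" by (intro nn_integral_mono) (auto simp: indicator_def)
 finally show "emeasure (state_mass eta j) (space (state_mass eta j)) \<noteq> \<infinity>"
  using sets_eq_imp_space_eq[OF sets_state_mass, of eta j] by (auto simp: top_unique)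
qed

lemma finite_rate_mass:
 assumes [measurable]: "r : borel_measurable borel" and r: "!!t. r t <= c" "c < \<infinity>"
 shows "finite_measure (rate_mass r)"
proof
 have "emeasure (rate_mass r) UNIV = (NN t. indicator {0..T} t * r t \<partial>lborel)"
  using nn_integral_rate_mass[of r "%_. 1"] sets_eq_imp_space_eq[OF sets_rate_mass, of r] by simp
 also have "... <= (NN t. c * indicator {0..T} t \<partial>lborel)" using r by (intro nn_integral_mono) (auto simp: indicator_def)
 also have "... < \<infinity>" using r T_pos by (simp add: nn_integral_cmult_indicator ennreal_mult_less_top)
 finally show "emeasure (rate_mass r) (space (rate_mass r)) \<noteq> \<infinity>"
  using sets_eq_imp_space_eq[OF sets_rate_mass, of r] by simp
qed

lemma finite_masses:
 assumes sets: "sets eta = sets Xs" and w3: "(NN (t, i, a). ennreal (w i ^ 3) \<partial>eta) < \<infinity>"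
 shows "finite_measure (state_mass eta j)" "finite_measure (rate_mass (%t. occ_out eta t j))"
  "finite_measure (rate_mass (%t. ennreal (pmf \<gamma> j / T)))" "finite_measure (rate_mass (%t. occ_in eta t j))"
proof -
 note fin = finite_if_w_integrable[OF sets w3]
 have c: "ennreal L * (NN (t, i, a). ennreal (w i ^ 3) \<partial>eta) < \<infinity>" using w3 by (simp add: ennreal_mult_less_top)
 show "finite_measure (state_mass eta j)" by (rule finite_state_mass[OF sets fin])
 show "finite_measure (rate_mass (%t. ennreal (pmf \<gamma> j / T)))" by (rule finite_rate_mass[of _ "ennreal (pmf \<gamma> j / T)"]) auto
 show "finite_measure (rate_mass (%t. occ_out eta t j))" "finite_measure (rate_mass (%t. occ_in eta t j))"
  by (rule finite_rate_mass[OF occ_rate_measurable(1)[OF sets fin] occ_rate_le(1)[OF sets] c]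
    finite_rate_mass[OF occ_rate_measurable(2)[OF sets fin] occ_rate_le(2)[OF sets] c])+
qed

text \<open>Continuous ramps that decrease to the indicator of \<open>{..s}\<close> determine the
  four finite measures on half-lines, and half-lines determine them on Borel sets. Weak limits
  provide balance for exactly such functions.\<close>

lemma occI_continuous:
 assumes sets: "sets eta = sets Xs" and w3: "(NN (t, i, a). ennreal (w i ^ 3) \<partial>eta) < \<infinity>"
  and bal: "!!phi j. continuous_on UNIV phi ==> (!!t. 0 <= phi t) ==> (!!t. phi t <= 1) ==>
    balance eta (%x. ennreal (phi (fst x)) * indicator {j} (snd x))"
 shows "occ eta"
proof (rule occI_marginals[OF sets w3])
 fix j and B :: "real set" assume B: "B : Sigma_Algebra.sets borel"
 note fin = finite_if_w_integrable[OF sets w3]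
 let ?M1 = "state_mass eta j" and ?M2 = "rate_mass (%t. occ_out eta t j)"
  and ?N1 = "rate_mass (%t. ennreal (pmf \<gamma> j / T))" and ?N2 = "rate_mass (%t. occ_in eta t j)"
 note m = finite_masses[OF sets w3, of j]
 have eq: "(NN t. ennreal (phi t) \<partial>?M1) + (NN t. ennreal (phi t) \<partial>?M2) = (NN t. ennreal (phi t) \<partial>?N1) + (NN t. ennreal (phi t) \<partial>?N2)"
  if "continuous_on UNIV phi" "!!t. 0 <= phi t" "!!t. phi t <= 1" for phi :: "real => real"
 proof -
  have "(%t. ennreal (phi t)) : borel_measurable borel" using that(1) by (intro measurable_compose[OF borel_measurable_continuous_onI measurable_ennreal])
  from balance_single[OF sets fin this, of j] show ?thesis using bal[OF that, of j] by simp
 qed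
 show "emeasure ?M1 B + emeasure ?M2 B = emeasure ?N1 B + emeasure ?N2 B"
 proof (rule finite_measures_sum_eqI[OF m(1,2,3,4) _ _ _ _ _ _ B])
  show "emeasure ?M1 UNIV + emeasure ?M2 UNIV = emeasure ?N1 UNIV + emeasure ?N2 UNIV"
   using eq[of "%_. 1"] sets_eq_imp_space_eq[OF sets_state_mass, of eta j] sets_eq_imp_space_eq[OF sets_rate_mass] by simp
  fix s :: real
  define phi where "phi = (%k t. max 0 (min 1 (1 + real k * (s - t))))"
  have phi: "continuous_on UNIV (phi k)" "0 <= phi k t" "phi k t <= 1" for k t
   by (auto simp: phi_def intro!: continuous_intros)
  have pt: "(%k. ennreal (phi k t)) \<longlonglongrightarrow> indicator {..s} t" for t
  proof (cases "t <= s")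
   case False
   then obtain k0 where k0: "1 < real k0 * (t - s)" using reals_Archimedean3[of "t - s"] by auto
   have "phi k t = 0" if "k0 <= k" for k
   proof -
    have "real k0 * (t - s) <= real k * (t - s)" using that False by (intro mult_right_mono) auto
    then show ?thesis using k0 by (simp add: phi_def algebra_simps)
   qed
   then show ?thesis using False by (intro tendsto_eventually) (auto simp: eventually_sequentially intro!: exI[of _ k0])
  qed (simp add: phi_def)
  have lim: "(%k. NN t. ennreal (phi k t) \<partial>M) \<longlonglongrightarrow> emeasure M {..s}"
   if "finite_measure M" and [measurable_cong]: "Sigma_Algebra.sets M = Sigma_Algebra.sets borel" for M
  proof -
   interpret finite_measure M by fact
   have [measurable]: "phi k : borel_measurable borel" for k using phi(1) by (rule borel_measurable_continuous_onI)
   have "(%k. NN t. ennreal (phi k t) \<partial>M) \<longlonglongrightarrow> (NN t. indicator {..s} t \<partial>M)"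
   proof (rule nn_integral_dominated_convergence[where w = "%_. 1"])
    show "AE t in M. ennreal (phi k t) <= 1" for k using phi(3) by (auto intro!: AE_I2)
   qed (auto simp: pt emeasure_finite less_top[symmetric])
   then show ?thesis using that(2) by simp
  qed
  have "(%k. (NN t. ennreal (phi k t) \<partial>?M1) + (NN t. ennreal (phi k t) \<partial>?M2)) \<longlonglongrightarrow> emeasure ?M1 {..s} + emeasure ?M2 {..s}"
   by (intro tendsto_add lim m) simp_all
  moreover have "(%k. (NN t. ennreal (phi k t) \<partial>?N1) + (NN t. ennreal (phi k t) \<partial>?N2)) \<longlonglongrightarrow> emeasure ?N1 {..s} + emeasure ?N2 {..s}"
   by (intro tendsto_add lim m) simp_all
  ultimately show "emeasure ?M1 {..s} + emeasure ?M2 {..s} = emeasure ?N1 {..s} + emeasure ?N2 {..s}"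
   unfolding eq[OF phi] by (rule LIMSEQ_unique)
 qed simp_all
qed

lemma dual_term_single:
 "dual_term (%x. phi (fst x) * indicator {j} (snd x)) t i a = (LINT s:{t..T}|lborel. phi s) * q j i a"
proof -
 have "(\<Sum>\<^sub>\<infinity>k. phi s * indicator {j} k * q k i a) = (\<Sum>\<^sub>\<infinity>k\<in>{j}. phi s * q k i a)" for s
  by (rule infsum_cong_neutral) (auto simp: indicator_def)
 then show ?thesis by (simp add: dual_term_def)
qed

lemma continuous_on_tail_integral:
 assumes "continuous_on UNIV (phi :: real => real)"
 shows "continuous_on {0..T} (%t. LINT s:{t..T}|lborel. phi s)"
proof -
 have int: "phi integrable_on {a..b}" for a b using assms by (intro integrable_continuous_real) (auto intro: continuous_on_subset)
 have eq: "(LINT s:{t..T}|lborel. phi s) = integral {0..T} phi - integral {0..t} phi" if "t : {0..T}" for t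
 proof -
  have "set_integrable lborel {t..T} phi" using assms by (intro borel_integrable_atLeastAtMost') (auto intro: continuous_on_subset)
  then have "(LINT s:{t..T}|lborel. phi s) = integral {t..T} phi" by (rule set_borel_integral_eq_integral(2))
  moreover have "integral {0..t} phi + integral {t..T} phi = integral {0..T} phi"
   using that int by (intro Henstock_Kurzweil_Integration.integral_combine) auto
  ultimately show ?thesis by linarith
 qed
 have "continuous_on {0..T} (%t. integral {0..T} phi - integral {0..t} phi)"
  by (intro continuous_on_diff continuous_on_const indefinite_integral_continuous_1 int)
 then show ?thesis by (subst continuous_on_cong[OF refl eq])
qed

lemma slice_measurable:
 assumes "!!i. continuous_on ({0..T} \<times> A i) (%(t, a). Phi (t, i, a) :: real)"
 shows "Phi : borel_measurable Xs"
proof -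
 have "(%(t, i, a). indicator ({0..T} \<times> A i) (t, a) *\<^sub>R Phi (t, i, a)) : borel_measurable Xs"
 proof (intro measurable_Xs_I measurable_by_state)
  fix i
  have "{0..T} \<times> A i : sets borel" using A_compact by (intro borel_closed closed_Times compact_imp_closed) auto
  from borel_measurable_continuous_on_indicator[OF this assms]
  show "(%(t, a). indicator ({0..T} \<times> A i) (t, a) *\<^sub>R Phi (t, i, a)) : borel_measurable (borel \<Otimes>\<^sub>M borel)"
   by (simp add: borel_prod case_prod_beta')
 qed
 moreover have "(case x of (t, i, a) => indicator ({0..T} \<times> A i) (t, a) *\<^sub>R Phi (t, i, a)) = Phi x" if "x : space Xs" for x
  using that by (auto simp: space_Xs)
 ultimately show ?thesis by (simp cong: measurable_cong)
qed

text \<open>Off the level \<open>w <= m\<close> one has \<open>C * w <= C * w ^ 3 / m\<close>: the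
  third moment gives uniform integrability of functions of order \<open>w\<close>.\<close>

lemma w_truncation:
 assumes sets: "sets eta = sets Xs" and prob: "prob_space eta" and W: "(NN (t, i, a). ennreal (w i ^ 3) \<partial>eta) <= ennreal W" "0 <= W"
  and Phi: "Phi : borel_measurable Xs" "!!t i a. t : {0..T} ==> a : A i ==> \<bar>Phi (t, i, a)\<bar> <= C * w i" "0 <= C" and m: "0 < m"
 shows "integrable eta Phi" "\<bar>(\<integral>x. Phi x \<partial>eta) - (\<integral>x. (if w (fst (snd x)) <= real m then Phi x else 0) \<partial>eta)\<bar> <= C * W / real m"
proof -
 interpret prob_space eta by fact
 have sp: "space eta = space Xs" by (rule sets_eq_imp_space_eq[OF sets])
 have Phim[measurable]: "Phi : borel_measurable eta" using Phi(1) measurable_cong_sets[OF sets refl] by blast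
 have wm[measurable]: "(%x. w (fst (snd x)) ^ k) : borel_measurable eta" for k using measurable_w_occ[OF sets, of "%x. x ^ k"] by (simp add: case_prod_beta')
 have [measurable]: "(%x. w (fst (snd x))) : borel_measurable eta" using wm[of 1] by simp
 have w3i: "integrable eta (%x. w (fst (snd x)) ^ 3)" and w3: "(\<integral>x. w (fst (snd x)) ^ 3 \<partial>eta) <= W"
 proof -
  have nn: "(NN x. ennreal (w (fst (snd x)) ^ 3) \<partial>eta) <= ennreal W" using W(1) by (simp add: case_prod_beta')
  then show i: "integrable eta (%x. w (fst (snd x)) ^ 3)"
   using w_pos by (intro integrableI_nonneg) (auto simp: less_imp_le less_top intro: le_less_trans)
  then show "(\<integral>x. w (fst (snd x)) ^ 3 \<partial>eta) <= W"
   using nn w_pos W(2) by (subst (asm) nn_integral_eq_integral) (auto simp: less_imp_le intro!: AE_I2)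
 qed
 have C3: "\<bar>Phi x\<bar> <= C * w (fst (snd x)) ^ 3" if "x : space eta" for x
 proof -
  have "\<bar>Phi x\<bar> <= C * w (fst (snd x)) ^ 1" using that Phi(2) unfolding sp space_Xs by auto
  also have "... <= C * w (fst (snd x)) ^ 3" using Phi(3) by (intro mult_left_mono w_pow_le) auto
  finally show ?thesis .
 qed
 show i: "integrable eta Phi"
  using C3 Phi(3) w_pos by (intro Bochner_Integration.integrable_bound[OF integrable_mult_right[OF w3i, of C]]) (auto simp: less_imp_le intro!: AE_I2)
 let ?t = "%x. if w (fst (snd x)) <= real m then Phi x else 0"
 have ti: "integrable eta ?t" by (rule Bochner_Integration.integrable_bound[OF i]) auto
 have "\<bar>(\<integral>x. Phi x \<partial>eta) - (\<integral>x. ?t x \<partial>eta)\<bar> = \<bar>\<integral>x. Phi x - ?t x \<partial>eta\<bar>" using i ti by simp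
 also have "... <= (\<integral>x. \<bar>Phi x - ?t x\<bar> \<partial>eta)" using integral_abs_bound[of eta "%x. Phi x - ?t x"] by simp
 also have "... <= (\<integral>x. C / real m * w (fst (snd x)) ^ 3 \<partial>eta)"
 proof (rule integral_mono)
  fix x assume x: "x : space eta"
  show "\<bar>Phi x - ?t x\<bar> <= C / real m * w (fst (snd x)) ^ 3"
  proof (cases "w (fst (snd x)) <= real m")
   case False
   let ?w = "w (fst (snd x))"
   have "real m * ?w <= ?w ^ 2 * ?w" using False m w_pos[of "fst (snd x)"] w_ge_1[of "fst (snd x)"]
    by (intro mult_right_mono) (auto simp: power2_eq_square intro: order_trans[of _ "?w * 1"])
   then have "?w <= ?w ^ 3 / real m" using m by (simp add: field_simps power3_eq_cube power2_eq_square)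
   moreover have "\<bar>Phi x\<bar> <= C * ?w" using x Phi(2) unfolding sp space_Xs by auto
   ultimately have "\<bar>Phi x\<bar> <= C * (?w ^ 3 / real m)" using Phi(3) by (meson mult_left_mono order_trans)
   then show ?thesis using False by simp
  qed (use Phi(3) w_pos in \<open>simp add: less_imp_le\<close>)
 qed (use i ti w3i in auto)
 also have "... <= C / real m * W" using w3 Phi(3) by (simp add: mult_left_mono divide_right_mono)
 finally show "\<bar>(\<integral>x. Phi x \<partial>eta) - (\<integral>x. ?t x \<partial>eta)\<bar> <= C * W / real m" by simp
qed

text \<open>The limit inherits the moment bound through the capped functions
  \<open>min (w ^ 3) m\<close>, and \<open>w_truncation\<close> extends convergence from bounded
  functions to those of order \<open>w\<close>. Balance passes to the limit because for a test
  function \<open>phi\<close> at a state \<open>j\<close> the dual term is a continuous function of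
  time times \<open>q j i a\<close>, hence continuous and of order \<open>w\<close>.\<close>

lemma occ_compact:
 assumes occ: "!!n. occ (eta n)"
 obtains r eta' where "strict_mono (r :: nat => nat)" "occ eta'"
  "!!Phi C. (!!i. continuous_on ({0..T} \<times> A i) (%(t, a). Phi (t, i, a))) ==>
    (!!t i a. t : {0..T} ==> a : A i ==> \<bar>Phi (t, i, a)\<bar> <= C * w i) ==> 0 <= (C :: real) ==>
    (%n. \<integral>x. Phi x \<partial>eta (r n)) \<longlonglongrightarrow> (\<integral>x. Phi x \<partial>eta')"
proof -
 obtain r eta' where r: "strict_mono (r :: nat => nat)" and sets: "sets eta' = sets Xs" and prob: "prob_space eta'"
  and conv: "!!Phi B. (!!i. continuous_on ({0..T} \<times> A i) (%(t, a). Phi (t, i, a))) ==> (!!x. x : space Xs ==> \<bar>Phi x\<bar> <= (B :: real)) ==>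
    Phi : borel_measurable Xs & (%n. \<integral>x. Phi x \<partial>eta (r n)) \<longlonglongrightarrow> (\<integral>x. Phi x \<partial>eta')"
  by (rule occ_subsequence[of eta, OF occ]) blast
 interpret P: prob_space eta' by (rule prob)
 interpret Pn: prob_space "eta n" for n by (rule occ_prob[OF occ])
 define W where "W = enn2real w3_const"
 have W0: "0 <= W" and Wn: "(NN (t, i, a). ennreal (w i ^ 3) \<partial>eta n) <= ennreal W" for n
  using occ_w3_bound[OF occ, of n] w3_const_finite by (auto simp: W_def)
 have W': "(NN (t, i, a). ennreal (w i ^ 3) \<partial>eta') <= ennreal W"
 proof (rule w3_bound_of_caps[OF sets])
  fix m :: nat
  define f where "f = (%x :: real \<times> 's \<times> 'a. min (w (fst (snd x)) ^ 3) (real m))"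
  have f: "0 <= f x" "f x <= real m" for x using w_pos by (auto simp: f_def less_imp_le)
  have fc: "f : borel_measurable Xs & (%n. \<integral>x. f x \<partial>eta (r n)) \<longlonglongrightarrow> (\<integral>x. f x \<partial>eta')"
   by (rule conv[of f "real m"]) (use f in \<open>auto simp: f_def case_prod_beta'\<close>)
  have fm: "f : borel_measurable eta'" "f : borel_measurable (eta n)" for n
   using fc measurable_cong_sets[OF sets refl] measurable_cong_sets[OF occ_sets[OF occ, of n] refl] by blast+
  have fi: "integrable eta' f" "integrable (eta n) f" for n
   using f fm by (auto intro!: P.integrable_const_bound[where B = "real m"] Pn.integrable_const_bound[where B = "real m"])
  have "(\<integral>x. f x \<partial>eta n) <= W" for n
  proof -
   have "ennreal (\<integral>x. f x \<partial>eta n) = (NN x. ennreal (f x) \<partial>eta n)" using fi f by (simp add: nn_integral_eq_integral)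
   also have "... <= (NN (t, i, a). ennreal (w i ^ 3) \<partial>eta n)" by (intro nn_integral_mono) (auto simp: f_def intro: ennreal_leI)
   also note Wn
   finally show ?thesis using W0 by (simp add: ennreal_le_iff)
  qed
  then have "(\<integral>x. f x \<partial>eta') <= W" using fc by (intro LIMSEQ_le_const2) auto
  moreover have "(NN (t, i, a). ennreal (min (w i ^ 3) (real m)) \<partial>eta') = ennreal (\<integral>x. f x \<partial>eta')"
   using fi(1) f by (subst nn_integral_eq_integral[symmetric]) (auto simp: f_def case_prod_beta')
  ultimately show "(NN (t, i, a). ennreal (min (w i ^ 3) (real m)) \<partial>eta') <= ennreal W" by (simp add: ennreal_leI)
 qed
 then have w3: "(NN (t, i, a). ennreal (w i ^ 3) \<partial>eta') < \<infinity>" by (rule le_less_trans) simp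
 have wconv: "(%n. \<integral>x. Phi x \<partial>eta (r n)) \<longlonglongrightarrow> (\<integral>x. Phi x \<partial>eta')"
  if Phi: "!!i. continuous_on ({0..T} \<times> A i) (%(t, a). Phi (t, i, a))"
   "!!t i a. t : {0..T} ==> a : A i ==> \<bar>Phi (t, i, a)\<bar> <= C * w i" "0 <= (C :: real)" for Phi C
 proof (rule LIMSEQ_I)
  fix e :: real assume e: "0 < e"
  obtain l where l: "3 * (C * W) / e < real l" using reals_Archimedean2 by blast
  define m where "m = Suc l"
  have m: "0 < m" "C * W / real m < e / 3" using l e by (auto simp: m_def field_simps)
  let ?t = "%x :: real \<times> 's \<times> 'a. if w (fst (snd x)) <= real m then Phi x else 0"
  have "(%n. \<integral>x. ?t x \<partial>eta (r n)) \<longlonglongrightarrow> (\<integral>x. ?t x \<partial>eta')"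
  proof (rule conv[THEN conjunct2])
   show "continuous_on ({0..T} \<times> A i) (%(t, a). ?t (t, i, a))" for i
    using Phi(1)[of i] by (cases "w i <= real m") (auto simp: case_prod_beta')
   fix x :: "real \<times> 's \<times> 'a" assume x: "x : space Xs"
   have "\<bar>Phi x\<bar> <= C * w (fst (snd x))" using x Phi(2) unfolding space_Xs by auto
   moreover have "w (fst (snd x)) <= real m ==> C * w (fst (snd x)) <= C * real m" using Phi(3) by (rule mult_left_mono[rotated])
   ultimately show "\<bar>?t x\<bar> <= C * real m" using Phi(3) by (auto intro: order_trans)
  qed
  moreover have "0 < e / 3" using e by simp
  ultimately obtain n0 where n0: "\<forall>n\<ge>n0. norm ((\<integral>x. ?t x \<partial>eta (r n)) - (\<integral>x. ?t x \<partial>eta')) < e / 3"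
   by (rule LIMSEQ_D[THEN exE])
  have "norm ((\<integral>x. Phi x \<partial>eta (r n)) - (\<integral>x. Phi x \<partial>eta')) < e" if "n0 <= n" for n
   using w_truncation(2)[OF occ_sets[OF occ] occ_prob[OF occ] Wn W0 slice_measurable[OF Phi(1)] Phi(2,3) m(1), of "r n"]
    w_truncation(2)[OF sets prob W' W0 slice_measurable[OF Phi(1)] Phi(2,3) m(1)] n0[rule_format, OF that] m(2)
   unfolding real_norm_def by linarith
  then show "\<exists>n0. \<forall>n\<ge>n0. norm ((\<integral>x. Phi x \<partial>eta (r n)) - (\<integral>x. Phi x \<partial>eta')) < e" by blast
 qed
 have "occ eta'"
 proof (rule occI_continuous[OF sets w3])
  fix phi :: "real => real" and j assume phi: "continuous_on UNIV phi" "!!t. 0 <= phi t" "!!t. phi t <= 1"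
  define g where "g = (%x :: real \<times> 's. phi (fst x) * indicator {j} (snd x))"
  have [measurable]: "phi : borel_measurable borel" using phi(1) by (rule borel_measurable_continuous_onI)
  have g01: "0 <= g x" "g x <= 1" for x using phi by (auto simp: g_def indicator_def)
  have gw: "\<bar>g x\<bar> <= 1 * w i ^ k" for x i k using g01[of x] one_le_power[OF w_ge_1[of i], of k] by simp
  have "g : borel_measurable borel_counting" unfolding g_def by measurable
  with gw have g: "w2_bounded g 1" by (simp add: w2_bounded_def)
  define J where "J = (%t. LINT s:{t..T}|lborel. phi s)"
  have dt: "dual_term g t i a = J t * q j i a" for t i a unfolding g_def J_def by (rule dual_term_single)
  have Jc: "continuous_on {0..T} J" unfolding J_def by (rule continuous_on_tail_integral[OF phi(1)])
  obtain B where B: "0 < B" "\<forall>x\<in>J ` {0..T}. norm x <= B"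
   using compact_imp_bounded[OF compact_continuous_image[OF Jc compact_Icc]] unfolding bounded_pos by blast
  then have B: "0 <= B" "!!t. t : {0..T} ==> \<bar>J t\<bar> <= B" by auto
  let ?K = "1 / T * (LINT t:{0..T}|lborel. (\<Sum>\<^sub>\<infinity>j. g (t, j) * pmf \<gamma> j))"
  have 1: "(%n. \<integral>(t, i, a). g (t, i) \<partial>eta (r n)) \<longlonglongrightarrow> (\<integral>(t, i, a). g (t, i) \<partial>eta')"
  proof (rule wconv[of _ 1])
   show "continuous_on ({0..T} \<times> A i) (%(t, a). case (t, i, a) of (t, i, a) => g (t, i))" for i
    unfolding g_def case_prod_beta' using phi(1) by (auto intro!: continuous_intros continuous_on_compose2[OF phi(1)])
  qed (use gw[of _ _ 1] in auto)
  have 2: "(%n. \<integral>(t, i, a). dual_term g t i a \<partial>eta (r n)) \<longlonglongrightarrow> (\<integral>(t, i, a). dual_term g t i a \<partial>eta')"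
  proof (rule wconv[of _ "B * L"])
   show "continuous_on ({0..T} \<times> A i) (%(t, a). case (t, i, a) of (t, i, a) => dual_term g t i a)" for i
    unfolding dt case_prod_beta' fst_conv snd_conv
    by (intro continuous_on_mult continuous_on_compose2[OF Jc] continuous_on_compose2[OF q_cont[of i j]] continuous_intros) auto
   show "\<bar>case (t, i, a) of (t, i, a) => dual_term g t i a\<bar> <= B * L * w i" if "t : {0..T}" "a : A i" for t i a
    using mult_mono[OF B(2)[OF that(1)] abs_q_le[OF that(2), of j] B(1)] by (simp add: dt abs_mult mult.assoc)
  qed (use B L_pos in simp)
  have "(%n. \<integral>(t, i, a). g (t, i) \<partial>eta (r n)) \<longlonglongrightarrow> ?K + (\<integral>(t, i, a). dual_term g t i a \<partial>eta')"
   unfolding occ_test(3)[OF occ g] using 2 by (rule tendsto_add[OF tendsto_const])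
  from LIMSEQ_unique[OF 1 this] have "balance eta' (%x. ennreal (g x))"
   unfolding balance_test_nonneg(3)[OF sets w3 g g01(1)] .
  then show "balance eta' (%x. ennreal (phi (fst x)) * indicator {j} (snd x))"
   by (simp add: g_def ennreal_mult' phi(2) ennreal_indicator)
 qed
 show ?thesis by (rule that[OF r \<open>occ eta'\<close>]) (fact wconv)
qed

end

section \<open>Signed measures and the primal constraint\<close>

lemma measure_of_eq_measure:
 assumes sets: "sets eta = sets M" and F: "!!B. B : sets M ==> F B = emeasure eta B"
 shows "measure_of (space M) (sets M) F = eta"
proof -
 have sp: "space M = space eta" using sets_eq_imp_space_eq[OF sets] by simp
 have "measure_of (space M) (sets M) F = measure_of (space M) (sets M) (emeasure eta)"
  by (rule measure_of_eq) (simp_all add: sets.space_closed sets.sigma_sets_eq F)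
 also have "... = measure_of (space eta) (sets eta) (emeasure eta)" by (simp only: sp sets)
 finally show ?thesis by (simp only: measure_of_of_measure)
qed

lemma pos_variation_measure:
 assumes "finite_measure eta" and sets: "sets eta = sets M"
 shows "pos_variation M (measure eta) = eta"
 unfolding pos_variation_def
proof (rule measure_of_eq_measure[OF sets])
 interpret finite_measure eta by fact
 fix B assume B: "B : sets M"
 show "(SUP C\<in>{C : sets M. C \<subseteq> B}. ennreal (measure eta C)) = emeasure eta B"
 proof (rule antisym)
  show "(SUP C\<in>{C : sets M. C \<subseteq> B}. ennreal (measure eta C)) <= emeasure eta B"
   using B sets by (intro SUP_least) (auto simp: emeasure_eq_measure intro!: ennreal_leI finite_measure_mono)
  show "emeasure eta B <= (SUP C\<in>{C : sets M. C \<subseteq> B}. ennreal (measure eta C))"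
   using B by (intro SUP_upper2[of B]) (auto simp: emeasure_eq_measure)
 qed
qed

lemma neg_variation_measure: "neg_variation M (measure eta) = null_measure M"
 unfolding neg_variation_def pos_variation_def
proof (rule measure_of_eq_measure)
 fix B assume "B : sets M"
 have "(SUP C\<in>{C : sets M. C \<subseteq> B}. ennreal (- measure eta C)) <= 0"
  by (intro SUP_least) (simp add: ennreal_neg)
 then show "(SUP C\<in>{C : sets M. C \<subseteq> B}. ennreal (- measure eta C)) = emeasure (null_measure M) B" by simp
qed simp

lemma total_variation_measure:
 assumes "finite_measure eta" "sets eta = sets M"
 shows "total_variation M (measure eta) = eta"
 unfolding total_variation_def pos_variation_measure[OF assms] neg_variation_measure
 using assms(2) by (intro measure_of_eq_measure) simp_all

lemma signed_integral_measure:
 assumes "finite_measure eta" "sets eta = sets M"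
 shows "signed_integral M (measure eta) f = (\<integral>x. f x \<partial>eta)"
proof -
 have "AE x in null_measure M. f x = 0" by (rule AE_I[of _ _ "space M"]) auto
 then have "(\<integral>x. f x \<partial>null_measure M) = 0" by (rule integral_eq_zero_AE)
 then show ?thesis by (simp add: signed_integral_def pos_variation_measure[OF assms] neg_variation_measure)
qed

lemma signed_measure_measure:
 assumes "finite_measure eta" "sets eta = sets M"
 shows "signed_measure M (measure eta)"
 unfolding signed_measure_def
 using finite_measure.finite_measure_UNION[OF assms(1)] assms(2) by (auto simp: measure_notin_sets)

text \<open>The value zero off the sigma-algebra is the convention of \<open>measure\<close> as
  well, so the equality holds as functions on all sets.\<close>

lemma nonneg_signed_measureE:
 assumes \<nu>: "signed_measure M \<nu>" "!!B. 0 <= \<nu> B"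
 obtains eta where "finite_measure eta" "sets eta = sets M" "\<nu> = measure eta"
proof -
 define eta where "eta = measure_of (space M) (sets M) (%B. ennreal (\<nu> B))"
 have sets: "sets eta = sets M" by (simp add: eta_def)
 have em: "emeasure eta B = ennreal (\<nu> B)" if "B : sets M" for B
 proof (rule emeasure_measure_of[OF eta_def sets.space_closed])
  show "positive (sets eta) (%B. ennreal (\<nu> B))" using \<nu>(1) by (simp add: positive_def signed_measure_def)
  show "countably_additive (sets eta) (%B. ennreal (\<nu> B))"
  proof (rule countably_additiveI)
   fix F :: "nat => _" assume "range F \<subseteq> sets eta" "disjoint_family F"
   then have "(%n. \<nu> (F n)) sums \<nu> (\<Union>n. F n)" using \<nu>(1) by (simp add: signed_measure_def sets)
   then show "(\<Sum>n. ennreal (\<nu> (F n))) = ennreal (\<nu> (\<Union>n. F n))"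
    using \<nu>(2) by (simp add: suminf_ennreal2 sums_iff)
  qed
  show "B : sets eta" using that by (simp add: sets)
 qed
 have "finite_measure eta"
  using em[of "space M"] by (intro finite_measureI) (simp add: sets_eq_imp_space_eq[OF sets])
 moreover have "\<nu> = measure eta"
 proof
  fix B show "\<nu> B = measure eta B"
   using em[of B] \<nu> by (cases "B : sets M") (auto simp: measure_def signed_measure_def sets emeasure_notin_sets)
 qed
 ultimately show ?thesis using sets that by blast
qed

lemma set_integral_lborel_count:
 fixes F :: "real \<times> 's :: countable => ennreal"
 assumes [measurable]: "F : borel_measurable borel_counting" "B : sets borel_counting"
  and fin: "(NN t. NN j. indicator B (t, j) * F (t, j) \<partial>counting \<partial>lborel) < \<infinity>"
 shows "set_integrable (lborel \<Otimes>\<^sub>M counting) B (%z. enn2real (F z))"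
  and "(LINT z:B|lborel \<Otimes>\<^sub>M counting. enn2real (F z)) =
   enn2real (NN t. NN j. indicator B (t, j) * F (t, j) \<partial>counting \<partial>lborel)"
proof -
 let ?M = "lborel \<Otimes>\<^sub>M count_space (UNIV :: 's set)"
 have s: "sets ?M = sets borel_counting" by (intro sets_pair_measure_cong) simp_all
 interpret C: sigma_finite_measure "count_space (UNIV :: 's set)" by (rule sigma_finite_count_countable)
 have m: "(%z. indicator B z * F z) : borel_measurable ?M"
  unfolding measurable_cong_sets[OF s refl] by measurable
 have nn: "(NN z. indicator B z * F z \<partial>?M) = (NN t. NN j. indicator B (t, j) * F (t, j) \<partial>counting \<partial>lborel)"
  using C.nn_integral_fst[OF m] by simp
 have e: "indicator B z *\<^sub>R enn2real (F z) = enn2real (indicator B z * F z)" for z by (simp add: indicator_def)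
 note i = integral_enn2real[OF m, unfolded nn, OF fin]
 show "set_integrable ?M B (%z. enn2real (F z))" unfolding set_integrable_def e by (rule i)
 show "(LINT z:B|?M. enn2real (F z)) = enn2real (NN t. NN j. indicator B (t, j) * F (t, j) \<partial>counting \<partial>lborel)"
  unfolding set_lebesgue_integral_def e by (rule i)
qed

context ctmdp
begin

lemma M_w3_plus_iff:
 "\<nu> : M_w3_plus T A w \<longleftrightarrow>
   (\<exists>eta. sets eta = sets Xs & (NN (t, i, a). ennreal (w i ^ 3) \<partial>eta) < \<infinity> & \<nu> = measure eta)"
proof
 assume "\<nu> : M_w3_plus T A w"
 then have \<nu>: "signed_measure Xs \<nu>" "!!B. 0 <= \<nu> B" "(NN x. ennreal (case x of (t, i, a) => w i ^ 3) \<partial>total_variation Xs \<nu>) < \<infinity>"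
  by (auto simp: M_w3_plus_def M_w3_def weighted_signed_measures_def)
 obtain eta where eta: "finite_measure eta" "sets eta = sets Xs" "\<nu> = measure eta"
  by (rule nonneg_signed_measureE[OF \<nu>(1,2)])
 then show "\<exists>eta. sets eta = sets Xs & (NN (t, i, a). ennreal (w i ^ 3) \<partial>eta) < \<infinity> & \<nu> = measure eta"
  using \<nu>(3) by (intro exI[of _ eta]) (simp add: total_variation_measure case_prod_beta')
next
 assume "\<exists>eta. sets eta = sets Xs & (NN (t, i, a). ennreal (w i ^ 3) \<partial>eta) < \<infinity> & \<nu> = measure eta"
 then obtain eta where eta: "sets eta = sets Xs" "(NN (t, i, a). ennreal (w i ^ 3) \<partial>eta) < \<infinity>" "\<nu> = measure eta" by blast
 note fin = finite_if_w_integrable[OF eta(1,2)]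
 show "\<nu> : M_w3_plus T A w"
  using eta signed_measure_measure[OF fin eta(1)]
  by (simp add: M_w3_plus_def M_w3_def weighted_signed_measures_def total_variation_measure[OF fin eta(1)] case_prod_beta')
qed

lemma rate_integral:
 assumes sets: "sets eta = sets Xs" and w3: "(NN (t, i, a). ennreal (w i ^ 3) \<partial>eta) < \<infinity>" and s: "s : {0..T}"
 shows "signed_integral Xs (measure eta) (%(t, i, a). indicator {t..T} s * q j i a) = enn2real (occ_in eta s j) - enn2real (occ_out eta s j)"
proof -
 note fin = finite_if_w_integrable[OF sets w3]
 let ?I = "%(t, i, a). indicator {..s} t * inrate i a j" and ?O = "%(t, i, a). indicator {..s} t * (if i = j then outrate i a else 0)"
 have m: "?I : borel_measurable eta" "?O : borel_measurable eta"
  by (intro measurable_occ[OF sets] measurable_by_state, measurable)+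
 have c: "ennreal L * (NN (t, i, a). ennreal (w i ^ 3) \<partial>eta) < \<infinity>" using w3 by (simp add: ennreal_mult_less_top)
 have f: "(NN x. ?I x \<partial>eta) < \<infinity>" "(NN x. ?O x \<partial>eta) < \<infinity>"
  using le_less_trans[OF occ_rate_le(2)[OF sets] c, of s j] le_less_trans[OF occ_rate_le(1)[OF sets] c, of s j]
  by (simp_all only: occ_in_def occ_out_def)
 note iI = integral_enn2real[OF m(1) f(1)] and iO = integral_enn2real[OF m(2) f(2)]
 have "(\<integral>(t, i, a). indicator {t..T} s * q j i a \<partial>eta) = (\<integral>x. enn2real (?I x) - enn2real (?O x) \<partial>eta)"
 proof (rule Bochner_Integration.integral_cong[OF refl])
  fix x assume "x : space eta"
  then obtain t i a where x: "x = (t, i, a)" "t : {0..T}" "a : A i" unfolding space_occ[OF sets] by auto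
  show "(case x of (t, i, a) => indicator {t..T} s * q j i a) = enn2real (?I x) - enn2real (?O x)"
   using s x(2) q_nonneg[OF x(3), of j] q_diag_nonpos[OF x(3)] x(3)
   by (cases "j = i") (auto simp: x(1) inrate_def outrate_def indicator_def)
 qed
 also have "... = (\<integral>x. enn2real (?I x) \<partial>eta) - (\<integral>x. enn2real (?O x) \<partial>eta)"
  by (rule Bochner_Integration.integral_diff[OF iI(1) iO(1)])
 finally show ?thesis unfolding signed_integral_measure[OF fin sets] iI(2) iO(2) occ_in_def occ_out_def .
qed

lemma rate_total_finite:
 assumes sets: "sets eta = sets Xs" and w3: "(NN (t, i, a). ennreal (w i ^ 3) \<partial>eta) < \<infinity>"
 shows "(NN t. NN j. indicator {0..T} t * occ_in eta t j \<partial>counting \<partial>lborel) < \<infinity>"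
  and "(NN t. NN j. indicator {0..T} t * occ_out eta t j \<partial>counting \<partial>lborel) < \<infinity>"
proof -
 note fin = finite_if_w_integrable[OF sets w3]
 let ?h = "%_ :: real \<times> 's. ennreal 1"
 have tb: "tail ?h t j <= ennreal (T * w j ^ 2)" if "t : {0..T}" for t j
 proof -
  have "tail ?h t j <= ennreal (1 * T)" using that by (intro tail_le_const) auto
  also have "... <= ennreal (T * w j ^ 2)" using T_pos one_le_power[OF w_ge_1[of j], of 2] by (intro ennreal_leI) (simp add: mult_le_cancel_left1)
  finally show ?thesis .
 qed
 have T0: "0 <= T" using T_pos by simp
 have [measurable]: "(%a. if i = j then outrate i a else 0) : borel_measurable borel" for i j by measurable
 have "(NN (s, i, a). (NN j. tail ?h s j * inrate i a j \<partial>counting) \<partial>eta) < \<infinity>"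
  by (rule nn_integral_w3_finite[OF sets w3, of _ "T * (R + L)"]) (simp add: w2_in_bound[OF T0 tb, simplified])
 then show "(NN t. NN j. indicator {0..T} t * occ_in eta t j \<partial>counting \<partial>lborel) < \<infinity>"
  by (subst (asm) occ_time_swap(1)[OF sets fin]) (simp_all add: occ_in_def[symmetric])
 have "(NN (s, i, a). (NN j. tail ?h s j * (if i = j then outrate i a else 0) \<partial>counting) \<partial>eta) < \<infinity>"
  unfolding tail_out_eq[symmetric]
  by (rule nn_integral_w3_finite[OF sets w3, of _ "T * L"]) (simp add: w2_out_bound[OF T0 tb, simplified])
 then show "(NN t. NN j. indicator {0..T} t * occ_out eta t j \<partial>counting \<partial>lborel) < \<infinity>"
  by (subst (asm) occ_time_swap(1)[OF sets fin]) (simp_all add: occ_out_def[symmetric])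
qed

lemma sets_Y_space: "B : sets (Y_space T) \<longleftrightarrow> B : sets (borel \<Otimes>\<^sub>M count_space (UNIV :: 's set)) & B \<subseteq> {0..T} \<times> UNIV"
 unfolding Y_space_def by (subst sets_restrict_space_iff) (auto simp: space_pair_measure)

text \<open>At a single set \<open>B\<close> the constraint is the balance identity tested with the
  indicator of \<open>B\<close>; all terms are finite, so the diagonal term can be moved between
  real and nonnegative form.\<close>

lemma flow_eq_iff_balance:
 assumes sets: "sets eta = sets Xs" and w3: "(NN (t, i, a). ennreal (w i ^ 3) \<partial>eta) < \<infinity>" and B: "B : Sigma_Algebra.sets (Y_space T)"
 shows "Y_marginal T A (measure eta) B -
   Y_density T (%(s, j). signed_integral Xs (measure eta) (%(t, i, a). indicator {t..T} s * q j i a)) B =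
   1 / T * Y_density T (%(t, j). pmf \<gamma> j) B \<longleftrightarrow> balance eta (indicator B)"
proof -
 note fin = finite_if_w_integrable[OF sets w3]
 interpret finite_measure eta by (rule fin)
 have Bm[measurable]: "B : Sigma_Algebra.sets borel_counting" and BT: "B \<subseteq> {0..T} \<times> UNIV" using B by (auto simp: sets_Y_space)
 let ?c = "%F. NN t. NN j. indicator B (t, j) * F (t, j) \<partial>counting \<partial>lborel"
 let ?I = "%z. occ_in eta (fst z) (snd z)" and ?O = "%z. occ_out eta (fst z) (snd z)" and ?G = "%z :: real \<times> 's. ennreal (pmf \<gamma> (snd z))"
 have m: "?I : borel_measurable borel_counting" "?O : borel_measurable borel_counting"
  "?G : borel_measurable borel_counting"
  using occ_in_measurable[OF sets fin] occ_out_measurable[OF sets fin] by (simp_all add: case_prod_beta')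
 have cb: "?c F <= (NN t. NN j. indicator {0..T} t * F (t, j) \<partial>counting \<partial>lborel)" for F
  using BT by (intro nn_integral_mono) (auto simp: indicator_def)
 have "(NN t. NN j. indicator {0..T} t * ?G (t, j) \<partial>counting \<partial>lborel) = ennreal T"
  using T_pos by (simp add: nn_integral_cmult pmf_sum)
 then have f: "?c ?I < \<infinity>" "?c ?O < \<infinity>" "?c ?G < \<infinity>"
  using le_less_trans[OF cb[of ?I]] le_less_trans[OF cb[of ?O]] le_less_trans[OF cb[of ?G]] rate_total_finite[OF sets w3] by simp_all
 note I = set_integral_lborel_count[OF m(1) Bm f(1)] and O = set_integral_lborel_count[OF m(2) Bm f(2)] and G = set_integral_lborel_count[OF m(3) Bm f(3)]
 have Bl: "B : Sigma_Algebra.sets (lborel \<Otimes>\<^sub>M counting)"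
  using Bm sets_pair_measure_cong[OF sets_lborel refl, of "count_space (UNIV :: 's set)"] by simp
 have flow: "Y_density T (%(s, j). signed_integral Xs (measure eta) (%(t, i, a). indicator {t..T} s * q j i a)) B = enn2real (?c ?I) - enn2real (?c ?O)"
 proof -
  have "Y_density T (%(s, j). signed_integral Xs (measure eta) (%(t, i, a). indicator {t..T} s * q j i a)) B
    = (LINT z:B|lborel \<Otimes>\<^sub>M counting. enn2real (?I z) - enn2real (?O z))"
   unfolding Y_density_def using B BT
   by (simp, intro set_lebesgue_integral_cong[OF Bl]) (auto simp: rate_integral[OF sets w3])
  then show ?thesis by (simp only: set_integral_diff(2)[OF I(1) O(1)] I(2) O(2))
 qed
 have init: "Y_density T (%(t, j). pmf \<gamma> j) B = enn2real (?c ?G)"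
  unfolding Y_density_def G(2)[symmetric] using B by (simp add: case_prod_beta')
 have pre: "{(t, i, a) : space Xs. (t, i) : B} : Sigma_Algebra.sets eta"
  and marg: "(NN (t, i, a). indicator B (t, i) \<partial>eta) = emeasure eta {(t, i, a) : space Xs. (t, i) : B}"
 proof -
  have "(%(t, i, a). indicator B (t, i) :: ennreal) : borel_measurable eta" by (rule measurable_ti_occ[OF sets]) simp
  from measurable_sets[OF this, of "{1}"] have "(%(t, i, a). indicator B (t, i) :: ennreal) -` {1} \<inter> space eta : Sigma_Algebra.sets eta" by simp
  also have "(%(t, i, a). indicator B (t, i) :: ennreal) -` {1} \<inter> space eta = {(t, i, a) : space Xs. (t, i) : B}"
   using sets_eq_imp_space_eq[OF sets] by (auto simp: indicator_def split: if_splits)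
  finally show p: "{(t, i, a) : space Xs. (t, i) : B} : Sigma_Algebra.sets eta" .
  have "(NN (t, i, a). indicator B (t, i) \<partial>eta) = (NN x. indicator {(t, i, a) : space Xs. (t, i) : B} x \<partial>eta)"
   using sets_eq_imp_space_eq[OF sets] by (intro nn_integral_cong) (auto simp: indicator_def)
  then show "(NN (t, i, a). indicator B (t, i) \<partial>eta) = emeasure eta {(t, i, a) : space Xs. (t, i) : B}" using p by simp
 qed
 have Y: "Y_marginal T A (measure eta) B = enn2real (NN (t, i, a). indicator B (t, i) \<partial>eta)"
  unfolding marg using B by (simp add: Y_marginal_def measure_def)
 have tt: "indicator B (t, j) * indicator {0..T} t = (indicator B (t, j) :: ennreal)" for t j using BT by (auto simp: indicator_def)
 have tt': "indicator B (t, j) * x * indicator {0..T} t = (indicator B (t, j) * x :: ennreal)" for t j x using BT by (auto simp: indicator_def)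
 have "balance eta (indicator B) \<longleftrightarrow> (NN (t, i, a). indicator B (t, i) \<partial>eta) + ?c ?O = ennreal (1 / T) * ?c ?G + ?c ?I"
  by (subst balance_iff[OF sets fin]) (simp_all add: tt tt')
 also have "... \<longleftrightarrow> enn2real ((NN (t, i, a). indicator B (t, i) \<partial>eta) + ?c ?O) = enn2real (ennreal (1 / T) * ?c ?G + ?c ?I)"
  using f by (intro enn2real_eq_iff[symmetric]) (auto simp: ennreal_mult_less_top marg emeasure_eq_measure)
 also have "... \<longleftrightarrow> enn2real (NN (t, i, a). indicator B (t, i) \<partial>eta) + enn2real (?c ?O) = 1 / T * enn2real (?c ?G) + enn2real (?c ?I)"
  using f T_pos by (simp add: enn2real_plus ennreal_mult_less_top enn2real_mult marg emeasure_eq_measure)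
 finally show ?thesis unfolding flow init Y by linarith
qed

text \<open>Rectangles \<open>B \<times> {j}\<close> already determine the measures in
  \<open>occI_marginals\<close>. Conversely every measurable set is a test function, and off the
  sigma-algebra both sides vanish by convention.\<close>

lemma flow_eq_iff_occ:
 assumes sets: "sets eta = sets Xs" and w3: "(NN (t, i, a). ennreal (w i ^ 3) \<partial>eta) < \<infinity>"
 shows "(%B. Y_marginal T A (measure eta) B -
   Y_density T (%(s, j). signed_integral Xs (measure eta) (%(t, i, a). indicator {t..T} s * q j i a)) B) =
   (%B. 1 / T * Y_density T (%(t, j). pmf \<gamma> j) B) \<longleftrightarrow> occ eta" (is "?L = ?R \<longleftrightarrow> _")
proof
 note fin = finite_if_w_integrable[OF sets w3]
 assume eq: "?L = ?R"
 have bal: "balance eta (indicator B)" if "B : Sigma_Algebra.sets (Y_space T)" for B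
  using flow_eq_iff_balance[OF sets w3 that] fun_cong[OF eq, of B] by simp
 show "occ eta"
 proof (rule occI_marginals[OF sets w3])
  fix j :: 's and B :: "real set" assume B[measurable]: "B : Sigma_Algebra.sets borel"
  \<comment> \<open>Sets of \<open>Y_space\<close> contain only times in \<open>[0, T]\<close>; all
    four measures live there, so nothing is lost.\<close>
  let ?B = "B \<inter> {0..T}"
  have "?B \<times> {j} : Sigma_Algebra.sets (Y_space T)" using B by (auto simp: sets_Y_space intro!: pair_measureI sets.Int)
  then have "balance eta (indicator (?B \<times> {j}))" by (rule bal)
  also have "indicator (?B \<times> {j}) = (%x. indicator ?B (fst x) * indicator {j} (snd x) :: ennreal)"
   by (auto simp: fun_eq_iff indicator_def)
  finally have b: "(NN t. indicator ?B t \<partial>state_mass eta j) + (NN t. indicator ?B t \<partial>rate_mass (%t. occ_out eta t j)) =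
   (NN t. indicator ?B t \<partial>rate_mass (%t. ennreal (pmf \<gamma> j / T))) + (NN t. indicator ?B t \<partial>rate_mass (%t. occ_in eta t j))"
   by (subst (asm) balance_single[OF sets fin]) simp_all
  have r: "emeasure (rate_mass r) B = (NN t. indicator ?B t \<partial>rate_mass r)" if [measurable]: "r : borel_measurable borel" for r
  proof -
   have "emeasure (rate_mass r) B = (NN t. indicator B t \<partial>rate_mass r)" by simp
   also have "... = (NN t. indicator ?B t \<partial>rate_mass r)"
    by (simp only: nn_integral_rate_mass that borel_measurable_indicator B sets.Int atLeastAtMost_borel) (auto intro!: nn_integral_cong simp: indicator_def)
   finally show ?thesis .
  qed
  have s: "emeasure (state_mass eta j) B = (NN t. indicator ?B t \<partial>state_mass eta j)"
  proof -
   have "emeasure (state_mass eta j) B = (NN t. indicator B t \<partial>state_mass eta j)" by simp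
   also have "... = (NN t. indicator ?B t \<partial>state_mass eta j)"
    by (subst (1 2) nn_integral_state_mass[OF sets]) (auto intro!: nn_integral_cong simp: indicator_def space_occ[OF sets])
   finally show ?thesis .
  qed
  note om = occ_rate_measurable[OF sets fin]
  show "emeasure (state_mass eta j) B + emeasure (rate_mass (%t. occ_out eta t j)) B =
   emeasure (rate_mass (%t. ennreal (pmf \<gamma> j / T))) B + emeasure (rate_mass (%t. occ_in eta t j)) B"
   using b by (simp only: s r[OF om(1)] r[OF om(2)] r[OF borel_measurable_const])
 qed
next
 assume occ: "occ eta"
 show "?L = ?R"
 proof
  fix B :: "(real \<times> 's) set"
  show "?L B = ?R B"
  proof (cases "B : Sigma_Algebra.sets (Y_space T)")
   case True
   then have "balance eta (indicator B)" by (intro occ_balance[OF occ] borel_measurable_indicator) (simp add: sets_Y_space)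
   then show ?thesis using flow_eq_iff_balance[OF sets w3 True] by simp
  qed (simp add: Y_marginal_def Y_density_def)
 qed
qed

text \<open>The convex combination is realised as a Bernoulli choice between the two
  measures.\<close>

lemma nn_integral_mixture:
 assumes sets: "sets eta1 = sets Xs" "sets eta2 = sets Xs" and prob: "prob_space eta1" "prob_space eta2" and s: "0 <= s" "s <= 1"
 obtains eta where "sets eta = sets Xs"
  "!!f :: real \<times> 's \<times> 'a => ennreal. f : borel_measurable Xs ==> (NN x. f x \<partial>eta) = ennreal s * (NN x. f x \<partial>eta1) + ennreal (1 - s) * (NN x. f x \<partial>eta2)"
proof -
 let ?k = "%b. if b then eta1 else eta2"
 let ?eta = "measure_pmf (bernoulli_pmf s) \<bind> ?k"
 have k: "?k : measure_pmf (bernoulli_pmf s) \<rightarrow>\<^sub>M subprob_algebra Xs"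
  using assms by (auto simp: measurable_def space_subprob_algebra prob_space_imp_subprob_space)
 have "sets ?eta = sets Xs" by (rule sets_bind) (use sets in \<open>auto split: if_splits\<close>)
 moreover have "(NN x. f x \<partial>?eta) = ennreal s * (NN x. f x \<partial>eta1) + ennreal (1 - s) * (NN x. f x \<partial>eta2)"
  if "f : borel_measurable Xs" for f :: "real \<times> 's \<times> 'a => ennreal"
  unfolding nn_integral_bind[OF that k] using s by (simp add: mult.commute)
 ultimately show ?thesis by (rule that)
qed

lemma real_integral_mixture:
 assumes f: "integrable eta1 f" "integrable eta2 f" "integrable eta (f :: 'x => real)" and s: "0 <= s" "s <= 1"
  and nn: "!!g :: 'x => ennreal. g = (%x. ennreal (f x)) \<or> g = (%x. ennreal (- f x)) ==>
   (NN x. g x \<partial>eta) = ennreal s * (NN x. g x \<partial>eta1) + ennreal (1 - s) * (NN x. g x \<partial>eta2)"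
 shows "(\<integral>x. f x \<partial>eta) = s * (\<integral>x. f x \<partial>eta1) + (1 - s) * (\<integral>x. f x \<partial>eta2)"
proof -
 note p = nn[OF disjI1[OF refl]] and m = nn[OF disjI2[OF refl]]
 have fin: "(NN x. ennreal (f x) \<partial>K) < top & (NN x. ennreal (- f x) \<partial>K) < top" if "integrable K f" for K
  using that unfolding real_integrable_def by (auto simp: less_top)
 have e: "enn2real (ennreal s * a + ennreal (1 - s) * b) = s * enn2real a + (1 - s) * enn2real b" if "a < top" "b < top" for a b
  using s that by (subst enn2real_plus) (auto simp: enn2real_mult ennreal_mult_less_top)
 show ?thesis
  unfolding real_lebesgue_integral_def[OF f(1)] real_lebesgue_integral_def[OF f(2)] real_lebesgue_integral_def[OF f(3)] p m
  using fin[OF f(1)] fin[OF f(2)] by (simp add: e right_diff_distrib)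
qed

text \<open>Balance is affine in the measure, and the initial term is the same for both, so it is
  reproduced by weights that add up to one.\<close>

lemma occ_mixture:
 assumes occ: "occ eta1" "occ eta2" and s: "0 <= s" "s <= 1"
 shows "\<exists>eta. occ eta & (\<forall>f C. f : borel_measurable Xs --> (\<forall>t i a. t : {0..T} --> a : A i --> \<bar>f (t, i, a)\<bar> <= C * w i ^ 3) -->
   (\<integral>x. f x \<partial>eta) = s * (\<integral>x. f x \<partial>eta1) + (1 - s) * (\<integral>x. f x \<partial>eta2))"
proof -
 obtain eta where sets: "sets eta = sets Xs" and nn: "!!f :: real \<times> 's \<times> 'a => ennreal. f : borel_measurable Xs ==>
   (NN x. f x \<partial>eta) = ennreal s * (NN x. f x \<partial>eta1) + ennreal (1 - s) * (NN x. f x \<partial>eta2)"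
  by (rule nn_integral_mixture[OF occ_sets[OF occ(1)] occ_sets[OF occ(2)] occ_prob[OF occ(1)] occ_prob[OF occ(2)] s]) blast
 have "occ eta"
  unfolding occ_def
 proof (intro conjI ballI sets)
  show "(NN (t, i, a). ennreal (w i ^ 3) \<partial>eta) < \<infinity>"
   using occ_w3[OF occ(1)] occ_w3[OF occ(2)] by (subst nn) (auto simp: measurable_w_occ[OF refl] ennreal_mult_less_top)
  fix h :: "real \<times> 's => ennreal" assume h: "h : borel_measurable borel_counting"
  let ?c = "ennreal (1 / T) * (NN t. (NN j. h (t, j) * ennreal (pmf \<gamma> j) * indicator {0..T} t \<partial>counting) \<partial>lborel)"
  have c: "?c = ennreal s * ?c + ennreal (1 - s) * ?c"
   using s by (simp add: distrib_right[symmetric] ennreal_plus[symmetric] del: ennreal_plus)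
  note m = nn[OF measurable_ti_occ[OF refl h]] nn[OF measurable_tail_out[OF refl h]] nn[OF measurable_tail_in[OF refl h]]
  have alg: "a1 + b1 = c + d1 ==> a2 + b2 = c + d2 ==> c = x * c + y * c ==>
   (x * a1 + y * a2) + (x * b1 + y * b2) = c + (x * d1 + y * d2)" for a1 b1 c d1 a2 b2 d2 x y :: ennreal
  proof -
   assume 1: "a1 + b1 = c + d1" "a2 + b2 = c + d2" "c = x * c + y * c"
   have "(x * a1 + y * a2) + (x * b1 + y * b2) = x * (a1 + b1) + y * (a2 + b2)" by (simp add: distrib_left ac_simps)
   also have "... = (x * c + y * c) + (x * d1 + y * d2)" unfolding 1(1,2) by (simp add: distrib_left ac_simps)
   finally show ?thesis using 1(3) by simp
  qed
  show "balance eta h"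
   unfolding balance_def m
   by (rule alg[OF occ_balance[OF occ(1) h, unfolded balance_def] occ_balance[OF occ(2) h, unfolded balance_def] c])
 qed
 moreover have "(\<integral>x. f x \<partial>eta) = s * (\<integral>x. f x \<partial>eta1) + (1 - s) * (\<integral>x. f x \<partial>eta2)"
  if f: "f : borel_measurable Xs" and b: "\<forall>t i a. t : {0..T} --> a : A i --> \<bar>f (t, i, a)\<bar> <= C * w i ^ 3" for f C
 proof (rule real_integral_mixture)
  have "integrable K f" if "occ K" for K
   by (rule occ_integrable[OF that f]) (use b in blast)
  then show "integrable eta1 f" "integrable eta2 f" "integrable eta f" using occ \<open>occ eta\<close> by blast+
  show "(NN x. g x \<partial>eta) = ennreal s * (NN x. g x \<partial>eta1) + ennreal (1 - s) * (NN x. g x \<partial>eta2)"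
   if "g = (%x. ennreal (f x)) \<or> g = (%x. ennreal (- f x))" for g :: "real \<times> 's \<times> 'a => ennreal"
   using that f by (intro nn) auto
 qed (use s in auto)
 ultimately show ?thesis by blast
qed

lemma occ_integral_bound:
 assumes occ: "occ eta" and b: "!!t i a. t : {0..T} ==> a : A i ==> \<bar>f (t, i, a)\<bar> <= C * w i ^ 3" and C: "0 <= C"
 shows "\<bar>\<integral>x. f x \<partial>eta\<bar> <= C * enn2real w3_const"
proof -
 have "ennreal (norm (\<integral>x. f x \<partial>eta)) <= (NN x. ennreal (norm (f x)) \<partial>eta)"
 proof (cases "integrable eta f")
  case True then show ?thesis by (rule integral_norm_bound_ennreal)
 qed (simp add: not_integrable_integral_eq)
 also have "... <= (NN x. ennreal C * (case x of (t, i, a) => ennreal (w i ^ 3)) \<partial>eta)"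
  using b C w_pos by (intro nn_integral_mono) (auto simp: space_occ[OF occ_sets[OF occ]] ennreal_mult'[symmetric] ennreal_leI)
 also have "... = ennreal C * (NN (t, i, a). ennreal (w i ^ 3) \<partial>eta)"
  by (intro nn_integral_cmult measurable_w_occ[OF occ_sets[OF occ]])
 also have "... <= ennreal C * ennreal (enn2real w3_const)"
  using occ_w3_bound[OF occ] w3_const_finite by (intro mult_left_mono) auto
 finally show ?thesis using C by (simp add: ennreal_mult'[symmetric] ennreal_le_iff)
qed

end

section \<open>Attainment and duality\<close>

locale ctmdp_costs = ctmdp T A q \<gamma> w L R
 for T :: real and A :: "'s :: countable => 'a :: polish_space set" and q and \<gamma> and w and L and R +
 fixes c :: "nat => 's => 'a => real" and d :: "nat => real" and N :: nat and M :: real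
 assumes M: "0 <= M" and c_cont: "!!n i. n <= N ==> continuous_on (A i) (c n i)"
  and c_bound: "!!n i a. n <= N ==> a : A i ==> \<bar>c n i a\<bar> <= M * w i"
begin

definition V :: "nat => (real \<times> 's \<times> 'a) measure => real" where
 "V n eta = T * (\<integral>(t, i, a). c n i a \<partial>eta)"

lemma c_slice: "n <= N ==> continuous_on ({0..T} \<times> A i) (%(t, a). (%(t, i, a). c n i a) (t, i, a))"
 unfolding case_prod_beta' fst_conv snd_conv
 by (intro continuous_on_compose2[OF c_cont] continuous_intros) auto

lemma c_measurable: "n <= N ==> (%(t, i, a). c n i a) : borel_measurable Xs"
 by (rule slice_measurable) (rule c_slice)

lemma c_bound3:
 assumes "n <= N" "a : A i" shows "\<bar>(%(t, i, a). c n i a) (t :: real, i, a)\<bar> <= M * w i ^ 3"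
proof -
 have "\<bar>c n i a\<bar> <= M * w i ^ 1" using c_bound[OF assms] by simp
 also have "... <= M * w i ^ 3" using M by (intro mult_left_mono w_pow_le) auto
 finally show ?thesis by simp
qed

lemma c_integrable: "n <= N ==> occ eta ==> integrable eta (%(t, i, a). c n i a)"
 by (rule occ_integrable[OF _ c_measurable c_bound3])

definition feas :: "(real \<times> 's \<times> 'a) measure => bool" where
 "feas eta \<longleftrightarrow> occ eta & (\<forall>n\<in>{1..N}. V n eta <= d n)"

text \<open>A minimizing sequence has a convergent subsequence by \<open>occ_compact\<close>;
  objective and constraints have continuous integrands of order \<open>w\<close>, so both pass to
  the limit.\<close>

lemma primal_attained:
 assumes "feas etas"
 obtains eta0 where "feas eta0" "!!eta. feas eta ==> V 0 eta0 <= V 0 eta"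
proof -
 let ?S = "V 0 ` {eta. feas eta}"
 have bdd: "bdd_below ?S"
 proof (rule bdd_belowI2[of _ "- (T * (M * enn2real w3_const))"])
  fix eta assume "eta : {eta. feas eta}"
  then have "\<bar>\<integral>(t, i, a). c 0 i a \<partial>eta\<bar> <= M * enn2real w3_const"
   using c_bound3[of 0] M by (intro occ_integral_bound) (auto simp: feas_def)
  then have "- (M * enn2real w3_const) <= (\<integral>(t, i, a). c 0 i a \<partial>eta)" by linarith
  then have "T * - (M * enn2real w3_const) <= V 0 eta" unfolding V_def using T_pos by (intro mult_left_mono) auto
  then show "- (T * (M * enn2real w3_const)) <= V 0 eta" by simp
 qed
 have "\<exists>eta. feas eta & V 0 eta < Inf ?S + 1 / real (Suc n)" for n
  using cInf_lessD[of ?S "Inf ?S + 1 / real (Suc n)"] assms by auto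
 then obtain eta where eta: "!!n. feas (eta n)" "!!n. V 0 (eta n) < Inf ?S + 1 / real (Suc n)" by metis
 have occ: "occ (eta n)" for n using eta(1) by (simp add: feas_def)
 obtain r eta' where r: "strict_mono (r :: nat => nat)" and eta': "occ eta'"
  and conv: "!!Phi C. (!!i. continuous_on ({0..T} \<times> A i) (%(t, a). Phi (t, i, a))) ==>
    (!!t i a. t : {0..T} ==> a : A i ==> \<bar>Phi (t, i, a)\<bar> <= C * w i) ==> 0 <= (C :: real) ==>
    (%n. \<integral>x. Phi x \<partial>eta (r n)) \<longlonglongrightarrow> (\<integral>x. Phi x \<partial>eta')"
  by (rule occ_compact[of eta, OF occ]) blast
 have Vconv: "(%n. V k (eta (r n))) \<longlonglongrightarrow> V k eta'" if "k <= N" for k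
  unfolding V_def
 proof (intro tendsto_mult tendsto_const conv[of _ M])
  show "continuous_on ({0..T} \<times> A i) (%(t, a). case (t, i, a) of (t, i, a) => c k i a)" for i by (rule c_slice[OF that])
 qed (use c_bound[OF that] M in auto)
 have "V n eta' <= d n" if "n : {1..N}" for n
  using that eta(1) by (intro LIMSEQ_le_const2[OF Vconv]) (auto simp: feas_def)
 then have f: "feas eta'" using eta' by (simp add: feas_def)
 have "V 0 eta' <= Inf ?S"
 proof (rule LIMSEQ_le[OF Vconv])
  show "(%n. Inf ?S + 1 / real (Suc n)) \<longlonglongrightarrow> Inf ?S"
   using tendsto_add[OF tendsto_const LIMSEQ_inverse_real_of_nat, of "Inf ?S"] by (simp add: inverse_eq_divide)
  have "V 0 (eta (r n)) <= Inf ?S + 1 / real (Suc n)" for n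
  proof -
   have "1 / real (Suc (r n)) <= 1 / real (Suc n)" using seq_suble[OF r, of n] by (intro divide_left_mono) auto
   then show ?thesis using eta(2)[of "r n"] by linarith
  qed
  then show "\<exists>n0. \<forall>n\<ge>n0. V 0 (eta (r n)) <= Inf ?S + 1 / real (Suc n)" by blast
 qed simp
 then have "V 0 eta' <= V 0 \<zeta>" if "feas \<zeta>" for \<zeta> using cInf_lower[OF _ bdd, of "V 0 \<zeta>"] that by fastforce
 with f show ?thesis by (rule that)
qed

lemma multipliers:
 assumes slater: "occ etas" "!!n. n : {1..N} ==> V n etas < d n" and p: "!!eta. feas eta ==> p <= V 0 eta"
 obtains l where "!!n. n : {1..N} ==> 0 <= l n" "!!eta. occ eta ==> p <= V 0 eta + (\<Sum>n=1..N. l n * (V n eta - d n))"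
proof -
 have "\<exists>l. (\<forall>n\<in>{1..N}. 0 <= l n) & (\<forall>eta\<in>Collect occ. p <= V 0 eta + (\<Sum>n=1..N. l n * (V n eta - d n)))"
 proof (rule lagrange_multipliers)
  fix eta1 eta2 :: "(real \<times> 's \<times> 'a) measure" and s :: real assume "eta1 : Collect occ" "eta2 : Collect occ" "0 <= s" "s <= 1"
  then have "occ eta1" "occ eta2" "0 <= s" "s <= 1" by simp_all
  from occ_mixture[OF this] obtain eta where eta: "occ eta" "\<forall>f C. f : borel_measurable Xs --> (\<forall>t i a. t : {0..T} --> a : A i --> \<bar>f (t, i, a)\<bar> <= C * w i ^ 3) -->
   (\<integral>x. f x \<partial>eta) = s * (\<integral>x. f x \<partial>eta1) + (1 - s) * (\<integral>x. f x \<partial>eta2)"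
   by (elim exE conjE)
  have "V n eta = s * V n eta1 + (1 - s) * V n eta2" if "n <= N" for n
  proof -
   have "(\<integral>(t, i, a). c n i a \<partial>eta) = s * (\<integral>(t, i, a). c n i a \<partial>eta1) + (1 - s) * (\<integral>(t, i, a). c n i a \<partial>eta2)"
    by (rule eta(2)[rule_format, OF c_measurable[OF that] c_bound3[OF that]])
   then show ?thesis unfolding V_def by (simp only: distrib_left mult.left_commute)
  qed
  then show "\<exists>eta\<in>Collect occ. V 0 eta = s * V 0 eta1 + (1 - s) * V 0 eta2 & (\<forall>n\<in>{1..N}. V n eta - d n = s * (V n eta1 - d n) + (1 - s) * (V n eta2 - d n))"
   using eta(1) by (intro bexI[of _ eta]) (auto simp: algebra_simps)
 qed (use slater p in \<open>auto simp: feas_def\<close>)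
 then obtain l where l: "\<forall>n\<in>{1..N}. 0 <= l n" "\<forall>eta\<in>Collect occ. p <= V 0 eta + (\<Sum>n=1..N. l n * (V n eta - d n))"
  by (elim exE conjE)
 show ?thesis by (rule that[of l]) (use l in blast)+
qed

end

context ctmdp_costs
begin

text \<open>Translates the program into occupation measures; the slack variables express the
  inequalities \<open>V n eta <= d n\<close>.\<close>

lemma primal_feasible_iff:
 "(\<nu>, x) : primal_feasible N T A q c d \<gamma> w \<longleftrightarrow>
   (\<exists>eta. occ eta & \<nu> = measure eta & x : {1..N} \<rightarrow>\<^sub>E {0..} & (\<forall>n\<in>{1..N}. V n eta + x n = d n))"
proof -
 have eq: "Gamma_op N T A q c (measure eta, x) = (%B. 1 / T * Y_density T (%(t, j). pmf \<gamma> j) B, \<lambda>n\<in>{1..N}. d n) \<longleftrightarrow>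
   occ eta & (\<forall>n\<in>{1..N}. V n eta + x n = d n)"
  if s: "sets eta = sets Xs" "(NN (t, i, a). ennreal (w i ^ 3) \<partial>eta) < \<infinity>" for eta
 proof -
  have sig: "T * signed_integral Xs (measure eta) (%(t, i, a). c n i a) = V n eta" for n
   unfolding V_def signed_integral_measure[OF finite_if_w_integrable[OF s] s(1)] ..
  have r: "(\<lambda>n\<in>{1..N}. V n eta + x n) = (\<lambda>n\<in>{1..N}. d n) \<longleftrightarrow> (\<forall>n\<in>{1..N}. V n eta + x n = d n)"
   unfolding fun_eq_iff restrict_def by auto
  show ?thesis unfolding Gamma_op_def prod.case prod.inject sig r flow_eq_iff_occ[OF s] ..
 qed
 show ?thesis
 proof
  assume "(\<nu>, x) : primal_feasible N T A q c d \<gamma> w"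
  then have x: "\<nu> : M_w3_plus T A w" "x : {1..N} \<rightarrow>\<^sub>E {0..}"
   "Gamma_op N T A q c (\<nu>, x) = (%B. 1 / T * Y_density T (%(t, j). pmf \<gamma> j) B, \<lambda>n\<in>{1..N}. d n)"
   unfolding primal_feasible_def by blast+
  obtain eta where eta: "sets eta = sets Xs" "(NN (t, i, a). ennreal (w i ^ 3) \<partial>eta) < \<infinity>" "\<nu> = measure eta"
   using x(1) unfolding M_w3_plus_iff by blast
  show "\<exists>eta. occ eta & \<nu> = measure eta & x : {1..N} \<rightarrow>\<^sub>E {0..} & (\<forall>n\<in>{1..N}. V n eta + x n = d n)"
   using x(2) eta(3) x(3)[unfolded eta(3) eq[OF eta(1,2)]] by blast
 next
  assume "\<exists>eta. occ eta & \<nu> = measure eta & x : {1..N} \<rightarrow>\<^sub>E {0..} & (\<forall>n\<in>{1..N}. V n eta + x n = d n)"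
  then obtain eta where eta: "occ eta" "\<nu> = measure eta" "x : {1..N} \<rightarrow>\<^sub>E {0..}" "\<forall>n\<in>{1..N}. V n eta + x n = d n" by blast
  note s = occ_sets[OF eta(1)] occ_w3[OF eta(1)]
  have "measure eta : M_w3_plus T A w" unfolding M_w3_plus_iff using s by blast
  moreover have "Gamma_op N T A q c (measure eta, x) = (%B. 1 / T * Y_density T (%(t, j). pmf \<gamma> j) B, \<lambda>n\<in>{1..N}. d n)"
   unfolding eq[OF s] using eta by blast
  ultimately show "(\<nu>, x) : primal_feasible N T A q c d \<gamma> w" unfolding primal_feasible_def eta(2) using eta(3) by blast
 qed
qed

lemma primal_cost_measure:
 assumes "occ eta" shows "primal_cost T A c (measure eta, x) = V 0 eta"
 unfolding primal_cost_def prod.case V_def signed_integral_measure[OF occ_finite[OF assms] occ_sets[OF assms]] ..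

text \<open>The dual inequality is integrated against \<open>eta\<close>. By \<open>occ_test\<close>
  the terms with \<open>h\<close> leave only the initial value, and \<open>u n <= 0\<close> turns
  \<open>V n eta <= d n\<close> into the right direction.\<close>

lemma weak_duality:
 assumes occ: "occ eta" and V: "!!n. n : {1..N} ==> V n eta <= d n" and D: "(h, u) : dual_feasible N T A q c w"
 shows "dual_value N T d \<gamma> (h, u) <= V 0 eta"
proof -
 have h: "h : borel_measurable (Y_space T)" "bdd_above ((%(t, i). \<bar>h (t, i)\<bar> / w i ^ 2) ` space (Y_space T))"
  and u: "u : {1..N} \<rightarrow>\<^sub>E {..0}"
  and ineq: "\<forall>(t, i, a)\<in>space Xs. T * c 0 i a - h (t, i) + (LINT s:{t..T}|lborel. (\<Sum>\<^sub>\<infinity>j. h (s, j) * q j i a))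
   - T * (\<Sum>n=1..N. u n * c n i a) \<ge> 0"
  using D unfolding dual_feasible_def B_w2_def mem_Collect_eq prod.case by - (elim conjE, assumption)+
 have spY: "space (Y_space T) = {0..T} \<times> (UNIV :: 's set)" by (simp add: Y_space_def space_restrict_space space_pair_measure)
 obtain C where C: "!!z. z : space (Y_space T) ==> (case z of (t, i) => \<bar>h (t, i)\<bar> / w i ^ 2) <= C" using h(2) unfolding bdd_above_def by blast
 \<comment> \<open>A dual feasible \<open>h\<close> is measurable only on \<open>Y_space\<close>;
   its extension by zero is a test function on the whole time axis, and only times in
   \<open>[0, T]\<close> enter the integrals.\<close>
 define h' where "h' = (%z. if z : {0..T} \<times> UNIV then h z else 0)"
 have "h' : borel_measurable borel_counting"
  using h(1) unfolding h'_def Y_space_def by (subst measurable_restrict_space_iff[symmetric]) (auto simp: space_pair_measure)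
 moreover have "\<bar>h' (t, i)\<bar> <= max 0 C * w i ^ 2" if "t : {0..T}" for t i
 proof -
  have "\<bar>h (t, i)\<bar> / w i ^ 2 <= max 0 C" using C[of "(t, i)"] that by (simp add: spY le_max_iff_disj)
  then show ?thesis using that w_pos[of i] by (simp add: h'_def pos_divide_le_eq)
 qed
 ultimately have b: "w2_bounded h' (max 0 C)" by (simp add: w2_bounded_def)
 have dt: "dual_term h' t i a = (LINT s:{t..T}|lborel. (\<Sum>\<^sub>\<infinity>j. h (s, j) * q j i a))" if "t : {0..T}" for t i a
  unfolding dual_term_def using that by (intro set_lebesgue_integral_cong) (auto simp: h'_def)
 have init: "(LINT t:{0..T}|lborel. (\<Sum>\<^sub>\<infinity>j. h' (t, j) * pmf \<gamma> j)) = (LINT t:{0..T}|lborel. (\<Sum>\<^sub>\<infinity>j. h (t, j) * pmf \<gamma> j))"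
  by (intro set_lebesgue_integral_cong) (auto simp: h'_def)
 note t = occ_test[OF occ b]
 let ?F = "%x. T * (case x of (t, i, a) => c 0 i a) - (case x of (t, i, a) => h' (t, i)) + (case x of (t, i, a) => dual_term h' t i a)
   - (\<Sum>n=1..N. T * u n * (case x of (t, i, a) => c n i a))"
 have i0: "integrable eta (%x. T * (case x of (t, i, a) => c 0 i a))" by (intro integrable_mult_right c_integrable occ) simp
 have iS: "integrable eta (%x. \<Sum>n=1..N. T * u n * (case x of (t, i, a) => c n i a))"
  by (intro Bochner_Integration.integrable_sum integrable_mult_right c_integrable occ) simp
 have sumV: "(\<integral>x. (\<Sum>n=1..N. T * u n * (case x of (t, i, a) => c n i a)) \<partial>eta) = (\<Sum>n=1..N. u n * V n eta)"
  by (subst Bochner_Integration.integral_sum) (auto intro!: integrable_mult_right c_integrable occ simp: V_def mult_ac)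
 have "0 <= (\<integral>x. ?F x \<partial>eta)"
 proof (rule Bochner_Integration.integral_nonneg)
  fix x assume "x : space eta"
  then obtain t i a where x: "x = (t, i, a)" "t : {0..T}" "a : A i" unfolding space_occ[OF occ_sets[OF occ]] by auto
  have "h' (t, i) = h (t, i)" using x(2) by (simp add: h'_def)
  then show "0 <= ?F x"
   using ineq[rule_format, of x] x by (simp add: space_Xs dt sum_distrib_left mult.assoc)
 qed
 also have "(\<integral>x. ?F x \<partial>eta) = V 0 eta - (\<integral>(t, i, a). h' (t, i) \<partial>eta) + (\<integral>(t, i, a). dual_term h' t i a \<partial>eta) - (\<Sum>n=1..N. u n * V n eta)"
  unfolding Bochner_Integration.integral_diff[OF Bochner_Integration.integrable_add[OF Bochner_Integration.integrable_diff[OF i0 t(1)] t(2)] iS]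
   Bochner_Integration.integral_add[OF Bochner_Integration.integrable_diff[OF i0 t(1)] t(2)] Bochner_Integration.integral_diff[OF i0 t(1)] sumV
  by (simp add: V_def)
 finally have "1 / T * (LINT t:{0..T}|lborel. (\<Sum>\<^sub>\<infinity>j. h (t, j) * pmf \<gamma> j)) <= V 0 eta - (\<Sum>n=1..N. u n * V n eta)"
  unfolding t(3) init by linarith
 moreover have "(\<Sum>n=1..N. d n * u n) <= (\<Sum>n=1..N. u n * V n eta)"
 proof (rule sum_mono)
  fix n assume n: "n : {1..N}"
  then have "u n <= 0" using u by auto
  then show "d n * u n <= u n * V n eta" using mult_left_mono_neg[OF V[OF n], of "u n"] by (simp add: mult.commute)
 qed
 ultimately show ?thesis unfolding dual_value_def prod.case by linarith
qed

text \<open>The Lagrangian cost is \<open>T\<close> times a single cost rate, so the solution of its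
  Hamilton-Jacobi-Bellman equation together with \<open>u = - l\<close> is dual feasible. Occupation
  measures with cost within any \<open>e\<close> of \<open>H.init_value\<close> transfer the bound
  \<open>p\<close> to the dual value.\<close>

lemma dual_attained:
 assumes l: "!!n. n : {1..N} ==> 0 <= l n" and p: "!!eta. occ eta ==> p <= V 0 eta + (\<Sum>n=1..N. l n * (V n eta - d n))"
 obtains z where "z : dual_feasible N T A q c w" "p <= dual_value N T d \<gamma> z"
proof -
 define g where "g i a = T * (c 0 i a + (\<Sum>n=1..N. l n * c n i a))" for i a
 define G where "G = T * (M + (\<Sum>n=1..N. l n * M))"
 define u where "u = (\<lambda>n\<in>{1..N}. - l n)"
 interpret H: hjb T A q \<gamma> w L R g G
 proof
  show "0 <= G" unfolding G_def using T_pos M l by (intro mult_nonneg_nonneg add_nonneg_nonneg sum_nonneg) auto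
  fix i a assume a: "a : A i"
  have "\<bar>\<Sum>n=1..N. l n * c n i a\<bar> <= (\<Sum>n=1..N. l n * (M * w i))"
  proof (rule order_trans[OF sum_abs], rule sum_mono)
   fix n assume n: "n : {1..N}"
   then show "\<bar>l n * c n i a\<bar> <= l n * (M * w i)" using l[OF n] c_bound[OF _ a, of n] by (simp add: abs_mult mult_left_mono)
  qed
  then have "\<bar>c 0 i a + (\<Sum>n=1..N. l n * c n i a)\<bar> <= M * w i + (\<Sum>n=1..N. l n * (M * w i))"
   using c_bound[OF _ a, of 0] by linarith
  then have "T * \<bar>c 0 i a + (\<Sum>n=1..N. l n * c n i a)\<bar> <= T * (M * w i + (\<Sum>n=1..N. l n * (M * w i)))"
   using T_pos by (intro mult_left_mono) auto
  moreover have "\<bar>g i a\<bar> = T * \<bar>c 0 i a + (\<Sum>n=1..N. l n * c n i a)\<bar>" unfolding g_def abs_mult using T_pos by simp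
  moreover have "G * w i = T * (M * w i + (\<Sum>n=1..N. l n * (M * w i)))"
   unfolding G_def by (simp only: distrib_right sum_distrib_right mult.assoc)
  ultimately show "\<bar>g i a\<bar> <= G * w i" by simp
 qed
 have gm: "(%(t, i, a). g i a) : borel_measurable Xs"
 proof (rule slice_measurable)
  show "continuous_on ({0..T} \<times> A i) (%(t, a). case (t, i, a) of (t, i, a) => g i a)" for i
   unfolding g_def case_prod_beta' fst_conv snd_conv
   by (intro continuous_on_mult continuous_on_add continuous_on_sum continuous_on_const continuous_on_compose2[OF c_cont] continuous_on_snd continuous_on_id) auto
 qed
 have hb: "H.hh : borel_measurable borel_counting" "!!t i. t : {0..T} ==> \<bar>H.hh (t, i)\<bar> <= H.Lam * w i ^ 2"
  using H.hh_bounded by (auto simp: w2_bounded_def)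
 have "H.hh : B_w2 T w"
  unfolding B_w2_def
 proof (intro CollectI conjI)
  show "H.hh : borel_measurable (Y_space T)" unfolding Y_space_def by (rule measurable_restrict_space1[OF hb(1)])
  show "bdd_above ((%(t, i). \<bar>H.hh (t, i)\<bar> / w i ^ 2) ` space (Y_space T))"
  proof (rule bdd_aboveI2[of _ _ H.Lam])
   fix z :: "real \<times> 's" assume "z : space (Y_space T)"
   then obtain t i where "z = (t, i)" "t : {0..T}" by (auto simp: Y_space_def space_restrict_space)
   then show "(case z of (t, i) => \<bar>H.hh (t, i)\<bar> / w i ^ 2) <= H.Lam" using hb(2)[of t i] w_pos[of i] by (simp add: pos_divide_le_eq)
  qed
 qed
 moreover have "u : {1..N} \<rightarrow>\<^sub>E {..0}" unfolding u_def using l by auto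
 moreover have us: "(\<Sum>n=1..N. u n * x n) = - (\<Sum>n=1..N. l n * x n)" for x :: "nat => real"
  unfolding u_def sum_negf[symmetric] by (intro sum.cong) auto
 have "T * c 0 i a - H.hh (t, i) + (LINT s:{t..T}|lborel. (\<Sum>\<^sub>\<infinity>j. H.hh (s, j) * q j i a)) - T * (\<Sum>n=1..N. u n * c n i a) \<ge> 0"
  if "t : {0..T}" "a : A i" for t i a
  using H.hh_dual_ineq[OF that] unfolding dual_term_def us by (simp add: g_def distrib_left)
 ultimately have "(H.hh, u) : dual_feasible N T A q c w" unfolding dual_feasible_def by (auto simp: space_Xs)
 moreover have "p <= dual_value N T d \<gamma> (H.hh, u)"
 proof (rule field_le_epsilon)
  fix e :: real assume "0 < e"
  then obtain eta where eta: "occ eta" "(\<integral>(t, i, a). g i a \<partial>eta) <= H.init_value + e" using H.near_optimal[OF _ gm] by blast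
  have e0: "(%(t, i, a). g i a) = (%x. T * (case x of (t, i, a) => c 0 i a) + (\<Sum>n=1..N. T * l n * (case x of (t, i, a) => c n i a)))"
   by (auto simp: g_def fun_eq_iff distrib_left sum_distrib_left mult.assoc)
  have "(\<integral>(t, i, a). g i a \<partial>eta) = V 0 eta + (\<Sum>n=1..N. l n * V n eta)"
   unfolding e0
   by (subst Bochner_Integration.integral_add, (intro integrable_mult_right c_integrable eta(1) Bochner_Integration.integrable_sum; simp)+,
     subst Bochner_Integration.integral_sum) (auto intro!: integrable_mult_right c_integrable eta(1) simp: V_def mult_ac)
  then have "V 0 eta + (\<Sum>n=1..N. l n * V n eta) <= H.init_value + e" using eta(2) by simp
  moreover have "(\<Sum>n=1..N. l n * (V n eta - d n)) = (\<Sum>n=1..N. l n * V n eta) - (\<Sum>n=1..N. l n * d n)"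
   by (simp add: right_diff_distrib sum_subtractf)
  moreover have "(\<Sum>n=1..N. d n * u n) = - (\<Sum>n=1..N. l n * d n)" using us[of d] by (simp add: mult.commute)
  ultimately show "p <= dual_value N T d \<gamma> (H.hh, u) + e"
   using p[OF eta(1)] unfolding dual_value_def prod.case H.init_value_def by linarith
 qed
 ultimately show ?thesis by (rule that)
qed

text \<open>Taking the attained primal value as \<open>p\<close> in the multiplier theorem gives a
  dual point of at least that value, and weak duality makes both values equal.\<close>

lemma strong_duality:
 assumes slater: "occ etas" "!!n. n : {1..N} ==> V n etas < d n"
 shows "(\<exists>z. is_arg_min (primal_cost T A c) (%z. z : primal_feasible N T A q c d \<gamma> w) z) &
     (\<exists>z. is_arg_max (dual_value N T d \<gamma>) (%z. z : dual_feasible N T A q c w) z) &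
     (INF z\<in>primal_feasible N T A q c d \<gamma> w. ereal (primal_cost T A c z)) =
     (SUP z\<in>dual_feasible N T A q c w. ereal (dual_value N T d \<gamma> z))"
proof -
 have "feas etas" using slater by (simp add: feas_def less_imp_le)
 then obtain eta0 where eta0: "feas eta0" "!!eta. feas eta ==> V 0 eta0 <= V 0 eta" by (rule primal_attained) blast
 obtain l where l: "!!n. n : {1..N} ==> 0 <= l n" "!!eta. occ eta ==> V 0 eta0 <= V 0 eta + (\<Sum>n=1..N. l n * (V n eta - d n))"
  by (rule multipliers[OF slater eta0(2)]) blast+
 obtain zd where zd: "zd : dual_feasible N T A q c w" "V 0 eta0 <= dual_value N T d \<gamma> zd" by (rule dual_attained[OF l])
 have o0: "occ eta0" "!!n. n : {1..N} ==> V n eta0 <= d n" using eta0(1) by (auto simp: feas_def)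
 define zp where "zp = (measure eta0, \<lambda>n\<in>{1..N}. d n - V n eta0)"
 have zp: "zp : primal_feasible N T A q c d \<gamma> w"
  unfolding zp_def primal_feasible_iff using o0 by (intro exI[of _ eta0]) auto
 have cp: "primal_cost T A c zp = V 0 eta0" unfolding zp_def by (rule primal_cost_measure[OF o0(1)])
 have le: "V 0 eta0 <= primal_cost T A c z" if "z : primal_feasible N T A q c d \<gamma> w" for z
 proof -
  obtain \<nu> x where z: "z = (\<nu>, x)" by (cases z)
  have "(\<nu>, x) : primal_feasible N T A q c d \<gamma> w" using that unfolding z .
  then obtain eta where eta: "occ eta" "\<nu> = measure eta" "x : {1..N} \<rightarrow>\<^sub>E {0..}" "\<forall>n\<in>{1..N}. V n eta + x n = d n"
   unfolding primal_feasible_iff by blast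
  have "V n eta <= d n" if n: "n : {1..N}" for n
  proof -
   have "x n : {0..}" using eta(3) n by (rule PiE_mem)
   then show ?thesis using eta(4)[rule_format, OF n] by simp
  qed
  then have "feas eta" using eta(1) by (simp add: feas_def)
  then show ?thesis unfolding z eta(2) primal_cost_measure[OF eta(1)] by (rule eta0(2))
 qed
 have ge: "dual_value N T d \<gamma> z <= V 0 eta0" if "z : dual_feasible N T A q c w" for z
  using weak_duality[OF o0, of "fst z" "snd z"] that by simp
 have cd: "dual_value N T d \<gamma> zd = V 0 eta0" using zd(2) ge[OF zd(1)] by simp
 have "(INF z\<in>primal_feasible N T A q c d \<gamma> w. ereal (primal_cost T A c z)) = ereal (V 0 eta0)"
  using INF_lower[OF zp, of "%z. ereal (primal_cost T A c z)"] cp le by (intro antisym INF_greatest) auto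
 moreover have "(SUP z\<in>dual_feasible N T A q c w. ereal (dual_value N T d \<gamma> z)) = ereal (V 0 eta0)"
  using SUP_upper[OF zd(1), of "%z. ereal (dual_value N T d \<gamma> z)"] cd ge by (intro antisym SUP_least) auto
 moreover have "is_arg_min (primal_cost T A c) (%z. z : primal_feasible N T A q c d \<gamma> w) zp"
  unfolding is_arg_min_def cp using zp le by (auto simp: not_less)
 moreover have "is_arg_max (dual_value N T d \<gamma>) (%z. z : dual_feasible N T A q c w) zd"
  unfolding is_arg_max_def cd using zd(1) ge by (auto simp: not_less)
 ultimately show ?thesis by (intro conjI, blast, blast, simp)
qed

end

section \<open>From the hypotheses to the duality statement\<close>

text \<open>A policy must also prescribe an admissible action on the path that starts in
  \<open>i\<close> and never jumps; at time zero it puts mass one on \<open>A i\<close>.\<close>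

lemma policy_actions_nonempty:
 assumes "\<pi> : policies A" shows "A i \<noteq> {}"
proof
 assume empty: "A i = {}"
 define om :: "'a path" where "om = (%l. if l = 0 then (Some i, \<infinity>) else (None, \<infinity>))"
 have "om : paths" unfolding paths_def by (rule UnI2) (auto simp: om_def intro!: exI[of _ 1])
 have sn: "snd (om l) = \<infinity>" for l by (simp add: om_def)
 have jt: "jump_time m om = (if m = 0 then 0 else \<infinity>)" for m
  unfolding jump_time_def by (induction m) (auto simp: sn)
 have "explosion_time om = \<infinity>"
  unfolding explosion_time_def by (intro limI tendsto_eventually) (auto simp: jt eventually_sequentially intro!: exI[of _ 1])
 moreover have "(THE m. jump_time m om <= ereal 0 & ereal 0 < jump_time (Suc m) om) = 0"
  by (rule the_equality) (auto simp: jt split: if_splits)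
 ultimately have "state_before om 0 = Some i" by (simp add: state_before_def state_at_def jump_state_def om_def)
 moreover have "emeasure (\<pi> om 0) (ext_actions A (state_before om 0)) = 1"
  using assms \<open>om : paths\<close> by (simp add: policies_def)
 ultimately show False using empty by simp
qed

theorem theorem5p3:
  fixes A :: "'s :: countable \<Rightarrow> 'a :: polish_space set"
    and q :: "'s \<Rightarrow> 's \<Rightarrow> 'a \<Rightarrow> real"
    and c :: "nat \<Rightarrow> 's \<Rightarrow> 'a \<Rightarrow> real"
    and d :: "nat \<Rightarrow> real"
    and N :: nat
    and T :: real
    and \<gamma> :: "'s pmf"
    and w :: "'s \<Rightarrow> real"
    and \<rho>1 \<rho>2 \<rho>3 b1 b2 b3 L M :: real
  assumes T_pos: "T > 0"
    \<comment> \<open>the model\<close>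
    and A_meas: "\<And>i. A i \<in> sets borel"
    and q_meas: "\<And>i j. q j i \<in> borel_measurable (restrict_space borel (A i))"
    and q_nonneg: "\<And>i j a. a \<in> A i \<Longrightarrow> j \<noteq> i \<Longrightarrow> q j i a \<ge> 0"
    and q_conservative: "\<And>i a. a \<in> A i \<Longrightarrow> ((\<lambda>j. q j i a) has_sum 0) UNIV"
    and q_stable: "\<And>i. bdd_above ((\<lambda>a. \<bar>q i i a\<bar>) ` A i)"
    and c_meas: "\<And>n i. n \<le> N \<Longrightarrow> c n i \<in> borel_measurable (restrict_space borel (A i))"
    \<comment> \<open>the constants\<close>
    and w_ge_1: "\<And>i. w i \<ge> 1"
    and constants: "\<rho>1 > 0" "\<rho>2 > 0" "\<rho>3 > 0" "b1 \<ge> 0" "b2 \<ge> 0" "b3 \<ge> 0" "L > 0" "M > 0"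
    \<comment> \<open>(1)\<close>
    and w_drift: "\<And>i a. a \<in> A i \<Longrightarrow>
          (\<lambda>j. w j * q j i a) summable_on UNIV \<and> (\<Sum>\<^sub>\<infinity>j. w j * q j i a) \<le> \<rho>1 * w i + b1"
    and q_bound: "\<And>i. (SUP a\<in>A i. \<bar>q i i a\<bar>) \<le> L * w i"
    \<comment> \<open>(2)\<close>
    and w_init: "(\<lambda>i. w i * pmf \<gamma> i) summable_on UNIV"
    and c_bound: "\<And>n i a. n \<le> N \<Longrightarrow> a \<in> A i \<Longrightarrow> \<bar>c n i a\<bar> \<le> M * w i"
    \<comment> \<open>(3)\<close>
    and w2_drift: "\<And>i a. a \<in> A i \<Longrightarrow>
          (\<lambda>j. w j ^ 2 * q j i a) summable_on UNIV \<and>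
          (\<Sum>\<^sub>\<infinity>j. w j ^ 2 * q j i a) \<le> \<rho>2 * w i ^ 2 + b2"
    and w3_drift: "\<And>i a. a \<in> A i \<Longrightarrow>
          (\<lambda>j. w j ^ 3 * q j i a) summable_on UNIV \<and>
          (\<Sum>\<^sub>\<infinity>j. w j ^ 3 * q j i a) \<le> \<rho>3 * w i ^ 3 + b3"
    \<comment> \<open>(4)\<close>
    and A_compact: "\<And>i. compact (A i)"
    \<comment> \<open>(5)\<close>
    and c_cont: "\<And>n i. n \<le> N \<Longrightarrow> continuous_on (A i) (c n i)"
    and q_cont: "\<And>i j. continuous_on (A i) (q j i)"
    and w_drift_cont: "\<And>i. continuous_on (A i) (\<lambda>a. \<Sum>\<^sub>\<infinity>k. w k * q k i a)"
    \<comment> \<open>(6)\<close>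
    and levels: "\<And>m :: nat. m \<ge> 1 \<Longrightarrow> {i. w i \<le> real m} \<noteq> {} \<and> finite {i. w i \<le> real m}"
    \<comment> \<open>(7)\<close>
    and w2_init: "(\<lambda>i. w i ^ 2 * pmf \<gamma> i) summable_on UNIV"
    and w3_init: "(\<lambda>i. w i ^ 3 * pmf \<gamma> i) summable_on UNIV"
    \<comment> \<open>(8)\<close>
    and slater: "\<exists>\<pi>\<in>policies A. \<exists>P. path_law A q \<gamma> \<pi> P \<and>
          (\<forall>n\<in>{1..N}. expected_cost T A (c n) \<pi> P < d n)"
  shows "(\<exists>z. is_arg_min (primal_cost T A c) (\<lambda>z. z \<in> primal_feasible N T A q c d \<gamma> w) z) \<and>
         (\<exists>z. is_arg_max (dual_value N T d \<gamma>) (\<lambda>z. z \<in> dual_feasible N T A q c w) z) \<and>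
         (INF z\<in>primal_feasible N T A q c d \<gamma> w. ereal (primal_cost T A c z)) =
         (SUP z\<in>dual_feasible N T A q c w. ereal (dual_value N T d \<gamma> z))"
proof -
 obtain \<pi> P where pol: "\<pi> : policies A" and law: "path_law A q \<gamma> \<pi> P"
  and cost: "!!n. n : {1..N} ==> expected_cost T A (c n) \<pi> P < d n" using slater by blast
 \<comment> \<open>One constant for all three drift conditions: since \<open>w >= 1\<close>, each
   additive constant is absorbed into the multiplicative one, and \<open>R\<close> dominates every
   sum of the two.\<close>
 define R where "R = \<rho>1 + \<rho>2 + \<rho>3 + b1 + b2 + b3"
 have drift: "x <= R * w i ^ k" if "x <= r * w i ^ k + b" "r + b <= R" "0 <= b" for x r b k i
 proof -
  have "1 <= w i ^ k" using w_ge_1 by (rule one_le_power)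
  then have "b <= b * w i ^ k" "(r + b) * w i ^ k <= R * w i ^ k" using that by (auto simp: mult_le_cancel_left1 intro!: mult_right_mono)
  then show ?thesis using that(1) by (simp add: distrib_right)
 qed
 interpret ctmdp_costs T A q \<gamma> w L R c d N M
 proof
  show "0 < T" "0 < L" "0 < R" using T_pos constants by (auto simp: R_def)
  show "compact (A i)" "A i \<noteq> {}" for i using A_compact policy_actions_nonempty[OF pol] by auto
  show "continuous_on (A i) (q j i)" for i j by (rule q_cont)
  show "a : A i ==> j \<noteq> i ==> 0 <= q j i a" for i j a by (rule q_nonneg)
  show "a : A i ==> ((%j. q j i a) has_sum 0) UNIV" for i a by (rule q_conservative)
  show "\<bar>q i i a\<bar> <= L * w i" if "a : A i" for i a
   using cSUP_upper[OF that q_stable] q_bound[of i] by linarith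
  show "1 <= w i" for i by (rule w_ge_1)
  show "(%j. w j ^ k * q j i a) summable_on UNIV & (\<Sum>\<^sub>\<infinity>j. w j ^ k * q j i a) <= R * w i ^ k"
   if "k : {1, 2, 3 :: nat}" "a : A i" for k i a
   using that(1) w_drift[OF that(2)] w2_drift[OF that(2)] w3_drift[OF that(2)] constants
    drift[of _ \<rho>1 i 1 b1] drift[of _ \<rho>2 i 2 b2] drift[of _ \<rho>3 i 3 b3] by (auto simp: R_def)
  show "finite {i. w i <= real n}" for n
  proof (cases n)
   case 0
   have "{i. w i <= real n} = {}" using 0 less_le_trans[OF zero_less_one w_ge_1] by (simp add: not_le)
   then show ?thesis by simp
  qed (use levels[of n] in simp)
  show "(%i. w i ^ 3 * pmf \<gamma> i) summable_on UNIV" by (rule w3_init)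
  show "0 <= M" using constants by simp
  show "n <= N ==> continuous_on (A i) (c n i)" for n i by (rule c_cont)
  show "n <= N ==> a : A i ==> \<bar>c n i a\<bar> <= M * w i" for n i a by (rule c_bound)
 qed
 \<comment> \<open>The strictly feasible policy enters through its occupation measure
   \<open>S.occm\<close>, which is the Slater point for the multipliers.\<close>
 interpret S: controlled T A q \<gamma> w L R \<pi> P by unfold_locales (fact pol, fact law)
 have "V n S.occm < d n" if "n : {1..N}" for n
 proof -
  have n: "n <= N" using that by simp
  show ?thesis
   using cost[OF that] S.expected_cost_occm[OF c_cont[OF n] c_bound[OF n] M] unfolding V_def by simp
 qed
 then show ?thesis by (rule strong_duality[OF S.occm_occ])
qed

end
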